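(* Let $R$ be a quasi-Gorenstein equidimensional reduced complete (Noetherian) local ring of prime characteristic, and let $I$ be either a proper ideal of $R$ of finite projective dimension or a parameter ideal of $R$. Then the parameter test ideal of $R$ is not contained in $I$, and the conductor of $R$ is not contained in $I$.
   Context: Let $(R,\mathfrak m)$ be a Noetherian local ring of prime characteristic $p$ and dimension $d$. - $R$ is quasi-Gorenstein if $\operatorname{H}^d_{\mathfrak m}(R)$ is isomorphic to the injective hull of $R/\mathfrak m$. - A parameter ideal is an ideal $J$ generated by $\operatorname{ht}J$ elements. - The tight closure $J^*$ of an ideal $J$ is the set of $z\in R$ for which there is $c\in R$, not in any minimal prime of $R$, such that $cz^{p^e}\in J^{[p^e]}$ for all $e\gg0$, where $J^{[p^e]}$ is the ideal generated by the $p^e$-th powers of elements of $J$. - The parameter test ideal of $R$ is the ideal of all $c\in R$ with $cJ^*\subseteq J$ for every parameter ideal $J$. - The conductor of a reduced ring $S$ with total ring of fractions $K$ and integral closure $\overline S$ (in $K$) is $(S:_K\overline S)=\{a\in K\mid a\overline S\subseteq S\}$. *)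

theory Defs
  imports "HOL-Algebra.Algebra" "HOL-Library.Extended_Nat"
begin

section \<open>Local rings, dimension, height\<close>

definition local_ring :: "('a, 'm) ring_scheme \<Rightarrow> bool" where
  "local_ring R \<longleftrightarrow> cring R \<and> (\<exists>!M. maximalideal M R)"

definition max_ideal :: "('a, 'm) ring_scheme \<Rightarrow> 'a set" where
  "max_ideal R = (THE M. maximalideal M R)"

definition has_char :: "('a, 'm) ring_scheme \<Rightarrow> nat \<Rightarrow> bool" where
  "has_char R p \<longleftrightarrow> (\<forall>n::nat. [n] \<cdot>\<^bsub>R\<^esub> \<one>\<^bsub>R\<^esub> = \<zero>\<^bsub>R\<^esub> \<longleftrightarrow> p dvd n)"

definition reduced_ring :: "('a, 'm) ring_scheme \<Rightarrow> bool" where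
  "reduced_ring R \<longleftrightarrow>
     (\<forall>x\<in>carrier R. \<forall>n::nat. x [^]\<^bsub>R\<^esub> n = \<zero>\<^bsub>R\<^esub> \<longrightarrow> x = \<zero>\<^bsub>R\<^esub>)"

definition prime_chain :: "('a, 'm) ring_scheme \<Rightarrow> nat \<Rightarrow> (nat \<Rightarrow> 'a set) \<Rightarrow> bool" where
  "prime_chain R n P \<longleftrightarrow>
     (\<forall>i\<le>n. primeideal (P i) R) \<and> (\<forall>i<n. P i \<subset> P (Suc i))"

definition krull_dim :: "('a, 'm) ring_scheme \<Rightarrow> enat" where
  "krull_dim R = (SUP n \<in> {n. \<exists>P. prime_chain R n P}. enat n)"

definition prime_height :: "('a, 'm) ring_scheme \<Rightarrow> 'a set \<Rightarrow> enat" where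
  "prime_height R Q = (SUP n \<in> {n. \<exists>P. prime_chain R n P \<and> P n = Q}. enat n)"

text \<open>The unit ideal has height \<open>\<infinity>\<close>, so it is not a parameter ideal below.\<close>

definition ideal_height :: "('a, 'm) ring_scheme \<Rightarrow> 'a set \<Rightarrow> enat" where
  "ideal_height R J = (INF Q \<in> {Q. primeideal Q R \<and> J \<subseteq> Q}. prime_height R Q)"

definition parameter_ideal :: "('a, 'm) ring_scheme \<Rightarrow> 'a set \<Rightarrow> bool" where
  "parameter_ideal R J \<longleftrightarrow>
     (\<exists>xs. set xs \<subseteq> carrier R \<and> J = Idl\<^bsub>R\<^esub> (set xs) \<and> ideal_height R J = enat (length xs))"

definition minimal_prime :: "('a, 'm) ring_scheme \<Rightarrow> 'a set \<Rightarrow> bool" where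
  "minimal_prime R P \<longleftrightarrow> primeideal P R \<and> (\<forall>Q. primeideal Q R \<and> Q \<subseteq> P \<longrightarrow> Q = P)"

definition equidimensional :: "('a, 'm) ring_scheme \<Rightarrow> bool" where
  "equidimensional R \<longleftrightarrow> (\<forall>P. minimal_prime R P \<longrightarrow> krull_dim (R Quot P) = krull_dim R)"

definition ideal_power :: "('a, 'm) ring_scheme \<Rightarrow> 'a set \<Rightarrow> nat \<Rightarrow> 'a set" where
  "ideal_power R J n = J [^]\<^bsub>ideals_set R\<^esub> n"

definition adic_converges ::
    "('a, 'm) ring_scheme \<Rightarrow> 'a set \<Rightarrow> (nat \<Rightarrow> 'a) \<Rightarrow> 'a \<Rightarrow> bool" where
  "adic_converges R J a l \<longleftrightarrow>
     (\<forall>k. \<exists>N. \<forall>n\<ge>N. a n \<ominus>\<^bsub>R\<^esub> l \<in> ideal_power R J k)"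

definition adic_cauchy :: "('a, 'm) ring_scheme \<Rightarrow> 'a set \<Rightarrow> (nat \<Rightarrow> 'a) \<Rightarrow> bool" where
  "adic_cauchy R J a \<longleftrightarrow>
     (\<forall>k. \<exists>N. \<forall>i\<ge>N. \<forall>j\<ge>N. a i \<ominus>\<^bsub>R\<^esub> a j \<in> ideal_power R J k)"

definition adically_complete :: "('a, 'm) ring_scheme \<Rightarrow> 'a set \<Rightarrow> bool" where
  "adically_complete R J \<longleftrightarrow>
     (\<Inter>k. ideal_power R J k) = {\<zero>\<^bsub>R\<^esub>} \<and>
     (\<forall>a \<in> UNIV \<rightarrow> carrier R. adic_cauchy R J a \<longrightarrow> (\<exists>l\<in>carrier R. adic_converges R J a l))"


section \<open>Modules\<close>

definition self_module :: "('a, 'm) ring_scheme \<Rightarrow> ('a, 'a) module" where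
  "self_module R = \<lparr>carrier = carrier R, monoid.mult = monoid.mult R, one = \<one>\<^bsub>R\<^esub>, ring.zero = \<zero>\<^bsub>R\<^esub>,
     add = add R, smult = monoid.mult R\<rparr>"

definition ideal_module :: "('a, 'm) ring_scheme \<Rightarrow> 'a set \<Rightarrow> ('a, 'a) module" where
  "ideal_module R I = (self_module R)\<lparr>carrier := I\<rparr>"

text \<open>The record type of modules extends that of rings; the multiplicative fields
  play no role in the locale \<open>module\<close> and are left unspecified.\<close>

definition quot_module :: "('a, 'b) module \<Rightarrow> 'b set \<Rightarrow> ('a, 'b set) module" where
  "quot_module M N = \<lparr>carrier = a_rcosets\<^bsub>M\<^esub> N, monoid.mult = undefined, one = undefined,
     ring.zero = N, add = set_add M, smult = (\<lambda>r A. \<Union>x\<in>A. N +>\<^bsub>M\<^esub> (r \<odot>\<^bsub>M\<^esub> x))\<rparr>"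

definition module_hom ::
    "('a, 'm) ring_scheme \<Rightarrow> ('a, 'b) module \<Rightarrow> ('a, 'c) module \<Rightarrow> ('b \<Rightarrow> 'c) set" where
  "module_hom R M N = {f \<in> carrier M \<rightarrow> carrier N.
     (\<forall>x\<in>carrier M. \<forall>y\<in>carrier M. f (x \<oplus>\<^bsub>M\<^esub> y) = f x \<oplus>\<^bsub>N\<^esub> f y) \<and>
     (\<forall>r\<in>carrier R. \<forall>x\<in>carrier M. f (r \<odot>\<^bsub>M\<^esub> x) = r \<odot>\<^bsub>N\<^esub> f x)}"

definition module_isomorphic ::
    "('a, 'm) ring_scheme \<Rightarrow> ('a, 'b) module \<Rightarrow> ('a, 'c) module \<Rightarrow> bool" where
  "module_isomorphic R M N \<longleftrightarrow> (\<exists>f\<in>module_hom R M N. bij_betw f (carrier M) (carrier N))"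

definition module_ker :: "('a, 'b) module \<Rightarrow> ('a, 'c) module \<Rightarrow> ('b \<Rightarrow> 'c) \<Rightarrow> 'b set" where
  "module_ker M N f = {x\<in>carrier M. f x = \<zero>\<^bsub>N\<^esub>}"

text \<open>The test modules \<open>A\<close>, \<open>B\<close> have to live on a fixed type. The type of the ring
  itself suffices: it carries the inclusions of ideals into \<open>R\<close>, so by Baer's criterion the
  extension property below implies the one for arbitrary modules.\<close>

definition injective_module :: "('a, 'm) ring_scheme \<Rightarrow> ('a, 'b) module \<Rightarrow> bool" where
  "injective_module R E \<longleftrightarrow> module R E \<and>
     (\<forall>(A :: ('a, 'a) module) (B :: ('a, 'a) module) g f.
        module R A \<and> module R B \<and> g \<in> module_hom R A B \<and> inj_on g (carrier A) \<and>
        f \<in> module_hom R A E \<longrightarrow>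
        (\<exists>h\<in>module_hom R B E. \<forall>x\<in>carrier A. h (g x) = f x))"

text \<open>Again the test modules live on fixed types. The given types suffice: the free module
  on the set \<open>carrier P\<close> lives on \<open>'b \<Rightarrow> 'a\<close>, and lifting the identity of \<open>P\<close> to it
  exhibits \<open>P\<close> as a direct summand of a free module.\<close>

definition projective_module :: "('a, 'm) ring_scheme \<Rightarrow> ('a, 'b) module \<Rightarrow> bool" where
  "projective_module R P \<longleftrightarrow> module R P \<and>
     (\<forall>(A :: ('a, 'b \<Rightarrow> 'a) module) (B :: ('a, 'b) module) g f.
        module R A \<and> module R B \<and> g \<in> module_hom R A B \<and> g ` carrier A = carrier B \<and>
        f \<in> module_hom R P B \<longrightarrow>
        (\<exists>h\<in>module_hom R P A. \<forall>x\<in>carrier P. g (h x) = f x))"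

definition injective_hull ::
    "('a, 'm) ring_scheme \<Rightarrow> ('a, 'b) module \<Rightarrow> ('a, 'c) module \<Rightarrow> bool" where
  "injective_hull R M E \<longleftrightarrow> injective_module R E \<and>
     (\<exists>i\<in>module_hom R M E. inj_on i (carrier M) \<and>
        (\<forall>N. submodule N R E \<and> N \<noteq> {\<zero>\<^bsub>E\<^esub>} \<longrightarrow> N \<inter> i ` carrier M \<noteq> {\<zero>\<^bsub>E\<^esub>}))"

text \<open>\<open>\<dots> \<rightarrow> P 1 \<rightarrow> P 0 \<rightarrow> M \<rightarrow> 0\<close>, with differentials \<open>d i : P (i + 1) \<rightarrow> P i\<close>.\<close>

definition projective_resolution ::
    "('a, 'm) ring_scheme \<Rightarrow> ('a, 'b) module \<Rightarrow> (nat \<Rightarrow> ('a, 'c) module) \<Rightarrow>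
     (nat \<Rightarrow> 'c \<Rightarrow> 'c) \<Rightarrow> ('c \<Rightarrow> 'b) \<Rightarrow> bool" where
  "projective_resolution R M P d e \<longleftrightarrow>
     (\<forall>i. projective_module R (P i)) \<and>
     (\<forall>i. d i \<in> module_hom R (P (Suc i)) (P i)) \<and>
     e \<in> module_hom R (P 0) M \<and>
     e ` carrier (P 0) = carrier M \<and>
     d 0 ` carrier (P 1) = module_ker (P 0) M e \<and>
     (\<forall>i. d (Suc i) ` carrier (P (Suc (Suc i))) = module_ker (P (Suc i)) (P i) (d i))"

text \<open>The infimum is over projective resolutions by modules on the type \<open>'c\<close>.
  The value is the usual projective dimension once \<open>'c\<close> is large enough (for a finitely
  generated module over a Noetherian ring, \<open>nat \<Rightarrow> 'a\<close> will do); for a smaller type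
  it can only be larger.\<close>

definition proj_dim ::
    "'c itself \<Rightarrow> ('a, 'm) ring_scheme \<Rightarrow> ('a, 'b) module \<Rightarrow> enat" where
  "proj_dim _ R M =
     (INF n \<in> {n. \<exists>(P :: nat \<Rightarrow> ('a, 'c) module) d e. projective_resolution R M P d e \<and>
                    (\<forall>i>n. carrier (P i) = {\<zero>\<^bsub>P i\<^esub>})}. enat n)"

text \<open>\<open>0 \<rightarrow> M \<rightarrow> C 0 \<rightarrow> C 1 \<rightarrow> \<dots>\<close>, with differentials \<open>d i : C i \<rightarrow> C (i + 1)\<close>.\<close>

definition injective_resolution ::
    "('a, 'm) ring_scheme \<Rightarrow> ('a, 'b) module \<Rightarrow> (nat \<Rightarrow> ('a, 'c) module) \<Rightarrow>
     (nat \<Rightarrow> 'c \<Rightarrow> 'c) \<Rightarrow> ('b \<Rightarrow> 'c) \<Rightarrow> bool" where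
  "injective_resolution R M C d e \<longleftrightarrow>
     (\<forall>i. injective_module R (C i)) \<and>
     (\<forall>i. d i \<in> module_hom R (C i) (C (Suc i))) \<and>
     e \<in> module_hom R M (C 0) \<and>
     inj_on e (carrier M) \<and>
     e ` carrier M = module_ker (C 0) (C 1) (d 0) \<and>
     (\<forall>i. d i ` carrier (C i) = module_ker (C (Suc i)) (C (Suc (Suc i))) (d (Suc i)))"


section \<open>Local cohomology and quasi-Gorenstein rings\<close>

definition torsion_part ::
    "('a, 'm) ring_scheme \<Rightarrow> 'a set \<Rightarrow> ('a, 'b) module \<Rightarrow> 'b set" where
  "torsion_part R J M =
     {x\<in>carrier M. \<exists>n. \<forall>a\<in>ideal_power R J n. a \<odot>\<^bsub>M\<^esub> x = \<zero>\<^bsub>M\<^esub>}"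

text \<open>The \<open>i\<close>-th cohomology module of the complex of \<open>J\<close>-torsion parts of \<open>(C, d)\<close>.
  If \<open>(C, d)\<close> is an injective resolution of \<open>M\<close>, this is (a model of) the local cohomology
  module of \<open>M\<close> in degree \<open>i\<close> with support in \<open>J\<close>.\<close>

definition torsion_cohomology ::
    "('a, 'm) ring_scheme \<Rightarrow> 'a set \<Rightarrow> (nat \<Rightarrow> ('a, 'c) module) \<Rightarrow> (nat \<Rightarrow> 'c \<Rightarrow> 'c) \<Rightarrow>
     nat \<Rightarrow> ('a, 'c set) module" where
  "torsion_cohomology R J C d i =
     quot_module
       ((C i)\<lparr>carrier := {x \<in> torsion_part R J (C i). d i x = \<zero>\<^bsub>C (Suc i)\<^esub>}\<rparr>)
       (case i of 0 \<Rightarrow> {\<zero>\<^bsub>C 0\<^esub>} | Suc j \<Rightarrow> d j ` torsion_part R J (C j))"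

definition is_local_cohomology ::
    "'c itself \<Rightarrow> ('a, 'm) ring_scheme \<Rightarrow> 'a set \<Rightarrow> ('a, 'b) module \<Rightarrow> nat \<Rightarrow>
     ('a, 'h) module \<Rightarrow> bool" where
  "is_local_cohomology _ R J M i H \<longleftrightarrow> module R H \<and>
     (\<exists>(C :: nat \<Rightarrow> ('a, 'c) module) d e. injective_resolution R M C d e \<and>
        module_isomorphic R (torsion_cohomology R J C d i) H)"

text \<open>The type \<open>'c\<close> carries the injective resolution used to compute local cohomology.
  Local cohomology does not depend on the resolution, so the property does not depend on
  \<open>'c\<close> as long as \<open>'c\<close> is large enough to carry a resolution at all (and it fails otherwise).\<close>

definition quasi_gorenstein :: "'c itself \<Rightarrow> ('a, 'm) ring_scheme \<Rightarrow> bool" where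
  "quasi_gorenstein T R \<longleftrightarrow>
     (\<exists>d (E :: ('a, 'c set) module). krull_dim R = enat d \<and>
        injective_hull R (quot_module (self_module R) (max_ideal R)) E \<and>
        is_local_cohomology T R (max_ideal R) (self_module R) d E)"


section \<open>Tight closure and the parameter test ideal\<close>

definition frobenius_power :: "('a, 'm) ring_scheme \<Rightarrow> 'a set \<Rightarrow> nat \<Rightarrow> 'a set" where
  "frobenius_power R J q = Idl\<^bsub>R\<^esub> {x [^]\<^bsub>R\<^esub> q | x. x \<in> J}"

definition tight_closure :: "('a, 'm) ring_scheme \<Rightarrow> nat \<Rightarrow> 'a set \<Rightarrow> 'a set" where
  "tight_closure R p J = {z\<in>carrier R. \<exists>c\<in>carrier R.
     (\<forall>P. minimal_prime R P \<longrightarrow> c \<notin> P) \<and>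
     (\<exists>N. \<forall>e\<ge>N. c \<otimes>\<^bsub>R\<^esub> (z [^]\<^bsub>R\<^esub> (p ^ e)) \<in> frobenius_power R J (p ^ e))}"

definition parameter_test_ideal :: "('a, 'm) ring_scheme \<Rightarrow> nat \<Rightarrow> 'a set" where
  "parameter_test_ideal R p = {c\<in>carrier R. \<forall>J. parameter_ideal R J \<longrightarrow>
     (\<forall>z\<in>tight_closure R p J. c \<otimes>\<^bsub>R\<^esub> z \<in> J)}"


section \<open>Total ring of fractions and conductor\<close>

definition non_zero_divisors :: "('a, 'm) ring_scheme \<Rightarrow> 'a set" where
  "non_zero_divisors R = {s\<in>carrier R. \<forall>x\<in>carrier R. s \<otimes>\<^bsub>R\<^esub> x = \<zero>\<^bsub>R\<^esub> \<longrightarrow> x = \<zero>\<^bsub>R\<^esub>}"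

definition frac_rel :: "('a, 'm) ring_scheme \<Rightarrow> (('a \<times> 'a) \<times> ('a \<times> 'a)) set" where
  "frac_rel R = {((a, s), (b, t)). a \<in> carrier R \<and> b \<in> carrier R \<and>
     s \<in> non_zero_divisors R \<and> t \<in> non_zero_divisors R \<and> a \<otimes>\<^bsub>R\<^esub> t = b \<otimes>\<^bsub>R\<^esub> s}"

definition total_frac :: "('a, 'm) ring_scheme \<Rightarrow> ('a \<times> 'a) set ring" where
  "total_frac R = \<lparr>carrier = (carrier R \<times> non_zero_divisors R) // frac_rel R,
     monoid.mult = (\<lambda>A B. \<Union>(a, s)\<in>A. \<Union>(b, t)\<in>B. frac_rel R `` {(a \<otimes>\<^bsub>R\<^esub> b, s \<otimes>\<^bsub>R\<^esub> t)}),
     one = frac_rel R `` {(\<one>\<^bsub>R\<^esub>, \<one>\<^bsub>R\<^esub>)},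
     ring.zero = frac_rel R `` {(\<zero>\<^bsub>R\<^esub>, \<one>\<^bsub>R\<^esub>)},
     add = (\<lambda>A B. \<Union>(a, s)\<in>A. \<Union>(b, t)\<in>B.
       frac_rel R `` {((a \<otimes>\<^bsub>R\<^esub> t) \<oplus>\<^bsub>R\<^esub> (b \<otimes>\<^bsub>R\<^esub> s), s \<otimes>\<^bsub>R\<^esub> t)})\<rparr>"

definition frac_embed :: "('a, 'm) ring_scheme \<Rightarrow> 'a \<Rightarrow> ('a \<times> 'a) set" where
  "frac_embed R a = frac_rel R `` {(a, \<one>\<^bsub>R\<^esub>)}"

text \<open>Polynomials are coefficient lists, leading coefficient first.\<close>

definition integral_closure :: "('a, 'm) ring_scheme \<Rightarrow> ('a \<times> 'a) set set" where
  "integral_closure R = {x\<in>carrier (total_frac R).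
     \<exists>f. polynomial\<^bsub>total_frac R\<^esub> (frac_embed R ` carrier R) f \<and> f \<noteq> [] \<and>
         Polynomials.lead_coeff f = \<one>\<^bsub>total_frac R\<^esub> \<and>
         ring.eval (total_frac R) f x = \<zero>\<^bsub>total_frac R\<^esub>}"

definition conductor :: "('a, 'm) ring_scheme \<Rightarrow> ('a \<times> 'a) set set" where
  "conductor R = {a\<in>carrier (total_frac R). \<forall>x\<in>integral_closure R.
     a \<otimes>\<^bsub>total_frac R\<^esub> x \<in> frac_embed R ` carrier R}"

end

theory Submission
  imports Defs
begin

text \<open>Since \<open>R\<close> is quasi-Gorenstein, its top local cohomology \<open>E\<close> is the injective hull of the residue
 field and carries a Frobenius action \<open>F\<close>; it is generated by the classes \<open>\<eta> t\<close> of
 \<open>1 / (x\<^sub>1 \<dots> x\<^sub>d)\<^sup>t\<close>, for parameters \<open>x\<close>. Let \<open>\<tau>\<close> be the ideal multiplying the tight closure of every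
 ideal \<open>J\<close> into \<open>J\<close>. It lies in the parameter test ideal, and in the conductor: if \<open>a/s\<close> is
 integral, then \<open>s\<^sup>l a\<^sup>N \<in> s\<^sup>N R\<close> for all \<open>N\<close>, so \<open>a\<close> is in the tight closure of \<open>s R\<close>. By Matlis duality
 \<open>\<tau>\<close> is the annihilator of the tight closure \<open>Z\<close> of \<open>0\<close> in \<open>E\<close>, which is \<open>F\<close>-stable, and \<open>\<tau> \<subseteq> I\<close> gives
 \<open>(0 :\<^sub>E I) \<subseteq> Z\<close>. For a parameter ideal \<open>I\<close> this would put \<open>\<eta> 1\<close> into \<open>Z\<close>, although the elements
 \<open>F\<^sup>e (\<eta> 1) = \<eta> (p\<^sup>e)\<close> generate \<open>E\<close>; with \<open>I = 0\<close> this shows \<open>\<tau> \<noteq> 0\<close>. If \<open>I\<close> has finite projective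
 dimension, some system of parameters acts as zero up to homotopy on the minimal resolution
 of \<open>R/I\<close>, the \<open>i\<close>-th parameter in degrees \<open>> i\<close>. A Koszul argument then shows that the \<open>F\<^sup>e(0 :\<^sub>E I)\<close>
 generate \<open>E\<close>, so that \<open>\<tau>\<close> would kill \<open>E\<close>.\<close>

text \<open>The Koszul argument plays two constructions against each other. The homotopies live over
  \<open>R\<close> before any Frobenius power is taken. They push every basis cochain of total
  degree \<open>d\<close> to a cocycle after \<open>d + 1\<close> corrections, one for each
  cardinality from 0 to \<open>d\<close>; this is the origin of the exponent \<open>d + 2\<close>.
  The top component \<open>\<rho>\<close> of the result gives an element
  \<open>\<rho> *\<^sub>E \<eta> (d + 2)\<close> killed by \<open>I\<close>, and pushing commutes
  with Frobenius. On the other side, minimality puts the matrices of a high Frobenius twist into a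
  high power of \<open>m\<close>, where Koszul cocycles are coboundaries by Artin--Rees. Hence the
  cochain with top component \<open>\<one>\<close> can be completed to a cocycle of the twisted
  complex, and pushing that cocycle expresses a power of the product of the parameters through the
  \<open>q\<close>-th powers of the \<open>\<rho>\<close>. The parameters come from minimal
  resolutions at all primes over \<open>I\<close>, whose lengths are bounded by the heights. No
  module is localised: exactness is only asked up to multipliers from a multiplicative set, and
  finitely many degrees at a time cost finitely many multipliers.\<close>

notation (input) monoid.mult (infixl \<open>**\<index>\<close> 70)

section \<open>Noetherian rings\<close>

context cring
begin

lemma ideal_intro:
 assumes "J \<subseteq> carrier R" "\<zero> \<in> J" "!!a b. a \<in> J ==> b \<in> J ==> a \<oplus> b \<in> J"
  "!!a r. a \<in> J ==> r \<in> carrier R ==> r ** a \<in> J"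
 shows "ideal J R"
proof (rule idealI)
 have neg: "\<ominus> a \<in> J" if "a \<in> J" for a
 proof -
  have "\<ominus> a = (\<ominus> \<one>) ** a" using assms(1) that l_minus[of \<one> a] by auto
  thus ?thesis using assms(4)[OF that, of "\<ominus> \<one>"] by simp
 qed
 show "subgroup J (add_monoid R)"
  by (rule add.subgroupI) (use assms neg in \<open>auto simp flip: a_inv_def\<close>)
qed (use assms m_comm ring_axioms in \<open>auto simp: subset_iff\<close>)

lemma idealD:
 assumes "ideal J R"
 shows "J \<subseteq> carrier R" "!!a. a \<in> J ==> a \<in> carrier R" "\<zero> \<in> J"
  "!!a b. a \<in> J ==> b \<in> J ==> a \<oplus> b \<in> J"
  "!!a r. a \<in> J ==> r \<in> carrier R ==> r ** a \<in> J"
  "!!a r. a \<in> J ==> r \<in> carrier R ==> a ** r \<in> J"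
  "!!a. a \<in> J ==> \<ominus> a \<in> J"
  "!!a b. a \<in> J ==> b \<in> J ==> a \<ominus> b \<in> J"
proof -
 interpret J: ideal J R by fact
 show "J \<subseteq> carrier R" "\<zero> \<in> J" by (auto simp: J.a_subset)
 show 1: "a \<in> carrier R" if "a \<in> J" for a using that by (rule J.Icarr)
 show 2: "a \<oplus> b \<in> J" if "a \<in> J" "b \<in> J" for a b using that by auto
 show 3: "\<ominus> a \<in> J" if "a \<in> J" for a using that by auto
 show "a \<ominus> b \<in> J" if "a \<in> J" "b \<in> J" for a b using that 2 3 by (simp add: minus_eq)
 show "r ** a \<in> J" "a ** r \<in> J" if "a \<in> J" "r \<in> carrier R" for a r
  using that J.I_l_closed J.I_r_closed by auto
qed

lemma primeD:
 assumes "primeideal Q R"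
 shows "ideal Q R" "\<one> \<notin> Q" "!!a b. a \<in> carrier R ==> b \<in> carrier R ==> a ** b \<in> Q ==> a \<in> Q \<or> b \<in> Q"
proof -
 interpret primeideal Q R by fact
 show "ideal Q R" by (rule is_ideal)
 show "\<one> \<notin> Q" using I_notcarr one_imp_carrier by auto
qed (use primeideal.I_prime[OF assms] in auto)

lemma finsum_in_ideal:
 assumes J: "ideal J R" and f: "!!i. i \<in> A ==> f i \<in> J" shows "(\<Oplus>i\<in>A. f i) \<in> J"
proof (cases "finite A")
 case True
 thus ?thesis using f
 proof (induction A)
  case (insert i A)
  hence "f \<in> A \<rightarrow> carrier R" "f i \<in> carrier R" using idealD(2)[OF J] by auto
  thus ?case using insert idealD(4)[OF J] by simp
 qed (simp add: idealD(3)[OF J])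
qed (simp add: finsum_infinite idealD(3)[OF J])

lemma ideal_one_carrier: "ideal J R ==> J ~= carrier R \<longleftrightarrow> \<one> \<notin> J"
 using ideal.one_imp_carrier by blast

lemma prime_pow:
 assumes "primeideal Q R" "a \<in> carrier R" "a [^] (n::nat) \<in> Q" shows "a \<in> Q"
 using assms(3)
proof (induction n)
 case 0 thus ?case using primeD(2)[OF assms(1)] by simp
next
 case (Suc n) thus ?case using primeD(3)[OF assms(1), of "a [^] n" a] assms(2) by auto
qed

definition adjoin :: "'a set => 'a => 'a set" where
 "adjoin J a = {j \<oplus> r ** a | j r. j \<in> J \<and> r \<in> carrier R}"

lemma adjoin_ideal:
 assumes J: "ideal J R" and a: "a \<in> carrier R"
 shows "ideal (adjoin J a) R" "J \<subseteq> adjoin J a" "a \<in> adjoin J a"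
  "!!L. ideal L R ==> J \<subseteq> L ==> a \<in> L ==> adjoin J a \<subseteq> L"
proof -
 note JD = idealD[OF J]
 show "ideal (adjoin J a) R"
 proof (rule ideal_intro)
  show "adjoin J a \<subseteq> carrier R" using JD a by (auto simp: adjoin_def)
  have "\<zero> = \<zero> \<oplus> \<zero> ** a" using a by simp
  thus "\<zero> \<in> adjoin J a" unfolding adjoin_def using JD by blast
 next
  fix x y assume "x \<in> adjoin J a" "y \<in> adjoin J a"
  then obtain j r j' r' where *: "x = j \<oplus> r ** a" "y = j' \<oplus> r' ** a" "j \<in> J" "j' \<in> J"
   "r \<in> carrier R" "r' \<in> carrier R" unfolding adjoin_def by blast
  have "x \<oplus> y = (j \<oplus> j') \<oplus> (r \<oplus> r') ** a" unfolding *(1,2) using a JD(2)[OF *(3)] JD(2)[OF *(4)] *(5,6) by algebra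
  thus "x \<oplus> y \<in> adjoin J a"
   unfolding adjoin_def using JD(4)[OF *(3,4)] a_closed[OF *(5,6)] by blast
 next
  fix x s assume "x \<in> adjoin J a" and s: "s \<in> carrier R"
  then obtain j r where *: "x = j \<oplus> r ** a" "j \<in> J" "r \<in> carrier R" unfolding adjoin_def by blast
  have "s ** x = (s ** j) \<oplus> (s ** r) ** a" unfolding *(1) using a s JD(2)[OF *(2)] *(3) by (simp add: r_distr m_assoc)
  thus "s ** x \<in> adjoin J a"
   unfolding adjoin_def using JD(5)[OF *(2) s] m_closed[OF s *(3)] by blast
 qed
 show "J \<subseteq> adjoin J a"
 proof
  fix j assume j: "j \<in> J"
  hence "j = j \<oplus> \<zero> ** a" using a JD by simp
  thus "j \<in> adjoin J a" unfolding adjoin_def using j by blast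
 qed
 have "a = \<zero> \<oplus> \<one> ** a" using a by simp
 thus "a \<in> adjoin J a" unfolding adjoin_def using JD by blast
 show "adjoin J a \<subseteq> L" if "ideal L R" "J \<subseteq> L" "a \<in> L" for L
  using that idealD[OF that(1)] by (auto simp: adjoin_def subset_iff)
qed

lemma quotient_ideal:
 assumes "ideal J R" "z \<in> carrier R"
 shows "ideal {r \<in> carrier R. r ** z \<in> J} R"
 by (rule ideal_intro) (use assms idealD[OF assms(1)] in \<open>auto simp: l_distr m_assoc\<close>)

end

locale noetherian_cring = cring R + noetherian_ring R for R (structure)
begin

text \<open>A nonempty chain of ideals contains its union (\<open>ideal_chain_is_trivial\<close>),
  so Zorn's lemma applies. Most finiteness arguments below rest on this maximum condition.\<close>

lemma maximal_ideal_in: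
 assumes "S ~= {}" "!!J. J \<in> S ==> ideal J R"
 obtains M where "M \<in> S" "!!J. J \<in> S ==> M \<subseteq> J ==> J = M"
proof -
 have "\<exists>M\<in>S. \<forall>L\<in>S. M \<subseteq> L --> L = M"
 proof (rule subset_Zorn_nonempty[OF assms(1)])
  fix C assume C: "C ~= {}" "subset.chain S C"
  hence "subset.chain {I. ideal I R} C" using assms(2) by (auto simp: pred_on.chain_def)
  hence "\<Union>C \<in> C" using ideal_chain_is_trivial[OF C(1)] by blast
  thus "\<Union>C \<in> S" using C by (auto simp: pred_on.chain_def)
 qed
 thus ?thesis using that by blast
qed

lemma ideal_noetherian_induct [consumes 1, case_names step]:
 assumes "ideal J R"
  and step: "!!J. ideal J R ==> (!!L. ideal L R ==> J \<subset> L ==> Q L) ==> Q J"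
 shows "Q J"
proof (rule ccontr)
 assume "\<not> Q J"
 hence "{J. ideal J R \<and> \<not> Q J} ~= {}" using assms(1) by blast
 then obtain M where "M \<in> {J. ideal J R \<and> \<not> Q J}"
  "!!L. L \<in> {J. ideal J R \<and> \<not> Q J} ==> M \<subseteq> L ==> L = M"
  by (rule maximal_ideal_in) auto
 thus False using step[of M] by blast
qed

text \<open>An ideal \<open>Q\<close> maximal among those above \<open>J\<close> that avoid
  \<open>U\<close> is prime: if neither \<open>a\<close> nor \<open>b\<close> were in
  \<open>Q\<close>, both enlarged ideals would meet \<open>U\<close>, and the product of the two
  points of \<open>U\<close> would lie in \<open>Q\<close> together with
  \<open>a ** b\<close>.\<close>

lemma prime_disjoint:
 assumes J: "ideal J R" and U: "U \<subseteq> carrier R" "\<one> \<in> U" "!!a b. a \<in> U ==> b \<in> U ==> a ** b \<in> U"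
  and "J \<inter> U = {}"
 obtains Q where "primeideal Q R" "J \<subseteq> Q" "Q \<inter> U = {}"
proof -
 have "{L. ideal L R \<and> J \<subseteq> L \<and> L \<inter> U = {}} ~= {}" using assms by blast
 then obtain Q where Q: "Q \<in> {L. ideal L R \<and> J \<subseteq> L \<and> L \<inter> U = {}}"
  "!!L. L \<in> {L. ideal L R \<and> J \<subseteq> L \<and> L \<inter> U = {}} ==> Q \<subseteq> L ==> L = Q"
  by (rule maximal_ideal_in) auto
 hence QI: "ideal Q R" by blast
 note QD = idealD[OF QI]
 have "primeideal Q R"
 proof (rule primeidealI)
  show "carrier R ~= Q" using Q U by auto
  fix a b assume ab: "a \<in> carrier R" "b \<in> carrier R" "a ** b \<in> Q"
  show "a \<in> Q \<or> b \<in> Q"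
  proof (rule ccontr)
   assume n: "\<not> ?thesis"
   have "\<exists>q r. q \<in> Q \<and> r \<in> carrier R \<and> q \<oplus> r ** c \<in> U" if "c \<in> carrier R" "c \<notin> Q" for c
   proof -
    have "adjoin Q c \<inter> U ~= {}"
     using Q(2)[of "adjoin Q c"] adjoin_ideal[OF QI that(1)] Q(1) that by auto
    thus ?thesis unfolding adjoin_def by blast
   qed
   then obtain q r q' r' where *: "q \<in> Q" "r \<in> carrier R" "q \<oplus> r ** a \<in> U"
     "q' \<in> Q" "r' \<in> carrier R" "q' \<oplus> r' ** b \<in> U" using n ab by meson
   have "(q \<oplus> r ** a) ** (q' \<oplus> r' ** b) = q ** (q' \<oplus> r' ** b) \<oplus> ((r ** a) ** q' \<oplus> (r ** r') ** (a ** b))"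
    using QD(2)[OF *(1)] QD(2)[OF *(4)] *(2,5) ab by algebra
   also have "\<dots> \<in> Q" using * ab QD by (simp add: m_closed)
   finally show False using U(3)[OF *(3,6)] Q(1) by blast
  qed
 qed (use QI is_cring in auto)
 thus ?thesis using that Q(1) by blast
qed

lemma proper_in_maximal:
 assumes "ideal J R" "J ~= carrier R"
 obtains M where "maximalideal M R" "J \<subseteq> M"
proof -
 have "{L. ideal L R \<and> J \<subseteq> L \<and> L ~= carrier R} ~= {}" using assms by blast
 then obtain M where M: "M \<in> {L. ideal L R \<and> J \<subseteq> L \<and> L ~= carrier R}"
  "!!L. L \<in> {L. ideal L R \<and> J \<subseteq> L \<and> L ~= carrier R} ==> M \<subseteq> L ==> L = M"
  by (rule maximal_ideal_in) auto
 have "maximalideal M R"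
 proof (rule maximalidealI)
  show "L = M \<or> L = carrier R" if "ideal L R" "M \<subseteq> L" "L \<subseteq> carrier R" for L
   using M(2)[of L] M(1) that by blast
 qed (use M in auto)
 thus ?thesis using that M by blast
qed

text \<open>Noetherian induction: if \<open>a ** b\<close> lies in \<open>J\<close> and neither
  factor does, the product of the two enlarged ideals lies in \<open>J\<close>, and their lists of
  primes are concatenated. This takes the place of primary decomposition.\<close>

lemma prime_product_below:
 assumes "ideal J R"
 obtains Ps where "!!Q. Q \<in> set Ps ==> primeideal Q R \<and> J \<subseteq> Q"
  "foldr (ideal_prod R) Ps (carrier R) \<subseteq> J"
proof -
 have "\<exists>Ps. (\<forall>Q\<in>set Ps. primeideal Q R \<and> J \<subseteq> Q) \<and> foldr (ideal_prod R) Ps (carrier R) \<subseteq> J"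
  using assms
 proof (induction J rule: ideal_noetherian_induct)
  case (step J)
  note JD = idealD[OF step(1)]
  consider "J = carrier R" | "primeideal J R" |
   a b where "a \<in> carrier R" "b \<in> carrier R" "a ** b \<in> J" "a \<notin> J" "b \<notin> J"
   using step(1) is_cring primeidealI[of J R] by metis
  thus ?case
  proof cases
   case 1 thus ?thesis by (intro exI[of _ "[]"]) auto
  next
   case 2
   have "foldr (ideal_prod R) [J] (carrier R) \<subseteq> J"
    using ideal_prod_inter[OF step(1) oneideal] by auto
   thus ?thesis using 2 by (intro exI[of _ "[J]"]) auto
  next
   case (3 a b)
   note A = adjoin_ideal[OF step(1) 3(1)] and B = adjoin_ideal[OF step(1) 3(2)]
   obtain Ps where Ps: "\<forall>Q\<in>set Ps. primeideal Q R \<and> adjoin J a \<subseteq> Q"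
    "foldr (ideal_prod R) Ps (carrier R) \<subseteq> adjoin J a" using step(2)[OF A(1)] A 3 by blast
   obtain Qs where Qs: "\<forall>Q\<in>set Qs. primeideal Q R \<and> adjoin J b \<subseteq> Q"
    "foldr (ideal_prod R) Qs (carrier R) \<subseteq> adjoin J b" using step(2)[OF B(1)] B 3 by blast
   have id: "ideal (foldr (ideal_prod R) Ls (carrier R)) R" if "\<forall>Q\<in>set Ls. ideal Q R" for Ls
    using that by (induction Ls) (auto intro: ideal_prod_is_ideal oneideal)
   have app: "foldr (ideal_prod R) (Ls @ Ms) (carrier R)
     = foldr (ideal_prod R) Ls (carrier R) \<cdot> foldr (ideal_prod R) Ms (carrier R)"
    if "\<forall>Q\<in>set Ls. ideal Q R" "\<forall>Q\<in>set Ms. ideal Q R" for Ls Ms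
    using that
   proof (induction Ls)
    case Nil
    thus ?case using ideal_prod_one[OF id[of Ms]] ideal_prod_commute[OF oneideal id[of Ms]]
     by simp
   next
    case (Cons L Ls)
    thus ?case using ideal_prod_assoc[of L "foldr (ideal_prod R) Ls (carrier R)"
      "foldr (ideal_prod R) Ms (carrier R)"] id by auto
   qed
   have pI: "\<forall>Q\<in>set Ps. ideal Q R" "\<forall>Q\<in>set Qs. ideal Q R" using Ps Qs primeD(1) by auto
   have "x \<in> J" if "x \<in> adjoin J a \<cdot> adjoin J b" for x
    using that
   proof (induction rule: ideal_prod.induct)
    case (prod i j)
    then obtain j1 r1 j2 r2 where *: "i = j1 \<oplus> r1 ** a" "j = j2 \<oplus> r2 ** b" "j1 \<in> J" "j2 \<in> J"
     "r1 \<in> carrier R" "r2 \<in> carrier R" unfolding adjoin_def by blast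
    have "i ** j = j1 ** (j2 \<oplus> r2 ** b) \<oplus> ((r1 ** a) ** j2 \<oplus> (r1 ** r2) ** (a ** b))"
     unfolding * using JD(2)[OF *(3)] JD(2)[OF *(4)] *(5,6) 3(1,2) by algebra
    also have "\<dots> \<in> J" using * 3 JD by (simp add: m_closed)
    finally show ?case .
   qed (use JD in auto)
   moreover have "x \<in> adjoin J a \<cdot> adjoin J b" if "x \<in> foldr (ideal_prod R) (Ps @ Qs) (carrier R)" for x
    using that unfolding app[OF pI]
   proof (induction rule: ideal_prod.induct)
    case (prod i j)
    thus ?case using Ps(2) Qs(2) by (intro ideal_prod.prod) auto
   qed (rule ideal_prod.sum)
   moreover have "\<forall>Q\<in>set (Ps @ Qs). primeideal Q R \<and> J \<subseteq> Q"
    using Ps(1) Qs(1) A(2) B(2) by (metis Un_iff order_trans set_append)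
   ultimately show ?thesis by (intro exI[of _ "Ps @ Qs"]) blast
  qed
 qed
 thus ?thesis using that by blast
qed

lemma ideal_list_prod:
 "\<forall>Q\<in>set Ls. ideal Q R ==> ideal (foldr (ideal_prod R) Ls (carrier R)) R"
 by (induction Ls) (auto intro: ideal_prod_is_ideal oneideal)

lemma prime_contains_factor:
 assumes "primeideal Q R" "\<forall>L\<in>set Ls. ideal L R" "foldr (ideal_prod R) Ls (carrier R) \<subseteq> Q"
 shows "\<exists>L\<in>set Ls. L \<subseteq> Q"
 using assms(2,3)
proof (induction Ls)
 case Nil
 thus ?case using primeD(2)[OF assms(1)] by auto
next
 case (Cons L Ls)
 thus ?case
  using primeideal_divides_ideal_prod[OF assms(1), of L "foldr (ideal_prod R) Ls (carrier R)"]
   ideal_list_prod[of Ls] by auto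
qed

text \<open>A prime over \<open>J\<close> contains the product of primes found below
  \<open>J\<close>, hence one of its factors. The factors include all minimal primes of
  \<open>J\<close> and possibly others.\<close>

lemma finite_primes_over:
 assumes "ideal J R"
 obtains \<P> where "finite \<P>" "!!Q. Q \<in> \<P> ==> primeideal Q R \<and> J \<subseteq> Q"
  "!!Q. primeideal Q R ==> J \<subseteq> Q ==> \<exists>P\<in>\<P>. P \<subseteq> Q"
proof -
 obtain Ps where Ps: "!!Q. Q \<in> set Ps ==> primeideal Q R \<and> J \<subseteq> Q"
  "foldr (ideal_prod R) Ps (carrier R) \<subseteq> J" using prime_product_below[OF assms] by blast
 show ?thesis
 proof (rule that[of "set Ps"])
  show "\<exists>P\<in>set Ps. P \<subseteq> Q" if "primeideal Q R" "J \<subseteq> Q" for Q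
   using prime_contains_factor[OF that(1), of Ps] Ps that(2) primeD(1) by blast
 qed (use Ps in auto)
qed

section \<open>Powers of an ideal\<close>

lemma ideal_power_Suc: "ideal J R ==> ideal_power R J (Suc n) = J \<cdot> ideal_power R J n"
 and ideal_power_ideal: "ideal J R ==> ideal (ideal_power R J n) R"
 and ideal_power_0: "ideal_power R J 0 = carrier R"
proof -
 interpret I: comm_monoid "ideals_set R" by (rule ideals_set_is_comm_monoid)
 show "ideal_power R J 0 = carrier R" by (simp add: ideal_power_def ideals_set_def)
 assume J: "ideal J R"
 hence c: "J \<in> carrier (ideals_set R)" by (simp add: ideals_set_def)
 thus "ideal (ideal_power R J n) R" 
  using I.nat_pow_closed[OF c, of n] by (simp add: ideal_power_def ideals_set_def)
 show "ideal_power R J (Suc n) = J \<cdot> ideal_power R J n"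
  using I.nat_pow_Suc2[OF c, of n] by (simp add: ideal_power_def ideals_set_def)
qed

text \<open>All factors of a product of primes below \<open>J\<close> equal \<open>M\<close>, so
  this product is a power of \<open>M\<close>.\<close>

lemma ideal_power_below:
 assumes J: "ideal J R" and M: "ideal M R" "!!Q. primeideal Q R ==> J \<subseteq> Q ==> Q = M"
 obtains n where "ideal_power R M n \<subseteq> J"
proof -
 obtain Ps where Ps: "!!Q. Q \<in> set Ps ==> primeideal Q R \<and> J \<subseteq> Q"
  "foldr (ideal_prod R) Ps (carrier R) \<subseteq> J" using prime_product_below[OF J] by blast
 have "foldr (ideal_prod R) Ls (carrier R) = ideal_power R M (length Ls)"
  if "!!Q. Q \<in> set Ls ==> Q = M" for Ls
  using that by (induction Ls) (auto simp: ideal_power_0 ideal_power_Suc[OF M(1)])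
 from this[of Ps] Ps M(2) have "ideal_power R M (length Ps) \<subseteq> J" by simp
 thus ?thesis by (rule that)
qed

lemma ideal_power_mono:
 assumes "ideal M R" "k \<le> n" shows "ideal_power R M n \<subseteq> ideal_power R M k"
 using assms(2)
proof (induction n rule: dec_induct)
 case (step n)
 have "ideal_power R M (Suc n) \<subseteq> ideal_power R M n"
  using ideal_prod_inter[OF assms(1) ideal_power_ideal[OF assms(1), of n]]
  unfolding ideal_power_Suc[OF assms(1)] by (rule subset_trans) simp
 with step(3) show ?case by blast
qed (rule subset_refl)

lemma pow_in_ideal_power:
 assumes "ideal M R" "a \<in> M" shows "a [^] (n::nat) \<in> ideal_power R M n"
proof (induction n)
 case (Suc n)
 have "a [^] Suc n = a ** a [^] n"
  by (rule nat_pow_Suc2) (use assms idealD(2) in blast)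
 thus ?case using ideal_prod.prod[OF assms(2) Suc, of R] by (simp only: ideal_power_Suc[OF assms(1)])
qed (auto simp: ideal_power_0)

text \<open>Induction on the number of primes. If every element of \<open>A\<close> lay in some
  prime, omitting one prime at a time would give elements \<open>x Q\<close> of \<open>A\<close>
  lying in \<open>Q\<close> and in no other prime; then \<open>x P\<close> plus the product of the
  remaining \<open>x Q\<close> avoids them all.\<close>

lemma prime_avoidance:
 assumes "finite \<P>" "!!Q. Q \<in> \<P> ==> primeideal Q R" "ideal A R" "!!Q. Q \<in> \<P> ==> \<not> A \<subseteq> Q"
 obtains x where "x \<in> A" "!!Q. Q \<in> \<P> ==> x \<notin> Q"
proof -
 have "\<exists>x\<in>A. \<forall>Q\<in>\<P>. x \<notin> Q"
  using assms(1,2,4)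
 proof (induction "card \<P>" arbitrary: \<P>)
  case 0
  thus ?case using idealD(3)[OF assms(3)] by auto
 next
  case (Suc n)
  note AD = idealD[OF assms(3)]
  show ?case
  proof (rule ccontr)
   assume neg: "\<not> ?thesis"
   have "\<forall>Q\<in>\<P>. \<exists>x. x \<in> A \<and> x \<in> Q \<and> (\<forall>Q'\<in>\<P> - {Q}. x \<notin> Q')"
   proof
    fix Q assume Q: "Q \<in> \<P>"
    have "\<exists>x\<in>A. \<forall>Q'\<in>\<P> - {Q}. x \<notin> Q'"
     by (rule Suc(1)) (use Suc Q in auto)
    thus "\<exists>x. x \<in> A \<and> x \<in> Q \<and> (\<forall>Q'\<in>\<P> - {Q}. x \<notin> Q')" using neg Q by blast
   qed
   then obtain x where x: "!!Q. Q \<in> \<P> ==> x Q \<in> A \<and> x Q \<in> Q \<and> (\<forall>Q'\<in>\<P> - {Q}. x Q \<notin> Q')" by metis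
   have "\<P> ~= {}" using Suc(2) by auto
   then obtain P where P: "P \<in> \<P>" by blast
   define S where "S = \<P> - {P}"
   have S: "finite S" "S \<subseteq> \<P>" "P \<notin> S" using Suc(3) by (auto simp: S_def)
   have pr: "(\<Otimes>Q\<in>T. x Q) \<in> carrier R \<and> (\<Otimes>Q\<in>T. x Q) \<notin> P \<and> (\<forall>Q\<in>T. (\<Otimes>Q\<in>T. x Q) \<in> Q)
     \<and> (T ~= {} --> (\<Otimes>Q\<in>T. x Q) \<in> A)" if "finite T" "T \<subseteq> S" for T
    using that
   proof (induction T rule: finite_induct)
    case empty thus ?case using primeD(2)[OF Suc(4)[OF P]] by simp
   next
    case (insert Q T)
    have c: "x \<in> insert Q T \<rightarrow> carrier R" using insert(4) S x AD by blast
    have e: "(\<Otimes>Q\<in>insert Q T. x Q) = x Q ** (\<Otimes>Q\<in>T. x Q)"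
     by (rule finprod_insert) (use insert c in auto)
    have xQ: "x Q \<in> A" "x Q \<in> Q" "x Q \<notin> P" "x Q \<in> carrier R" "Q \<in> \<P>"
     using x[of Q] insert(4) S P AD by auto
    show ?case unfolding e
     using insert xQ idealD(5,6)[OF primeD(1)[OF Suc(4)]] primeD(3)[OF Suc(4)[OF P], of "x Q" "(\<Otimes>Q\<in>T. x Q)"]
      AD(6) S(2) by (auto simp: subset_iff)
   qed
   define y where "y = (\<Otimes>Q\<in>S. x Q)"
   have y: "y \<in> carrier R" "y \<notin> P" "!!Q. Q \<in> S ==> y \<in> Q" "S ~= {} ==> y \<in> A"
    using pr[OF S(1)] by (auto simp: y_def)
   show False
   proof (cases "S = {}")
    case True
    hence "\<P> = {P}" using P S_def by auto
    thus False using neg Suc(5)[OF P] by auto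
   next
    case False
    define z where "z = x P \<oplus> y"
    have xP: "x P \<in> A" "x P \<in> P" "x P \<in> carrier R" "!!Q. Q \<in> S ==> x P \<notin> Q" using x[OF P] AD S_def by auto
    have zA: "z \<in> A" using xP y False AD unfolding z_def by auto
    have "z \<notin> Q" if Q: "Q \<in> \<P>" for Q
    proof
     assume z: "z \<in> Q"
     note QD = idealD[OF primeD(1)[OF Suc(4)[OF Q]]]
     have e: "y = z \<ominus> x P" "x P = z \<ominus> y"
      unfolding z_def using xP(3) y(1) by algebra+
     show False
     proof (cases "Q = P")
      case True thus ?thesis using QD(8)[OF z, of "x P"] xP y(2) e(1) by simp
     next
      case False hence "Q \<in> S" using Q S_def by auto
      thus ?thesis using QD(8)[OF z, of y] xP(4) y(3) e(2) by simp
     qed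
    qed
    thus False using neg zA by blast
   qed
  qed
 qed
 then obtain x where "x \<in> A" "\<forall>Q\<in>\<P>. x \<notin> Q" by blast
 thus ?thesis using that[of x] by blast
qed

end

section \<open>Chains of primes and systems of parameters\<close>

text \<open>Height at least \<open>n\<close>, as a relation instead of a supremum in
  \<open>enat\<close>.\<close>

definition chain_to :: "('a, 'm) ring_scheme => nat => 'a set => bool" where
 "chain_to R n Q \<longleftrightarrow> (\<exists>P. prime_chain R n P \<and> P n = Q)"

lemma chain_to_prime: "chain_to R n Q ==> primeideal Q R"
 unfolding chain_to_def prime_chain_def by auto

lemma chain_to_0: "primeideal Q R ==> chain_to R 0 Q"
 unfolding chain_to_def prime_chain_def by auto

text \<open>The bottom of the chain is cut off, since its top has to stay \<open>Q\<close>; hence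
  the shift of the index.\<close>

lemma chain_to_mono:
 assumes "chain_to R n Q" "k \<le> n" shows "chain_to R k Q"
proof -
 obtain P where "prime_chain R n P" "P n = Q" using assms(1) unfolding chain_to_def by blast
 hence "prime_chain R k (\<lambda>i. P (i + (n - k)))" "P (k + (n - k)) = Q"
  using assms(2) unfolding prime_chain_def by auto
 thus ?thesis unfolding chain_to_def by blast
qed

lemma chain_to_Suc:
 assumes "chain_to R n P" "P \<subset> Q" "primeideal Q R" shows "chain_to R (Suc n) Q"
proof -
 obtain C where C: "prime_chain R n C" "C n = P" using assms(1) unfolding chain_to_def by blast
 have "prime_chain R (Suc n) (\<lambda>i. if i = Suc n then Q else C i)"
  using C assms unfolding prime_chain_def by (auto simp: less_Suc_eq le_Suc_eq)
 thus ?thesis unfolding chain_to_def by (intro exI[of _ "\<lambda>i. if i = Suc n then Q else C i"]) auto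
qed

lemma chain_to_up:
 assumes "chain_to R n P" "P \<subseteq> Q" "primeideal Q R" shows "chain_to R n Q"
 using assms chain_to_Suc[of R n P Q] chain_to_mono[of R "Suc n" Q n] by (cases "P = Q") auto

lemma prime_height_ge_chain:
 assumes "primeideal Q R" "enat n \<le> prime_height R Q" shows "chain_to R n Q"
proof (rule ccontr)
 assume neg: "\<not> chain_to R n Q"
 have k: "k < n" if "chain_to R k Q" for k
  using neg chain_to_mono[OF that, of n] by (meson not_le)
 \<comment> \<open>The one-element chain excludes \<open>n = 0\<close>, so the bound
   \<open>n - 1\<close> used next is strictly smaller than \<open>n\<close>.\<close>
 hence n: "n > 0" using chain_to_0[OF assms(1)] by blast
 have "prime_height R Q \<le> enat (n - 1)"
  unfolding prime_height_def
 proof (rule SUP_least)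
  fix k assume "k \<in> {n. \<exists>P. prime_chain R n P \<and> P n = Q}"
  hence "k < n" using k unfolding chain_to_def by blast
  thus "enat k \<le> enat (n - 1)" by simp
 qed
 hence "enat n \<le> enat (n - 1)" using assms(2) by (rule order_trans[rotated])
 thus False using n by simp
qed

text \<open>\<open>d\<close> is the Krull dimension, expressed by chains so that no
  \<open>enat\<close> occurs.\<close>

locale noetherian_local = noetherian_cring +
 fixes m :: "'a set" and d :: nat
 assumes max_m: "maximalideal m R" and max_unique: "maximalideal L R ==> L = m"
  and chain_exists: "\<exists>P. prime_chain R d P" and chain_bound: "prime_chain R n P ==> n \<le> d"
begin

abbreviation mpow :: "nat => 'a set" where "mpow \<equiv> ideal_power R m"

lemma prime_m: "primeideal m R" using max_m by (rule maximalideal_prime)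

lemma ideal_m: "ideal m R" using prime_m by (rule primeD(1))

lemma proper_le_m: assumes "ideal J R" "\<one> \<notin> J" shows "J \<subseteq> m"
 using proper_in_maximal[OF assms(1)] ideal_one_carrier[OF assms(1)] assms(2) max_unique by metis

lemma prime_le_m: "primeideal Q R ==> Q \<subseteq> m"
 using proper_le_m primeD by blast

lemma unit_outside_m:
 assumes "a \<in> carrier R" "a \<notin> m" obtains b where "b \<in> carrier R" "a ** b = \<one>"
proof -
 have "\<one> \<in> PIdl a"
 proof (rule ccontr)
  assume "\<one> \<notin> PIdl a"
  hence "PIdl a \<subseteq> m" by (intro proper_le_m cgenideal_ideal assms)
  thus False using assms cgenideal_self[OF assms(1)] by blast
 qed
 then obtain b where "b \<in> carrier R" "\<one> = b ** a" unfolding cgenideal_def by blast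
 thus ?thesis using that[of b] assms m_comm by metis
qed

lemma chain_to_bound: "chain_to R n Q ==> n \<le> d"
 unfolding chain_to_def using chain_bound by blast

lemma chain_to_m: "chain_to R d m"
proof -
 obtain P where P: "prime_chain R d P" using chain_exists by blast
 hence "chain_to R d (P d)" unfolding chain_to_def by blast
 thus ?thesis using chain_to_up[OF _ prime_le_m prime_m] chain_to_prime by blast
qed

text \<open>The lengths of chains ending at \<open>Q\<close> are bounded by \<open>d\<close>, and
  the bottom of a longest one is minimal because it could otherwise be prolonged downwards.\<close>

lemma minimal_prime_below:
 assumes "primeideal Q R" obtains P where "minimal_prime R P" "P \<subseteq> Q"
proof -
 define S where "S = {n. chain_to R n Q}"
 have "finite S" "S ~= {}" using chain_to_bound chain_to_0[OF assms]
  by (auto simp: S_def intro: finite_subset[of _ "{..d}"])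
 hence n: "chain_to R (Max S) Q" using Max_in[of S] by (auto simp: S_def)
 then obtain P where P: "prime_chain R (Max S) P" "P (Max S) = Q" unfolding chain_to_def by blast
 have "minimal_prime R (P 0)"
  unfolding minimal_prime_def
 proof (intro conjI allI impI)
  show "primeideal (P 0) R" using P(1) unfolding prime_chain_def by blast
  fix L assume L: "primeideal L R \<and> L \<subseteq> P 0"
  show "L = P 0"
  proof (rule ccontr)
   assume "L ~= P 0"
   hence "prime_chain R (Suc (Max S)) (\<lambda>i. case i of 0 => L | Suc j => P j)"
    using L P(1) unfolding prime_chain_def by (auto split: nat.splits)
   hence "Suc (Max S) \<in> S" using P(2) unfolding S_def chain_to_def
    by (intro CollectI exI[of _ "\<lambda>i. case i of 0 => L | Suc j => P j"]) auto
   thus False using Max_ge[OF \<open>finite S\<close>] Suc_n_not_le_n by blast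
  qed
 qed
 moreover have "P i \<subseteq> P (Max S)" if "i \<le> Max S" for i
  using that
 proof (induction rule: inc_induct)
  case (step i) thus ?case using P(1) unfolding prime_chain_def by blast
 qed simp
 ultimately show ?thesis using that P(2) by blast
qed

text \<open>A prime over the first \<open>k\<close> elements has height at least \<open>k\<close>; the next element
 avoids the finitely many minimal ones among them whose height is exactly \<open>k\<close>.\<close>

lemma parameters_extend:
 assumes x0: "x0 ` {..<n} \<subseteq> m" "!!Q. primeideal Q R ==> x0 ` {..<n} \<subseteq> Q ==> chain_to R n Q"
  and n: "n \<le> d"
  and c: "!!i. n \<le> i ==> i < d ==> ideal (c i) R"
   "!!i Q. n \<le> i ==> i < d ==> primeideal Q R ==> \<not> chain_to R (Suc i) Q ==> \<not> c i \<subseteq> Q"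
 obtains x N where "!!i. i < n ==> x i = x0 i" "!!i. i < d ==> x i \<in> m"
  "!!i. n \<le> i ==> i < d ==> x i \<in> c i" "mpow N \<subseteq> Idl (x ` {..<d})"
proof -
 have "\<exists>x. (\<forall>i<n. x i = x0 i) \<and> x ` {..<k} \<subseteq> m \<and> (\<forall>i. n \<le> i \<and> i < k --> x i \<in> c i) \<and>
   (\<forall>Q. primeideal Q R \<and> x ` {..<k} \<subseteq> Q --> chain_to R k Q)" if "n \<le> k" "k \<le> d" for k
  using that
 proof (induction k rule: dec_induct)
  case base
  show ?case using x0 by (intro exI[of _ x0]) auto
 next
  case (step k)
  then obtain x where x: "\<forall>i<n. x i = x0 i" "x ` {..<k} \<subseteq> m" "\<forall>i. n \<le> i \<and> i < k --> x i \<in> c i"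
   "\<forall>Q. primeideal Q R \<and> x ` {..<k} \<subseteq> Q --> chain_to R k Q" by auto
  have xc: "x ` {..<k} \<subseteq> carrier R" using x(2) idealD(1)[OF ideal_m] by blast
  obtain \<P> where \<P>: "finite \<P>" "!!Q. Q \<in> \<P> ==> primeideal Q R \<and> Idl (x ` {..<k}) \<subseteq> Q"
   "!!Q. primeideal Q R ==> Idl (x ` {..<k}) \<subseteq> Q ==> \<exists>P\<in>\<P>. P \<subseteq> Q"
   using finite_primes_over[OF genideal_ideal[OF xc]] by blast
  let ?\<P> = "{Q \<in> \<P>. \<not> chain_to R (Suc k) Q}"
  have ci: "ideal (c k) R" using c(1)[of k] step by simp
  \<comment> \<open>The new element is taken from \<open>m\<close> and \<open>c k\<close> at once. A
    prime containing the intersection contains one of the two; \<open>c k\<close> is excluded by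
    hypothesis, and \<open>m\<close> because it has height \<open>d\<close>, at least
    \<open>Suc k\<close>.\<close>
  have A: "ideal (m \<inter> c k) R" using i_intersect[OF ideal_m ci] .
  obtain y where y: "y \<in> m \<inter> c k" "!!Q. Q \<in> ?\<P> ==> y \<notin> Q"
  proof (rule prime_avoidance[of ?\<P>, OF _ _ A])
   show "finite ?\<P>" using \<P>(1) by simp
   show "primeideal Q R" if "Q \<in> ?\<P>" for Q using that \<P>(2) by auto
   show "\<not> m \<inter> c k \<subseteq> Q" if "Q \<in> ?\<P>" for Q
   proof
    assume sub: "m \<inter> c k \<subseteq> Q"
    have Q: "primeideal Q R" "\<not> chain_to R (Suc k) Q" using that \<P>(2) by auto
    have "m \<cdot> c k \<subseteq> Q" using ideal_prod_inter[OF ideal_m ci] sub by (rule subset_trans)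
    hence "m \<subseteq> Q \<or> c k \<subseteq> Q" by (rule primeideal_divides_ideal_prod[OF Q(1) ideal_m ci])
    moreover have "\<not> m \<subseteq> Q"
     using prime_le_m[OF Q(1)] Q(2) chain_to_mono[OF chain_to_m, of "Suc k"] step by auto
    ultimately show False using c(2)[of k Q] Q step by auto
   qed
  qed (use that in auto)
  define x' where "x' = x(k := y)"
  have im: "x' ` {..<Suc k} = insert y (x ` {..<k})" by (auto simp: x'_def lessThan_Suc)
  have "chain_to R (Suc k) Q" if Q: "primeideal Q R" "x' ` {..<Suc k} \<subseteq> Q" for Q
  proof -
   have xQ: "x ` {..<k} \<subseteq> Q" "y \<in> Q" using Q(2) im by auto
   have "Idl (x ` {..<k}) \<subseteq> Q" using genideal_minimal[OF primeD(1)[OF Q(1)] xQ(1)] .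
   then obtain P where P: "P \<in> \<P>" "P \<subseteq> Q" using \<P>(3)[OF Q(1)] by blast
   have Pp: "primeideal P R" "x ` {..<k} \<subseteq> P"
    using \<P>(2)[OF P(1)] genideal_self[OF xc] by auto
   show ?thesis
   proof (cases "chain_to R (Suc k) P")
    case True thus ?thesis using chain_to_up P(2) Q(1) by blast
   next
    case False
    hence "y \<notin> P" using y(2)[of P] P(1) by auto
    hence "P \<subset> Q" using P(2) xQ by auto
    thus ?thesis using chain_to_Suc x(4) Pp Q(1) by blast
   qed
  qed
  hence "\<forall>Q. primeideal Q R \<and> x' ` {..<Suc k} \<subseteq> Q --> chain_to R (Suc k) Q" by blast
  moreover have "x' ` {..<Suc k} \<subseteq> m" using im x y by auto
  moreover have "\<forall>i<n. x' i = x0 i" "\<forall>i. n \<le> i \<and> i < Suc k --> x' i \<in> c i"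
   using x y step(1) by (auto simp: x'_def less_Suc_eq)
  ultimately show ?case by blast
 qed
 from this[OF n order_refl] obtain x where x: "\<forall>i<n. x i = x0 i" "x ` {..<d} \<subseteq> m"
  "\<forall>i. n \<le> i \<and> i < d --> x i \<in> c i"
  "\<forall>Q. primeideal Q R \<and> x ` {..<d} \<subseteq> Q --> chain_to R d Q" by auto
 have xc: "x ` {..<d} \<subseteq> carrier R" using x(2) idealD(1)[OF ideal_m] by blast
 have "Q = m" if "primeideal Q R" "Idl (x ` {..<d}) \<subseteq> Q" for Q
 proof (rule ccontr)
  assume "Q ~= m"
  hence "Q \<subset> m" using prime_le_m[OF that(1)] by auto
  moreover have "chain_to R d Q" using x(4) that genideal_self[OF xc] by blast
  ultimately have "chain_to R (Suc d) m" using chain_to_Suc prime_m by blast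
  thus False using chain_to_bound by fastforce
 qed
 then obtain N where "mpow N \<subseteq> Idl (x ` {..<d})"
  using ideal_power_below[OF genideal_ideal[OF xc] ideal_m] by blast
 thus ?thesis using x that[of x N] by (auto simp: image_subset_iff)
qed

end

abbreviation (input) smultM (\<open>_ *[_] _\<close> [70, 0, 71] 70) where "r *[M] x \<equiv> r \<odot>\<^bsub>M\<^esub> x"
abbreviation (input) addM (\<open>_ +[_] _\<close> [65, 0, 66] 65) where "x +[M] y \<equiv> x \<oplus>\<^bsub>M\<^esub> y"
abbreviation (input) minusM (\<open>_ -[_] _\<close> [65, 0, 66] 65) where "x -[M] y \<equiv> x \<ominus>\<^bsub>M\<^esub> y"
notation (input) ring.zero (\<open>0[_]\<close>)

section \<open>Modules\<close>

context module
begin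

lemma submoduleD:
 assumes "submodule H R M"
 shows "H \<subseteq> carrier M" "!!a. a \<in> H ==> a \<in> carrier M" "0[M] \<in> H"
  "!!a b. a \<in> H ==> b \<in> H ==> a +[M] b \<in> H"
  "!!r a. r \<in> carrier R ==> a \<in> H ==> r *[M] a \<in> H"
  "!!a. a \<in> H ==> \<ominus>\<^bsub>M\<^esub> a \<in> H"
  "!!a b. a \<in> H ==> b \<in> H ==> a -[M] b \<in> H"
proof -
 note E = submoduleE[OF assms]
 show 1: "H \<subseteq> carrier M" by (rule E(1))
 thus "a \<in> carrier M" if "a \<in> H" for a using that by blast
 show "0[M] \<in> H" using subgroup.one_closed[OF submodule.axioms(1)[OF assms]] by simp
 show 2: "a +[M] b \<in> H" if "a \<in> H" "b \<in> H" for a b using E(5) that by blast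
 show "r *[M] a \<in> H" if "r \<in> carrier R" "a \<in> H" for r a using E(4) that by blast
 show 3: "\<ominus>\<^bsub>M\<^esub> a \<in> H" if "a \<in> H" for a using E(3) that by blast
 show "a -[M] b \<in> H" if "a \<in> H" "b \<in> H" for a b
  using that 2 3 by (simp add: a_minus_def)
qed

lemma submodule_intro:
 assumes "H \<subseteq> carrier M" "0[M] \<in> H" "!!a b. a \<in> H ==> b \<in> H ==> a +[M] b \<in> H"
  "!!r a. r \<in> carrier R ==> a \<in> H ==> r *[M] a \<in> H"
 shows "submodule H R M"
proof (rule submoduleI)
 show "\<ominus>\<^bsub>M\<^esub> a \<in> H" if "a \<in> H" for a
 proof -
  have "\<ominus>\<^bsub>M\<^esub> a = (\<ominus> \<one>) *[M] a" using assms(1) that smult_l_minus[of \<one> a] by auto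
  thus ?thesis using assms(4)[of "\<ominus> \<one>" a] that by simp
 qed
qed (use assms in auto)

lemma smult_minus_distr:
 "r \<in> carrier R ==> a \<in> carrier M ==> b \<in> carrier M ==> r *[M] (a -[M] b) = r *[M] a -[M] r *[M] b"
 by (simp add: a_minus_def smult_r_distr smult_r_minus)

lemma smult_minus_distr_l:
 "r \<in> carrier R ==> s \<in> carrier R ==> a \<in> carrier M ==> (r \<ominus> s) *[M] a = r *[M] a -[M] s *[M] a"
 by (simp add: a_minus_def smult_l_distr smult_l_minus)

lemma smult_commute:
 "r \<in> carrier R ==> s \<in> carrier R ==> a \<in> carrier M ==> r *[M] (s *[M] a) = s *[M] (r *[M] a)"
 by (simp add: smult_assoc1[symmetric] m_comm)

lemma minus_eq_zero_iff:
 "a \<in> carrier M ==> b \<in> carrier M ==> a -[M] b = 0[M] \<longleftrightarrow> a = b"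
 by (metis M.add.inv_closed M.add.inv_inv M.minus_eq M.minus_equality M.r_neg)

lemma add_minus_cancel:
 "b \<in> carrier M ==> a \<in> carrier M ==> b +[M] (a -[M] b) = a"
 by (simp add: M.minus_eq M.a_lcomm[of b a] M.r_neg)

lemma annihilator_ideal:
 "a \<in> carrier M ==> ideal {r \<in> carrier R. r *[M] a = 0[M]} R"
 by (rule ideal_intro) (auto simp: smult_l_distr smult_assoc1)

lemma cyclic_submodule:
 assumes e: "e \<in> carrier M"
 shows "submodule {r *[M] e | r. r \<in> carrier R} R M" "e \<in> {r *[M] e | r. r \<in> carrier R}"
proof -
 show "e \<in> {r *[M] e | r. r \<in> carrier R}" using smult_one[OF e] by force
 show "submodule {r *[M] e | r. r \<in> carrier R} R M"
 proof (rule submodule_intro, goal_cases)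
  case 2 thus ?case using smult_l_null[OF e] by force
 next
  case (3 a b)
  then obtain r s where "a = r *[M] e" "b = s *[M] e" "r \<in> carrier R" "s \<in> carrier R" by blast
  thus ?case using e by (auto simp: smult_l_distr[symmetric])
 next
  case (4 s a)
  then obtain r where "a = r *[M] e" "r \<in> carrier R" by blast
  thus ?case using e 4 by (auto simp: smult_assoc1[symmetric])
 qed (use e in auto)
qed

lemma annihilator_submodule:
 "J \<subseteq> carrier R ==> submodule {a \<in> carrier M. \<forall>j\<in>J. j *[M] a = 0[M]} R M"
 by (rule submodule_intro) (auto simp: smult_r_distr subset_iff, metis smult_commute smult_r_null subsetD)

end

lemma module_homD:
 assumes "f \<in> module_hom R M N"
 shows "x \<in> carrier M ==> f x \<in> carrier N"
  "x \<in> carrier M ==> y \<in> carrier M ==> f (x +[M] y) = f x +[N] f y"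
  "r \<in> carrier R ==> x \<in> carrier M ==> f (r *[M] x) = r *[N] f x"
 using assms by (auto simp: module_hom_def)

lemma module_homI:
 assumes "!!x. x \<in> carrier M ==> f x \<in> carrier N"
  "!!x y. x \<in> carrier M ==> y \<in> carrier M ==> f (x +[M] y) = f x +[N] f y"
  "!!r x. r \<in> carrier R ==> x \<in> carrier M ==> f (r *[M] x) = r *[N] f x"
 shows "f \<in> module_hom R M N"
 using assms by (auto simp: module_hom_def)

lemma module_hom_comp:
 "f \<in> module_hom R M N ==> g \<in> module_hom R N L ==> (\<lambda>x. g (f x)) \<in> module_hom R M L"
 by (rule module_homI) (auto simp: module_homD)

lemma module_hom_zero:
 assumes "module R M" "module R N" "f \<in> module_hom R M N" shows "f 0[M] = 0[N]"
proof -
 interpret M: module R M by fact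
 interpret N: module R N by fact
 note f = module_homD[OF assms(3)]
 have "f 0[M] = f (\<zero>\<^bsub>R\<^esub> *[M] 0[M])" by simp
 also have "\<dots> = \<zero>\<^bsub>R\<^esub> *[N] f 0[M]" by (rule f(3)) auto
 finally show ?thesis using f(1)[of "0[M]"] by simp
qed

lemma module_hom_kernel:
 assumes "module R M" "module R N" "f \<in> module_hom R M N" shows "submodule {x \<in> carrier M. f x = 0[N]} R M"
proof -
 interpret M: module R M by fact
 interpret N: module R N by fact
 show ?thesis
  by (rule M.submodule_intro) (use module_homD[OF assms(3)] module_hom_zero[OF assms] in auto)
qed

lemma module_hom_image:
 assumes "module R M" "module R N" "f \<in> module_hom R M N" "submodule S R M" shows "submodule (f ` S) R N"
proof -
 interpret M: module R M by fact
 interpret N: module R N by fact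
 note f = module_homD[OF assms(3)] and S = M.submoduleD[OF assms(4)]
 show ?thesis
 proof (rule N.submodule_intro)
  show "0[N] \<in> f ` S" using module_hom_zero[OF assms(1-3)] S(3) by (metis imageI)
  show "a +[N] b \<in> f ` S" if "a \<in> f ` S" "b \<in> f ` S" for a b
   using that S(2,4) by (auto simp flip: f(2))
  show "r *[N] a \<in> f ` S" if "r \<in> carrier R" "a \<in> f ` S" for r a
   using that S(2,5) by (auto simp flip: f(3))
 qed (use f(1) S(2) in auto)
qed

section \<open>Noetherian modules and Artin--Rees\<close>

definition noetherian_module :: "('a, 'm) ring_scheme => ('a, 'b) module => bool" where
 "noetherian_module R M \<longleftrightarrow> module R M \<and> (\<forall>S. S ~= {} \<and> (\<forall>N\<in>S. submodule N R M) -->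
   (\<exists>N\<in>S. \<forall>L\<in>S. N \<subseteq> L --> L = N))"

text \<open>A maximal \<open>K\<close> with \<open>K \<inter> Z \<subseteq> T\<close> absorbs high powers of every \<open>y\<close> with \<open>y Z \<subseteq> T\<close>:
 this is the form in which the Artin--Rees lemma is used.\<close>

lemma artin_rees:
 fixes R (structure)
 assumes noeth: "noetherian_module R M" and T: "submodule T R M" and Z: "submodule Z R M" and TZ: "T \<subseteq> Z"
  and Y: "Y \<subseteq> carrier R" "!!y z. y \<in> Y ==> z \<in> Z ==> y *[M] z \<in> T"
 shows "\<exists>K. submodule K R M \<and> T \<subseteq> K \<and> K \<inter> Z \<subseteq> T \<and>
  (\<forall>y\<in>Y. \<exists>N::nat. \<forall>x\<in>carrier M. (y [^]\<^bsub>R\<^esub> N) *[M] x \<in> K)"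
proof -
 have "module R M" using noeth unfolding noetherian_module_def by blast
 then interpret module R M .
 have maxi: "\<exists>N\<in>S. \<forall>L\<in>S. N \<subseteq> L --> L = N" if "S ~= {}" "!!N. N \<in> S ==> submodule N R M" for S
  using noeth that unfolding noetherian_module_def by blast
 let ?S = "{K. submodule K R M \<and> T \<subseteq> K \<and> K \<inter> Z \<subseteq> T}"
 have "\<exists>K\<in>?S. \<forall>L\<in>?S. K \<subseteq> L --> L = K" by (rule maxi) (use T in auto)
 then obtain K where K: "submodule K R M" "T \<subseteq> K" "K \<inter> Z \<subseteq> T"
  "!!L. submodule L R M ==> T \<subseteq> L ==> L \<inter> Z \<subseteq> T ==> K \<subseteq> L ==> L = K" by auto
 note KD = submoduleD[OF K(1)]
 have "\<exists>N::nat. \<forall>x\<in>carrier M. (y [^] N) *[M] x \<in> K" if y: "y \<in> Y" for y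
 proof -
  have yc: "y \<in> carrier R" using y Y by blast
  \<comment> \<open>\<open>A n\<close> is the colon of \<open>K\<close> by \<open>y^n\<close>; this
    increasing chain stops at some \<open>N\<close>.\<close>
  define A where "A n = {x \<in> carrier M. (y [^] (n::nat)) *[M] x \<in> K}" for n
  have Asub: "submodule (A n) R M" for n
  proof (rule submodule_intro)
   show "r *[M] a \<in> A n" if "r \<in> carrier R" "a \<in> A n" for r a
    using that yc KD(5)[of r "(y [^] n) *[M] a"] smult_commute[of "y [^] n" r a] by (auto simp: A_def)
  qed (use KD yc in \<open>auto simp: A_def smult_r_distr\<close>)
  have "\<exists>N\<in>range A. \<forall>L\<in>range A. N \<subseteq> L --> L = N" by (rule maxi) (use Asub in auto)
  then obtain N where N: "!!n. A N \<subseteq> A n ==> A n = A N" by auto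
  have "A N \<subseteq> A (Suc N)"
  proof
   fix x assume "x \<in> A N"
   hence x: "x \<in> carrier M" "(y [^] N) *[M] x \<in> K" by (auto simp: A_def)
   have "(y [^] Suc N) *[M] x = y *[M] ((y [^] N) *[M] x)"
    using x(1) yc nat_pow_Suc2[OF yc, of N] by (simp only: smult_assoc1 nat_pow_closed)
   thus "x \<in> A (Suc N)" using x KD(5)[OF yc x(2)] by (simp add: A_def)
  qed
  hence AN: "A (Suc N) = A N" by (rule N)
  \<comment> \<open>Maximality of \<open>K\<close> is tested on \<open>K + y^N M\<close>. If
    \<open>z = k + y^N x\<close> lies in \<open>Z\<close>, then \<open>y z\<close> lies in
    \<open>T\<close>, hence in \<open>K\<close>, so \<open>x\<close> is in
    \<open>A (Suc N) = A N\<close> and \<open>z\<close> itself is in \<open>K\<close>, hence in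
    \<open>T\<close>.\<close>
  define K' where "K' = {k +[M] (y [^] N) *[M] x | k x. k \<in> K \<and> x \<in> carrier M}"
  have K'm: "submodule K' R M"
  proof (rule submodule_intro)
   show "K' \<subseteq> carrier M" using KD yc by (auto simp: K'_def)
   have "0[M] = 0[M] +[M] (y [^] N) *[M] 0[M]" using yc by simp
   thus "0[M] \<in> K'" unfolding K'_def using KD(3) by blast
  next
   fix a b assume "a \<in> K'" "b \<in> K'"
   then obtain k x k' x' where *: "a = k +[M] (y [^] N) *[M] x" "b = k' +[M] (y [^] N) *[M] x'"
    "k \<in> K" "k' \<in> K" "x \<in> carrier M" "x' \<in> carrier M" unfolding K'_def by blast
   have "a +[M] b = (k +[M] k') +[M] (y [^] N) *[M] (x +[M] x')"
    unfolding *(1,2) using KD(2)[OF *(3)] KD(2)[OF *(4)] *(5,6) yc by (simp add: smult_r_distr M.a_ac)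
   thus "a +[M] b \<in> K'" unfolding K'_def using KD(4)[OF *(3,4)] M.a_closed[OF *(5,6)] by blast
  next
   fix r a assume r: "r \<in> carrier R" and "a \<in> K'"
   then obtain k x where *: "a = k +[M] (y [^] N) *[M] x" "k \<in> K" "x \<in> carrier M" unfolding K'_def by blast
   have "r *[M] a = r *[M] k +[M] (y [^] N) *[M] (r *[M] x)"
    unfolding *(1) using KD(2)[OF *(2)] *(3) yc r by (simp add: smult_r_distr smult_commute)
   thus "r *[M] a \<in> K'" unfolding K'_def using KD(5)[OF r *(2)] smult_closed[OF r *(3)] by blast
  qed
  have KK': "K \<subseteq> K'"
  proof
   fix k assume k: "k \<in> K"
   hence "k = k +[M] (y [^] N) *[M] 0[M]" using KD(2)[OF k] yc by simp
   thus "k \<in> K'" unfolding K'_def using k by blast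
  qed
  have K'Z: "K' \<inter> Z \<subseteq> T"
  proof
   fix z assume "z \<in> K' \<inter> Z"
   then obtain k x where *: "z = k +[M] (y [^] N) *[M] x" "k \<in> K" "x \<in> carrier M" and zZ: "z \<in> Z"
    unfolding K'_def by blast
   have kc: "k \<in> carrier M" using KD(2)[OF *(2)] .
   have yz: "y *[M] z \<in> K" using Y(2)[OF y zZ] K(2) by blast
   have "(y [^] Suc N) *[M] x = y *[M] ((y [^] N) *[M] x)"
    using *(3) yc nat_pow_Suc2[OF yc, of N] by (simp only: smult_assoc1 nat_pow_closed)
   also have "\<dots> = y *[M] z -[M] y *[M] k"
    unfolding *(1) using kc *(3) yc by (simp add: smult_r_distr M.minus_eq M.a_ac M.r_neg1 M.r_neg2)
   also have "\<dots> \<in> K" using yz KD(5)[OF yc *(2)] by (rule KD(7))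
   finally have "x \<in> A (Suc N)" using *(3) by (simp add: A_def)
   hence "(y [^] N) *[M] x \<in> K" unfolding AN by (simp add: A_def)
   hence "z \<in> K" unfolding *(1) using KD(4) *(2) by blast
   thus "z \<in> T" using K(3) zZ by blast
  qed
  have "K' = K" using K(4)[OF K'm _ K'Z KK'] K(2) KK' by blast
  moreover have "(y [^] N) *[M] x \<in> K'" if "x \<in> carrier M" for x
  proof -
   have "(y [^] N) *[M] x = 0[M] +[M] (y [^] N) *[M] x" using that yc by simp
   thus ?thesis unfolding K'_def using KD(3) that by blast
  qed
  ultimately show ?thesis by blast
 qed
 with K(1-3) show ?thesis by blast
qed

subsection \<open>Modules of vectors\<close>

definition vectors :: "('a, 'm) ring_scheme => 'k set => ('k => 'a) set" where
 "vectors R A = {f. (\<forall>k. f k \<in> carrier R) \<and> (\<forall>k. k \<notin> A --> f k = \<zero>\<^bsub>R\<^esub>)}"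

definition vector_module :: "('a, 'm) ring_scheme => 'k set => ('a, 'k => 'a) module" where
 "vector_module R A = \<lparr>carrier = vectors R A, monoid.mult = undefined, one = undefined,
   ring.zero = (\<lambda>_. \<zero>\<^bsub>R\<^esub>), add = (\<lambda>f g k. f k \<oplus>\<^bsub>R\<^esub> g k), smult = (\<lambda>r f k. r \<otimes>\<^bsub>R\<^esub> f k)\<rparr>"

lemma vector_module_simps [simp]:
 "carrier (vector_module R A) = vectors R A" "0[vector_module R A] = (\<lambda>_. \<zero>\<^bsub>R\<^esub>)"
 "f +[vector_module R A] g = (\<lambda>k. f k \<oplus>\<^bsub>R\<^esub> g k)" "r *[vector_module R A] f = (\<lambda>k. r \<otimes>\<^bsub>R\<^esub> f k)"
 by (simp_all add: vector_module_def)

lemma self_module_simps [simp]: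
 "carrier (self_module R) = carrier R" "0[self_module R] = \<zero>\<^bsub>R\<^esub>"
 "a +[self_module R] b = a \<oplus>\<^bsub>R\<^esub> b" "r *[self_module R] a = r \<otimes>\<^bsub>R\<^esub> a"
 by (simp_all add: self_module_def)

lemma vectorsD: "f \<in> vectors R A ==> f k \<in> carrier R" "f \<in> vectors R A ==> k \<notin> A ==> f k = \<zero>\<^bsub>R\<^esub>"
 by (auto simp: vectors_def)

context cring
begin

lemma vector_module: "module R (vector_module R A)"
proof (rule moduleI)
 show "abelian_group (vector_module R A)"
 proof (rule abelian_groupI)
  show "\<exists>g\<in>carrier (vector_module R A). g +[vector_module R A] f = 0[vector_module R A]"
   if "f \<in> carrier (vector_module R A)" for f
   using that by (intro bexI[of _ "\<lambda>k. \<ominus> f k"]) (auto simp: vectors_def l_neg)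
 qed (auto simp: vectors_def a_ac)
qed (auto simp: vectors_def l_distr r_distr m_assoc is_cring)

lemma self_module: "module R (self_module R)"
proof (rule moduleI)
 show "abelian_group (self_module R)"
 proof (rule abelian_groupI)
  show "\<exists>g\<in>carrier (self_module R). g +[self_module R] f = 0[self_module R]"
   if "f \<in> carrier (self_module R)" for f
   using that by (intro bexI[of _ "\<ominus> f"]) (auto simp: l_neg)
 qed (auto simp: a_ac)
qed (auto simp: l_distr r_distr m_assoc is_cring)

lemma submodule_self: "submodule J R (self_module R) \<longleftrightarrow> ideal J R"
proof
 assume J: "submodule J R (self_module R)"
 show "ideal J R"
  using module.submoduleD(1,3,4,5)[OF self_module J] by (intro ideal_intro) auto
next
 assume J: "ideal J R"
 show "submodule J R (self_module R)"
  by (rule module.submodule_intro[OF self_module]) (use idealD[OF J] in auto)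
qed

end

context noetherian_cring
begin

lemma noetherian_self_module: "noetherian_module R (self_module R)"
 unfolding noetherian_module_def submodule_self
proof (intro conjI allI impI)
 fix S :: "'a set set" assume "S ~= {} \<and> (\<forall>N\<in>S. ideal N R)"
 then obtain M where "M \<in> S" "!!J. J \<in> S ==> M \<subseteq> J ==> J = M" by (metis maximal_ideal_in)
 thus "\<exists>N\<in>S. \<forall>L\<in>S. N \<subseteq> L --> L = N" by blast
qed (rule self_module)

text \<open>Induction on the index set. If \<open>N \<subseteq> L\<close> have the same ideal of
  \<open>a\<close>-th coordinates and the same vectors vanishing at \<open>a\<close>, they are
  equal; so \<open>p N\<close> is maximised first, and then \<open>q N\<close> among the submodules
  with that \<open>p N\<close>.\<close>

lemma noetherian_vector_module:
 fixes A :: "'k set"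
 assumes "finite A" shows "noetherian_module R (vector_module R A)"
 unfolding noetherian_module_def
proof (intro conjI allI impI, goal_cases)
 case 1 show ?case by (rule vector_module)
next
 case (2 S)
 hence "S ~= {}" "!!N. N \<in> S ==> submodule N R (vector_module R A)" by auto
 with assms show ?case
 proof (induction A arbitrary: S rule: finite_induct)
  case empty
  have "N = {\<lambda>_. \<zero>}" if "N \<in> S" for N
   using module.submoduleD(1,3)[OF vector_module empty(2)[OF that]] by (auto simp: vectors_def)
  thus ?case using empty(1) by blast
 next
  case (insert a A)
  let ?M = "vector_module R (insert a A)"
  interpret V: module R ?M by (rule vector_module)
  have sub: "submodule N R ?M" if "N \<in> S" for N using insert(5) that by blast
  define p where "p N = (\<lambda>f. f a) ` N" for N :: "('k => 'a) set"
  have pI: "ideal (p N) R" if "N \<in> S" for N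
  proof (rule ideal_intro)
   note D = V.submoduleD[OF sub[OF that]]
   show "p N \<subseteq> carrier R" using D(1) by (auto simp: p_def vectors_def)
   show "\<zero> \<in> p N" using D(3) by (force simp: p_def)
   show "x \<oplus> y \<in> p N" if "x \<in> p N" "y \<in> p N" for x y
   proof -
    obtain f g where "f \<in> N" "g \<in> N" "x = f a" "y = g a" using \<open>x \<in> p N\<close> \<open>y \<in> p N\<close> by (auto simp: p_def)
    thus ?thesis using D(4)[of f g] by (auto simp: p_def intro!: image_eqI[where x="\<lambda>k. f k \<oplus> g k"])
   qed
   show "r ** x \<in> p N" if "x \<in> p N" "r \<in> carrier R" for x r
   proof -
    obtain f where "f \<in> N" "x = f a" using \<open>x \<in> p N\<close> by (auto simp: p_def)
    thus ?thesis using D(5)[of r f] \<open>r \<in> carrier R\<close> by (auto simp: p_def intro!: image_eqI[where x="\<lambda>k. r ** f k"])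
   qed
  qed
  obtain P where P: "P \<in> p ` S" "!!J. J \<in> p ` S ==> P \<subseteq> J ==> J = P"
   by (rule maximal_ideal_in[of "p ` S"]) (use insert(4) pI in blast)+
  define q where "q N = N \<inter> vectors R A" for N :: "('k => 'a) set"
  let ?S = "{N \<in> S. p N = P}"
  have "\<exists>N\<in>q ` ?S. \<forall>L\<in>q ` ?S. N \<subseteq> L --> L = N"
  proof (rule insert(3))
   show "q ` ?S ~= {}" using P(1) by blast
   fix N assume "N \<in> q ` ?S"
   then obtain N' where N': "N' \<in> S" "N = q N'" by auto
   note D = V.submoduleD[OF sub[OF N'(1)]]
   show "submodule N R (vector_module R A)"
    using D(3) D(4) D(5) unfolding N'(2) q_def
    by (intro module.submodule_intro[OF vector_module]) (auto simp: vectors_def)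
  qed
  then obtain N where N: "N \<in> S" "p N = P" "!!L. L \<in> S ==> p L = P ==> q N \<subseteq> q L ==> q L = q N"
   by auto
  have "L = N" if L: "L \<in> S" "N \<subseteq> L" for L
  proof
   have "p N \<subseteq> p L" "q N \<subseteq> q L" using L(2) by (auto simp: p_def q_def)
   hence pL: "p L = P" and qL: "q L = q N" using N P(2)[of "p L"] L(1) by auto
   note D = V.submoduleD[OF sub[OF L(1)]] and D' = V.submoduleD[OF sub[OF N(1)]]
   show "L \<subseteq> N"
   proof
    fix f assume f: "f \<in> L"
    hence "f a \<in> p N" using pL N(2) by (auto simp: p_def)
    then obtain g where g: "g \<in> N" "g a = f a" by (auto simp: p_def)
    have fc: "f \<in> vectors R (insert a A)" "g \<in> vectors R (insert a A)" using D(1) D'(1) f g by auto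
    have e: "g +[?M] (f -[?M] g) = f"
     by (rule V.add_minus_cancel) (use fc in simp_all)
    \<comment> \<open>Inverses in the record are not given pointwise; multiplication by
      \<open>\<ominus> \<one>\<close> makes the difference explicit.\<close>
    have "f -[?M] g = f +[?M] ((\<ominus> \<one>) *[?M] g)"
     using fc V.smult_l_minus[of \<one> g] V.smult_one[of g] by (simp add: V.M.minus_eq del: vector_module_simps(3,4))
    hence e2: "f -[?M] g = (\<lambda>k. f k \<oplus> (\<ominus> \<one>) ** g k)" by simp
    have "f -[?M] g \<in> L" using D(7)[OF f, of g] g L by blast
    moreover have "f -[?M] g \<in> vectors R A"
     unfolding e2 using fc g(2) l_minus[of \<one>] by (auto simp: vectors_def r_neg) (metis r_neg minus_zero r_zero zero_closed)
    ultimately have "f -[?M] g \<in> q L" unfolding q_def by blast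
    hence "f -[?M] g \<in> q N" unfolding qL .
    hence "f -[?M] g \<in> N" unfolding q_def by blast
    thus "f \<in> N" using D'(4)[OF g(1), of "f -[?M] g"] e by (simp only:)
   qed
  qed (rule L(2))
  thus ?case using N(1) by blast
 qed
qed

end

text \<open>The inclusion of \<open>J\<close> into \<open>R\<close> is a test map for injectivity,
  and \<open>e\<close> is the image of \<open>\<one>\<close> under the extension of
  \<open>f\<close>.\<close>

lemma (in cring) baer_extension:
 assumes E: "injective_module R E" and J: "ideal J R" and f: "f \<in> J \<rightarrow> carrier E"
  "!!a b. a \<in> J ==> b \<in> J ==> f (a \<oplus> b) = f a +[E] f b"
  "!!r a. r \<in> carrier R ==> a \<in> J ==> f (r ** a) = r *[E] f a"
 shows "\<exists>e\<in>carrier E. \<forall>j\<in>J. f j = j *[E] e"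
proof -
 have sm: "module R (ideal_module R J)"
  unfolding ideal_module_def
  using submodule.submodule_is_module[of J R "self_module R"] submodule_self J self_module by blast
 have s: "carrier (ideal_module R J) = J" "!!a b. a +[ideal_module R J] b = a \<oplus> b"
  "!!r b. r *[ideal_module R J] b = r ** b" by (simp_all add: ideal_module_def self_module_def)
 have "\<exists>h\<in>module_hom R (self_module R) E. \<forall>x\<in>carrier (ideal_module R J). h (id x) = f x"
 proof -
  have "id \<in> module_hom R (ideal_module R J) (self_module R)" "inj_on id (carrier (ideal_module R J))"
   "f \<in> module_hom R (ideal_module R J) E"
   using f idealD(1)[OF J] by (auto simp: module_hom_def s)
  thus ?thesis using E sm self_module unfolding injective_module_def by blast
 qed
 then obtain h where h: "h \<in> module_hom R (self_module R) E" "!!j. j \<in> J ==> h j = f j" by (auto simp: s)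
 show ?thesis
 proof (intro bexI[of _ "h \<one>"] ballI)
  show "h \<one> \<in> carrier E" using h(1) by (auto simp: module_hom_def)
  fix j assume j: "j \<in> J"
  hence jc: "j \<in> carrier R" using idealD[OF J] by blast
  have "h (j ** \<one>) = j *[E] h \<one>" using h(1) jc by (simp add: module_hom_def del: r_one)
  thus "f j = j *[E] h \<one>" using h(2)[OF j] jc by simp
 qed
qed

text \<open>The assumption \<open>wd\<close> says that \<open>j + s r \<mapsto> s v\<close> is a
  well-defined map on \<open>J + R r\<close>; Baer's criterion makes it a multiplication.
  Injectivity is used in this form: an element killed by \<open>J\<close> with a prescribed
  multiple.\<close>

lemma (in cring) baer_adjoin:
 assumes E: "injective_module R E" and J: "ideal J R" and r: "r \<in> carrier R" and v: "v \<in> carrier E"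
  and wd: "!!s. s \<in> carrier R ==> s ** r \<in> J ==> s *[E] v = 0[E]"
 shows "\<exists>e\<in>carrier E. (\<forall>j\<in>J. j *[E] e = 0[E]) \<and> r *[E] e = v"
proof -
 interpret E: module R E using E unfolding injective_module_def by blast
 note JD = idealD[OF J] and A = adjoin_ideal[OF J r]
 define f where "f a = (SOME u. \<exists>j s. j \<in> J \<and> s \<in> carrier R \<and> a = j \<oplus> s ** r \<and> u = s *[E] v)" for a
 have f: "f (j \<oplus> s ** r) = s *[E] v" if js: "j \<in> J" "s \<in> carrier R" for j s
  unfolding f_def
 proof (rule some_equality)
  show "\<exists>j' s'. j' \<in> J \<and> s' \<in> carrier R \<and> j \<oplus> s ** r = j' \<oplus> s' ** r \<and> s *[E] v = s' *[E] v" using js by blast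
  fix u assume "\<exists>j' s'. j' \<in> J \<and> s' \<in> carrier R \<and> j \<oplus> s ** r = j' \<oplus> s' ** r \<and> u = s' *[E] v"
  then obtain j' s' where *: "j' \<in> J" "s' \<in> carrier R" "j \<oplus> s ** r = j' \<oplus> s' ** r" "u = s' *[E] v" by (elim exE conjE)
  have c: "j \<in> carrier R" "j' \<in> carrier R" using JD(2) * js by auto
  have "(s \<ominus> s') ** r = (j \<oplus> s ** r) \<ominus> (j' \<oplus> s' ** r) \<oplus> (j' \<ominus> j)" using js(2) *(2) c r by algebra
  also have "\<dots> = j' \<ominus> j" unfolding *(3) using c *(2) r by (simp add: minus_eq r_neg)
  finally have "(s \<ominus> s') ** r \<in> J" using JD(8)[OF *(1) js(1)] by simp
  hence "(s \<ominus> s') *[E] v = 0[E]" using wd[OF minus_closed[OF js(2) *(2)]] by blast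
  thus "u = s *[E] v" unfolding *(4) using js(2) *(2) v by (simp add: E.smult_minus_distr_l E.minus_eq_zero_iff)
 qed
 have adj: "\<exists>j s. j \<in> J \<and> s \<in> carrier R \<and> a = j \<oplus> s ** r" if "a \<in> adjoin J r" for a
  using that unfolding adjoin_def by blast
 have "\<exists>e\<in>carrier E. \<forall>a\<in>adjoin J r. f a = a *[E] e"
 proof (rule baer_extension[OF E A(1), of f])
  show "f \<in> adjoin J r \<rightarrow> carrier E"
  proof
   fix a assume "a \<in> adjoin J r"
   then obtain j s where "j \<in> J" "s \<in> carrier R" "a = j \<oplus> s ** r" using adj by blast
   thus "f a \<in> carrier E" using f v by simp
  qed
  fix a assume "a \<in> adjoin J r"
  then obtain j s where a: "j \<in> J" "s \<in> carrier R" "a = j \<oplus> s ** r" using adj by blast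
  have jc: "j \<in> carrier R" using JD(2) a by auto
  show "f (a \<oplus> a') = f a +[E] f a'" if a'L: "a' \<in> adjoin J r" for a'
  proof -
   obtain j' s' where a': "j' \<in> J" "s' \<in> carrier R" "a' = j' \<oplus> s' ** r" using adj[OF a'L] by blast
   have e: "a \<oplus> a' = (j \<oplus> j') \<oplus> (s \<oplus> s') ** r" unfolding a(3) a'(3) using jc JD(2)[OF a'(1)] r a(2) a'(2) by algebra
   have "f (a \<oplus> a') = (s \<oplus> s') *[E] v" unfolding e by (rule f[OF JD(4)[OF a(1) a'(1)] a_closed[OF a(2) a'(2)]])
   thus ?thesis using f[OF a(1,2)] f[OF a'(1,2)] a a' v by (simp add: E.smult_l_distr)
  qed
  show "f (w ** a) = w *[E] f a" if w: "w \<in> carrier R" for w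
  proof -
   have e: "w ** a = (w ** j) \<oplus> (w ** s) ** r"
    unfolding a(3) using w jc r a(2) by (simp add: r_distr m_assoc)
   have "f (w ** a) = (w ** s) *[E] v" unfolding e by (rule f[OF JD(5)[OF a(1) w] m_closed[OF w a(2)]])
   thus ?thesis using f[OF a(1,2)] a w v by (simp add: E.smult_assoc1)
  qed
 qed
 then obtain e where e: "e \<in> carrier E" "!!a. a \<in> adjoin J r ==> f a = a *[E] e" by (elim bexE) simp
 have "j *[E] e = 0[E]" if j: "j \<in> J" for j
  using e(2)[of j] A(2) j f[OF j zero_closed] JD(2)[OF j] r v by auto
 moreover have "r *[E] e = v"
  using e(2)[OF A(3)] f[OF JD(3) one_closed] r v by simp
 ultimately show ?thesis using e(1) by blast
qed

section \<open>Top local cohomology\<close>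

text \<open>Composition with the projection replaces cosets by a map \<open>\<pi>\<close> on
  representatives with kernel \<open>N\<close>. Both the local cohomology and the residue field are
  handled through it.\<close>

lemma quot_module_map:
 fixes R (structure) and M :: "('a, 'b) module"
 assumes "module R M" and N: "submodule N R M" and E: "module R E"
  and f: "f \<in> module_hom R (quot_module M N) E" "inj_on f (carrier (quot_module M N))"
 obtains \<pi> where "!!z. z \<in> carrier M ==> \<pi> z \<in> carrier E" "f ` carrier (quot_module M N) = \<pi> ` carrier M"
  "!!z w. z \<in> carrier M ==> w \<in> carrier M ==> \<pi> (z +[M] w) = \<pi> z +[E] \<pi> w"
  "!!r z. r \<in> carrier R ==> z \<in> carrier M ==> \<pi> (r *[M] z) = r *[E] \<pi> z"
  "!!z. z \<in> carrier M ==> \<pi> z = 0[E] \<longleftrightarrow> z \<in> N"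
proof -
 interpret module R M by fact
 interpret E: module R E by (rule E)
 note ND = submoduleD[OF N]
 have "additive_subgroup N M" using submodule.axioms(1)[OF N] by (rule additive_subgroup.intro)
 then interpret N: abelian_subgroup N M
  using M.abelian_group_axioms by (intro abelian_subgroupI3)
 have car: "carrier (quot_module M N) = {N +>\<^bsub>M\<^esub> x | x. x \<in> carrier M}"
  by (auto simp: quot_module_def A_RCOSETS_def')
 have coset: "N +>\<^bsub>M\<^esub> x \<in> carrier (quot_module M N)" if "x \<in> carrier M" for x
  using that car by auto
 have add: "(N +>\<^bsub>M\<^esub> x) +[quot_module M N] (N +>\<^bsub>M\<^esub> y) = N +>\<^bsub>M\<^esub> (x +[M] y)"
  if "x \<in> carrier M" "y \<in> carrier M" for x y
  using N.a_rcos_sum[OF that] by (simp add: quot_module_def)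
 have sm: "r *[quot_module M N] (N +>\<^bsub>M\<^esub> x) = N +>\<^bsub>M\<^esub> (r *[M] x)"
  if rx: "r \<in> carrier R" "x \<in> carrier M" for r x
 proof -
  have "N +>\<^bsub>M\<^esub> (r *[M] y) = N +>\<^bsub>M\<^esub> (r *[M] x)" if "y \<in> N +>\<^bsub>M\<^esub> x" for y
  proof -
   obtain h where h: "h \<in> N" "y = h +[M] x" using \<open>y \<in> N +>\<^bsub>M\<^esub> x\<close> by (auto simp: a_r_coset_def')
   have "r *[M] y = (r *[M] h) +[M] (r *[M] x)"
    using h ND(2) rx by (simp add: smult_r_distr)
   hence "r *[M] y \<in> N +>\<^bsub>M\<^esub> (r *[M] x)"
    using ND(5)[OF rx(1) h(1)] by (auto simp: a_r_coset_def')
   thus ?thesis using N.a_repr_independence'[of "r *[M] y" "r *[M] x"] rx by auto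
  qed
  moreover have "x \<in> N +>\<^bsub>M\<^esub> x" using N.a_rcos_self[OF rx(2)] .
  ultimately have "(\<Union>y\<in>N +>\<^bsub>M\<^esub> x. N +>\<^bsub>M\<^esub> (r *[M] y)) = N +>\<^bsub>M\<^esub> (r *[M] x)" by blast
  thus ?thesis by (simp add: quot_module_def)
 qed
 define \<pi> where "\<pi> z = f (N +>\<^bsub>M\<^esub> z)" for z
 have 1: "\<pi> z \<in> carrier E" if "z \<in> carrier M" for z
  using f(1) coset[OF that] by (auto simp: \<pi>_def module_hom_def)
 have 2: "f ` carrier (quot_module M N) = \<pi> ` carrier M"
  unfolding car \<pi>_def by blast
 have 3: "\<pi> (z +[M] w) = \<pi> z +[E] \<pi> w" if "z \<in> carrier M" "w \<in> carrier M" for z w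
  using f(1) coset that add[OF that, symmetric] by (simp add: \<pi>_def module_hom_def)
 have 4: "\<pi> (r *[M] z) = r *[E] \<pi> z" if "r \<in> carrier R" "z \<in> carrier M" for r z
  using f(1) coset that sm[OF that, symmetric] by (simp add: \<pi>_def module_hom_def)
 have z0: "\<pi> 0[M] = 0[E]"
  using 4[of \<zero> "0[M]"] 1[of "0[M]"] by simp
 have "\<pi> z = 0[E] \<longleftrightarrow> z \<in> N" if z: "z \<in> carrier M" for z
 proof -
  have "\<pi> z = \<pi> 0[M] \<longleftrightarrow> N +>\<^bsub>M\<^esub> z = N +>\<^bsub>M\<^esub> 0[M]"
   unfolding \<pi>_def
   by (rule inj_on_eq_iff[OF f(2) coset[OF z] coset[OF M.zero_closed]])
  also have "\<dots> \<longleftrightarrow> z \<in> N"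
   unfolding N.a_rcos_const[OF ND(3)] using N.a_rcos_self[OF z] N.a_rcos_const[of z] by blast
  finally show ?thesis using z0 by simp
 qed
 thus ?thesis using that[of \<pi>] 1 2 3 4 by blast
qed

section \<open>Local cohomology from an injective resolution, one element at a time\<close>

locale injective_resolution_of_ring = noetherian_cring R for R :: "('a, 'm) ring_scheme" (structure) +
 fixes C :: "nat => ('a, 'c) module" and D :: "nat => 'c => 'c" and e :: "'a => 'c" and x :: "nat => 'a"
 assumes resolution: "injective_resolution R (self_module R) C D e" and x_closed: "x l \<in> carrier R"
begin

lemma C_injective: "injective_module R (C i)"
 using resolution unfolding injective_resolution_def by blast

sublocale C: module R "C i" for i
 using C_injective[of i] unfolding injective_module_def by blast

abbreviation smC (\<open>(_ *{_} _)\<close> [75, 0, 76] 75) where "r *{i} c \<equiv> r \<odot>\<^bsub>C i\<^esub> c"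
abbreviation minusC (\<open>(_ -{_} _)\<close> [65, 0, 66] 65) where "a -{i} b \<equiv> a \<ominus>\<^bsub>C i\<^esub> b"
abbreviation zC where "zC i \<equiv> \<zero>\<^bsub>C i\<^esub>"

lemma D_hom: "D i \<in> module_hom R (C i) (C (Suc i))"
 using resolution unfolding injective_resolution_def by blast

lemma D_closed [simp]: "c \<in> carrier (C i) ==> D i c \<in> carrier (C (Suc i))"
 and D_add [simp]: "c \<in> carrier (C i) ==> b \<in> carrier (C i) ==> D i (c +[C i] b) = D i c +[C (Suc i)] D i b"
 and D_smult [simp]: "r \<in> carrier R ==> c \<in> carrier (C i) ==> D i (r *{i} c) = r *{Suc i} D i c"
 using D_hom[of i] by (auto simp: module_hom_def)

lemma D_zero [simp]: "D i (zC i) = zC (Suc i)"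
 using D_smult[of \<zero> "zC i" i] by simp

lemma D_minus [simp]:
 assumes "c \<in> carrier (C i)" "b \<in> carrier (C i)"
 shows "D i (c -{i} b) = D i c -{Suc i} D i b"
proof -
 have "\<ominus>\<^bsub>C i\<^esub> b = (\<ominus> \<one>) *{i} b" "\<ominus>\<^bsub>C (Suc i)\<^esub> D i b = (\<ominus> \<one>) *{Suc i} D i b"
  using assms C.smult_l_minus[of \<one>] by auto
 thus ?thesis using assms by (simp add: C.M.minus_eq)
qed

lemma exact: "D (Suc i) c = zC (Suc (Suc i)) ==> c \<in> carrier (C (Suc i)) ==> \<exists>b\<in>carrier (C i). D i b = c"
 and DD: "b \<in> carrier (C i) ==> D (Suc i) (D i b) = zC (Suc (Suc i))"
proof -
 have "D i ` carrier (C i) = module_ker (C (Suc i)) (C (Suc (Suc i))) (D (Suc i))"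
  using resolution unfolding injective_resolution_def by blast
 hence *: "!!c. c \<in> D i ` carrier (C i) \<longleftrightarrow> c \<in> carrier (C (Suc i)) \<and> D (Suc i) c = zC (Suc (Suc i))"
  unfolding module_ker_def by blast
 show "\<exists>b\<in>carrier (C i). D i b = c" if "D (Suc i) c = zC (Suc (Suc i))" "c \<in> carrier (C (Suc i))"
  using *[of c] that by blast
 show "D (Suc i) (D i b) = zC (Suc (Suc i))" if "b \<in> carrier (C i)"
  using *[of "D i b"] that by blast
qed

lemma e_hom: "e \<one> \<in> carrier (C 0)" "D 0 (e \<one>) = zC 1" "r \<in> carrier R ==> r *{0} e \<one> = zC 0 ==> r = \<zero>"
 "c \<in> carrier (C 0) ==> D 0 c = zC 1 ==> \<exists>r\<in>carrier R. c = r *{0} e \<one>"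
proof -
 have h: "e \<in> module_hom R (self_module R) (C 0)" "inj_on e (carrier R)"
  "e ` carrier R = module_ker (C 0) (C 1) (D 0)"
  using resolution unfolding injective_resolution_def by auto
 have er: "e r = r *{0} e \<one>" if "r \<in> carrier R" for r
 proof -
  have "e (r ** \<one>) = r *{0} e \<one>" using h(1) that by (simp add: module_hom_def del: r_one)
  thus ?thesis using that by simp
 qed
 show e1: "e \<one> \<in> carrier (C 0)" using h(1) by (auto simp: module_hom_def)
 show "D 0 (e \<one>) = zC 1" using h(3) unfolding module_ker_def by blast
 show "r = \<zero>" if r: "r \<in> carrier R" "r *{0} e \<one> = zC 0"
 proof -
  have "e r = e \<zero>" using er[OF r(1)] er[OF zero_closed] r(2) e1 by simp
  thus ?thesis using h(2) r(1) unfolding inj_on_def by blast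
 qed
 show "\<exists>r\<in>carrier R. c = r *{0} e \<one>" if "c \<in> carrier (C 0)" "D 0 c = zC 1"
 proof -
  have "c \<in> e ` carrier R" using h(3) that unfolding module_ker_def by blast
  thus ?thesis using er by blast
 qed
qed

text \<open>Torsion with respect to the first \<open>j\<close> elements only, so that the torsion
  functor of all parameters is reached by induction on \<open>j\<close>.\<close>

definition Gam :: "nat => nat => 'c set" where
 "Gam j i = {c \<in> carrier (C i). \<forall>l<j. \<exists>n::nat. (x l [^] n) *{i} c = zC i}"

text \<open>Boundaries of the complex \<open>Gam j\<close> in degree \<open>j\<close>: with
  \<open>j\<close> elements only this degree, the top one, is studied.\<close>

definition Bd :: "nat => 'c set" where
 "Bd j = (case j of 0 => {zC 0} | Suc i => D i ` Gam j i)"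

definition Xp :: "nat => 'a" where "Xp j = (\<Otimes>l\<in>{..<j}. x l)"

definition Pw :: "nat => nat => 'a set" where "Pw j n = Idl ((\<lambda>l. x l [^] n) ` {..<j})"

lemma pow_closed [simp]: "x l [^] (n::nat) \<in> carrier R"
 using x_closed by simp

lemma Xp_closed [simp]: "Xp j \<in> carrier R" "Xp j [^] (n::nat) \<in> carrier R"
proof -
 show "Xp j \<in> carrier R" unfolding Xp_def by (rule finprod_closed) (use x_closed in blast)
 thus "Xp j [^] n \<in> carrier R" by simp
qed

lemma Xp_0: "Xp 0 = \<one>" and Xp_Suc: "Xp (Suc j) = x j ** Xp j"
 using x_closed by (auto simp: Xp_def lessThan_Suc)

lemma pow_kills_more:
 assumes "y \<in> carrier R" "c \<in> carrier (C i)" "(y [^] (n::nat)) *{i} c = zC i"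
 shows "(y [^] (k + n)) *{i} c = zC i"
 using assms nat_pow_mult[OF assms(1), of k n, symmetric] by (simp add: C.smult_assoc1)

lemma Gam_closed: "c \<in> Gam j i ==> c \<in> carrier (C i)"
 by (auto simp: Gam_def)

lemma Gam_submodule: "submodule (Gam j i) R (C i)"
proof (rule C.submodule_intro)
 fix a b assume a: "a \<in> Gam j i" and b: "b \<in> Gam j i"
 show "a +[C i] b \<in> Gam j i"
  unfolding Gam_def
 proof (intro CollectI conjI allI impI)
  fix l assume "l < j"
  then obtain n k where "(x l [^] (n::nat)) *{i} a = zC i" "(x l [^] (k::nat)) *{i} b = zC i"
   using a b unfolding Gam_def by blast
  hence "(x l [^] (k + n)) *{i} a = zC i" "(x l [^] (k + n)) *{i} b = zC i"
   using pow_kills_more[OF x_closed Gam_closed[OF a], of l n k]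
    pow_kills_more[OF x_closed Gam_closed[OF b], of l k n] by (auto simp: add.commute)
  hence "(x l [^] (k + n)) *{i} (a +[C i] b) = zC i"
   using a b by (simp add: C.smult_r_distr Gam_closed)
  thus "\<exists>n::nat. (x l [^] n) *{i} (a +[C i] b) = zC i" by blast
 qed (use a b in \<open>simp add: Gam_closed\<close>)
next
 fix r a assume r: "r \<in> carrier R" and a: "a \<in> Gam j i"
 show "r *{i} a \<in> Gam j i"
  unfolding Gam_def
 proof (intro CollectI conjI allI impI)
  fix l assume "l < j"
  then obtain n where "(x l [^] (n::nat)) *{i} a = zC i" using a unfolding Gam_def by blast
  hence "(x l [^] n) *{i} (r *{i} a) = zC i"
   using C.smult_commute[of "x l [^] n" r a i] r Gam_closed[OF a] by simp
  thus "\<exists>n::nat. (x l [^] n) *{i} (r *{i} a) = zC i" by blast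
 qed (use r a in \<open>simp add: Gam_closed\<close>)
qed (auto simp: Gam_def)

lemmas Gam_D = C.submoduleD[OF Gam_submodule]

lemma Gam_0: "Gam 0 i = carrier (C i)" by (auto simp: Gam_def)

lemma Gam_Suc: "c \<in> Gam (Suc j) i \<longleftrightarrow> c \<in> Gam j i \<and> (\<exists>n::nat. (x j [^] n) *{i} c = zC i)"
 by (auto simp: Gam_def less_Suc_eq)

lemma D_Gam: "c \<in> Gam j i ==> D i c \<in> Gam j (Suc i)"
proof -
 assume c: "c \<in> Gam j i"
 have "\<exists>n::nat. (x l [^] n) *{Suc i} D i c = zC (Suc i)" if l: "l < j" for l
 proof -
  obtain n :: nat where "(x l [^] n) *{i} c = zC i" using c l unfolding Gam_def by blast
  hence "D i ((x l [^] n) *{i} c) = zC (Suc i)" by simp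
  thus ?thesis using Gam_closed[OF c] by auto
 qed
 thus "D i c \<in> Gam j (Suc i)" using Gam_closed[OF c] unfolding Gam_def by auto
qed

lemma Bd_submodule: "submodule (Bd j) R (C j)"
proof (cases j)
 case 0
 thus ?thesis by (intro C.submodule_intro) (auto simp: Bd_def)
next
 case (Suc i)
 thus ?thesis
  using module_hom_image[OF C.module_axioms C.module_axioms D_hom Gam_submodule] by (simp add: Bd_def)
qed

lemmas Bd_D = C.submoduleD[OF Bd_submodule]

lemma D_Bd: "b \<in> Bd j ==> D j b = zC (Suc j)"
 by (cases j) (auto simp: Bd_def DD Gam_closed)

lemma Bd_Gam: "Bd j \<subseteq> Gam j j"
 by (cases j) (auto simp: Bd_def D_Gam Gam_0)

lemma smult_pow_add: "y \<in> carrier R ==> c \<in> carrier (C i) ==>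
  (y [^] (n + k :: nat)) *{i} c = (y [^] n) *{i} ((y [^] k) *{i} c)"
 by (simp add: C.smult_assoc1 flip: nat_pow_mult)

text \<open>\<open>Gam j i\<close> is divisible by \<open>y\<close> up to \<open>y\<close>-torsion, because \<open>C i\<close> is injective:
 the map \<open>y\<^sup>s\<^sup>+\<^sup>t r \<mapsto> y\<^sup>s r c\<close> extends by \<open>0\<close> to an ideal \<open>K\<close> containing powers of the \<open>x l\<close>.\<close>

lemma Gam_divisible:
 assumes c: "c \<in> Gam j i" and y: "y \<in> carrier R"
 obtains b s where "b \<in> Gam j i" "(y [^] (s + t :: nat)) *{i} b = (y [^] (s::nat)) *{i} c"
proof -
 have cc: "c \<in> carrier (C i)" using Gam_closed[OF c] .
 \<comment> \<open>Annihilators of the powers of \<open>y\<close>. They become constant at some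
   \<open>s\<close>, which allows the cancellation of \<open>y^t\<close> from
   \<open>y^(s + t) r = 0\<close>.\<close>
 define A where "A n = {r \<in> carrier R. y [^] (n::nat) ** r = \<zero>}" for n
 have AI: "ideal (A n) R" for n
  by (rule ideal_intro) (use y in \<open>auto simp: A_def r_distr m_lcomm\<close>)
 have Amono: "A n \<subseteq> A (n + k)" for n k
 proof
  fix r assume "r \<in> A n"
  hence r: "r \<in> carrier R" "y [^] n ** r = \<zero>" by (auto simp: A_def)
  have "y [^] (n + k) ** r = y [^] k ** (y [^] n ** r)"
   using r(1) y nat_pow_mult[OF y, of k n] by (simp add: m_assoc[symmetric] add.commute)
  thus "r \<in> A (n + k)" using r y by (simp add: A_def)
 qed
 obtain s where s: "!!k. A (s + k) = A s"
 proof -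
  have "\<exists>M\<in>range A. \<forall>J\<in>range A. M \<subseteq> J --> J = M"
   using noetherian_self_module AI unfolding noetherian_module_def submodule_self
   by (elim conjE allE[of _ "range A"]) auto
  then obtain s where s: "!!n. A s \<subseteq> A n ==> A n = A s" by auto
  show ?thesis by (rule that[of s]) (rule s[OF Amono])
 qed
 define Z where "Z = PIdl (y [^] (s + t))"
 have ZI: "ideal Z R" unfolding Z_def using y by (simp add: cgenideal_ideal)
 \<comment> \<open>\<open>T\<close> is the part of \<open>Z\<close> on which the intended map
   vanishes. Powers of the \<open>x l\<close> kill \<open>c\<close> and so multiply \<open>Z\<close>
   into \<open>T\<close>; Artin--Rees therefore gives an ideal \<open>K\<close> with
   \<open>K \<inter> Z \<subseteq> T\<close> that contains powers of the \<open>x l\<close>.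
   Prescribing zero on \<open>K\<close> keeps the map well defined and forces \<open>b\<close> into
   \<open>Gam j i\<close>.\<close>
 define T where "T = {z. \<exists>r\<in>carrier R. z = r ** y [^] (s + t) \<and> (y [^] s ** r) *{i} c = zC i}"
 have TI: "ideal T R"
 proof (rule ideal_intro)
  show "T \<subseteq> carrier R" using y by (auto simp: T_def)
  show "\<zero> \<in> T" using y cc by (auto simp: T_def intro!: bexI[of _ \<zero>])
  show "a \<oplus> b \<in> T" if ab: "a \<in> T" "b \<in> T" for a b
  proof -
   obtain r r' where *: "r \<in> carrier R" "a = r ** y [^] (s + t)" "(y [^] s ** r) *{i} c = zC i"
    "r' \<in> carrier R" "b = r' ** y [^] (s + t)" "(y [^] s ** r') *{i} c = zC i"
    using ab unfolding T_def by blast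
   hence "a \<oplus> b = (r \<oplus> r') ** y [^] (s + t)" "(y [^] s ** (r \<oplus> r')) *{i} c = zC i"
    using y cc by (auto simp: l_distr r_distr C.smult_l_distr)
   thus ?thesis unfolding T_def using *(1,4) by blast
  qed
  show "r ** a \<in> T" if ar: "a \<in> T" "r \<in> carrier R" for a r
  proof -
   obtain r' where *: "r' \<in> carrier R" "a = r' ** y [^] (s + t)" "(y [^] s ** r') *{i} c = zC i"
    using ar unfolding T_def by blast
   have "(y [^] s ** (r ** r')) *{i} c = r *{i} ((y [^] s ** r') *{i} c)"
    using y cc ar(2) *(1) by (simp add: m_lcomm flip: C.smult_assoc1)
   hence "r ** a = (r ** r') ** y [^] (s + t)" "(y [^] s ** (r ** r')) *{i} c = zC i"
    using y ar(2) * by (auto simp: m_assoc)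
   thus ?thesis unfolding T_def using *(1) ar(2) by blast
  qed
 qed
 have TZ: "T \<subseteq> Z" unfolding T_def Z_def cgenideal_def by blast
 have "\<forall>l. \<exists>n::nat. l < j --> (x l [^] n) *{i} c = zC i" using c unfolding Gam_def by blast
 then obtain n where n: "!!l. l < j ==> (x l [^] (n l::nat)) *{i} c = zC i" by metis
 have Y: "(\<lambda>l. x l [^] n l) ` {..<j} \<subseteq> carrier R" by auto
 have YZ: "v *[self_module R] z \<in> T" if vz: "v \<in> (\<lambda>l. x l [^] n l) ` {..<j}" "z \<in> Z" for v z
 proof -
  obtain l where l: "l < j" "v = x l [^] n l" using vz(1) by blast
  obtain r where r: "r \<in> carrier R" "z = r ** y [^] (s + t)" using vz(2) unfolding Z_def cgenideal_def by blast
  have "(y [^] s ** (v ** r)) *{i} c = (y [^] s ** r) *{i} (v *{i} c)"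
   using y cc r(1) l(2) m_comm[of v r] by (simp add: m_assoc flip: C.smult_assoc1)
  also have "\<dots> = zC i" using n[OF l(1)] l(2) y r(1) by simp
  finally show ?thesis unfolding T_def using r y l(2) by (auto simp: m_assoc intro!: bexI[of _ "v ** r"])
 qed
 have TZ': "submodule T R (self_module R)" "submodule Z R (self_module R)"
  using TI ZI by (simp_all add: submodule_self)
 obtain K where K: "submodule K R (self_module R)" "T \<subseteq> K" "K \<inter> Z \<subseteq> T"
  "!!v. v \<in> (\<lambda>l. x l [^] n l) ` {..<j} ==> \<exists>N::nat. \<forall>a\<in>carrier (self_module R). (v [^] N) *[self_module R] a \<in> K"
  using artin_rees[OF noetherian_self_module TZ' TZ Y YZ] by meson
 have KI: "ideal K R" using K(1) submodule_self by blast
 have yc: "y [^] (s + t) \<in> carrier R" "y [^] s \<in> carrier R" using y by auto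
 have wd: "r *{i} ((y [^] s) *{i} c) = zC i" if r: "r \<in> carrier R" "r ** y [^] (s + t) \<in> K" for r
 proof -
  have "r ** y [^] (s + t) \<in> Z" unfolding Z_def cgenideal_def using r(1) by blast
  hence "r ** y [^] (s + t) \<in> T" using K(3) r(2) by blast
  then obtain w where w: "w \<in> carrier R" "r ** y [^] (s + t) = w ** y [^] (s + t)"
   "(y [^] s ** w) *{i} c = zC i" unfolding T_def by blast
  have "y [^] (s + t) ** (r \<ominus> w) = r ** y [^] (s + t) \<ominus> w ** y [^] (s + t)"
   using r(1) w(1) yc by algebra
  also have "\<dots> = \<zero>" unfolding w(2) using w(1) yc by (simp add: minus_eq r_neg)
  finally have "r \<ominus> w \<in> A (s + t)" using r(1) w(1) by (simp add: A_def)
  hence "y [^] s ** (r \<ominus> w) = \<zero>" unfolding s by (simp add: A_def)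
  moreover have "y [^] s ** r = y [^] s ** w \<oplus> y [^] s ** (r \<ominus> w)" using r(1) w(1) yc(2) by algebra
  ultimately have "y [^] s ** r = y [^] s ** w" using yc w(1) by simp
  thus ?thesis using w r(1) yc cc C.smult_commute[of r "y [^] s" c i] by (simp flip: C.smult_assoc1)
 qed
 obtain b where b: "b \<in> carrier (C i)" "\<forall>k\<in>K. k *{i} b = zC i" and 1: "(y [^] (s + t)) *{i} b = (y [^] s) *{i} c"
  using baer_adjoin[OF C_injective[of i] KI yc(1) C.smult_closed[OF yc(2) cc] wd] by blast
 have "b \<in> Gam j i"
  unfolding Gam_def
 proof (intro CollectI conjI allI impI)
  fix l assume "l < j"
  then obtain N :: nat where "\<forall>a\<in>carrier R. (x l [^] n l) [^] N ** a \<in> K" using K(4)[of "x l [^] n l"] by auto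
  hence "(x l [^] n l) [^] N ** \<one> \<in> K" by blast
  hence "((x l [^] (n l * N))) *{i} b = zC i" using b(2) x_closed by (simp add: nat_pow_pow)
  thus "\<exists>n::nat. (x l [^] n) *{i} b = zC i" by blast
 qed (rule b(1))
 thus ?thesis using that[of b s] 1 by blast
qed

end

context module
begin

lemma minus_zero_right [simp]: "a \<in> carrier M ==> a -[M] 0[M] = a"
 using add_minus_cancel[of "0[M]" a] by simp

lemma minus_self [simp]: "a \<in> carrier M ==> a -[M] a = 0[M]"
 by (simp add: minus_eq_zero_iff)

lemma minus_telescope:
 assumes "a \<in> carrier M" "b \<in> carrier M" "c \<in> carrier M"
 shows "(a -[M] b) +[M] (b -[M] c) = a -[M] c" "(a -[M] b) -[M] (c -[M] b) = a -[M] c"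
proof -
 have 1: "(a -[M] b) +[M] (b -[M] c) = a -[M] c" if "a \<in> carrier M" "b \<in> carrier M" "c \<in> carrier M" for a b c
  using that by (simp add: M.minus_eq M.a_assoc M.r_neg1)
 thus "(a -[M] b) +[M] (b -[M] c) = a -[M] c" using assms by blast
 have "\<ominus>\<^bsub>M\<^esub> (c -[M] b) = b -[M] c" using assms by (simp add: M.minus_eq M.minus_add M.a_comm)
 thus "(a -[M] b) -[M] (c -[M] b) = a -[M] c"
  using 1[OF assms] M.minus_eq[of "a -[M] b" "c -[M] b"] by simp
qed

lemma minus_telescope4:
 assumes "a \<in> carrier M" "b \<in> carrier M" "c \<in> carrier M" "d \<in> carrier M"
 shows "(a -[M] b) +[M] ((c -[M] a) -[M] (d -[M] b)) = c -[M] d"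
proof -
 have "\<ominus>\<^bsub>M\<^esub> (d -[M] b) = b -[M] d" using assms by (simp add: M.minus_eq M.minus_add M.a_comm)
 hence "(a -[M] b) +[M] ((c -[M] a) -[M] (d -[M] b)) = ((c -[M] a) +[M] (a -[M] b)) +[M] (b -[M] d)"
  using assms M.minus_eq[of "c -[M] a" "d -[M] b"] by (simp add: M.a_ac)
 thus ?thesis using assms by (simp add: minus_telescope)
qed

end

context injective_resolution_of_ring
begin

lemma Bd_divisible:
 assumes b: "\<beta> \<in> Bd j" and y: "y \<in> carrier R"
 obtains b s where "b \<in> Bd j" "(y [^] (s + t :: nat)) *{j} b = (y [^] (s::nat)) *{j} \<beta>"
proof (cases j)
 case 0
 thus ?thesis using that[of "zC 0" 0] b y by (auto simp: Bd_def)
next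
 case (Suc i)
 then obtain b' where b': "b' \<in> Gam j i" "\<beta> = D i b'" using b by (auto simp: Bd_def)
 obtain c s where c: "c \<in> Gam j i" "(y [^] (s + t)) *{i} c = (y [^] (s::nat)) *{i} b'"
  by (rule Gam_divisible[OF b'(1) y, of t])
 have "D i ((y [^] (s + t)) *{i} c) = D i ((y [^] s) *{i} b')" using c(2) by simp
 hence "(y [^] (s + t)) *{j} D i c = (y [^] s) *{j} \<beta>"
  using y Gam_closed[OF c(1)] Gam_closed[OF b'(1)] by (simp add: Suc b'(2))
 moreover have "D i c \<in> Bd j" using c(1) by (auto simp: Bd_def Suc)
 ultimately show ?thesis using that by blast
qed

lemma Gam_Suc_I: "c \<in> Gam j i ==> (x j [^] (n::nat)) *{i} c = zC i ==> c \<in> Gam (Suc j) i"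
 unfolding Gam_Suc by blast

lemma D_in_Bd_Suc: "g \<in> Gam (Suc j) j ==> D j g \<in> Bd (Suc j)"
 by (auto simp: Bd_def)

text \<open>The connecting map for adding \<open>x j\<close>, without localisation: divisibility of
  boundaries corrects \<open>b\<close> by a boundary \<open>b'\<close> to an
  \<open>x j\<close>-torsion element, and \<open>D j b'\<close> is zero.\<close>

lemma connecting_Bd:
 assumes b: "b \<in> Gam j j" and N: "(x j [^] (N::nat)) *{j} b \<in> Bd j"
 shows "D j b \<in> Bd (Suc j)"
proof -
 obtain b' s where b': "b' \<in> Bd j" "(x j [^] (s + N)) *{j} b' = (x j [^] (s::nat)) *{j} ((x j [^] N) *{j} b)"
  by (rule Bd_divisible[OF N x_closed, of j N])
 have c: "b \<in> carrier (C j)" "b' \<in> carrier (C j)" using b b'(1) Gam_closed Bd_D(2) by auto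
 have "(x j [^] (s + N)) *{j} (b -{j} b') = zC j"
  using c b'(2) by (simp add: C.smult_minus_distr smult_pow_add[OF x_closed] C.minus_eq_zero_iff)
 moreover have "b -{j} b' \<in> Gam j j" using b b'(1) Bd_Gam Gam_D(7) by blast
 ultimately have "b -{j} b' \<in> Gam (Suc j) j" by (rule Gam_Suc_I[rotated])
 hence "D j (b -{j} b') \<in> Bd (Suc j)" by (rule D_in_Bd_Suc)
 thus ?thesis using c D_Bd[OF b'(1)] by simp
qed

text \<open>Vanishing of local cohomology above the number of elements.\<close>

definition vanishing :: "nat => bool" where
 "vanishing j \<longleftrightarrow> (\<forall>i\<ge>j. \<forall>c\<in>Gam j (Suc i). D (Suc i) c = zC (Suc (Suc i)) --> (\<exists>b\<in>Gam j i. D i b = c))"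

text \<open>Lift \<open>c\<close> to \<open>b\<close> in \<open>Gam j i\<close>. A power of
  \<open>x j\<close> makes \<open>b\<close> a cocycle, which by induction is \<open>D k b'\<close>;
  dividing \<open>b'\<close> by that power gives \<open>b2\<close>, and \<open>b\<close> minus
  \<open>D k b2\<close> is \<open>x j\<close>-torsion with the same image \<open>c\<close>.\<close>

lemma vanishing: "vanishing j"
proof (induction j)
 case 0
 thus ?case using exact by (auto simp: vanishing_def Gam_0)
next
 case (Suc j)
 show ?case
  unfolding vanishing_def
 proof (intro allI ballI impI)
  fix i c assume i: "Suc j \<le> i" and c: "c \<in> Gam (Suc j) (Suc i)" and Dc: "D (Suc i) c = zC (Suc (Suc i))"
  obtain k where k: "i = Suc k" "j \<le> k" using i by (cases i) auto
  have cj: "c \<in> Gam j (Suc i)" and "\<exists>n::nat. (x j [^] n) *{Suc i} c = zC (Suc i)"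
   using c unfolding Gam_Suc by blast+
  then obtain n :: nat where n: "(x j [^] n) *{Suc i} c = zC (Suc i)" by blast
  have "j \<le> i" using i by simp
  then obtain b where b: "b \<in> Gam j i" "D i b = c" using Suc cj Dc unfolding vanishing_def by blast
  have bc: "b \<in> carrier (C i)" using Gam_closed b by blast
  have "(x j [^] n) *{i} b \<in> Gam j (Suc k)" using Gam_D(5)[OF pow_closed b(1)] k by simp
  moreover have "D (Suc k) ((x j [^] n) *{i} b) = zC (Suc (Suc k))"
   using bc b(2) n k(1) by simp
  ultimately obtain b' where b': "b' \<in> Gam j k" "D k b' = (x j [^] n) *{i} b"
   using Suc k(2) unfolding vanishing_def by blast
  obtain b2 s where b2: "b2 \<in> Gam j k" "(x j [^] (s + n)) *{k} b2 = (x j [^] (s::nat)) *{k} b'"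
   by (rule Gam_divisible[OF b'(1) x_closed, of j n])
  have kc: "b2 \<in> carrier (C k)" "b' \<in> carrier (C k)" using b2 b' Gam_closed by auto
  have "D k ((x j [^] (s + n)) *{k} b2) = D k ((x j [^] s) *{k} b')" using b2(2) by simp
  hence "(x j [^] (s + n)) *{i} D k b2 = (x j [^] s) *{i} ((x j [^] n) *{i} b)"
   using kc b'(2) k(1) by simp
  moreover have Dk: "D k b2 \<in> Gam j i" "D k b2 \<in> carrier (C i)" using D_Gam[OF b2(1)] Gam_closed k(1) by auto
  ultimately have "(x j [^] (s + n)) *{i} (b -{i} D k b2) = zC i"
   using bc by (simp add: C.smult_minus_distr smult_pow_add[OF x_closed] C.minus_eq_zero_iff)
  hence "b -{i} D k b2 \<in> Gam (Suc j) i" using Gam_D(7)[OF b(1) Dk(1)] by (rule Gam_Suc_I[rotated])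
  moreover have "D i (b -{i} D k b2) = c"
   using bc Dk(2) b(2) DD[OF kc(1)] k(1) Gam_closed[OF c] by simp
  ultimately show "\<exists>b\<in>Gam (Suc j) i. D i b = c" by blast
 qed
qed

lemma Pw_ideal: "ideal (Pw j n) R"
 unfolding Pw_def by (rule genideal_ideal) auto

lemma Pw_gen: "l < j ==> x l [^] n \<in> Pw j n"
 unfolding Pw_def using genideal_self[of "(\<lambda>l. x l [^] n) ` {..<j}"]
 by (metis (no_types, lifting) imageE image_eqI lessThan_iff pow_closed subset_iff)

lemma Pw_Suc: "Pw j n \<subseteq> Pw (Suc j) n"
 unfolding Pw_def[of j] by (rule genideal_minimal[OF Pw_ideal]) (use Pw_gen[of _ "Suc j"] in auto)

lemma Xp_factor: "l < j ==> \<exists>r\<in>carrier R. Xp j = r ** x l"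
proof (induction j)
 case (Suc j)
 show ?case
 proof (cases "l = j")
  case True thus ?thesis using m_comm[OF x_closed Xp_closed(1), of j j] Xp_Suc by auto
 next
  case False
  then obtain r where r: "r \<in> carrier R" "Xp j = r ** x l" using Suc by auto
  hence "Xp (Suc j) = (x j ** r) ** x l" using x_closed by (simp add: Xp_Suc m_assoc)
  thus ?thesis using r(1) x_closed by blast
 qed
qed simp

lemma Xp_pow_Pw: "a \<in> Pw j n ==> Xp j [^] k ** a \<in> Pw j (n + k)"
proof -
 assume a: "a \<in> Pw j n"
 let ?L = "{r \<in> carrier R. r ** Xp j [^] k \<in> Pw j (n + k)}"
 have L: "ideal ?L R" by (rule quotient_ideal[OF Pw_ideal Xp_closed(2)])
 have "x l [^] n \<in> ?L" if l: "l < j" for l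
 proof -
  obtain r where r: "r \<in> carrier R" "Xp j = r ** x l" using Xp_factor[OF l] by blast
  have "Xp j [^] k = r [^] k ** x l [^] k" unfolding r(2) using r(1) x_closed by (rule nat_pow_distrib)
  hence "x l [^] n ** Xp j [^] k = r [^] k ** x l [^] (n + k)"
   using r(1) x_closed by (simp add: m_lcomm flip: nat_pow_mult)
  thus ?thesis using idealD(5)[OF Pw_ideal Pw_gen[OF l, of "n + k"], of "r [^] k"] r(1) by simp
 qed
 hence "Pw j n \<subseteq> ?L" unfolding Pw_def[of j n] by (intro genideal_minimal[OF L]) auto
 thus ?thesis using a m_comm idealD(2)[OF Pw_ideal a] by auto
qed

text \<open>\<open>u t\<close> represents \<open>1 / Xp j ^ t\<close>. The last two clauses describe
  its annihilator as in the direct limit of the \<open>R / Pw j t\<close>: it contains the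
  \<open>x l ^ t\<close>, and each of its elements is carried into \<open>Pw j (t + s)\<close> by
  some \<open>Xp j ^ s\<close>.\<close>

definition generating :: "nat => (nat => 'c) => bool" where
 "generating j u \<longleftrightarrow> (\<forall>t. u t \<in> Gam j j \<and> D j (u t) = zC (Suc j)) \<and>
  (\<forall>c\<in>Gam j j. D j c = zC (Suc j) --> (\<exists>r\<in>carrier R. \<exists>t. c -{j} r *{j} u t \<in> Bd j)) \<and>
  (\<forall>t. Xp j *{j} u (Suc t) -{j} u t \<in> Bd j) \<and>
  (\<forall>t. \<forall>l<j. (x l [^] t) *{j} u t \<in> Bd j) \<and>
  (\<forall>t. \<forall>r\<in>carrier R. r *{j} u t \<in> Bd j --> (\<exists>s. r ** Xp j [^] s \<in> Pw j (t + s)))"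

lemma generatingD:
 assumes "generating j u"
 shows "u t \<in> Gam j j" "u t \<in> carrier (C j)" "D j (u t) = zC (Suc j)"
  "c \<in> Gam j j ==> D j c = zC (Suc j) ==> \<exists>r\<in>carrier R. \<exists>t. c -{j} r *{j} u t \<in> Bd j"
  "Xp j *{j} u (Suc t) -{j} u t \<in> Bd j"
  "l < j ==> (x l [^] t) *{j} u t \<in> Bd j"
  "r \<in> carrier R ==> r *{j} u t \<in> Bd j ==> \<exists>s. r ** Xp j [^] s \<in> Pw j (t + s)"
 using assms Gam_closed unfolding generating_def by blast+

lemma generating_shift:
 assumes u: "generating j u" shows "(Xp j [^] k) *{j} u (t + k) -{j} u t \<in> Bd j"
proof (induction k)
 case 0
 thus ?case using generatingD(2)[OF u] Bd_D(3) by (simp add: C.minus_eq_zero_iff)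
next
 case (Suc k)
 let ?M = "C j" let ?X = "Xp j [^] k"
 have c: "u t \<in> carrier ?M" for t using generatingD(2)[OF u] .
 have "?X *{j} (Xp j *{j} u (Suc (t + k)) -{j} u (t + k)) \<in> Bd j"
  by (rule Bd_D(5)) (use generatingD(5)[OF u] in simp_all)
 hence "?X *{j} (Xp j *{j} u (Suc (t + k)) -{j} u (t + k)) +[C j] (?X *{j} u (t + k) -{j} u t) \<in> Bd j"
  using Suc by (rule Bd_D(4))
 moreover have "?X *{j} (Xp j *{j} u (Suc (t + k)) -{j} u (t + k)) +[C j] (?X *{j} u (t + k) -{j} u t)
   = (Xp j [^] Suc k) *{j} u (t + Suc k) -{j} u t"
  using c by (simp add: C.smult_minus_distr C.smult_assoc1 C.minus_telescope)
 ultimately show ?case by simp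
qed

text \<open>One more parameter \<open>y = x j\<close>: if \<open>y\<^sup>\<sigma>\<^sup>+\<^sup>t b t = y\<^sup>\<sigma> u t\<close>, then \<open>D j (b t)\<close>
 represents the class of \<open>u t / y\<^sup>t\<close> under the connecting map.\<close>

lemma generating_Suc:
 assumes u: "generating j u" shows "\<exists>v. generating (Suc j) v"
proof -
 let ?M = "C j" let ?y = "x j" let ?X = "Xp j"
 note uc = generatingD(2)[OF u]
 have "\<forall>t. \<exists>b s. b \<in> Gam j j \<and> (?y [^] (s + t :: nat)) *{j} b = (?y [^] (s::nat)) *{j} u t"
 proof
  fix t
  show "\<exists>b s. b \<in> Gam j j \<and> (?y [^] (s + t :: nat)) *{j} b = (?y [^] (s::nat)) *{j} u t"
  proof -
   obtain b s where "b \<in> Gam j j" "(?y [^] (s + t :: nat)) *{j} b = (?y [^] (s::nat)) *{j} u t"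
    by (rule Gam_divisible[OF generatingD(1)[OF u, of t] x_closed[of j], of t])
   thus ?thesis by (intro exI conjI)
  qed
 qed
 then obtain b \<sigma> where b: "!!t. b t \<in> Gam j j" "!!t. (?y [^] (\<sigma> t + t)) *{j} b t = (?y [^] (\<sigma> t::nat)) *{j} u t"
  by metis
 have bc: "b t \<in> carrier ?M" for t using Gam_closed b(1) by blast
 have yc: "?y \<in> carrier R" by (rule x_closed)
 have pm: "(?y [^] (n + k :: nat)) *{j} c = (?y [^] n) *{j} ((?y [^] k) *{j} c)" if "c \<in> carrier ?M" for n k c
  using smult_pow_add[OF yc that] .
 define v where "v t = D j (b t)" for t
 have vc: "v t \<in> carrier (C (Suc j))" for t unfolding v_def using bc by simp
 have "generating (Suc j) v"
  unfolding generating_def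
 proof (intro conjI allI ballI impI)
  fix t
  \<comment> \<open>\<open>y^t b t - u t\<close> is \<open>y\<close>-torsion by the choice of
    \<open>b t\<close>, and since \<open>u t\<close> is a cocycle its image under \<open>D j\<close>
    is \<open>y^t v t\<close>. So that multiple of \<open>v t\<close> is a boundary.\<close>
  have "(?y [^] (\<sigma> t)) *{j} ((?y [^] t) *{j} b t -{j} u t) = zC j"
   using b(2)[of t] bc uc pm[OF bc, of "\<sigma> t" t t] by (simp add: C.smult_minus_distr C.minus_eq_zero_iff)
  moreover have "(?y [^] t) *{j} b t -{j} u t \<in> Gam j j"
   using b(1) generatingD(1)[OF u] Gam_D(5,7) pow_closed by blast
  ultimately have g: "(?y [^] t) *{j} b t -{j} u t \<in> Gam (Suc j) j" by (rule Gam_Suc_I[rotated])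
  have "D j ((?y [^] t) *{j} b t -{j} u t) = (?y [^] t) *{Suc j} v t"
   using bc uc generatingD(3)[OF u] by (simp add: v_def)
  hence yt: "(?y [^] t) *{Suc j} v t \<in> Bd (Suc j)" using D_in_Bd_Suc[OF g] by simp
  hence yt0: "(?y [^] t) *{Suc j} v t \<in> Gam (Suc j) (Suc j)" using Bd_Gam by blast
  have vG: "v t \<in> Gam j (Suc j)" unfolding v_def by (rule D_Gam[OF b(1)])
  from yt0 obtain n :: nat where "(?y [^] n) *{Suc j} ((?y [^] t) *{Suc j} v t) = zC (Suc j)"
   unfolding Gam_Suc by blast
  hence "(?y [^] (n + t)) *{Suc j} v t = zC (Suc j)" using smult_pow_add[OF yc vc] by simp
  thus "v t \<in> Gam (Suc j) (Suc j)" using vG by (rule Gam_Suc_I[rotated])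
  show "D (Suc j) (v t) = zC (Suc (Suc j))" unfolding v_def by (rule DD[OF bc])
  show "(x l [^] t) *{Suc j} v t \<in> Bd (Suc j)" if "l < Suc j" for l
  proof (cases "l = j")
   case True thus ?thesis using yt by simp
  next
   case False
   hence l: "l < j" using that by simp
   have "(?y [^] (\<sigma> t + t)) *{j} ((x l [^] t) *{j} b t) = (?y [^] \<sigma> t) *{j} ((x l [^] t) *{j} u t)"
    using C.smult_commute[of "?y [^] (\<sigma> t + t)" "x l [^] t" "b t" j]
     C.smult_commute[of "?y [^] \<sigma> t" "x l [^] t" "u t" j] b(2)[of t] bc uc by simp
   also have "\<dots> \<in> Bd j" using generatingD(6)[OF u l] Bd_D(5) pow_closed by blast
   finally have "D j ((x l [^] t) *{j} b t) \<in> Bd (Suc j)"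
    using connecting_Bd Gam_D(5)[OF pow_closed b(1)] by blast
   thus ?thesis using bc by (simp add: v_def)
  qed
  show "Xp (Suc j) *{Suc j} v (Suc t) -{Suc j} v t \<in> Bd (Suc j)"
  proof -
   let ?b = "Xp (Suc j) *{j} b (Suc t) -{j} b t"
   let ?N = "\<sigma> t + \<sigma> (Suc t) + t"
   have 1: "(?y [^] ?N) *{j} (Xp (Suc j) *{j} b (Suc t)) = (?y [^] (\<sigma> t + \<sigma> (Suc t))) *{j} (?X *{j} u (Suc t))"
   proof -
    have "(?y [^] ?N) *{j} (Xp (Suc j) *{j} b (Suc t)) = (?y [^] ?N ** ?y ** ?X) *{j} b (Suc t)"
     using bc yc by (simp add: Xp_Suc C.smult_assoc1)
    also have "?y [^] ?N ** ?y ** ?X = (?y [^] \<sigma> t ** ?X) ** ?y [^] (\<sigma> (Suc t) + Suc t)"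
    proof -
     have "?y [^] ?N ** ?y = ?y [^] Suc ?N" by (rule nat_pow_Suc[symmetric])
     also have "Suc ?N = \<sigma> t + (\<sigma> (Suc t) + Suc t)" by simp
     also have "?y [^] (\<sigma> t + (\<sigma> (Suc t) + Suc t)) = ?y [^] \<sigma> t ** ?y [^] (\<sigma> (Suc t) + Suc t)"
      by (rule nat_pow_mult[OF yc, symmetric])
     finally have "?y [^] ?N ** ?y = ?y [^] \<sigma> t ** ?y [^] (\<sigma> (Suc t) + Suc t)" .
     thus ?thesis using yc by (simp add: m_ac)
    qed
    also have "\<dots> *{j} b (Suc t) = (?y [^] \<sigma> t ** ?X) *{j} ((?y [^] \<sigma> (Suc t)) *{j} u (Suc t))"
     using bc yc b(2)[of "Suc t"] by (simp add: C.smult_assoc1)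
    also have "\<dots> = (?y [^] (\<sigma> t + \<sigma> (Suc t))) *{j} (?X *{j} u (Suc t))"
     using uc yc C.smult_commute[of ?X "?y [^] \<sigma> (Suc t)" "u (Suc t)" j] by (simp add: C.smult_assoc1 pm)
    finally show ?thesis .
   qed
   have 2: "(?y [^] ?N) *{j} b t = (?y [^] (\<sigma> t + \<sigma> (Suc t))) *{j} u t"
   proof -
    have "(?y [^] ?N) *{j} b t = (?y [^] \<sigma> (Suc t)) *{j} ((?y [^] (\<sigma> t + t)) *{j} b t)"
     using bc by (simp add: add_ac flip: pm)
    also have "\<dots> = (?y [^] (\<sigma> t + \<sigma> (Suc t))) *{j} u t"
     using uc b(2)[of t] by (simp add: add.commute[of "\<sigma> t"] pm)
    finally show ?thesis .
   qed
   have "(?y [^] ?N) *{j} ?b = (?y [^] (\<sigma> t + \<sigma> (Suc t))) *{j} (?X *{j} u (Suc t) -{j} u t)"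
    using bc uc 1 2 by (simp add: C.smult_minus_distr)
   also have "\<dots> \<in> Bd j" using generatingD(5)[OF u] Bd_D(5) pow_closed by blast
   finally have "D j ?b \<in> Bd (Suc j)"
    using connecting_Bd Gam_D(7)[OF Gam_D(5)[OF Xp_closed(1) b(1)] b(1)] by blast
   thus ?thesis using bc by (simp add: v_def)
  qed
 next
  fix c assume c: "c \<in> Gam (Suc j) (Suc j)" and Dc: "D (Suc j) c = zC (Suc (Suc j))"
  have cj: "c \<in> Gam j (Suc j)" and "\<exists>n::nat. (?y [^] n) *{Suc j} c = zC (Suc j)"
   using c unfolding Gam_Suc by blast+
  then obtain s :: nat where s: "(?y [^] s) *{Suc j} c = zC (Suc j)" by blast
  obtain a where a: "a \<in> Gam j j" "D j a = c" using vanishing[of j] cj Dc unfolding vanishing_def by blast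
  have ac: "a \<in> carrier ?M" using Gam_closed a by blast
  have "D j ((?y [^] s) *{j} a) = zC (Suc j)" using ac a(2) s by simp
  then obtain r t where r: "r \<in> carrier R" "(?y [^] s) *{j} a -{j} r *{j} u t \<in> Bd j"
   using generatingD(4)[OF u Gam_D(5)[OF pow_closed a(1)]] by blast
  \<comment> \<open>The class of \<open>y^s a\<close> is a multiple of \<open>u t\<close>. Rewritten
    at level \<open>T = t + s\<close>, the relation becomes one between \<open>y^T a\<close> and
    \<open>u T\<close>, hence between \<open>a\<close> and \<open>b T\<close> up to a power of
    \<open>y\<close>, as \<open>connecting_Bd\<close> needs it.\<close>
  define T where "T = t + s"
  define r' where "r' = ?y [^] t ** (r ** ?X [^] s)"
  have r'c: "r' \<in> carrier R" unfolding r'_def using r(1) by simp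
  have "r *{j} ((?X [^] s) *{j} u T -{j} u t) \<in> Bd j"
   using generating_shift[OF u, of s t] r(1) Bd_D(5) unfolding T_def by blast
  hence "((?y [^] s) *{j} a -{j} r *{j} u t) -{j} r *{j} ((?X [^] s) *{j} u T -{j} u t) \<in> Bd j"
   by (rule Bd_D(7)[OF r(2)])
  also have "((?y [^] s) *{j} a -{j} r *{j} u t) -{j} r *{j} ((?X [^] s) *{j} u T -{j} u t)
    = (?y [^] s) *{j} a -{j} (r ** ?X [^] s) *{j} u T"
   using ac uc r(1) by (simp add: C.smult_minus_distr C.smult_assoc1 C.minus_telescope)
  finally have "(?y [^] t) *{j} ((?y [^] s) *{j} a -{j} (r ** ?X [^] s) *{j} u T) \<in> Bd j"
   using Bd_D(5) pow_closed by blast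
  also have "(?y [^] t) *{j} ((?y [^] s) *{j} a -{j} (r ** ?X [^] s) *{j} u T)
    = (?y [^] T) *{j} a -{j} r' *{j} u T"
   using ac uc r(1) by (simp add: C.smult_minus_distr r'_def C.smult_assoc1 T_def pm)
  finally have "(?y [^] \<sigma> T) *{j} ((?y [^] T) *{j} a -{j} r' *{j} u T) \<in> Bd j"
   using Bd_D(5) pow_closed by blast
  also have "(?y [^] \<sigma> T) *{j} ((?y [^] T) *{j} a -{j} r' *{j} u T)
    = (?y [^] (\<sigma> T + T)) *{j} (a -{j} r' *{j} b T)"
   using ac uc bc r'c b(2)[of T] C.smult_commute[of "?y [^] \<sigma> T" r' "u T" j]
    C.smult_commute[of "?y [^] (\<sigma> T + T)" r' "b T" j] pm[OF ac, of "\<sigma> T" T]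
   by (simp add: C.smult_minus_distr)
  finally have "D j (a -{j} r' *{j} b T) \<in> Bd (Suc j)"
   using connecting_Bd Gam_D(7)[OF a(1) Gam_D(5)[OF r'c b(1)]] by blast
  hence "c -{Suc j} r' *{Suc j} v T \<in> Bd (Suc j)" using ac bc r'c a(2) by (simp add: v_def)
  thus "\<exists>r\<in>carrier R. \<exists>t. c -{Suc j} r *{Suc j} v t \<in> Bd (Suc j)" using r'c by blast
 next
  fix t r assume r: "r \<in> carrier R" and "r *{Suc j} v t \<in> Bd (Suc j)"
  then obtain g where g: "g \<in> Gam (Suc j) j" "r *{Suc j} v t = D j g" by (auto simp: Bd_def)
  have gj: "g \<in> Gam j j" and "\<exists>n::nat. (?y [^] n) *{j} g = zC j"
   using g(1) unfolding Gam_Suc by blast+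
  then obtain N :: nat where N: "(?y [^] N) *{j} g = zC j" by blast
  have gc: "g \<in> carrier ?M" using Gam_closed gj by blast
  let ?z = "r *{j} b t -{j} g"
  have zG: "?z \<in> Gam j j" using Gam_D(7)[OF Gam_D(5)[OF r b(1)] gj] .
  have "D j ?z = zC (Suc j)" using bc gc r g(2) by (simp add: v_def C.minus_eq_zero_iff)
  then obtain r' t' where r': "r' \<in> carrier R" "?z -{j} r' *{j} u t' \<in> Bd j"
   using generatingD(4)[OF u zG] by blast
  \<comment> \<open>\<open>r b t - g\<close> is a cocycle, hence \<open>r' u t'\<close> up to a
    boundary. Multiplying by \<open>?Y\<close> kills \<open>g\<close> and clears the powers of
    \<open>y\<close>; compared at the common level \<open>T\<close>, the relation says that
    \<open>?h\<close> annihilates the class of \<open>u T\<close>.\<close>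
  define T where "T = t + t'"
  define M where "M = \<sigma> t + N"
  let ?Y = "?y [^] (\<sigma> t + t + N)"
  have YN: "?Y *{j} ?z = (?y [^] M ** r) *{j} u t"
  proof -
   have "?Y *{j} g = zC j" using N gc pm[OF gc, of "\<sigma> t + t" N] by simp
   moreover have "?Y *{j} (r *{j} b t) = (?y [^] N ** r) *{j} ((?y [^] (\<sigma> t + t)) *{j} b t)"
    using r bc C.smult_commute[of "?y [^] (\<sigma> t + t)" r "b t" j]
    by (simp add: add.commute[of _ N] pm C.smult_assoc1)
   moreover have "\<dots> = (?y [^] M ** r) *{j} u t"
    unfolding b(2) using r uc C.smult_commute[of "?y [^] \<sigma> t" r "u t" j]
    by (simp add: M_def add.commute[of _ N] pm C.smult_assoc1)
   ultimately show ?thesis using bc gc r uc by (simp add: C.smult_minus_distr)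
  qed
  let ?a1 = "?y [^] M ** r" let ?a2 = "?Y ** r'"
  have ac: "?a1 \<in> carrier R" "?a2 \<in> carrier R" using r r'(1) by auto
  have "?Y *{j} (?z -{j} r' *{j} u t') \<in> Bd j" using Bd_D(5)[OF pow_closed r'(2)] .
  also have "?Y *{j} (?z -{j} r' *{j} u t') = ?a1 *{j} u t -{j} ?a2 *{j} u t'"
   using YN bc gc uc r r'(1) by (simp add: C.smult_minus_distr[of _ ?z] C.smult_assoc1)
  finally have 1: "?a1 *{j} u t -{j} ?a2 *{j} u t' \<in> Bd j" .
  have 2: "?a1 *{j} ((?X [^] t') *{j} u T -{j} u t) \<in> Bd j"
   using generating_shift[OF u, of t' t] ac(1) Bd_D(5) unfolding T_def by blast
  have 3: "?a2 *{j} ((?X [^] t) *{j} u T -{j} u t') \<in> Bd j"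
   using generating_shift[OF u, of t t'] ac(2) Bd_D(5) unfolding T_def by (simp add: add.commute)
  let ?h = "?a1 ** ?X [^] t' \<ominus> ?a2 ** ?X [^] t"
  have hc: "?h \<in> carrier R" using ac by simp
  have "(?a1 *{j} u t -{j} ?a2 *{j} u t') +[C j]
    (?a1 *{j} ((?X [^] t') *{j} u T -{j} u t) -{j} ?a2 *{j} ((?X [^] t) *{j} u T -{j} u t')) \<in> Bd j"
   by (rule Bd_D(4)[OF 1 Bd_D(7)[OF 2 3]])
  also have "(?a1 *{j} u t -{j} ?a2 *{j} u t') +[C j]
    (?a1 *{j} ((?X [^] t') *{j} u T -{j} u t) -{j} ?a2 *{j} ((?X [^] t) *{j} u T -{j} u t'))
    = ?h *{j} u T"
  proof -
   define A where "A = ?a1 *{j} u t"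
   define B where "B = ?a2 *{j} u t'"
   define A' where "A' = ?a1 *{j} ((?X [^] t') *{j} u T)"
   define B' where "B' = ?a2 *{j} ((?X [^] t) *{j} u T)"
   have c: "A \<in> carrier ?M" "B \<in> carrier ?M" "A' \<in> carrier ?M" "B' \<in> carrier ?M"
    unfolding A_def B_def A'_def B'_def using ac uc by auto
   have "(A -{j} B) +[C j] ((A' -{j} A) -{j} (B' -{j} B)) = A' -{j} B'"
    using c by (simp add: C.minus_telescope4)
   moreover have "?h *{j} u T = A' -{j} B'"
    unfolding A'_def B'_def using ac uc by (simp add: C.smult_minus_distr_l C.smult_assoc1)
   ultimately show ?thesis unfolding A_def B_def A'_def B'_def using ac uc by (simp add: C.smult_minus_distr)
  qed
  finally obtain s where s: "?h ** ?X [^] s \<in> Pw j (T + s)" using generatingD(7)[OF u hc] by blast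
  \<comment> \<open>With this exponent the \<open>r'\<close>-part carries exactly the factor
    \<open>y^(t + ?S)\<close>, and the part containing \<open>?h\<close> lies in
    \<open>Pw j (t + ?S)\<close>.\<close>
  let ?S = "M + t' + s"
  have "?X [^] M ** (?h ** ?X [^] s) \<in> Pw (Suc j) (T + s + M)" using Xp_pow_Pw[OF s, of M] Pw_Suc by blast
  hence m1: "?y [^] (t' + s) ** (?X [^] M ** (?h ** ?X [^] s)) \<in> Pw (Suc j) (t + ?S)"
   using idealD(5)[OF Pw_ideal] pow_closed by (simp add: T_def add_ac)
  have m2: "(r' ** ?X [^] (t + s + M)) ** ?y [^] (t + ?S) \<in> Pw (Suc j) (t + ?S)"
   by (rule idealD(5)[OF Pw_ideal Pw_gen]) (use r'(1) in auto)
  have "r ** Xp (Suc j) [^] ?S = ?y [^] (t' + s) ** (?X [^] M ** (?h ** ?X [^] s)) \<oplus> (r' ** ?X [^] (t + s + M)) ** ?y [^] (t + ?S)"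
  proof -
   let ?P = "?y [^] (t' + s)" let ?Q = "?X [^] M" let ?U = "?X [^] s"
   have cs: "?P \<in> carrier R" "?Q \<in> carrier R" "?U \<in> carrier R" "?X [^] t' \<in> carrier R" "?X [^] t \<in> carrier R"
    "?y [^] M \<in> carrier R" "?Y \<in> carrier R" by auto
   have "?P ** (?Q ** (?h ** ?U)) = r ** ((?P ** ?y [^] M) ** ((?Q ** ?X [^] t') ** ?U)) \<ominus> r' ** ((?P ** ?Y) ** ((?Q ** ?X [^] t) ** ?U))"
    using cs r r'(1) by algebra
   moreover have "(?P ** ?y [^] M) ** ((?Q ** ?X [^] t') ** ?U) = Xp (Suc j) [^] ?S"
    unfolding Xp_Suc using yc by (simp add: nat_pow_distrib nat_pow_mult add_ac)
   moreover have "(?P ** ?Y) = ?y [^] (t + ?S)" "(?Q ** ?X [^] t) ** ?U = ?X [^] (t + s + M)"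
    using yc by (simp_all add: nat_pow_mult M_def add_ac)
   moreover have "r ** W = (r ** W \<ominus> r' ** (V ** V')) \<oplus> (r' ** V') ** V" if "W \<in> carrier R" "V \<in> carrier R" "V' \<in> carrier R" for W V V'
    using that r r'(1) by algebra
   ultimately show ?thesis by simp
  qed
  hence "r ** Xp (Suc j) [^] ?S \<in> Pw (Suc j) (t + ?S)" using idealD(4)[OF Pw_ideal m1 m2] by simp
  thus "\<exists>s. r ** Xp (Suc j) [^] s \<in> Pw (Suc j) (t + s)" by blast
 qed
 thus ?thesis by blast
qed

lemma generating_exists: "\<exists>u. generating j u"
proof (induction j)
 case 0
 have "generating 0 (\<lambda>_. e \<one>)"
  unfolding generating_def
 proof (intro conjI allI ballI impI)
  fix t show "e \<one> \<in> Gam 0 0" "D 0 (e \<one>) = zC (Suc 0)" using e_hom(1,2) by (simp_all add: Gam_0)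
 next
  fix c assume "c \<in> Gam 0 0" "D 0 c = zC (Suc 0)"
  then obtain r where "r \<in> carrier R" "c = r *{0} e \<one>" using e_hom(4)[of c] by (auto simp: Gam_0)
  thus "\<exists>r\<in>carrier R. \<exists>t::nat. c -{0} r *{0} e \<one> \<in> Bd 0" using e_hom(1)
   by (intro bexI[of _ r] exI[of _ 0]) (auto simp: Bd_def)
 next
  fix t :: nat and r assume r: "r \<in> carrier R" "r *{0} e \<one> \<in> Bd 0"
  hence "r = \<zero>" using e_hom(3) by (simp add: Bd_def)
  thus "\<exists>s. r ** Xp 0 [^] s \<in> Pw 0 (t + s)" using idealD(3)[OF Pw_ideal] by (simp add: Xp_0)
 qed (use e_hom(1) in \<open>simp_all add: Bd_def Xp_0\<close>)
 thus ?case by blast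
next
 case (Suc j) thus ?case using generating_Suc by blast
qed

end

context noetherian_local
begin

text \<open>A prime over \<open>J\<close> contains the \<open>x l\<close> with \<open>l < d\<close>,
  hence a power of \<open>m\<close>, hence \<open>m\<close>; so \<open>m\<close> is the only prime
  over \<open>J\<close>.\<close>

lemma parameter_powers_below:
 assumes J: "ideal J R" and xc: "!!l. x l \<in> carrier R" and N: "mpow N \<subseteq> Idl (x ` {..<d})"
  and pow: "!!l. l < d ==> \<exists>n::nat. x l [^] n \<in> J"
 shows "\<exists>K. mpow K \<subseteq> J"
proof -
 have "Q = m" if Q: "primeideal Q R" "J \<subseteq> Q" for Q
 proof -
  have "x ` {..<d} \<subseteq> Q" using pow Q prime_pow[OF Q(1) xc] by blast
  hence "Idl (x ` {..<d}) \<subseteq> Q" using genideal_minimal primeD(1)[OF Q(1)] by blast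
  hence "m \<subseteq> Q" using pow_in_ideal_power[OF ideal_m, of _ N] N prime_pow[OF Q(1)] idealD(2)[OF ideal_m] by blast
  thus ?thesis using prime_le_m[OF Q(1)] by blast
 qed
 thus ?thesis using ideal_power_below[OF J ideal_m] by blast
qed

text \<open>The generating cocycles of degree \<open>d\<close>, transported to the given model
  \<open>E\<close>, present it as the direct limit of the quotients of \<open>R\<close> by the
  \<open>t\<close>-th powers of the parameters.\<close>

lemma top_local_cohomology:
 fixes E :: "('a, 'c set) module"
 assumes E: "is_local_cohomology TYPE('c) R m (self_module R) d E"
  and xc: "!!l. x l \<in> carrier R" and xm: "!!l. l < d ==> x l \<in> m" and N: "mpow N \<subseteq> Idl (x ` {..<d})"
 shows "\<exists>\<eta>. (\<forall>t. \<eta> t \<in> carrier E) \<and> (\<forall>e\<in>carrier E. \<exists>r\<in>carrier R. \<exists>t. e = r *[E] \<eta> t) \<and>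
  (\<forall>t. (\<Otimes>l\<in>{..<d}. x l) *[E] \<eta> (Suc t) = \<eta> t) \<and> (\<forall>t. \<forall>l<d. (x l [^] t) *[E] \<eta> t = 0[E]) \<and>
  (\<forall>t. \<forall>r\<in>carrier R. r *[E] \<eta> t = 0[E] -->
    (\<exists>s. r ** (\<Otimes>l\<in>{..<d}. x l) [^] (s::nat) \<in> Idl ((\<lambda>l. x l [^] (t + s)) ` {..<d})))"
proof -
 have Em: "module R E" using E unfolding is_local_cohomology_def by blast
 interpret E: module R E by (rule Em)
 obtain C D e where C: "injective_resolution R (self_module R) (C :: nat => ('a, 'c) module) D e"
  and iso: "module_isomorphic R (torsion_cohomology R m C D d) E"
  using E unfolding is_local_cohomology_def by blast
 interpret IR: injective_resolution_of_ring R C D e x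
  by unfold_locales (use C xc in auto)
 \<comment> \<open>Both torsions agree because the ideal of the parameters lies between a power of
   \<open>m\<close> and \<open>m\<close>.\<close>
 have tors: "torsion_part R m (C i) = IR.Gam d i" for i
 proof
  show "torsion_part R m (C i) \<subseteq> IR.Gam d i"
  proof
   fix c assume "c \<in> torsion_part R m (C i)"
   then obtain n where n: "c \<in> carrier (C i)" "\<forall>a\<in>mpow n. a *[C i] c = 0[C i]"
    unfolding torsion_part_def by blast
   thus "c \<in> IR.Gam d i"
    using pow_in_ideal_power[OF ideal_m xm, of _ n] unfolding IR.Gam_def by blast
  qed
  show "IR.Gam d i \<subseteq> torsion_part R m (C i)"
  proof
   fix c assume c: "c \<in> IR.Gam d i"
   hence cc: "c \<in> carrier (C i)" by (rule IR.Gam_closed)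
   have "\<exists>K. mpow K \<subseteq> {r \<in> carrier R. r *[C i] c = 0[C i]}"
    using c xc unfolding IR.Gam_def
    by (intro parameter_powers_below[OF _ xc N] IR.C.annihilator_ideal[OF cc]) auto
   thus "c \<in> torsion_part R m (C i)" using cc unfolding torsion_part_def by blast
  qed
 qed
 define Z where "Z = {c \<in> IR.Gam d d. D d c = 0[C (Suc d)]}"
 define M where "M = (C d)\<lparr>carrier := Z\<rparr>"
 have Zs: "submodule Z R (C d)"
  by (rule IR.C.submodule_intro) (use IR.C.submoduleD[OF IR.Gam_submodule[of d d]] in \<open>auto simp: Z_def\<close>)
 have M: "module R M" unfolding M_def using submodule.submodule_is_module[OF Zs] IR.C.module_axioms by blast
 have Ms [simp]: "carrier M = Z" "a +[M] b = a +[C d] b" "r *[M] a = r *[C d] a" "0[M] = 0[C d]" for a b r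
  by (simp_all add: M_def)
 have BZ: "IR.Bd d \<subseteq> Z" using IR.Bd_Gam IR.D_Bd unfolding Z_def by blast
 have BM: "submodule (IR.Bd d) R M"
  by (rule module.submodule_intro[OF M]) (use BZ IR.C.submoduleD[OF IR.Bd_submodule[of d]] in auto)
 have "torsion_cohomology R m C D d = quot_module M (IR.Bd d)"
  unfolding torsion_cohomology_def M_def Z_def IR.Bd_def tors by (cases d) (simp_all add: tors)
 then obtain f where f: "f \<in> module_hom R (quot_module M (IR.Bd d)) E"
  "bij_betw f (carrier (quot_module M (IR.Bd d))) (carrier E)"
  using iso unfolding module_isomorphic_def by auto
 obtain \<pi> where pc: "!!z. z \<in> Z ==> \<pi> z \<in> carrier E" and im: "f ` carrier (quot_module M (IR.Bd d)) = \<pi> ` Z"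
  and pa: "!!z w. z \<in> Z ==> w \<in> Z ==> \<pi> (z +[C d] w) = \<pi> z +[E] \<pi> w"
  and pm: "!!r z. r \<in> carrier R ==> z \<in> Z ==> \<pi> (r *[C d] z) = r *[E] \<pi> z"
  and pk: "!!z. z \<in> Z ==> \<pi> z = 0[E] \<longleftrightarrow> z \<in> IR.Bd d"
  by (rule quot_module_map[OF M BM Em f(1) bij_betw_imp_inj_on[OF f(2)], unfolded Ms]) (rule that)
 have ps: "\<exists>z\<in>Z. \<pi> z = e" if "e \<in> carrier E" for e
  using im bij_betw_imp_surj_on[OF f(2)] that by force
 have pmin: "\<pi> z = \<pi> w" if "z -[C d] w \<in> IR.Bd d" "z \<in> Z" "w \<in> Z" for z w
 proof -
  have c: "z \<in> carrier (C d)" "w \<in> carrier (C d)" using that Zs IR.C.submoduleD(2) by blast+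
  have "w +[C d] (z -[C d] w) = z" by (rule IR.C.add_minus_cancel[OF c(2,1)])
  hence "\<pi> z = \<pi> w +[E] \<pi> (z -[C d] w)" using pa[OF that(3), of "z -[C d] w"] that(1) BZ by auto
  thus ?thesis using pk[of "z -[C d] w"] that BZ pc[of w] by auto
 qed
 obtain u where u: "IR.generating d u" using IR.generating_exists by blast
 note uD = IR.generatingD[OF u]
 have uZ: "u t \<in> Z" for t using uD(1,3) by (simp add: Z_def)
 have X: "(\<Otimes>l\<in>{..<d}. x l) = IR.Xp d" by (simp add: IR.Xp_def)
 show ?thesis
  unfolding X
 proof (intro exI[of _ "\<lambda>t. \<pi> (u t)"] conjI allI impI ballI)
  show "\<pi> (u t) \<in> carrier E" for t using pc uZ by blast
  show "\<exists>r\<in>carrier R. \<exists>t. e = r *[E] \<pi> (u t)" if e: "e \<in> carrier E" for e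
  proof -
   obtain z where z: "z \<in> Z" "\<pi> z = e" using ps[OF e] by blast
   then obtain r t where r: "r \<in> carrier R" "z -[C d] r *[C d] u t \<in> IR.Bd d"
    using uD(4)[of z] unfolding Z_def by blast
   have "\<pi> z = \<pi> (r *[C d] u t)"
    by (rule pmin[OF r(2) z(1)]) (rule IR.C.submoduleD(5)[OF Zs r(1) uZ])
   thus ?thesis using pm[OF r(1) uZ] z r(1) by auto
  qed
  show "IR.Xp d *[E] \<pi> (u (Suc t)) = \<pi> (u t)" for t
   using pmin[OF uD(5) IR.C.submoduleD(5)[OF Zs IR.Xp_closed(1) uZ] uZ, of t] pm[OF IR.Xp_closed(1) uZ] by simp
  show "(x l [^] t) *[E] \<pi> (u t) = 0[E]" if "l < d" for l t
   using pk[of "(x l [^] t) *[C d] u t"] uD(6)[OF that, of t] BZ pm[OF IR.pow_closed uZ] by auto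
  show "\<exists>s. r ** IR.Xp d [^] s \<in> Idl ((\<lambda>l. x l [^] (t + s)) ` {..<d})"
   if r: "r \<in> carrier R" "r *[E] \<pi> (u t) = 0[E]" for r t
  proof -
   have "r *[C d] u t \<in> IR.Bd d" using pk[OF IR.C.submoduleD(5)[OF Zs r(1) uZ]] pm[OF r(1) uZ] r(2) by simp
   thus ?thesis using uD(7)[OF r(1)] unfolding IR.Pw_def by blast
  qed
 qed
qed

end

section \<open>The injective hull of the residue field\<close>

text \<open>The injective hull enters through these facts: injectivity, a socle generated by
  \<open>\<sigma>\<close>, and torsion. Completeness of \<open>R\<close> serves Matlis duality for
  arbitrary submodules.\<close>

locale injective_hull_module = noetherian_local R m d + E: module R E
 for R :: "('a, 'm) ring_scheme" (structure) and m :: "'a set" and d :: nat and E :: "('a, 'e) module" +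
 fixes \<sigma> :: 'e
 assumes injective: "injective_module R E" and \<sigma>: "\<sigma> \<in> carrier E" "\<sigma> ~= \<zero>\<^bsub>E\<^esub>" "!!r. r \<in> m ==> r \<odot>\<^bsub>E\<^esub> \<sigma> = \<zero>\<^bsub>E\<^esub>"
  and socle: "!!e. e \<in> carrier E ==> (!!r. r \<in> m ==> r \<odot>\<^bsub>E\<^esub> e = \<zero>\<^bsub>E\<^esub>) ==> \<exists>r\<in>carrier R. e = r \<odot>\<^bsub>E\<^esub> \<sigma>"
  and torsion: "!!e. e \<in> carrier E ==> \<exists>n. \<forall>a\<in>ideal_power R m n. a \<odot>\<^bsub>E\<^esub> e = \<zero>\<^bsub>E\<^esub>"
  and complete: "adically_complete R m"
begin

abbreviation smE (infixr \<open>*\<^sub>E\<close> 75) where "r *\<^sub>E e \<equiv> r \<odot>\<^bsub>E\<^esub> e"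
abbreviation zeroE (\<open>0\<^sub>E\<close>) where "0\<^sub>E \<equiv> \<zero>\<^bsub>E\<^esub>"
abbreviation addE (infixl \<open>+\<^sub>E\<close> 65) where "a +\<^sub>E b \<equiv> a \<oplus>\<^bsub>E\<^esub> b"
abbreviation minusE (infixl \<open>-\<^sub>E\<close> 65) where "a -\<^sub>E b \<equiv> a \<ominus>\<^bsub>E\<^esub> b"

lemma smult_\<sigma>_zero: "s \<in> carrier R ==> s *\<^sub>E \<sigma> = 0\<^sub>E \<longleftrightarrow> s \<in> m"
proof
 assume s: "s \<in> carrier R" "s *\<^sub>E \<sigma> = 0\<^sub>E"
 show "s \<in> m"
 proof (rule ccontr)
  assume "s \<notin> m"
  then obtain b where b: "b \<in> carrier R" "s ** b = \<one>" using unit_outside_m s(1) by blast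
  have "\<sigma> = (s ** b) *\<^sub>E \<sigma>" using b \<sigma> by simp
  also have "\<dots> = b *\<^sub>E (s *\<^sub>E \<sigma>)" using s(1) b(1) \<sigma>(1) by (simp add: m_comm[of s b] E.smult_assoc1)
  finally show False using s(2) b(1) \<sigma>(2) by simp
 qed
qed (rule \<sigma>(3))

text \<open>Send \<open>J\<close> to zero and \<open>r\<close> to \<open>\<sigma>\<close>. This is
  well defined because the \<open>s\<close> with \<open>s ** r\<close> in \<open>J\<close> form a
  proper ideal, and \<open>m\<close> kills \<open>\<sigma>\<close>.\<close>

lemma annihilator_separates:
 assumes J: "ideal J R" and r: "r \<in> carrier R" "r \<notin> J"
 shows "\<exists>e\<in>carrier E. (\<forall>j\<in>J. j *\<^sub>E e = 0\<^sub>E) \<and> r *\<^sub>E e ~= 0\<^sub>E"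
proof -
 have "{s \<in> carrier R. s ** r \<in> J} \<subseteq> m"
  by (rule proper_le_m[OF quotient_ideal[OF J r(1)]]) (use r in simp)
 hence sm: "s *\<^sub>E \<sigma> = 0\<^sub>E" if "s \<in> carrier R" "s ** r \<in> J" for s
  using that \<sigma>(3) by blast
 obtain e where "e \<in> carrier E" "\<forall>j\<in>J. j *\<^sub>E e = 0\<^sub>E" "r *\<^sub>E e = \<sigma>"
  using baer_adjoin[OF injective J r(1) \<sigma>(1) sm] by blast
 thus ?thesis using \<sigma>(2) by auto
qed

text \<open>The homomorphism is given by its graph \<open>F\<close>; its domain need not be all of \<open>0 :\<^sub>E L\<close>.\<close>

lemma partial_hom_is_multiplication:
 assumes L: "ideal L R" "mpow n \<subseteq> L"
  and F: "!!e y. (e, y) \<in> F ==> e \<in> carrier E \<and> y \<in> carrier E"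
   "!!e y e' y'. (e, y) \<in> F ==> (e', y') \<in> F ==> (e +\<^sub>E e', y +\<^sub>E y') \<in> F"
   "!!r e y. r \<in> carrier R ==> (e, y) \<in> F ==> (r *\<^sub>E e, r *\<^sub>E y) \<in> F"
   "!!y. (0\<^sub>E, y) \<in> F ==> y = 0\<^sub>E"
   "!!e y l. (e, y) \<in> F ==> l \<in> L ==> l *\<^sub>E e = 0\<^sub>E"
 shows "\<exists>r\<in>carrier R. \<forall>(e, y)\<in>F. y = r *\<^sub>E e"
 using L F
proof (induction L arbitrary: F rule: ideal_noetherian_induct)
 case (step L)
 note LD = idealD[OF step(1)] and F = step.prems(2-6)
 show ?case
 proof (cases "\<one> \<in> L")
  case True
  have "y = \<zero> *\<^sub>E e" if "(e, y) \<in> F" for e y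
  proof -
   have ec: "e \<in> carrier E" using F(1)[OF that] by simp
   have "e = 0\<^sub>E" using F(5)[OF that True] ec by simp
   thus ?thesis using F(4) that by simp
  qed
  thus ?thesis by blast
 next
  case False
  \<comment> \<open>A socle element of \<open>R / L\<close>: for the least \<open>k\<close> with
    \<open>mpow k \<subseteq> L\<close>, any element of the preceding power outside \<open>L\<close>
    will do.\<close>
  have "\<exists>a\<in>carrier R. a \<notin> L \<and> (\<forall>r\<in>m. r ** a \<in> L)"
  proof -
   define k where "k = (LEAST k. mpow k \<subseteq> L)"
   have k: "mpow k \<subseteq> L" unfolding k_def using LeastI[of "\<lambda>k. mpow k \<subseteq> L" n] step.prems(1) by simp
   have "k ~= 0"
   proof
    assume "k = 0"
    hence "carrier R \<subseteq> L" using k by (simp add: ideal_power_0)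
    thus False using False by auto
   qed
   then obtain k' where k': "k = Suc k'" by (cases k) auto
   hence "\<not> mpow k' \<subseteq> L" using not_less_Least[of k' "\<lambda>k. mpow k \<subseteq> L"] k_def by simp
   then obtain a where a: "a \<in> mpow k'" "a \<notin> L" by blast
   have "r ** a \<in> L" if "r \<in> m" for r
    using ideal_prod.prod[OF that a(1), of R] k unfolding k' ideal_power_Suc[OF ideal_m] by blast
   thus ?thesis using a idealD(2)[OF ideal_power_ideal[OF ideal_m]] by blast
  qed
  then obtain a where a: "a \<in> carrier R" "a \<notin> L" "!!r. r \<in> m ==> r ** a \<in> L" by blast
  let ?L' = "adjoin L a"
  note A = adjoin_ideal[OF step(1) a(1)]
  \<comment> \<open>On the pairs whose first entry is killed by \<open>a\<close> as well, the
    induction hypothesis for \<open>L + R a\<close> gives a multiplier \<open>r\<close>.\<close>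
  let ?F' = "{(e, y) \<in> F. a *\<^sub>E e = 0\<^sub>E}"
  have "\<exists>r\<in>carrier R. \<forall>(e, y)\<in>?F'. y = r *\<^sub>E e"
  proof (rule step.IH[OF A(1)])
   show "L \<subset> ?L'" using A a(2) by blast
   show "mpow n \<subseteq> ?L'" using step.prems(1) A(2) by blast
   show "e \<in> carrier E \<and> y \<in> carrier E" if "(e, y) \<in> ?F'" for e y using that F(1) by blast
   show "(e +\<^sub>E e', y +\<^sub>E y') \<in> ?F'" if "(e, y) \<in> ?F'" "(e', y') \<in> ?F'" for e y e' y'
    using that F(1)[of e y] F(1)[of e' y'] F(2)[of e y e' y'] a(1) by (simp add: E.smult_r_distr)
   show "(r *\<^sub>E e, r *\<^sub>E y) \<in> ?F'" if "r \<in> carrier R" "(e, y) \<in> ?F'" for r e y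
    using that F(1)[of e y] F(3)[of r e y] a(1) E.smult_commute[of a r e] by simp
   show "y = 0\<^sub>E" if "(0\<^sub>E, y) \<in> ?F'" for y using that F(4) by blast
   show "l *\<^sub>E e = 0\<^sub>E" if ey: "(e, y) \<in> ?F'" "l \<in> ?L'" for e y l
   proof -
    obtain j s where l: "l = j \<oplus> s ** a" "j \<in> L" "s \<in> carrier R" using ey(2) unfolding adjoin_def by blast
    have "e \<in> carrier E" "a *\<^sub>E e = 0\<^sub>E" "j *\<^sub>E e = 0\<^sub>E" using ey(1) F(1)[of e y] F(5)[OF _ l(2), of e y] by auto
    thus ?thesis unfolding l(1) using LD(2)[OF l(2)] l(3) a(1) by (simp add: E.smult_l_distr E.smult_assoc1)
   qed
  qed
  then obtain r where r: "r \<in> carrier R" "!!e y. (e, y) \<in> F ==> a *\<^sub>E e = 0\<^sub>E ==> y = r *\<^sub>E e" by auto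
  have soc: "\<exists>s\<in>carrier R. a *\<^sub>E e = s *\<^sub>E \<sigma>" if ey: "(e, y) \<in> F" for e y
  proof (rule socle)
   have ec: "e \<in> carrier E" using F(1)[OF ey] by simp
   thus "a *\<^sub>E e \<in> carrier E" using a(1) by simp
   show "t *\<^sub>E (a *\<^sub>E e) = 0\<^sub>E" if t: "t \<in> m" for t
    using F(5)[OF ey a(3)[OF t]] E.smult_assoc1[of t a e] idealD(2)[OF ideal_m t] a(1) ec by simp
  qed
  show ?thesis
  proof (cases "\<forall>(e, y)\<in>F. a *\<^sub>E e = 0\<^sub>E")
   case True
   thus ?thesis using r by blast
  next
   case False
   then obtain e0 y0 where e0: "(e0, y0) \<in> F" "a *\<^sub>E e0 ~= 0\<^sub>E" by blast
   obtain s where s: "s \<in> carrier R" "a *\<^sub>E e0 = s *\<^sub>E \<sigma>" using soc[OF e0(1)] by blast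
   have "s \<notin> m" using e0(2) s smult_\<sigma>_zero by auto
   then obtain b where b: "b \<in> carrier R" "s ** b = \<one>" using unit_outside_m s(1) by blast
   \<comment> \<open>Normalised so that \<open>a\<close> sends \<open>e1\<close> to the socle
     generator.\<close>
   define e1 y1 where "e1 = b *\<^sub>E e0" and "y1 = b *\<^sub>E y0"
   have ey1: "(e1, y1) \<in> F" unfolding e1_def y1_def by (rule F(3)[OF b(1) e0(1)])
   have c1: "e1 \<in> carrier E" "y1 \<in> carrier E" using F(1)[OF ey1] by auto
   have ae1: "a *\<^sub>E e1 = \<sigma>"
   proof -
    have "a *\<^sub>E e1 = b *\<^sub>E (s *\<^sub>E \<sigma>)"
     unfolding e1_def s(2)[symmetric] using a(1) b(1) F(1)[OF e0(1)] by (intro E.smult_commute) auto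
    also have "\<dots> = (s ** b) *\<^sub>E \<sigma>" using s(1) b(1) \<sigma>(1) by (simp add: m_comm[of s b] E.smult_assoc1)
    finally show ?thesis using b(2) \<sigma>(1) by simp
   qed
   \<comment> \<open>The error of \<open>r\<close> at \<open>e1\<close> is killed by
     \<open>m\<close>, hence equals \<open>u \<sigma> = u a e1\<close>. Adding \<open>u ** a\<close>
     to \<open>r\<close> repairs it and changes nothing where \<open>a\<close> acts as zero.\<close>
   have "\<exists>u\<in>carrier R. y1 -\<^sub>E r *\<^sub>E e1 = u *\<^sub>E \<sigma>"
   proof (rule socle)
    show "y1 -\<^sub>E r *\<^sub>E e1 \<in> carrier E" using c1 r(1) by simp
    fix t assume t: "t \<in> m"
    hence tc: "t \<in> carrier R" using idealD(2)[OF ideal_m] by blast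
    have "a *\<^sub>E (t *\<^sub>E e1) = 0\<^sub>E" using E.smult_commute[OF a(1) tc c1(1)] ae1 \<sigma>(3)[OF t] by simp
    hence "t *\<^sub>E y1 = r *\<^sub>E (t *\<^sub>E e1)" using r(2)[OF F(3)[OF tc ey1]] by blast
    thus "t *\<^sub>E (y1 -\<^sub>E r *\<^sub>E e1) = 0\<^sub>E"
     using tc c1 r(1) E.smult_commute[OF r(1) tc c1(1)] by (simp add: E.smult_minus_distr)
   qed
   then obtain u where u: "u \<in> carrier R" "y1 -\<^sub>E r *\<^sub>E e1 = u *\<^sub>E \<sigma>" by blast
   have "y = (r \<oplus> u ** a) *\<^sub>E e" if ey: "(e, y) \<in> F" for e y
   proof -
    have c: "e \<in> carrier E" "y \<in> carrier E" using F(1)[OF ey] by auto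
    obtain v where v: "v \<in> carrier R" "a *\<^sub>E e = v *\<^sub>E \<sigma>" using soc[OF ey] by blast
    \<comment> \<open>Subtracting \<open>v e1\<close> moves \<open>e\<close> into the part killed by
      \<open>a\<close>, where \<open>r\<close> is already right.\<close>
    have neg: "(e +\<^sub>E (\<ominus> v) *\<^sub>E e1, y +\<^sub>E (\<ominus> v) *\<^sub>E y1) \<in> F"
     using F(2)[OF ey F(3)[OF a_inv_closed[OF v(1)] ey1]] .
    have "a *\<^sub>E (e +\<^sub>E (\<ominus> v) *\<^sub>E e1) = v *\<^sub>E \<sigma> +\<^sub>E (\<ominus> v) *\<^sub>E \<sigma>"
     using c c1 a(1) v ae1 E.smult_commute[OF a(1) a_inv_closed[OF v(1)] c1(1)] by (simp add: E.smult_r_distr)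
    also have "\<dots> = 0\<^sub>E" using v(1) \<sigma>(1) by (simp add: E.smult_l_minus E.M.r_neg)
    finally have eq: "y +\<^sub>E (\<ominus> v) *\<^sub>E y1 = r *\<^sub>E (e +\<^sub>E (\<ominus> v) *\<^sub>E e1)" using r(2)[OF neg] by blast
    have "y1 = r *\<^sub>E e1 +\<^sub>E u *\<^sub>E \<sigma>"
     using E.add_minus_cancel[of "r *\<^sub>E e1" y1] u(2) r(1) c1 by simp
    hence vy1: "v *\<^sub>E y1 = v *\<^sub>E (r *\<^sub>E e1) +\<^sub>E (u ** a) *\<^sub>E e"
     using v r(1) c1 c u(1) \<sigma>(1) a(1) E.smult_commute[OF v(1) u(1) \<sigma>(1)] by (simp add: E.smult_r_distr E.smult_assoc1)
    have "y = v *\<^sub>E y1 +\<^sub>E (y +\<^sub>E (\<ominus> v) *\<^sub>E y1)"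
     using c c1 v(1) by (simp add: E.smult_l_minus E.M.a_lcomm[of "v *\<^sub>E y1" y] E.M.r_neg)
    also have "\<dots> = (v *\<^sub>E (r *\<^sub>E e1) +\<^sub>E (u ** a) *\<^sub>E e) +\<^sub>E (r *\<^sub>E e +\<^sub>E (\<ominus> v) *\<^sub>E (r *\<^sub>E e1))"
     unfolding eq vy1 using c c1 v(1) r(1) E.smult_commute[OF r(1) a_inv_closed[OF v(1)] c1(1)] by (simp add: E.smult_r_distr)
    also have "\<dots> = (u ** a) *\<^sub>E e +\<^sub>E r *\<^sub>E e"
    proof -
     have *: "(A +\<^sub>E B) +\<^sub>E (C +\<^sub>E \<ominus>\<^bsub>E\<^esub> A) = B +\<^sub>E C"
      if "A \<in> carrier E" "B \<in> carrier E" "C \<in> carrier E" for A B C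
     proof -
      have "(A +\<^sub>E B) +\<^sub>E (C +\<^sub>E \<ominus>\<^bsub>E\<^esub> A) = (B +\<^sub>E C) +\<^sub>E (A +\<^sub>E \<ominus>\<^bsub>E\<^esub> A)"
       using that by (simp add: E.M.a_ac)
      thus ?thesis using that by (simp add: E.M.r_neg)
     qed
     show ?thesis using *[of "v *\<^sub>E (r *\<^sub>E e1)" "(u ** a) *\<^sub>E e" "r *\<^sub>E e"] c c1 v(1) r(1) u(1) a(1)
      by (simp add: E.smult_l_minus)
    qed
    finally show ?thesis using c r(1) u(1) a(1) by (simp add: E.smult_l_distr E.M.a_comm)
   qed
   hence "\<forall>(e, y)\<in>F. y = (r \<oplus> u ** a) *\<^sub>E e" by blast
   thus ?thesis using r(1) u(1) a(1) by (intro bexI[of _ "r \<oplus> u ** a"]) auto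
  qed
 qed
qed

lemma complete_limit:
 assumes a: "!!n. a n \<in> carrier R" "!!k. a (Suc k) \<ominus> a k \<in> mpow k"
 shows "\<exists>l\<in>carrier R. \<forall>k. \<exists>N. \<forall>n\<ge>N. a n \<ominus> l \<in> mpow k"
proof -
 have step: "a (k + i) \<ominus> a k \<in> mpow k" for k i
 proof (induction i)
  case 0
  thus ?case using a(1)[of k] idealD(3)[OF ideal_power_ideal[OF ideal_m]] by (simp add: minus_eq r_neg)
 next
  case (Suc i)
  have "a (k + Suc i) \<ominus> a k = (a (Suc (k + i)) \<ominus> a (k + i)) \<oplus> (a (k + i) \<ominus> a k)"
   using a(1)[of "k + Suc i"] a(1)[of "k + i"] a(1)[of k] by simp algebra
  moreover have "a (Suc (k + i)) \<ominus> a (k + i) \<in> mpow k"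
   using a(2)[of "k + i"] ideal_power_mono[OF ideal_m, of k "k + i"] by auto
  ultimately show ?case using Suc idealD(4)[OF ideal_power_ideal[OF ideal_m]] by metis
 qed
 have "adic_cauchy R m a"
  unfolding adic_cauchy_def
 proof (intro allI exI[of _ "_::nat"] impI)
  fix k i j :: nat assume "k \<le> i" "k \<le> j"
  hence "a i \<ominus> a k \<in> mpow k" "a j \<ominus> a k \<in> mpow k"
   using step[of k "i - k"] step[of k "j - k"] by auto
  hence "(a i \<ominus> a k) \<ominus> (a j \<ominus> a k) \<in> mpow k"
   by (rule idealD(8)[OF ideal_power_ideal[OF ideal_m]])
  moreover have "(a i \<ominus> a k) \<ominus> (a j \<ominus> a k) = a i \<ominus> a j" using a(1)[of i] a(1)[of j] a(1)[of k] by algebra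
  ultimately show "a i \<ominus> a j \<in> mpow k" by simp
 qed
 moreover have "a \<in> UNIV \<rightarrow> carrier R" using a(1) by auto
 ultimately show ?thesis using complete unfolding adically_complete_def adic_converges_def by blast
qed

text \<open>Since \<open>r\<close> kills \<open>Z \<inter> T\<close>, the map
  \<open>z + e \<mapsto> r e\<close> on \<open>Z + T\<close> is well defined; as
  \<open>mpow n\<close> kills its domain, it is a multiplication.\<close>

lemma extend_multiplication:
 assumes Z: "submodule Z R E" and T: "submodule T R E"
  and n: "!!a e. a \<in> mpow n ==> e \<in> Z \<or> e \<in> T ==> a *\<^sub>E e = 0\<^sub>E"
  and r: "r \<in> carrier R" "!!e. e \<in> Z ==> e \<in> T ==> r *\<^sub>E e = 0\<^sub>E"
 shows "\<exists>r'\<in>carrier R. (\<forall>z\<in>Z. r' *\<^sub>E z = 0\<^sub>E) \<and> (\<forall>e\<in>T. r' *\<^sub>E e = r *\<^sub>E e)"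
proof -
 note ZD = E.submoduleD[OF Z] and TD = E.submoduleD[OF T]
 let ?F = "{(z +\<^sub>E e, r *\<^sub>E e) | z e. z \<in> Z \<and> e \<in> T}"
 have "\<exists>r'\<in>carrier R. \<forall>(e, y)\<in>?F. y = r' *\<^sub>E e"
 proof (rule partial_hom_is_multiplication[OF ideal_power_ideal[OF ideal_m] subset_refl])
  show "e \<in> carrier E \<and> y \<in> carrier E" if "(e, y) \<in> ?F" for e y using that ZD(2) TD(2) r(1) by auto
  show "(e +\<^sub>E e', y +\<^sub>E y') \<in> ?F" if ee: "(e, y) \<in> ?F" "(e', y') \<in> ?F" for e y e' y'
  proof -
   obtain z f z' f' where *: "z \<in> Z" "f \<in> T" "e = z +\<^sub>E f" "y = r *\<^sub>E f"
    "z' \<in> Z" "f' \<in> T" "e' = z' +\<^sub>E f'" "y' = r *\<^sub>E f'" using ee by blast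
   have "e +\<^sub>E e' = (z +\<^sub>E z') +\<^sub>E (f +\<^sub>E f')" "y +\<^sub>E y' = r *\<^sub>E (f +\<^sub>E f')"
    unfolding * using ZD(2)[OF *(1)] ZD(2)[OF *(5)] TD(2)[OF *(2)] TD(2)[OF *(6)] r(1) by (simp_all add: E.smult_r_distr E.M.a_ac)
   thus ?thesis using ZD(4)[OF *(1,5)] TD(4)[OF *(2,6)] by blast
  qed
  show "(t *\<^sub>E e, t *\<^sub>E y) \<in> ?F" if ee: "t \<in> carrier R" "(e, y) \<in> ?F" for t e y
  proof -
   obtain z f where *: "z \<in> Z" "f \<in> T" "e = z +\<^sub>E f" "y = r *\<^sub>E f" using ee(2) by blast
   have "t *\<^sub>E e = t *\<^sub>E z +\<^sub>E t *\<^sub>E f" "t *\<^sub>E y = r *\<^sub>E (t *\<^sub>E f)"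
    unfolding * using ZD(2)[OF *(1)] TD(2)[OF *(2)] ee(1) r(1) by (simp_all add: E.smult_r_distr E.smult_commute)
   thus ?thesis using ZD(5)[OF ee(1) *(1)] TD(5)[OF ee(1) *(2)] by blast
  qed
  show "y = 0\<^sub>E" if y: "(0\<^sub>E, y) \<in> ?F" for y
  proof -
   obtain z f where *: "z \<in> Z" "f \<in> T" "0\<^sub>E = z +\<^sub>E f" "y = r *\<^sub>E f" using y by blast
   have "f = \<ominus>\<^bsub>E\<^esub> z" using *(3) ZD(2)[OF *(1)] TD(2)[OF *(2)] E.M.minus_equality[of f z] E.M.a_comm[of z f] by simp
   thus ?thesis using r(2)[OF _ *(2)] ZD(6)[OF *(1)] *(4) by simp
  qed
  show "l *\<^sub>E e = 0\<^sub>E" if ey: "(e, y) \<in> ?F" "l \<in> mpow n" for e y l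
  proof -
   obtain z f where *: "z \<in> Z" "f \<in> T" "e = z +\<^sub>E f" using ey by blast
   have "l \<in> carrier R" using idealD(2)[OF ideal_power_ideal[OF ideal_m] ey(2)] .
   thus ?thesis unfolding *(3) using n[OF ey(2), of z] n[OF ey(2), of f] *(1,2) ZD(2) TD(2) by (simp add: E.smult_r_distr)
  qed
 qed
 then obtain r' where r': "r' \<in> carrier R" "\<forall>(e, y)\<in>?F. y = r' *\<^sub>E e" by blast
 have r2: "r *\<^sub>E e = r' *\<^sub>E (z +\<^sub>E e)" if "z \<in> Z" "e \<in> T" for z e using r'(2) that by blast
 have "r' *\<^sub>E e = r *\<^sub>E e" if "e \<in> T" for e using r2[OF ZD(3) that] TD(2)[OF that] by simp
 moreover have "r' *\<^sub>E z = 0\<^sub>E" if "z \<in> Z" for z using r2[OF that TD(3)] ZD(2)[OF that] r(1) by simp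
 ultimately show ?thesis using r'(1) by blast
qed

text \<open>Let \<open>m^(k + 1)\<close> be the least power killing \<open>\<eta>\<close>. An
  \<open>a\<close> in \<open>m^k\<close> with \<open>a \<eta>\<close> nonzero puts
  \<open>a \<eta>\<close> into the socle, where it is a unit multiple of
  \<open>\<sigma>\<close>.\<close>

lemma multiple_is_socle_generator:
 assumes \<eta>: "\<eta> \<in> carrier E" "\<eta> ~= 0\<^sub>E" shows "\<exists>r\<in>carrier R. r *\<^sub>E \<eta> = \<sigma>"
proof -
 define K where "K k \<longleftrightarrow> (\<forall>a\<in>mpow k. a *\<^sub>E \<eta> = 0\<^sub>E)" for k
 obtain k0 where "K k0" using torsion[OF \<eta>(1)] unfolding K_def by blast
 hence K: "K (LEAST k. K k)" by (rule LeastI)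
 have "\<not> K 0" using \<eta> by (auto simp: K_def ideal_power_0 intro!: bexI[of _ \<one>])
 then obtain k where k: "(LEAST k. K k) = Suc k" using K by (cases "LEAST k. K k") auto
 hence "\<not> K k" using not_less_Least[of k K] by simp
 then obtain a where a: "a \<in> mpow k" "a *\<^sub>E \<eta> ~= 0\<^sub>E" unfolding K_def by blast
 have ac: "a \<in> carrier R" using idealD(2)[OF ideal_power_ideal[OF ideal_m] a(1)] .
 have K': "b *\<^sub>E \<eta> = 0\<^sub>E" if "b \<in> m \<cdot> mpow k" for b
  using K that unfolding k unfolding K_def ideal_power_Suc[OF ideal_m] by blast
 have "t *\<^sub>E (a *\<^sub>E \<eta>) = 0\<^sub>E" if t: "t \<in> m" for t
  using K'[OF ideal_prod.prod[OF t a(1), of R]] E.smult_assoc1[OF idealD(2)[OF ideal_m t] ac \<eta>(1)] by simp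
 then obtain s where s: "s \<in> carrier R" "a *\<^sub>E \<eta> = s *\<^sub>E \<sigma>" using socle[of "a *\<^sub>E \<eta>"] ac \<eta>(1) by auto
 hence "s \<notin> m" using a(2) \<sigma>(3) by auto
 then obtain b where b: "b \<in> carrier R" "s ** b = \<one>" using unit_outside_m s(1) by blast
 have "(b ** a) *\<^sub>E \<eta> = (s ** b) *\<^sub>E \<sigma>" using b(1) s ac \<eta>(1) \<sigma>(1) m_comm[of s b] by (simp add: E.smult_assoc1)
 thus ?thesis using b ac \<sigma>(1) by (intro bexI[of _ "b ** a"]) auto
qed

text \<open>Multipliers that send \<open>\<eta>\<close> to \<open>\<sigma>\<close> and kill larger
  and larger parts of \<open>Z\<close> are built level by level. Successive ones agree on the part
  of \<open>E\<close> killed by a power of \<open>m\<close>, so they differ by an element of that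
  power, and completeness supplies the limit.\<close>

lemma matlis_separates:
 assumes Z: "submodule Z R E" and \<eta>: "\<eta> \<in> carrier E" "\<eta> \<notin> Z"
 shows "\<exists>r\<in>carrier R. (\<forall>z\<in>Z. r *\<^sub>E z = 0\<^sub>E) \<and> r *\<^sub>E \<eta> ~= 0\<^sub>E"
proof -
 note ZD = E.submoduleD[OF Z]
 define T where "T n = {e \<in> carrier E. \<forall>a\<in>mpow n. a *\<^sub>E e = 0\<^sub>E}" for n
 have Ts: "submodule (T n) R E" for n unfolding T_def
  by (rule E.annihilator_submodule) (use idealD(1)[OF ideal_power_ideal[OF ideal_m]] in blast)
 note TD = E.submoduleD[OF Ts]
 have ZT: "submodule (Z \<inter> T n) R E" for n
  by (rule E.submodule_intro) (use ZD E.submoduleD[OF Ts[of n]] in auto)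
 have Tmono: "T k \<subseteq> T n" if "k \<le> n" for k n
  using ideal_power_mono[OF ideal_m that] by (auto simp: T_def)
 have Tall: "\<exists>n. e \<in> T n" if "e \<in> carrier E" for e using torsion[OF that] that by (auto simp: T_def)
 obtain n0 where n0: "\<eta> \<in> T n0" using Tall[OF \<eta>(1)] by blast
 define P where "P n r \<longleftrightarrow> r \<in> carrier R \<and> (\<forall>z\<in>Z \<inter> T (n0 + n). r *\<^sub>E z = 0\<^sub>E) \<and> r *\<^sub>E \<eta> = \<sigma>" for n r
 have base: "\<exists>r. P 0 r"
 proof -
  let ?C = "{s *\<^sub>E \<eta> | s. s \<in> carrier R}"
  obtain r where r: "r \<in> carrier R" "r *\<^sub>E \<eta> = \<sigma>" using multiple_is_socle_generator[OF \<eta>(1)] \<eta>(2) ZD(3) by blast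
  have C: "submodule ?C R E" "\<eta> \<in> ?C" by (rule E.cyclic_submodule[OF \<eta>(1)])+
  have "\<exists>r'\<in>carrier R. (\<forall>z\<in>Z \<inter> T n0. r' *\<^sub>E z = 0\<^sub>E) \<and> (\<forall>e\<in>?C. r' *\<^sub>E e = r *\<^sub>E e)"
  proof (rule extend_multiplication[OF ZT C(1) _ r(1)])
   show "a *\<^sub>E e = 0\<^sub>E" if a: "a \<in> mpow n0" "e \<in> Z \<inter> T n0 \<or> e \<in> ?C" for a e
    using a(2) TD(5)[OF _ n0] a(1) unfolding T_def by blast
   show "r *\<^sub>E e = 0\<^sub>E" if e: "e \<in> Z \<inter> T n0" "e \<in> ?C" for e
   proof -
    obtain s where s: "s \<in> carrier R" "e = s *\<^sub>E \<eta>" using e(2) by blast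
    \<comment> \<open>Otherwise \<open>s\<close> is a unit, and \<open>\<eta>\<close> would be a
      multiple of \<open>e\<close> in \<open>Z\<close>.\<close>
    have "s \<in> m"
    proof (rule ccontr)
     assume "s \<notin> m"
     then obtain b where b: "b \<in> carrier R" "s ** b = \<one>" using unit_outside_m s(1) by blast
     have "\<eta> = b *\<^sub>E e" using b \<eta>(1) s m_comm[OF s(1) b(1)] E.smult_assoc1[OF b(1) s(1) \<eta>(1)] by simp
     thus False using ZD(5)[OF b(1)] e(1) \<eta>(2) by simp
    qed
    thus ?thesis using \<sigma>(3) s r E.smult_commute[OF r(1) s(1) \<eta>(1)] by simp
   qed
  qed
  thus ?thesis using C(2) r(2) unfolding P_def by auto
 qed
 have next': "\<exists>r'. P (Suc n) r' \<and> r' \<ominus> r \<in> mpow (n0 + n)" if Pr: "P n r" for n r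
 proof -
  have r: "r \<in> carrier R" "!!z. z \<in> Z ==> z \<in> T (n0 + n) ==> r *\<^sub>E z = 0\<^sub>E" "r *\<^sub>E \<eta> = \<sigma>" using Pr unfolding P_def by blast+
  let ?T = "T (n0 + n)" and ?T' = "T (Suc (n0 + n))"
  have "\<exists>r'\<in>carrier R. (\<forall>z\<in>Z \<inter> ?T'. r' *\<^sub>E z = 0\<^sub>E) \<and> (\<forall>e\<in>?T. r' *\<^sub>E e = r *\<^sub>E e)"
  proof (rule extend_multiplication[OF ZT Ts _ r(1)])
   show "a *\<^sub>E e = 0\<^sub>E" if "a \<in> mpow (Suc (n0 + n))" "e \<in> Z \<inter> ?T' \<or> e \<in> ?T" for a e
    using that Tmono[of "n0 + n" "Suc (n0 + n)"] unfolding T_def by auto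
  qed (use r(2) in blast)
  then obtain r' where r': "r' \<in> carrier R" "\<forall>z\<in>Z \<inter> ?T'. r' *\<^sub>E z = 0\<^sub>E" "!!e. e \<in> ?T ==> r' *\<^sub>E e = r *\<^sub>E e" by blast
  have "r' *\<^sub>E \<eta> = \<sigma>" using r'(3) n0 Tmono[of n0 "n0 + n"] r(3) by auto
  \<comment> \<open>The annihilator of the part killed by a power of \<open>m\<close> is that power:
    any element outside it is detected by \<open>annihilator_separates\<close>.\<close>
  moreover have "r' \<ominus> r \<in> mpow (n0 + n)"
  proof (rule ccontr)
   assume "\<not> ?thesis"
   then obtain e where e: "e \<in> carrier E" "\<forall>j\<in>mpow (n0 + n). j *\<^sub>E e = 0\<^sub>E" "(r' \<ominus> r) *\<^sub>E e ~= 0\<^sub>E"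
    using annihilator_separates[OF ideal_power_ideal[OF ideal_m] minus_closed[OF r'(1) r(1)]] by blast
   hence "e \<in> ?T" by (auto simp: T_def)
   thus False using r'(3)[of e] e r'(1) r(1) by (simp add: E.smult_minus_distr_l)
  qed
  ultimately show ?thesis using r'(1,2) unfolding P_def by (intro exI[of _ r']) auto
 qed
 obtain a where a: "!!n. P n (a n)" "!!n. a (Suc n) \<ominus> a n \<in> mpow (n0 + n)"
  using dependent_nat_choice[of P "\<lambda>n r r'. r' \<ominus> r \<in> mpow (n0 + n)"] base next' by blast
 have ac: "a n \<in> carrier R" for n using a(1)[of n] unfolding P_def by blast
 have "a (Suc n) \<ominus> a n \<in> mpow n" for n
  using a(2)[of n] ideal_power_mono[OF ideal_m, of n "n0 + n"] by auto
 then obtain l where l: "l \<in> carrier R" "!!k. \<exists>N. \<forall>n\<ge>N. a n \<ominus> l \<in> mpow k"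
  using complete_limit[of a, OF ac] by blast
 \<comment> \<open>On an element killed by \<open>mpow k\<close> the limit acts like any
   sufficiently late term of the sequence.\<close>
 have lim: "\<exists>n\<ge>k. l *\<^sub>E e = a n *\<^sub>E e" if e: "e \<in> T k" for e k
 proof -
  obtain N where "\<forall>n\<ge>N. a n \<ominus> l \<in> mpow k" using l(2) by blast
  hence "a (max N k) \<ominus> l \<in> mpow k" by simp
  hence "(a (max N k) \<ominus> l) *\<^sub>E e = 0\<^sub>E" using e by (auto simp: T_def)
  hence "l *\<^sub>E e = a (max N k) *\<^sub>E e" using TD(2)[OF e] l(1) ac by (simp add: E.smult_minus_distr_l E.minus_eq_zero_iff)
  thus ?thesis by (intro exI[of _ "max N k"]) simp
 qed
 have "l *\<^sub>E \<eta> = \<sigma>" using lim[OF n0] a(1) unfolding P_def by force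
 moreover have "l *\<^sub>E z = 0\<^sub>E" if z: "z \<in> Z" for z
 proof -
  obtain k where k: "z \<in> T k" using Tall[OF ZD(2)[OF z]] by blast
  obtain n where n: "n \<ge> k" "l *\<^sub>E z = a n *\<^sub>E z" using lim[OF k] by blast
  have "z \<in> T (n0 + n)" using Tmono[of k "n0 + n"] n(1) k by auto
  thus ?thesis using a(1)[of n] n(2) z unfolding P_def by auto
 qed
 ultimately show ?thesis using l(1) \<sigma>(2) by auto
qed

end

section \<open>Frobenius\<close>

lemma (in cring) binomial:
 assumes a: "a \<in> carrier R" and b: "b \<in> carrier R"
 shows "(a \<oplus> b) [^] (n::nat) = (\<Oplus>k\<in>{..n}. [(n choose k)] \<cdot> (a [^] k ** b [^] (n - k)))"
proof (induction n)
 case 0 show ?case by simp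
next
 case (Suc n)
 define T where "T n k = [(n choose k)] \<cdot> (a [^] k ** b [^] (n - k))" for n k :: nat
 have c [simp]: "T n k \<in> carrier R" for n k using a b by (simp add: T_def)
 have step: "T n k ** a \<oplus> T n (Suc k) ** b = T (Suc n) (Suc k)" if "k \<le> n" for k
 proof -
  let ?w = "a [^] Suc k ** b [^] (n - k)"
  have w: "?w \<in> carrier R" using a b by simp
  have "T n k ** a = [(n choose k)] \<cdot> ?w"
   using a b by (simp add: T_def add_pow_ldistr add_pow_rdistr m_ac)
  moreover have "T n (Suc k) ** b = [(n choose Suc k)] \<cdot> ?w"
  proof (cases "k = n")
   case True thus ?thesis using a b by (simp add: T_def binomial_eq_0)
  next
   case False
   hence "n - k = Suc (n - Suc k)" using that by simp
   thus ?thesis using a b by (simp add: T_def add_pow_ldistr add_pow_rdistr m_ac)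
  qed
  ultimately show ?thesis using w by (simp add: T_def add.nat_pow_mult)
 qed
 have "(a \<oplus> b) [^] Suc n = (\<Oplus>k\<in>{..n}. T n k) ** a \<oplus> (\<Oplus>k\<in>{..n}. T n k) ** b"
  using Suc a b by (simp add: T_def r_distr)
 also have "(\<Oplus>k\<in>{..n}. T n k) ** b = (\<Oplus>k\<in>{..Suc n}. T n k ** b)"
  using b by (simp add: finsum_Suc finsum_ldistr) (simp add: T_def binomial_eq_0)
 also have "\<dots> = (\<Oplus>k\<in>{..n}. T n (Suc k) ** b) \<oplus> T n 0 ** b"
  by (rule finsum_Suc2) (use b in simp)
 also have "(\<Oplus>k\<in>{..n}. T n k) ** a \<oplus> ((\<Oplus>k\<in>{..n}. T n (Suc k) ** b) \<oplus> T n 0 ** b)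
   = (\<Oplus>k\<in>{..n}. T n k ** a \<oplus> T n (Suc k) ** b) \<oplus> T n 0 ** b"
  using a b by (simp add: finsum_ldistr finsum_addf a_assoc Pi_def)
 also have "(\<Oplus>k\<in>{..n}. T n k ** a \<oplus> T n (Suc k) ** b) = (\<Oplus>k\<in>{..n}. T (Suc n) (Suc k))"
  by (rule finsum_cong') (use step in auto)
 also have "T n 0 ** b = T (Suc n) 0" using a b by (simp add: T_def)
 also have "(\<Oplus>k\<in>{..n}. T (Suc n) (Suc k)) \<oplus> T (Suc n) 0 = (\<Oplus>k\<in>{..Suc n}. T (Suc n) k)"
  by (rule finsum_Suc2[symmetric]) simp
 finally show ?case by (simp only: T_def)
qed

locale char_p_ring = cring +
 fixes p :: nat
 assumes prime_p: "Factorial_Ring.prime p" and char_p: "has_char R p"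
begin

lemma p_multiple_zero: "x \<in> carrier R ==> p dvd n ==> [n] \<cdot> x = \<zero>"
proof -
 assume x: "x \<in> carrier R" and "p dvd n"
 hence "[n] \<cdot> \<one> = \<zero>" using char_p unfolding has_char_def by blast
 thus "[n] \<cdot> x = \<zero>" using add_pow_ldistr[of \<one> x n] x by simp
qed

lemma frobenius_add_p:
 assumes "a \<in> carrier R" "b \<in> carrier R" shows "(a \<oplus> b) [^] p = a [^] p \<oplus> b [^] p"
proof -
 define T where "T k = [(p choose k)] \<cdot> (a [^] k ** b [^] (p - k))" for k :: nat
 have c: "T k \<in> carrier R" for k using assms by (simp add: T_def)
 \<comment> \<open>The sum splits into the first term, \<open>q + 1\<close> middle terms with
   binomial coefficients divisible by \<open>p\<close>, and the last term.\<close>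
 obtain q where q: "p = Suc (Suc q)" using prime_ge_2_nat[OF prime_p] by (metis Suc_le_D numeral_2_eq_2 Suc_le_mono)
 have z: "T (Suc i) = \<zero>" if "i \<le> q" for i
 proof -
  have "p dvd (p choose Suc i)" by (rule dvd_choose_prime) (use that q prime_p in auto)
  thus ?thesis unfolding T_def by (intro p_multiple_zero) (use assms in auto)
 qed
 have "(a \<oplus> b) [^] p = (\<Oplus>k\<in>{..Suc (Suc q)}. T k)" using binomial[OF assms, of p] q by (simp add: T_def)
 also have "\<dots> = T (Suc (Suc q)) \<oplus> (\<Oplus>k\<in>{..Suc q}. T k)" by (rule finsum_Suc) (use c in auto)
 also have "(\<Oplus>k\<in>{..Suc q}. T k) = (\<Oplus>k\<in>{..q}. T (Suc k)) \<oplus> T 0" by (rule finsum_Suc2) (use c in auto)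
 also have "(\<Oplus>k\<in>{..q}. T (Suc k)) = (\<Oplus>k\<in>{..q}. \<zero>)" by (rule finsum_cong') (use z in auto)
 also have "T (Suc (Suc q)) \<oplus> ((\<Oplus>k\<in>{..q}. \<zero>) \<oplus> T 0) = a [^] p \<oplus> b [^] p"
  using assms by (simp add: T_def q[symmetric])
 finally show ?thesis .
qed

lemma frobenius_add:
 assumes "a \<in> carrier R" "b \<in> carrier R" shows "(a \<oplus> b) [^] (p ^ e) = a [^] (p ^ e) \<oplus> b [^] (p ^ e)"
proof (induction e)
 case (Suc e)
 have "z [^] (p ^ Suc e) = (z [^] (p ^ e)) [^] p" if "z \<in> carrier R" for z
  using that by (simp add: nat_pow_pow mult.commute)
 thus ?case using Suc assms frobenius_add_p by simp
qed (use assms in simp)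

lemma frobenius_minus:
 assumes "a \<in> carrier R" "b \<in> carrier R" shows "(a \<ominus> b) [^] (p ^ e) = a [^] (p ^ e) \<ominus> b [^] (p ^ e)"
proof -
 have "a [^] (p ^ e) = ((a \<ominus> b) \<oplus> b) [^] (p ^ e)" using assms by (simp add: minus_eq a_assoc l_neg)
 also have "\<dots> = (a \<ominus> b) [^] (p ^ e) \<oplus> b [^] (p ^ e)" by (rule frobenius_add) (use assms in auto)
 finally show ?thesis using assms by (simp add: minus_eq a_assoc r_neg)
qed

lemma q_pos: "p ^ e > 0" using prime_gt_0_nat[OF prime_p] by simp

lemma frobenius_zero: "\<zero> [^] (p ^ e) = \<zero>"
 using q_pos[of e] by (simp add: nat_pow_zero)

lemma Idl_frobenius:
 assumes S: "S \<subseteq> carrier R" and a: "a \<in> Idl S" shows "a [^] (p ^ e) \<in> Idl ((\<lambda>s. s [^] (p ^ e)) ` S)"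
proof -
 let ?J = "Idl ((\<lambda>s. s [^] (p ^ e)) ` S)"
 have S': "(\<lambda>s. s [^] (p ^ e)) ` S \<subseteq> carrier R" using S by auto
 note JD = idealD[OF genideal_ideal[OF S']]
 let ?L = "{a \<in> carrier R. a [^] (p ^ e) \<in> ?J}"
 have "ideal ?L R"
  by (rule ideal_intro) (use JD frobenius_zero in \<open>auto simp: frobenius_add nat_pow_distrib\<close>)
 moreover have "S \<subseteq> ?L" using S genideal_self[OF S'] by auto
 ultimately have "Idl S \<subseteq> ?L" by (rule genideal_minimal)
 thus ?thesis using a by blast
qed

end

section \<open>Tight closure and the Frobenius action on the injective hull\<close>

definition test_ideal :: "('a, 'm) ring_scheme => nat => 'a set" where
 "test_ideal R p = {c \<in> carrier R. \<forall>J. ideal J R --> (\<forall>z\<in>tight_closure R p J. c \<otimes>\<^bsub>R\<^esub> z \<in> J)}"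

locale frobenius_hull = injective_hull_module R m d E \<sigma> + char_p_ring R p
 for R :: "('a, 'm) ring_scheme" (structure) and m :: "'a set" and d :: nat and E :: "('a, 'e) module"
  and \<sigma> :: 'e and p :: nat +
 fixes x :: "nat => 'a" and \<eta> :: "nat => 'e" and \<xi> :: 'a
 assumes x_closed: "x l \<in> carrier R" and \<xi>: "\<xi> = (\<Otimes>l\<in>{..<d}. x l)"
  and \<eta>_closed: "\<eta> t \<in> carrier E" and \<eta>_span: "e \<in> carrier E ==> \<exists>r\<in>carrier R. \<exists>t. e = r *\<^sub>E \<eta> t"
  and \<eta>_Suc: "\<xi> *\<^sub>E \<eta> (Suc t) = \<eta> t" and \<eta>_kill: "l < d ==> (x l [^] t) *\<^sub>E \<eta> t = 0\<^sub>E"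
  and \<eta>_zero: "r \<in> carrier R ==> r *\<^sub>E \<eta> t = 0\<^sub>E ==>
    \<exists>s::nat. r ** \<xi> [^] s \<in> Idl ((\<lambda>l. x l [^] (t + s)) ` {..<d})"
begin

lemma \<xi>_closed [simp]: "\<xi> \<in> carrier R"
 unfolding \<xi> by (rule finprod_closed) (use x_closed in auto)

lemma \<eta>_shift: "(\<xi> [^] k) *\<^sub>E \<eta> (t + k) = \<eta> t"
proof (induction k)
 case (Suc k)
 have "(\<xi> [^] Suc k) *\<^sub>E \<eta> (t + Suc k) = (\<xi> [^] k) *\<^sub>E (\<xi> *\<^sub>E \<eta> (Suc (t + k)))"
  using \<eta>_closed by (simp add: E.smult_assoc1)
 thus ?case using Suc by (simp add: \<eta>_Suc)
qed (use \<eta>_closed in simp)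

lemma Idl_kills_\<eta>:
 assumes "a \<in> Idl ((\<lambda>l. x l [^] t) ` {..<d})" shows "a *\<^sub>E \<eta> t = 0\<^sub>E"
proof -
 have "Idl ((\<lambda>l. x l [^] t) ` {..<d}) \<subseteq> {r \<in> carrier R. r *\<^sub>E \<eta> t = 0\<^sub>E}"
  by (rule genideal_minimal[OF E.annihilator_ideal[OF \<eta>_closed]]) (use \<eta>_kill x_closed in auto)
 thus ?thesis using assms by blast
qed

text \<open>By \<open>\<eta>_zero\<close> the vanishing is witnessed by a membership in an ideal of
  \<open>R\<close>, and memberships survive \<open>q\<close>-th powers. This makes the Frobenius
  action well defined.\<close>

lemma frobenius_kills:
 assumes r: "r \<in> carrier R" "r *\<^sub>E \<eta> t = 0\<^sub>E" shows "(r [^] (p ^ e)) *\<^sub>E \<eta> (p ^ e * t) = 0\<^sub>E"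
proof -
 let ?q = "p ^ e"
 obtain s where "r ** \<xi> [^] (s::nat) \<in> Idl ((\<lambda>l. x l [^] (t + s)) ` {..<d})" using \<eta>_zero[OF r] by blast
 hence "(r ** \<xi> [^] s) [^] ?q \<in> Idl ((\<lambda>s. s [^] ?q) ` (\<lambda>l. x l [^] (t + s)) ` {..<d})"
  by (rule Idl_frobenius[rotated]) (use x_closed in auto)
 moreover have "(\<lambda>s. s [^] ?q) ` (\<lambda>l. x l [^] (t + s)) ` {..<d} = (\<lambda>l. x l [^] (?q * t + ?q * s)) ` {..<d}"
  using x_closed by (simp add: image_image nat_pow_pow add_mult_distrib mult.commute)
 moreover have "(r ** \<xi> [^] s) [^] ?q = r [^] ?q ** \<xi> [^] (?q * s)"
  using r by (simp add: nat_pow_distrib nat_pow_pow mult.commute)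
 ultimately have "(r [^] ?q ** \<xi> [^] (?q * s)) *\<^sub>E \<eta> (?q * t + ?q * s) = 0\<^sub>E" using Idl_kills_\<eta> by simp
 thus ?thesis using r \<eta>_closed \<eta>_shift[of "?q * s" "?q * t"] by (simp add: E.smult_assoc1)
qed

lemma common_level: "r \<in> carrier R ==> r *\<^sub>E \<eta> t = (r ** \<xi> [^] k) *\<^sub>E \<eta> (t + k)"
 using \<eta>_closed \<eta>_shift[of k t] by (simp add: E.smult_assoc1)

lemma frobenius_well_defined:
 assumes r: "r \<in> carrier R" "r' \<in> carrier R" and eq: "r *\<^sub>E \<eta> t = r' *\<^sub>E \<eta> t'"
 shows "(r [^] (p ^ e)) *\<^sub>E \<eta> (p ^ e * t) = (r' [^] (p ^ e)) *\<^sub>E \<eta> (p ^ e * t')"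
proof -
 let ?q = "p ^ e"
 let ?a = "r ** \<xi> [^] t'" and ?b = "r' ** \<xi> [^] t"
 have c: "?a \<in> carrier R" "?b \<in> carrier R" using r by auto
 have "?a *\<^sub>E \<eta> (t + t') = ?b *\<^sub>E \<eta> (t + t')"
  using eq common_level[OF r(1), of t t'] common_level[OF r(2), of t' t] by (simp add: add.commute)
 hence "(?a \<ominus> ?b) *\<^sub>E \<eta> (t + t') = 0\<^sub>E" using c \<eta>_closed by (simp add: E.smult_minus_distr_l)
 hence "((?a \<ominus> ?b) [^] ?q) *\<^sub>E \<eta> (?q * (t + t')) = 0\<^sub>E" by (rule frobenius_kills[rotated]) (use c in simp)
 hence "(?a [^] ?q) *\<^sub>E \<eta> (?q * (t + t')) = (?b [^] ?q) *\<^sub>E \<eta> (?q * (t + t'))"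
  unfolding frobenius_minus[OF c] using c \<eta>_closed by (simp add: E.smult_minus_distr_l E.minus_eq_zero_iff)
 moreover have "?a [^] ?q = r [^] ?q ** \<xi> [^] (?q * t')" "?b [^] ?q = r' [^] ?q ** \<xi> [^] (?q * t)"
  using r by (simp_all add: nat_pow_distrib nat_pow_pow mult.commute)
 ultimately show ?thesis
  using common_level[of "r [^] ?q" "?q * t" "?q * t'"] common_level[of "r' [^] ?q" "?q * t'" "?q * t"] r
  by (simp add: distrib_left add.commute)
qed

text \<open>The natural Frobenius action on top local cohomology: \<open>r / \<xi>^t\<close> goes to
  \<open>r^q / \<xi>^(q t)\<close>.\<close>

definition Fr :: "nat => 'e => 'e" where
 "Fr e \<zeta> = (SOME v. \<exists>r\<in>carrier R. \<exists>t. \<zeta> = r *\<^sub>E \<eta> t \<and> v = (r [^] (p ^ e)) *\<^sub>E \<eta> (p ^ e * t))"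

lemma Fr_\<eta>:
 assumes r: "r \<in> carrier R" shows "Fr e (r *\<^sub>E \<eta> t) = (r [^] (p ^ e)) *\<^sub>E \<eta> (p ^ e * t)"
 unfolding Fr_def
proof (rule some_equality)
 show "\<exists>r'\<in>carrier R. \<exists>t'. r *\<^sub>E \<eta> t = r' *\<^sub>E \<eta> t' \<and> (r [^] (p ^ e)) *\<^sub>E \<eta> (p ^ e * t) = (r' [^] (p ^ e)) *\<^sub>E \<eta> (p ^ e * t')"
  using r by (intro bexI[of _ r] exI[of _ t]) auto
 fix v assume "\<exists>r'\<in>carrier R. \<exists>t'. r *\<^sub>E \<eta> t = r' *\<^sub>E \<eta> t' \<and> v = (r' [^] (p ^ e)) *\<^sub>E \<eta> (p ^ e * t')"
 then obtain r' t' where *: "r' \<in> carrier R" "r *\<^sub>E \<eta> t = r' *\<^sub>E \<eta> t'" "v = (r' [^] (p ^ e)) *\<^sub>E \<eta> (p ^ e * t')"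
  by (elim bexE exE conjE)
 show "v = (r [^] (p ^ e)) *\<^sub>E \<eta> (p ^ e * t)" unfolding *(3) by (rule frobenius_well_defined[OF r *(1,2), symmetric])
qed

lemma Fr_closed: "\<zeta> \<in> carrier E ==> Fr e \<zeta> \<in> carrier E"
 using \<eta>_span[of \<zeta>] Fr_\<eta> \<eta>_closed by auto

lemma Fr_smult:
 assumes "r \<in> carrier R" "\<zeta> \<in> carrier E" shows "Fr e (r *\<^sub>E \<zeta>) = (r [^] (p ^ e)) *\<^sub>E Fr e \<zeta>"
proof -
 obtain s t where s: "s \<in> carrier R" "\<zeta> = s *\<^sub>E \<eta> t" using \<eta>_span[OF assms(2)] by blast
 have "r *\<^sub>E \<zeta> = (r ** s) *\<^sub>E \<eta> t" using s assms(1) \<eta>_closed by (simp add: E.smult_assoc1)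
 hence "Fr e (r *\<^sub>E \<zeta>) = ((r ** s) [^] (p ^ e)) *\<^sub>E \<eta> (p ^ e * t)" using Fr_\<eta>[OF m_closed[OF assms(1) s(1)]] by simp
 thus ?thesis using s assms(1) \<eta>_closed by (simp add: Fr_\<eta> nat_pow_distrib E.smult_assoc1)
qed

lemma Fr_add:
 assumes "\<zeta> \<in> carrier E" "\<zeta>' \<in> carrier E" shows "Fr e (\<zeta> +\<^sub>E \<zeta>') = Fr e \<zeta> +\<^sub>E Fr e \<zeta>'"
proof -
 obtain s t where s: "s \<in> carrier R" "\<zeta> = s *\<^sub>E \<eta> t" using \<eta>_span[OF assms(1)] by blast
 obtain s' t' where s': "s' \<in> carrier R" "\<zeta>' = s' *\<^sub>E \<eta> t'" using \<eta>_span[OF assms(2)] by blast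
 have c: "s ** \<xi> [^] t' \<in> carrier R" "s' ** \<xi> [^] t \<in> carrier R" using s s' by auto
 have z: "\<zeta> = (s ** \<xi> [^] t') *\<^sub>E \<eta> (t + t')" "\<zeta>' = (s' ** \<xi> [^] t) *\<^sub>E \<eta> (t + t')"
  using s(2) s'(2) common_level[OF s(1), of t t'] common_level[OF s'(1), of t' t] by (simp_all add: add.commute)
 have "\<zeta> +\<^sub>E \<zeta>' = (s ** \<xi> [^] t' \<oplus> s' ** \<xi> [^] t) *\<^sub>E \<eta> (t + t')"
  unfolding z using c \<eta>_closed by (simp add: E.smult_l_distr)
 thus ?thesis
  using Fr_\<eta>[OF a_closed[OF c], of e "t + t'"] Fr_\<eta>[OF c(1), of e "t + t'"] Fr_\<eta>[OF c(2), of e "t + t'"] c \<eta>_closed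
  by (simp add: z[symmetric] frobenius_add E.smult_l_distr)
qed

lemma Fr_zero: "Fr e 0\<^sub>E = 0\<^sub>E"
 using Fr_smult[of \<zero> "\<eta> 0" e] \<eta>_closed[of 0] Fr_closed[of "\<eta> 0" e] frobenius_zero by simp

lemma faithful:
 assumes c: "c \<in> carrier R" "!!t. c *\<^sub>E \<eta> t = 0\<^sub>E" shows "c = \<zero>"
proof (rule ccontr)
 assume "c ~= \<zero>"
 then obtain e where e: "e \<in> carrier E" "c *\<^sub>E e ~= 0\<^sub>E"
  using annihilator_separates[OF zeroideal c(1)] by auto
 obtain r t where "r \<in> carrier R" "e = r *\<^sub>E \<eta> t" using \<eta>_span[OF e(1)] by blast
 thus False using e(2) c E.smult_commute[OF c(1), of r "\<eta> t"] \<eta>_closed by simp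
qed

abbreviation \<tau> :: "'a set" where "\<tau> \<equiv> test_ideal R p"

text \<open>In terms of generators, that \<open>\<tau>\<close> is the annihilator of
  \<open>Z\<close> is formal; that each element behaves as in the tight closure of zero is proved
  afterwards (\<open>Z_tight\<close>).\<close>

inductive_set Z :: "'e set" where
 Z_gen: "ideal J R ==> z \<in> tight_closure R p J ==> \<zeta> \<in> carrier E ==> (!!j. j \<in> J ==> j *\<^sub>E \<zeta> = 0\<^sub>E) ==> z *\<^sub>E \<zeta> \<in> Z"
| Z_add: "a \<in> Z ==> b \<in> Z ==> a +\<^sub>E b \<in> Z"

lemma frobenius_power_ideal: "ideal J R ==> ideal (frobenius_power R J q) R"
 unfolding frobenius_power_def by (rule genideal_ideal) (use idealD(2) in auto)

lemma frobenius_power_mem: "ideal J R ==> j \<in> J ==> j [^] q \<in> frobenius_power R J q"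
 unfolding frobenius_power_def
 using genideal_self[of "{x [^] q |x. x \<in> J}"] idealD(2)[of J] by blast

lemma frobenius_power_frobenius_power:
 "ideal J R ==> frobenius_power R J (q * q') \<subseteq> frobenius_power R (frobenius_power R J q) q'"
 unfolding frobenius_power_def[of R J "q * q'"]
proof (rule genideal_minimal, goal_cases)
 case 1 thus ?case by (intro frobenius_power_ideal)
next
 case 2
 have "j [^] (q * q') \<in> frobenius_power R (frobenius_power R J q) q'" if j: "j \<in> J" for j
  using frobenius_power_mem[OF frobenius_power_ideal[OF 2] frobenius_power_mem[OF 2 j, of q], of q']
   idealD(2)[OF 2 j] by (simp add: nat_pow_pow)
 thus ?case by blast
qed

lemma frobenius_power_kills:
 assumes J: "ideal J R" and \<zeta>: "\<zeta> \<in> carrier E" "!!j. j \<in> J ==> j *\<^sub>E \<zeta> = 0\<^sub>E"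
  and a: "a \<in> frobenius_power R J (p ^ e)" shows "a *\<^sub>E Fr e \<zeta> = 0\<^sub>E"
proof -
 have "frobenius_power R J (p ^ e) \<subseteq> {r \<in> carrier R. r *\<^sub>E Fr e \<zeta> = 0\<^sub>E}"
  unfolding frobenius_power_def
 proof (rule genideal_minimal[OF E.annihilator_ideal[OF Fr_closed[OF \<zeta>(1)]]])
  have "(j [^] (p ^ e)) *\<^sub>E Fr e \<zeta> = 0\<^sub>E" if "j \<in> J" for j
   using Fr_smult[of j \<zeta> e] \<zeta> that idealD(2)[OF J that] Fr_zero by simp
  thus "{x [^] (p ^ e) |x. x \<in> J} \<subseteq> {r \<in> carrier R. r *\<^sub>E Fr e \<zeta> = 0\<^sub>E}" using idealD(2)[OF J] by auto
 qed
 thus ?thesis using a by blast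
qed

lemma tight_closureD:
 assumes "z \<in> tight_closure R p J"
 shows "z \<in> carrier R" "\<exists>c\<in>carrier R. (\<forall>P. minimal_prime R P --> c \<notin> P) \<and>
   (\<exists>N. \<forall>e\<ge>N. c ** z [^] (p ^ e) \<in> frobenius_power R J (p ^ e))"
 using assms unfolding tight_closure_def by auto

lemma ideal_subset_tight_closure:
 assumes J: "ideal J R" shows "J \<subseteq> tight_closure R p J"
proof
 fix z assume z: "z \<in> J"
 have "\<one> ** z [^] (p ^ e) \<in> frobenius_power R J (p ^ e)" for e
  using frobenius_power_mem[OF J z] idealD(2)[OF J z] by simp
 thus "z \<in> tight_closure R p J"
  unfolding tight_closure_def using idealD(2)[OF J z] primeD(2)
  by (intro CollectI conjI bexI[of _ \<one>] exI[of _ 0]) (auto simp: minimal_prime_def)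
qed

lemma Z_closed: "\<zeta> \<in> Z ==> \<zeta> \<in> carrier E"
 by (induction rule: Z.induct) (auto dest: tight_closureD)

lemma Z_submodule: "submodule Z R E"
proof (rule E.submodule_intro)
 show "Z \<subseteq> carrier E" using Z_closed by blast
 have "\<zero> \<in> tight_closure R p {\<zero>}" using ideal_subset_tight_closure[OF zeroideal] by blast
 hence "\<zero> *\<^sub>E 0\<^sub>E \<in> Z" by (rule Z_gen[OF zeroideal]) auto
 thus "0\<^sub>E \<in> Z" by simp
 show "a +\<^sub>E b \<in> Z" if "a \<in> Z" "b \<in> Z" for a b by (rule Z_add[OF that])
 show "r *\<^sub>E a \<in> Z" if r: "r \<in> carrier R" and a: "a \<in> Z" for r a
  using a
 proof (induction rule: Z.induct)
  case (Z_gen J z \<zeta>)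
  have zc: "z \<in> carrier R" using tight_closureD(1)[OF Z_gen(2)] .
  have "z *\<^sub>E (r *\<^sub>E \<zeta>) \<in> Z"
  proof (rule Z.Z_gen[OF Z_gen(1,2)])
   show "j *\<^sub>E (r *\<^sub>E \<zeta>) = 0\<^sub>E" if j: "j \<in> J" for j
    using E.smult_commute[OF idealD(2)[OF Z_gen(1) j] r Z_gen(3)] Z_gen(4)[OF j] r by simp
  qed (use r Z_gen in simp)
  thus ?case using E.smult_commute[OF r zc Z_gen(3)] by simp
 next
  case (Z_add a b)
  thus ?case using Z_closed r Z.Z_add[OF Z_add(3,4)] by (simp add: E.smult_r_distr)
 qed
qed

lemma \<tau>_kills_Z: "c \<in> \<tau> ==> \<zeta> \<in> Z ==> c *\<^sub>E \<zeta> = 0\<^sub>E"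
proof -
 assume c: "c \<in> \<tau>" and "\<zeta> \<in> Z"
 have cc: "c \<in> carrier R" using c unfolding test_ideal_def by blast
 from \<open>\<zeta> \<in> Z\<close> show "c *\<^sub>E \<zeta> = 0\<^sub>E"
 proof (induction rule: Z.induct)
  case (Z_gen J z \<zeta>)
  have "c ** z \<in> J" using c Z_gen(1,2) unfolding test_ideal_def by blast
  thus ?case using Z_gen(4)[of "c ** z"] cc tight_closureD(1)[OF Z_gen(2)] Z_gen(3) by (simp add: E.smult_assoc1)
 next
  case (Z_add a b)
  thus ?case using cc Z_closed by (simp add: E.smult_r_distr)
 qed
qed

text \<open>If \<open>c ** z\<close> were outside \<open>J\<close>, some \<open>e\<close> killed by
  \<open>J\<close> would not be killed by \<open>c ** z\<close>; but \<open>z e\<close> belongs to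
  \<open>Z\<close>.\<close>

lemma kills_Z_imp_\<tau>:
 assumes c: "c \<in> carrier R" "!!\<zeta>. \<zeta> \<in> Z ==> c *\<^sub>E \<zeta> = 0\<^sub>E" shows "c \<in> \<tau>"
proof -
 have "c ** z \<in> J" if J: "ideal J R" and z: "z \<in> tight_closure R p J" for J z
 proof (rule ccontr)
  assume "c ** z \<notin> J"
  moreover have zc: "z \<in> carrier R" using tight_closureD(1)[OF z] .
  ultimately obtain e where e: "e \<in> carrier E" "\<forall>j\<in>J. j *\<^sub>E e = 0\<^sub>E" "(c ** z) *\<^sub>E e ~= 0\<^sub>E"
   using annihilator_separates[OF J, of "c ** z"] c(1) by blast
  have "z *\<^sub>E e \<in> Z" by (rule Z_gen[OF J z e(1)]) (use e(2) in blast)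
  thus False using c(2)[of "z *\<^sub>E e"] e c(1) zc by (simp add: E.smult_assoc1)
 qed
 thus ?thesis using c(1) unfolding test_ideal_def by blast
qed

text \<open>If \<open>z\<close> is in the tight closure of \<open>J\<close>, then \<open>z^q\<close>
  is in that of the Frobenius power of \<open>J\<close>, with the same multiplier; and this
  Frobenius power kills \<open>Fr e \<zeta>\<close>.\<close>

lemma Fr_Z: "\<zeta> \<in> Z ==> Fr e \<zeta> \<in> Z"
proof (induction rule: Z.induct)
 case (Z_gen J z \<zeta>)
 let ?q = "p ^ e"
 have zc: "z \<in> carrier R" using tight_closureD(1)[OF Z_gen(2)] .
 obtain c N where c: "c \<in> carrier R" "\<forall>P. minimal_prime R P --> c \<notin> P"
  "\<forall>i\<ge>N. c ** z [^] (p ^ i) \<in> frobenius_power R J (p ^ i)" using tight_closureD(2)[OF Z_gen(2)] by blast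
 have "c ** (z [^] ?q) [^] (p ^ i) \<in> frobenius_power R (frobenius_power R J ?q) (p ^ i)" if "i \<ge> N" for i
 proof -
  have "c ** z [^] (p ^ (e + i)) \<in> frobenius_power R J (p ^ (e + i))" using c(3) that by simp
  thus ?thesis using frobenius_power_frobenius_power[OF Z_gen(1), of ?q "p ^ i"] zc
   by (auto simp: power_add nat_pow_pow)
 qed
 hence t: "z [^] ?q \<in> tight_closure R p (frobenius_power R J ?q)"
  unfolding tight_closure_def using c(1,2) zc by blast
 have "(z [^] ?q) *\<^sub>E Fr e \<zeta> \<in> Z"
  by (rule Z.Z_gen[OF frobenius_power_ideal[OF Z_gen(1)] t Fr_closed[OF Z_gen(3)]])
   (rule frobenius_power_kills[OF Z_gen(1,3,4)])
 thus ?case using Fr_smult[OF zc Z_gen(3)] by simp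
next
 case (Z_add a b)
 thus ?case using Fr_add Z_closed Z.Z_add by simp
qed

text \<open>For a generator the multiplier of \<open>z\<close> works, since the Frobenius powers of
  \<open>J\<close> kill \<open>Fr e \<zeta>\<close>. For a sum the two multipliers are multiplied;
  their product still avoids every minimal prime.\<close>

lemma Z_tight:
 "\<zeta> \<in> Z ==> \<exists>c\<in>carrier R. (\<forall>P. minimal_prime R P --> c \<notin> P) \<and> (\<exists>N. \<forall>e\<ge>N. c *\<^sub>E Fr e \<zeta> = 0\<^sub>E)"
proof (induction rule: Z.induct)
 case (Z_gen J z \<zeta>)
 have zc: "z \<in> carrier R" using tight_closureD(1)[OF Z_gen(2)] .
 obtain c N where c: "c \<in> carrier R" "\<forall>P. minimal_prime R P --> c \<notin> P"
  "\<forall>i\<ge>N. c ** z [^] (p ^ i) \<in> frobenius_power R J (p ^ i)" using tight_closureD(2)[OF Z_gen(2)] by blast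
 have "c *\<^sub>E Fr i (z *\<^sub>E \<zeta>) = 0\<^sub>E" if i: "i \<ge> N" for i
 proof -
  have "(c ** z [^] (p ^ i)) *\<^sub>E Fr i \<zeta> = 0\<^sub>E"
   by (rule frobenius_power_kills[OF Z_gen(1,3)]) (use Z_gen(4) c(3) i in auto)
  thus ?thesis using Fr_smult[OF zc Z_gen(3)] c(1) zc Fr_closed[OF Z_gen(3)] by (simp add: E.smult_assoc1)
 qed
 thus ?case using c(1,2) by blast
next
 case (Z_add a b)
 obtain c N where c: "c \<in> carrier R" "\<forall>P. minimal_prime R P --> c \<notin> P" "\<forall>e\<ge>N. c *\<^sub>E Fr e a = 0\<^sub>E"
  using Z_add(3) by blast
 obtain c' N' where c': "c' \<in> carrier R" "\<forall>P. minimal_prime R P --> c' \<notin> P" "\<forall>e\<ge>N'. c' *\<^sub>E Fr e b = 0\<^sub>E"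
  using Z_add(4) by blast
 have "c ** c' \<notin> P" if P: "minimal_prime R P" for P
  using primeD(3)[of P c c'] P c c' unfolding minimal_prime_def by blast
 moreover have "(c ** c') *\<^sub>E Fr e (a +\<^sub>E b) = 0\<^sub>E" if "e \<ge> max N N'" for e
 proof -
  have Fc: "Fr e a \<in> carrier E" "Fr e b \<in> carrier E" using Z_add Z_closed Fr_closed by auto
  have "c *\<^sub>E Fr e a = 0\<^sub>E" "c' *\<^sub>E Fr e b = 0\<^sub>E" using c(3) c'(3) that by auto
  thus ?thesis
   using Fc c(1) c'(1) Fr_add[of a b e] Z_add Z_closed E.smult_commute[OF c(1) c'(1) Fc(1)]
   by (simp add: E.smult_r_distr E.smult_assoc1)
 qed
 ultimately show ?case using c(1) c'(1) by (intro bexI[of _ "c ** c'"] conjI exI[of _ "max N N'"]) auto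
qed

text \<open>A multiplier killing \<open>Z\<close> but not \<open>\<zeta>\<close> would lie in
  \<open>\<tau>\<close>, hence in \<open>I\<close>, which kills \<open>\<zeta>\<close>.\<close>

lemma annihilated_in_Z:
 assumes "\<tau> \<subseteq> I" "\<zeta> \<in> carrier E" "!!i. i \<in> I ==> i *\<^sub>E \<zeta> = 0\<^sub>E" shows "\<zeta> \<in> Z"
proof (rule ccontr)
 assume "\<zeta> \<notin> Z"
 then obtain r where r: "r \<in> carrier R" "\<forall>z\<in>Z. r *\<^sub>E z = 0\<^sub>E" "r *\<^sub>E \<zeta> ~= 0\<^sub>E"
  using matlis_separates[OF Z_submodule assms(2)] by blast
 hence "r \<in> \<tau>" by (intro kills_Z_imp_\<tau>) auto
 thus False using assms(1,3) r(3) by blast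
qed

lemma \<tau>_not_in_parameters:
 assumes "I \<subseteq> Idl (x ` {..<d})" shows "\<not> \<tau> \<subseteq> I"
proof
 assume sub: "\<tau> \<subseteq> I"
 have "(\<lambda>l. x l [^] (1::nat)) ` {..<d} = x ` {..<d}" using x_closed by simp
 hence "i *\<^sub>E \<eta> 1 = 0\<^sub>E" if "i \<in> I" for i using Idl_kills_\<eta>[of i 1] assms that by auto
 hence "\<eta> 1 \<in> Z" by (rule annihilated_in_Z[OF sub \<eta>_closed])
 then obtain c N where c: "c \<in> carrier R" "\<forall>P. minimal_prime R P --> c \<notin> P" "\<forall>e\<ge>N. c *\<^sub>E Fr e (\<eta> 1) = 0\<^sub>E"
  using Z_tight by blast
 have Fr1: "Fr e (\<eta> 1) = \<eta> (p ^ e)" for e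
  using Fr_\<eta>[OF one_closed, of e 1] \<eta>_closed by simp
 have "c *\<^sub>E \<eta> t = 0\<^sub>E" for t
 proof -
  let ?e = "max N t"
  \<comment> \<open>Once \<open>p ^ ?e\<close> is at least \<open>t\<close>, the element
    \<open>\<eta> t\<close> is a multiple of \<open>\<eta> (p ^ ?e)\<close>.\<close>
  have "t \<le> p ^ ?e" using less_exp[of ?e] prime_ge_2_nat[OF prime_p] power_mono[of 2 p ?e] by linarith
  then obtain k where k: "p ^ ?e = t + k" using le_Suc_ex by blast
  have "c *\<^sub>E \<eta> (t + k) = 0\<^sub>E" using c(3) Fr1[of ?e] k by (metis max.cobounded1)
  hence "(\<xi> [^] k) *\<^sub>E (c *\<^sub>E \<eta> (t + k)) = 0\<^sub>E" by simp
  thus ?thesis using E.smult_commute[of "\<xi> [^] k" c "\<eta> (t + k)"] c(1) \<eta>_closed \<eta>_shift[of k t] by simp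
 qed
 hence "c = \<zero>" by (rule faithful[OF c(1)])
 moreover obtain P where "minimal_prime R P" using minimal_prime_below[OF prime_m] by blast
 ultimately show False using c(2) idealD(3) primeD(1) unfolding minimal_prime_def by blast
qed

lemma \<tau>_nonzero: "\<exists>c\<in>\<tau>. c ~= \<zero>"
proof -
 have "{\<zero>} \<subseteq> Idl (x ` {..<d})" using idealD(3)[OF genideal_ideal[of "x ` {..<d}"]] x_closed by auto
 thus ?thesis using \<tau>_not_in_parameters by blast
qed

lemma \<tau>_kills_Fr:
 assumes "\<tau> \<subseteq> I" "c \<in> \<tau>" "\<zeta> \<in> carrier E" "!!i. i \<in> I ==> i *\<^sub>E \<zeta> = 0\<^sub>E"
 shows "c *\<^sub>E Fr e \<zeta> = 0\<^sub>E"
 by (rule \<tau>_kills_Z[OF assms(2) Fr_Z[OF annihilated_in_Z[OF assms(1,3,4)]]])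

end

section \<open>Koszul cochains with coefficients in a complex of free modules\<close>

text \<open>The exponent of the sign with which \<open>i\<close> enters the Koszul differential at
  \<open>S\<close>.\<close>

definition pos :: "nat => nat set => nat" where "pos i S = card {l \<in> S. l < i}"

context cring
begin

lemma finsum_swap:
 assumes "finite A" "finite B" "!!l m. l \<in> A ==> m \<in> B ==> f l m \<in> carrier R"
 shows "(\<Oplus>l\<in>A. \<Oplus>m\<in>B. f l m) = (\<Oplus>m\<in>B. \<Oplus>l\<in>A. f l m)"
 using assms(1,3)
proof (induction A rule: finite_induct)
 case (insert a A)
 have c: "(\<lambda>m. f a m) \<in> B \<rightarrow> carrier R" "(\<lambda>m. \<Oplus>l\<in>A. f l m) \<in> B \<rightarrow> carrier R"
  "(\<lambda>l. \<Oplus>m\<in>B. f l m) \<in> A \<rightarrow> carrier R" "(\<Oplus>m\<in>B. f a m) \<in> carrier R"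
  using insert(4) by (auto intro!: finsum_closed)
 have "(\<Oplus>m\<in>B. \<Oplus>l\<in>insert a A. f l m) = (\<Oplus>m\<in>B. f a m \<oplus> (\<Oplus>l\<in>A. f l m))"
  using insert by (intro finsum_cong') (auto intro!: finsum_closed finsum_insert)
 also have "\<dots> = (\<Oplus>m\<in>B. f a m) \<oplus> (\<Oplus>m\<in>B. \<Oplus>l\<in>A. f l m)" using c by (simp add: finsum_addf)
 also have "\<dots> = (\<Oplus>m\<in>B. f a m) \<oplus> (\<Oplus>l\<in>A. \<Oplus>m\<in>B. f l m)" using insert by auto
 also have "\<dots> = (\<Oplus>l\<in>insert a A. \<Oplus>m\<in>B. f l m)"
  by (rule finsum_insert[symmetric]) (use insert c in auto)
 finally show ?case by simp
qed simp

lemma finsum_zero': "(!!i. i \<in> A ==> f i = \<zero>) ==> (\<Oplus>i\<in>A. f i) = \<zero>"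
 using finsum_cong'[of A A "\<lambda>_. \<zero>" f] by auto

lemma finsum_antisymmetric:
 assumes "finite S" "!!i l. f i l \<in> carrier R" "!!i l. i \<in> S ==> l \<in> S ==> i ~= l ==> f i l = \<ominus> f l i"
 shows "(\<Oplus>i\<in>S. \<Oplus>l\<in>S - {i}. f i l) = \<zero>"
 using assms(1,3)
proof (induction S rule: finite_induct)
 case (insert a S)
 note c = assms(2)
 have c': "(\<Oplus>l\<in>T. f i l) \<in> carrier R" "(\<Oplus>l\<in>T. f l i) \<in> carrier R" for T i using c by (auto intro!: finsum_closed)
 have "(\<Oplus>i\<in>insert a S. \<Oplus>l\<in>insert a S - {i}. f i l)
   = (\<Oplus>l\<in>insert a S - {a}. f a l) \<oplus> (\<Oplus>i\<in>S. \<Oplus>l\<in>insert a S - {i}. f i l)"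
  by (rule finsum_insert) (use insert(1,2) c' in auto)
 also have "insert a S - {a} = S" using insert(2) by auto
 also have "(\<Oplus>i\<in>S. \<Oplus>l\<in>insert a S - {i}. f i l) = (\<Oplus>i\<in>S. f i a \<oplus> (\<Oplus>l\<in>S - {i}. f i l))"
 proof (rule finsum_cong')
  fix i assume i: "i \<in> S"
  have "insert a S - {i} = insert a (S - {i})" using i insert(2) by auto
  thus "(\<Oplus>l\<in>insert a S - {i}. f i l) = f i a \<oplus> (\<Oplus>l\<in>S - {i}. f i l)"
   using insert(1,2) c by (simp add: finsum_insert)
 qed (use c c' in auto)
 also have "\<dots> = (\<Oplus>i\<in>S. f i a) \<oplus> (\<Oplus>i\<in>S. \<Oplus>l\<in>S - {i}. f i l)"
  using c c' by (simp add: finsum_addf)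
 also have "(\<Oplus>i\<in>S. \<Oplus>l\<in>S - {i}. f i l) = \<zero>" by (rule insert(3)) (rule insert(4), auto)
 also have "(\<Oplus>l\<in>S. f a l) \<oplus> ((\<Oplus>i\<in>S. f i a) \<oplus> \<zero>) = (\<Oplus>i\<in>S. f a i \<oplus> f i a)"
  using c c' by (simp add: finsum_addf)
 also have "\<dots> = \<zero>"
 proof (rule finsum_zero')
  fix i assume "i \<in> S"
  hence "f a i = \<ominus> f i a" using insert(2) by (intro insert(4)) auto
  thus "f a i \<oplus> f i a = \<zero>" using c by (simp add: l_neg)
 qed
 finally show ?case .
qed simp

definition sg :: "nat => 'a" where "sg n = (\<ominus> \<one>) [^] n"

lemma sg_closed [simp]: "sg n \<in> carrier R" by (simp add: sg_def)

lemma sg_Suc: "sg (Suc n) = \<ominus> sg n" by (simp add: sg_def r_minus)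

lemma sg_sq [simp]: "sg n ** sg n = \<one>"
 by (induction n) (simp_all add: sg_def l_minus r_minus)

lemma sg_sg_cancel: "a \<in> carrier R ==> sg n ** (sg n ** a) = a"
 by (simp add: m_assoc[symmetric])

text \<open>Removing the smaller element lowers the position of the larger one by one; removing the
  larger leaves the smaller in place.\<close>

lemma sg_swap:
 assumes "finite S" "i \<in> S" "l \<in> S" "i ~= l"
 shows "sg (pos i S) ** sg (pos l (S - {i})) = \<ominus> (sg (pos l S) ** sg (pos i (S - {l})))"
proof -
 have *: "pos i (S - {l}) = pos i S" "pos l S = Suc (pos l (S - {i}))"
  if "i < l" "i \<in> S" for i l
 proof -
  have "{j \<in> S - {l}. j < i} = {j \<in> S. j < i}" using that by auto
  thus "pos i (S - {l}) = pos i S" by (simp add: pos_def)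
  have "{j \<in> S. j < l} = insert i {j \<in> S - {i}. j < l}" using that by auto
  thus "pos l S = Suc (pos l (S - {i}))" using assms(1) by (simp add: pos_def)
 qed
 show ?thesis
 proof (cases "i < l")
  case True
  thus ?thesis using *[of i l] assms by (simp add: sg_Suc l_minus r_minus m_comm)
 next
  case False
  thus ?thesis using *[of l i] assms by (simp add: sg_Suc l_minus r_minus m_comm)
 qed
qed

text \<open>The Koszul coboundary of \<open>y\<close>, on cochains indexed by sets; the basis
  element \<open>k\<close> of the coefficient module is only carried along.\<close>

definition dlt :: "(nat => 'a) => (nat set => 'k => 'a) => nat set => 'k => 'a" where
 "dlt y w S k = (\<Oplus>i\<in>S. sg (pos i S) ** (y i ** w (S - {i}) k))"

lemma dlt_closed [simp]: "(!!i. y i \<in> carrier R) ==> (!!S k. w S k \<in> carrier R) ==> dlt y w S k \<in> carrier R"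
 unfolding dlt_def by (rule finsum_closed) auto

lemma dlt_dlt:
 assumes y: "!!i. y i \<in> carrier R" and w: "!!S k. w S k \<in> carrier R" and S: "finite S"
 shows "dlt y (dlt y w) S k = \<zero>"
proof -
 define f where "f i l = (sg (pos i S) ** sg (pos l (S - {i}))) ** (y i ** y l ** w (S - {i} - {l}) k)" for i l
 have "dlt y (dlt y w) S k = (\<Oplus>i\<in>S. \<Oplus>l\<in>S - {i}. f i l)"
  unfolding dlt_def[of y "dlt y w"]
 proof (rule finsum_cong')
  fix i assume "i \<in> S"
  have "sg (pos i S) ** (y i ** dlt y w (S - {i}) k)
   = (\<Oplus>l\<in>S - {i}. sg (pos i S) ** (y i ** (sg (pos l (S - {i})) ** (y l ** w (S - {i} - {l}) k))))"
   unfolding dlt_def using S y w by (simp add: finsum_rdistr Pi_def)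
  also have "\<dots> = (\<Oplus>l\<in>S - {i}. f i l)"
   by (rule finsum_cong') (use y w in \<open>auto simp: f_def m_ac\<close>)
  finally show "sg (pos i S) ** (y i ** dlt y w (S - {i}) k) = (\<Oplus>l\<in>S - {i}. f i l)" .
 qed (use y w in \<open>auto simp: f_def intro!: finsum_closed\<close>)
 also have "\<dots> = \<zero>"
 proof (rule finsum_antisymmetric[OF S])
  show "f i l \<in> carrier R" for i l using y w by (simp add: f_def)
  show "f i l = \<ominus> f l i" if "i \<in> S" "l \<in> S" "i ~= l" for i l
  proof -
   have "S - {i} - {l} = S - {l} - {i}" by blast
   thus ?thesis unfolding f_def sg_swap[OF S that] using y w by (simp add: l_minus m_comm[of "y i" "y l"])
  qed
 qed
 finally show ?thesis .
qed

lemma dlt_add: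
 assumes "!!i. y i \<in> carrier R" "!!S k. w S k \<in> carrier R" "!!S k. v S k \<in> carrier R" "finite S"
 shows "dlt y (\<lambda>S k. w S k \<oplus> v S k) S k = dlt y w S k \<oplus> dlt y v S k"
 unfolding dlt_def using assms by (simp add: r_distr finsum_addf)

lemma dlt_smult:
 assumes "!!i. y i \<in> carrier R" "!!S k. w S k \<in> carrier R" "r \<in> carrier R" "finite S"
 shows "dlt y (\<lambda>S k. r ** w S k) S k = r ** dlt y w S k"
 unfolding dlt_def using assms by (simp add: finsum_rdistr m_lcomm Pi_def)

lemma dlt_uminus:
 assumes "!!i. y i \<in> carrier R" "!!S k. w S k \<in> carrier R" "finite S"
 shows "dlt y (\<lambda>S k. \<ominus> w S k) S k = \<ominus> dlt y w S k"
 using dlt_smult[OF assms(1,2), where r="\<ominus> \<one>" and S=S and k=k] assms by (simp add: l_minus)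

text \<open>Cochains on \<open>S \<union> {i}\<close> contract \<open>y\<^sub>i\<close>.\<close>

lemma dlt_contraction:
 assumes y: "!!i. y i \<in> carrier R" and w: "!!S k. w S k \<in> carrier R" and S: "finite S"
  and w0: "dlt y w (insert i S) k = \<zero>"
 shows "dlt y (\<lambda>S k. if i \<in> S then \<zero> else sg (pos i (insert i S)) ** w (insert i S) k) S k = y i ** w S k"
proof -
 let ?v = "\<lambda>S k. if i \<in> S then \<zero> else sg (pos i (insert i S)) ** w (insert i S) k"
 have "?v S k \<in> carrier R" for S k using w by simp
 hence v: "?v S k \<in> carrier R" for S k .
 show ?thesis
 proof (cases "i \<in> S")
  case True
  have Si: "insert i (S - {i}) = S" using True by blast
  have vi: "?v (S - {i}) k = sg (pos i S) ** w S k" by (simp add: insert_absorb[OF True])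
  have "dlt y ?v S k = (\<Oplus>l\<in>insert i (S - {i}). sg (pos l S) ** (y l ** ?v (S - {l}) k))"
   unfolding Si dlt_def ..
  also have "\<dots> = sg (pos i S) ** (y i ** ?v (S - {i}) k) \<oplus> (\<Oplus>l\<in>S - {i}. sg (pos l S) ** (y l ** ?v (S - {l}) k))"
   by (rule finsum_insert) (use S y w in auto)
  also have "(\<Oplus>l\<in>S - {i}. sg (pos l S) ** (y l ** ?v (S - {l}) k)) = \<zero>"
   by (rule finsum_zero') (use True y in auto)
  also have "sg (pos i S) ** (y i ** ?v (S - {i}) k) = y i ** w S k"
   unfolding vi using y w by (simp add: m_lcomm[of "sg (pos i S)" "y i"] sg_sg_cancel)
  finally show ?thesis using y w by simp
 next
  case False
  let ?T = "insert i S"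
  have T: "finite ?T" using S by simp
  have e: "sg (pos l S) ** (y l ** ?v (S - {l}) k) = (\<ominus> sg (pos i ?T)) ** (sg (pos l ?T) ** (y l ** w (?T - {l}) k))"
   if l: "l \<in> S" for l
  proof -
   have li: "l ~= i" using l False by auto
   have eq: "?T - {i} = S" "insert i (S - {l}) = ?T - {l}" using False li by auto
   have sw: "sg (pos i ?T) ** sg (pos l S) = \<ominus> (sg (pos l ?T) ** sg (pos i (?T - {l})))"
    using sg_swap[OF T, of i l] l li unfolding eq(1) by simp
   have "sg (pos l S) ** sg (pos i (?T - {l})) = sg (pos i ?T) ** ((sg (pos i ?T) ** sg (pos l S)) ** sg (pos i (?T - {l})))"
    by (simp add: m_assoc sg_sg_cancel)
   also have "\<dots> = (\<ominus> sg (pos i ?T)) ** sg (pos l ?T)"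
    unfolding sw by (simp add: l_minus r_minus m_assoc)
   finally have s: "sg (pos l S) ** sg (pos i (?T - {l})) = (\<ominus> sg (pos i ?T)) ** sg (pos l ?T)" .
   have "sg (pos l S) ** (y l ** ?v (S - {l}) k) = (sg (pos l S) ** sg (pos i (?T - {l}))) ** (y l ** w (?T - {l}) k)"
    using False y w unfolding eq by (simp add: m_ac)
   thus ?thesis unfolding s using y w by (simp add: m_assoc)
  qed
  have "dlt y ?v S k = (\<Oplus>l\<in>S. (\<ominus> sg (pos i ?T)) ** (sg (pos l ?T) ** (y l ** w (?T - {l}) k)))"
   unfolding dlt_def[of y ?v] by (rule finsum_cong') (use e y w in auto)
  also have "\<dots> = (\<ominus> sg (pos i ?T)) ** (\<Oplus>l\<in>S. sg (pos l ?T) ** (y l ** w (?T - {l}) k))"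
   using S y w by (simp add: finsum_rdistr)
  \<comment> \<open>The cocycle condition at \<open>insert i S\<close> enters here: it expresses the
    sum over \<open>S\<close> by the summand of \<open>i\<close>.\<close>
  also have "(\<Oplus>l\<in>S. sg (pos l ?T) ** (y l ** w (?T - {l}) k)) = \<ominus> (sg (pos i ?T) ** (y i ** w S k))"
  proof -
   have "dlt y w ?T k = sg (pos i ?T) ** (y i ** w (?T - {i}) k) \<oplus> (\<Oplus>l\<in>S. sg (pos l ?T) ** (y l ** w (?T - {l}) k))"
    unfolding dlt_def by (rule finsum_insert) (use S False y w in auto)
   moreover have "?T - {i} = S" using False by auto
   moreover have "(\<Oplus>l\<in>S. sg (pos l ?T) ** (y l ** w (?T - {l}) k)) \<in> carrier R"
    by (rule finsum_closed) (use y w in auto)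
   ultimately show ?thesis using w0 y w minus_equality[of "\<Oplus>l\<in>S. sg (pos l ?T) ** (y l ** w (?T - {l}) k)"]
    by (simp add: a_comm)
  qed
  also have "(\<ominus> sg (pos i ?T)) ** (\<ominus> (sg (pos i ?T) ** (y i ** w S k))) = y i ** w S k"
   using y w by (simp add: l_minus r_minus sg_sg_cancel)
  finally show ?thesis .
 qed
qed

definition mult_on :: "(nat => 'a) => nat set => 'a" where "mult_on \<mu> S = (\<Otimes>i\<in>S. \<mu> i)"

lemma mult_on_closed [simp]: "(!!i. \<mu> i \<in> carrier R) ==> mult_on \<mu> S \<in> carrier R"
 unfolding mult_on_def by (rule finprod_closed) auto

lemma mult_on_remove:
 "finite S ==> i \<in> S ==> (!!i. \<mu> i \<in> carrier R) ==> mult_on \<mu> S = \<mu> i ** mult_on \<mu> (S - {i})"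
 unfolding mult_on_def
 by (subst insert_Diff[of i S, symmetric], simp, rule finprod_insert) auto

text \<open>The factor \<open>\<mu> i\<close> missing in the product over \<open>S - {i}\<close> is
  supplied by the new differential. These are the transition maps between Koszul complexes of
  different powers of the parameters.\<close>

lemma dlt_mult_on:
 assumes y: "!!i. y i \<in> carrier R" and \<mu>: "!!i. \<mu> i \<in> carrier R" and w: "!!S k. w S k \<in> carrier R" and S: "finite S"
 shows "dlt (\<lambda>i. y i ** \<mu> i) (\<lambda>S k. mult_on \<mu> S ** w S k) S k = mult_on \<mu> S ** dlt y w S k"
proof -
 have "dlt (\<lambda>i. y i ** \<mu> i) (\<lambda>S k. mult_on \<mu> S ** w S k) S k
   = (\<Oplus>i\<in>S. mult_on \<mu> S ** (sg (pos i S) ** (y i ** w (S - {i}) k)))"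
  unfolding dlt_def
 proof (rule finsum_cong')
  fix i assume i: "i \<in> S"
  show "sg (pos i S) ** (y i ** \<mu> i ** (mult_on \<mu> (S - {i}) ** w (S - {i}) k))
    = mult_on \<mu> S ** (sg (pos i S) ** (y i ** w (S - {i}) k))"
   unfolding mult_on_remove[OF S i \<mu>] using y \<mu> w by (simp add: m_ac)
 qed (use y \<mu> w in auto)
 also have "\<dots> = mult_on \<mu> S ** dlt y w S k"
  unfolding dlt_def using S y \<mu> w by (simp add: finsum_rdistr Pi_def)
 finally show ?thesis .
qed

definition mv :: "'k set => ('k => 'k => 'a) => ('k => 'a) => 'k => 'a" where
 "mv K A v k = (\<Oplus>l\<in>K. A k l ** v l)"

lemma mv_closed [simp]: "(!!k l. A k l \<in> carrier R) ==> (!!l. v l \<in> carrier R) ==> mv K A v k \<in> carrier R"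
 unfolding mv_def by (rule finsum_closed) auto

lemma mv_cong: "(!!l. l \<in> K ==> v l = v' l) ==> (!!k l. A k l \<in> carrier R) ==> (!!l. v' l \<in> carrier R) ==> mv K A v k = mv K A v' k"
 unfolding mv_def by (rule finsum_cong') auto

lemma mv_mv:
 assumes "finite K" "!!k l. A k l \<in> carrier R" "!!k l. B k l \<in> carrier R" "!!l. v l \<in> carrier R"
 shows "mv K A (mv K B v) k = (\<Oplus>m\<in>K. (\<Oplus>l\<in>K. A k l ** B l m) ** v m)"
proof -
 have "mv K A (mv K B v) k = (\<Oplus>l\<in>K. \<Oplus>m\<in>K. (A k l ** B l m) ** v m)"
  unfolding mv_def by (rule finsum_cong') (use assms in \<open>auto simp: finsum_rdistr m_assoc Pi_def\<close>)
 also have "\<dots> = (\<Oplus>m\<in>K. \<Oplus>l\<in>K. (A k l ** B l m) ** v m)"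
  by (rule finsum_swap) (use assms in auto)
 also have "\<dots> = (\<Oplus>m\<in>K. (\<Oplus>l\<in>K. A k l ** B l m) ** v m)"
  by (rule finsum_cong') (use assms in \<open>auto simp: finsum_ldistr Pi_def\<close>)
 finally show ?thesis .
qed

lemma mv_add:
 "finite K ==> (!!k l. A k l \<in> carrier R) ==> (!!l. v l \<in> carrier R) ==> (!!l. w l \<in> carrier R) ==>
  mv K A (\<lambda>l. v l \<oplus> w l) k = mv K A v k \<oplus> mv K A w k"
 unfolding mv_def by (simp add: r_distr finsum_addf)

lemma mv_smult:
 "finite K ==> (!!k l. A k l \<in> carrier R) ==> (!!l. v l \<in> carrier R) ==> r \<in> carrier R ==>
  mv K A (\<lambda>l. r ** v l) k = r ** mv K A v k"
 unfolding mv_def by (simp add: finsum_rdistr m_lcomm Pi_def)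

lemma mv_finsum:
 assumes "finite K" "finite S" "!!k l. A k l \<in> carrier R" "!!i l. v i l \<in> carrier R"
 shows "mv K A (\<lambda>l. \<Oplus>i\<in>S. v i l) k = (\<Oplus>i\<in>S. mv K A (v i) k)"
proof -
 have "mv K A (\<lambda>l. \<Oplus>i\<in>S. v i l) k = (\<Oplus>l\<in>K. \<Oplus>i\<in>S. A k l ** v i l)"
  unfolding mv_def by (rule finsum_cong') (use assms in \<open>auto simp: finsum_rdistr Pi_def\<close>)
 thus ?thesis unfolding mv_def using assms finsum_swap[of K S "\<lambda>l i. A k l ** v i l"] by simp
qed

end

text \<open>A complex of free modules with basis \<open>K\<close>: \<open>\<phi> k\<close> is the image of the basis element \<open>k\<close>.\<close>

locale free_complex = cring R for R :: "('a, 'm) ring_scheme" (structure) +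
 fixes d :: nat and K :: "'k set" and deg :: "'k => nat" and \<phi> :: "'k => 'k => 'a"
 assumes fin: "finite K" and \<phi>_closed [simp]: "\<phi> k l \<in> carrier R"
  and \<phi>_deg: "k \<in> K ==> l \<in> K ==> deg k ~= Suc (deg l) ==> \<phi> k l = \<zero>"
  and \<phi>\<phi>: "k \<in> K ==> n \<in> K ==> (\<Oplus>l\<in>K. \<phi> k l ** \<phi> l n) = \<zero>"
begin

text \<open>\<open>mv K \<phi>\<close> applies the transposed maps: the coefficients lie in the dual
  complex, and the degree goes up. The sign makes \<open>par\<close> anticommute with
  \<open>dlt\<close>, so that \<open>Dk\<close> squares to zero.\<close>

definition par :: "(nat set => 'k => 'a) => nat set => 'k => 'a" where
 "par w S k = sg (card S) ** mv K \<phi> (w S) k"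

definition Dk :: "(nat => 'a) => (nat set => 'k => 'a) => nat set => 'k => 'a" where
 "Dk y w S k = dlt y w S k \<oplus> par w S k"

definition homog :: "nat => (nat set => 'k => 'a) => bool" where
 "homog c w \<longleftrightarrow> (\<forall>S k. S \<subseteq> {..<d} --> k \<in> K --> card S + deg k ~= c --> w S k = \<zero>)"

lemma par_in_carrier [simp]: "(!!S k. w S k \<in> carrier R) ==> par w S k \<in> carrier R"
 by (simp add: par_def)

lemma Dk_in_carrier [simp]: "(!!i. y i \<in> carrier R) ==> (!!S k. w S k \<in> carrier R) ==> Dk y w S k \<in> carrier R"
 by (simp add: Dk_def)

lemma mv_zero: "(!!l. l \<in> K ==> v l = \<zero>) ==> (!!k l. A k l \<in> carrier R) ==> mv K A v k = \<zero>"
 unfolding mv_def by (rule finsum_zero') simp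

lemma par_add: "(!!S k. w S k \<in> carrier R) ==> (!!S k. v S k \<in> carrier R) ==> par (\<lambda>S k. w S k \<oplus> v S k) S k = par w S k \<oplus> par v S k"
 unfolding par_def by (simp add: mv_add[OF fin] r_distr)

lemma par_smult: "(!!S k. w S k \<in> carrier R) ==> r \<in> carrier R ==> par (\<lambda>S k. r ** w S k) S k = r ** par w S k"
 unfolding par_def by (simp add: mv_smult[OF fin] m_lcomm)

lemma Dk_lin:
 assumes "!!i. y i \<in> carrier R" "!!S k. w S k \<in> carrier R" "!!S k. v S k \<in> carrier R" "r \<in> carrier R" "finite S"
 shows "Dk y (\<lambda>S k. w S k \<oplus> r ** v S k) S k = Dk y w S k \<oplus> r ** Dk y v S k"
 unfolding Dk_def using assms
 by (simp add: dlt_add dlt_smult par_add par_smult r_distr a_ac)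

lemma Dk_Dk:
 assumes y: "!!i. y i \<in> carrier R" and w: "!!S k. w S k \<in> carrier R" and S: "finite S" and k: "k \<in> K"
 shows "Dk y (Dk y w) S k = \<zero>"
proof -
 have c: "dlt y w S k \<in> carrier R" "par w S k \<in> carrier R" for S k using y w by simp_all
 have "dlt y (Dk y w) S k = dlt y (dlt y w) S k \<oplus> dlt y (par w) S k"
  unfolding Dk_def[abs_def] by (rule dlt_add) (use y c S in auto)
 also have "dlt y (dlt y w) S k = \<zero>" by (rule dlt_dlt) (use y w S in auto)
 also have "\<zero> \<oplus> dlt y (par w) S k = dlt y (par w) S k" using y c by simp
 finally have 1: "dlt y (Dk y w) S k = dlt y (par w) S k" .
 have "par (Dk y w) S k = par (dlt y w) S k \<oplus> par (par w) S k"
  unfolding Dk_def[abs_def] by (rule par_add) (use c in auto)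
 also have "par (par w) S k = \<zero>"
 proof -
  have "mv K \<phi> (mv K \<phi> (w S)) k = (\<Oplus>m\<in>K. (\<Oplus>l\<in>K. \<phi> k l ** \<phi> l m) ** w S m)"
   by (rule mv_mv[OF fin]) (use w in auto)
  also have "\<dots> = \<zero>" by (rule finsum_zero') (use \<phi>\<phi>[OF k] w in auto)
  finally show ?thesis unfolding par_def by (simp add: mv_smult[OF fin] w)
 qed
 finally have 2: "par (Dk y w) S k = par (dlt y w) S k" using c by simp
 \<comment> \<open>Removing \<open>i\<close> changes the parity of the cardinality, whence the minus
   sign between \<open>par\<close> and \<open>dlt\<close>.\<close>
 have e: "sg (card S) ** (sg (pos i S) ** (y i ** mv K \<phi> (w (S - {i})) k)) = \<ominus> (sg (pos i S) ** (y i ** par w (S - {i}) k))"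
  if i: "i \<in> S" for i
 proof -
  have "card S = Suc (card (S - {i}))" using i S by (metis card_Suc_Diff1)
  thus ?thesis unfolding par_def using y w by (simp add: sg_Suc l_minus r_minus m_lcomm)
 qed
 have "mv K \<phi> (dlt y w S) k = (\<Oplus>i\<in>S. mv K \<phi> (\<lambda>l. sg (pos i S) ** (y i ** w (S - {i}) l)) k)"
  unfolding dlt_def[abs_def] by (rule mv_finsum[OF fin S]) (use y w in auto)
 also have "\<dots> = (\<Oplus>i\<in>S. sg (pos i S) ** (y i ** mv K \<phi> (w (S - {i})) k))"
  by (rule finsum_cong') (use y w in \<open>auto simp: mv_smult[OF fin]\<close>)
 finally have "par (dlt y w) S k = (\<Oplus>i\<in>S. sg (card S) ** (sg (pos i S) ** (y i ** mv K \<phi> (w (S - {i})) k)))"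
  unfolding par_def using S y w by (simp add: finsum_rdistr Pi_def)
 also have "\<dots> = (\<Oplus>i\<in>S. \<ominus> (sg (pos i S) ** (y i ** par w (S - {i}) k)))"
  by (rule finsum_cong') (use e y w in auto)
 finally have "dlt y (par w) S k \<oplus> par (dlt y w) S k
   = (\<Oplus>i\<in>S. sg (pos i S) ** (y i ** par w (S - {i}) k) \<oplus> \<ominus> (sg (pos i S) ** (y i ** par w (S - {i}) k)))"
  unfolding dlt_def using y c(2) by (simp add: finsum_addf)
 also have "\<dots> = \<zero>" by (rule finsum_zero') (use y c(2) in \<open>auto simp: r_neg\<close>)
 finally show ?thesis unfolding Dk_def[of y "Dk y w"] 1 2 .
qed

lemma sub_finite: "S \<subseteq> {..<d} ==> finite S" using finite_subset finite_lessThan by blast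

lemma dlt_zero: "(!!i. i \<in> S ==> w (S - {i}) k = \<zero>) ==> (!!i. y i \<in> carrier R) ==> dlt y w S k = \<zero>"
 unfolding dlt_def by (rule finsum_zero') auto

lemma homog_Dk:
 assumes y: "!!i. y i \<in> carrier R" and w: "!!S k. w S k \<in> carrier R" "homog c w" shows "homog (Suc c) (Dk y w)"
 unfolding homog_def
proof (intro allI impI)
 fix S k assume S: "S \<subseteq> {..<d}" and k: "k \<in> K" and ne: "card S + deg k ~= Suc c"
 have "w (S - {i}) k = \<zero>" if i: "i \<in> S" for i
 proof -
  have "card S = Suc (card (S - {i}))" using i sub_finite[OF S] by (metis card_Suc_Diff1)
  moreover have "S - {i} \<subseteq> {..<d}" using S by blast
  ultimately show ?thesis using w(2) k ne unfolding homog_def by (metis add_Suc)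
 qed
 hence "dlt y w S k = \<zero>" by (intro dlt_zero) (use y in auto)
 moreover have "mv K \<phi> (w S) k = \<zero>"
  unfolding mv_def
 proof (rule finsum_zero')
  fix l assume l: "l \<in> K"
  show "\<phi> k l ** w S l = \<zero>"
   using \<phi>_deg[OF k l] w S l ne unfolding homog_def by (cases "deg k = Suc (deg l)") auto
 qed
 ultimately show "Dk y w S k = \<zero>" by (simp add: Dk_def par_def)
qed

lemma Dk_mult_on:
 assumes y: "!!i. y i \<in> carrier R" and \<mu>: "!!i. \<mu> i \<in> carrier R" and w: "!!S k. w S k \<in> carrier R" and S: "finite S"
 shows "Dk (\<lambda>i. y i ** \<mu> i) (\<lambda>S k. mult_on \<mu> S ** w S k) S k = mult_on \<mu> S ** Dk y w S k"
proof -
 have "par (\<lambda>S k. mult_on \<mu> S ** w S k) S k = mult_on \<mu> S ** par w S k"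
  unfolding par_def using w \<mu> by (simp add: mv_smult[OF fin] m_lcomm)
 thus ?thesis
  unfolding Dk_def dlt_mult_on[OF assms] using y \<mu> w par_in_carrier[OF w] by (simp add: r_distr)
qed

lemma Dk_cong:
 assumes "!!T l. T \<subseteq> S ==> l \<in> K ==> w T l = w' T l" "!!S k. w' S k \<in> carrier R" "!!i. y i \<in> carrier R" "k \<in> K"
 shows "Dk y w S k = Dk y w' S k"
proof -
 have "dlt y w S k = dlt y w' S k"
  unfolding dlt_def by (rule finsum_cong') (use assms in auto)
 moreover have "mv K \<phi> (w S) k = mv K \<phi> (w' S) k" by (rule mv_cong) (use assms in auto)
 ultimately show ?thesis by (simp add: Dk_def par_def)
qed

end

text \<open>For \<open>i < d\<close>, multiplication by \<open>x i\<close> is homotopic to zero in degrees \<open>> i\<close>, via \<open>h i\<close>.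
 A cochain \<open>w\<close> at level \<open>t\<close> stands for \<open>w S k / (\<Prod>i\<in>S. x i)\<^sup>t\<close>, and \<open>push\<close> subtracts from
 \<open>w\<close> the image of its coboundary under the resulting contraction.\<close>

locale koszul = free_complex R d K deg \<phi>
 for R :: "('a, 'm) ring_scheme" (structure) and d :: nat and K :: "'k set" and deg :: "'k => nat"
  and \<phi> :: "'k => 'k => 'a" +
 fixes h :: "nat => 'k => 'k => 'a" and x :: "nat => 'a"
 assumes h_closed [simp]: "h i k l \<in> carrier R"
  and x_closed [simp]: "x i \<in> carrier R" and x_d: "x d = \<one>"
  and h_deg: "k \<in> K ==> l \<in> K ==> deg l ~= Suc (deg k) ==> h i k l = \<zero>"
  and homotopy: "i \<le> d ==> k \<in> K ==> n \<in> K ==> i < deg k ==> deg k \<le> Suc d ==>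
   (\<Oplus>l\<in>K. \<phi> k l ** h i l n) \<oplus> (\<Oplus>l\<in>K. h i k l ** \<phi> l n) = (if k = n then x i else \<zero>)"
begin

text \<open>In total degree \<open>Suc d\<close> the coefficient degree is
  \<open>Suc d - card S\<close>, which exceeds \<open>Min S\<close>; so the homotopy for
  \<open>Min S\<close> is available there. For the empty set the degree is \<open>Suc d\<close>, and
  the index \<open>d\<close> with \<open>x d = \<one>\<close> takes over.\<close>

definition idx :: "nat set => nat" where "idx S = (if S = {} then d else Min S)"

text \<open>The homotopy for \<open>idx S\<close> only produces the factor \<open>x (idx S)\<close>;
  the product over the other indices completes it to \<open>mult_on x S\<close>.\<close>

definition sh :: "(nat set => 'k => 'a) => nat set => 'k => 'a" where
 "sh w S k = sg (card S) ** (mult_on x (S - {idx S}) ** mv K (h (idx S)) (w S) k)"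

definition push :: "(nat => 'a) => (nat set => 'k => 'a) => nat set => 'k => 'a" where
 "push y w S k = mult_on x S ** w S k \<ominus> sh (Dk y w) S k"

lemma sh_in_carrier [simp]: "(!!S k. w S k \<in> carrier R) ==> sh w S k \<in> carrier R"
 by (simp add: sh_def)

lemma push_in_carrier [simp]: "(!!i. y i \<in> carrier R) ==> (!!S k. w S k \<in> carrier R) ==> push y w S k \<in> carrier R"
 by (simp add: push_def)

lemma homog_push:
 assumes y: "!!i. y i \<in> carrier R" and w: "!!S k. w S k \<in> carrier R" "homog c w" shows "homog c (push y w)"
 unfolding homog_def
proof (intro allI impI)
 fix S k assume S: "S \<subseteq> {..<d}" and k: "k \<in> K" and ne: "card S + deg k ~= c"
 have "w S k = \<zero>" using w(2) S k ne unfolding homog_def by blast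
 moreover have "mv K (h (idx S)) (Dk y w S) k = \<zero>"
  unfolding mv_def
 proof (rule finsum_zero')
  fix l assume l: "l \<in> K"
  show "h (idx S) k l ** Dk y w S l = \<zero>"
  proof (cases "deg l = Suc (deg k)")
   case True
   hence "Dk y w S l = \<zero>" using homog_Dk[OF y w] S l ne unfolding homog_def by auto
   thus ?thesis by simp
  next
   case False
   thus ?thesis using h_deg[OF k l] Dk_in_carrier[OF y w(1)] by simp
  qed
 qed
 ultimately show "push y w S k = \<zero>" by (simp add: push_def sh_def minus_eq)
qed

text \<open>The sign of \<open>sh\<close> cancels that of \<open>par\<close>, and what remains is
  the homotopy identity for \<open>idx S\<close>. Where the total degree is not
  \<open>Suc d\<close>, both sides vanish.\<close>

lemma contraction:
 assumes v: "!!S k. v S k \<in> carrier R" "homog (Suc d) v" and S: "S \<subseteq> {..<d}" and k: "k \<in> K"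
 shows "par (sh v) S k \<oplus> sh (par v) S k = mult_on x S ** v S k"
proof -
 let ?i = "idx S" let ?c = "mult_on x (S - {?i})"
 define A where "A n = (\<Oplus>l\<in>K. \<phi> k l ** h ?i l n)" for n
 define B where "B n = (\<Oplus>l\<in>K. h ?i k l ** \<phi> l n)" for n
 have AB: "A n \<in> carrier R" "B n \<in> carrier R" for n unfolding A_def B_def by (auto intro!: finsum_closed)
 have vc: "v S n \<in> carrier R" for n using v(1) by simp
 have 1: "mv K \<phi> (mv K (h ?i) (v S)) k = (\<Oplus>n\<in>K. A n ** v S n)"
  unfolding A_def by (rule mv_mv[OF fin]) (use vc in auto)
 have 2: "mv K (h ?i) (mv K \<phi> (v S)) k = (\<Oplus>n\<in>K. B n ** v S n)"
  unfolding B_def by (rule mv_mv[OF fin]) (use vc in auto)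
 have "par (sh v) S k = ?c ** mv K \<phi> (mv K (h ?i) (v S)) k"
  unfolding par_def sh_def using vc by (simp add: mv_smult[OF fin] sg_sg_cancel)
 moreover have "sh (par v) S k = ?c ** mv K (h ?i) (mv K \<phi> (v S)) k"
  unfolding par_def sh_def using vc by (simp add: mv_smult[OF fin] m_lcomm[of "mult_on _ _"] sg_sg_cancel)
 ultimately have "par (sh v) S k \<oplus> sh (par v) S k = ?c ** ((\<Oplus>n\<in>K. A n ** v S n) \<oplus> (\<Oplus>n\<in>K. B n ** v S n))"
  unfolding 1 2 using AB vc by (simp add: r_distr Pi_def)
 also have "(\<Oplus>n\<in>K. A n ** v S n) \<oplus> (\<Oplus>n\<in>K. B n ** v S n) = (\<Oplus>n\<in>K. (A n \<oplus> B n) ** v S n)"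
  using AB vc by (simp add: finsum_addf l_distr Pi_def)
 also have "\<dots> = x ?i ** v S k"
 proof (cases "card S + deg k = Suc d")
  case True
  \<comment> \<open>\<open>S\<close> is contained in \<open>{Min S..<d}\<close>, so it has at most
    \<open>d - Min S\<close> elements, and \<open>deg k = Suc d - card S\<close> is larger than
    \<open>Min S\<close>.\<close>
  have i: "?i \<le> d" "?i < deg k"
  proof -
   have "S \<subseteq> {Min S..<d}" if "S ~= {}" using S sub_finite[OF S] by auto
   hence "card S \<le> d - Min S" if "S ~= {}" using card_mono[of "{Min S..<d}" S] that by simp
   moreover have "Min S < d" if "S ~= {}" using Min_in[OF sub_finite[OF S] that] S by auto
   ultimately have "?i \<le> d \<and> ?i < deg k" using True by (cases "S = {}") (simp_all add: idx_def)
   thus "?i \<le> d" "?i < deg k" by simp_all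
  qed
  have "(\<Oplus>n\<in>K. (A n \<oplus> B n) ** v S n) = (\<Oplus>n\<in>K. if k = n then x ?i ** v S n else \<zero>)"
  proof (rule finsum_cong')
   fix n assume n: "n \<in> K"
   have "A n \<oplus> B n = (if k = n then x ?i else \<zero>)"
    unfolding A_def B_def by (rule homotopy[OF i(1) k n i(2)]) (use True in simp)
   thus "(A n \<oplus> B n) ** v S n = (if k = n then x ?i ** v S n else \<zero>)" using vc by simp
  qed (use vc in auto)
  also have "\<dots> = x ?i ** v S k" by (rule finsum_singleton[OF k fin]) (use vc in auto)
  finally show ?thesis .
 next
  case False
  hence "v S k = \<zero>" using v(2) S k unfolding homog_def by blast
  moreover have "(A n \<oplus> B n) ** v S n = \<zero>" if n: "n \<in> K" for n
  proof (cases "deg n = deg k")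
   case True
   hence "v S n = \<zero>" using v(2) S n False unfolding homog_def by auto
   thus ?thesis using AB by simp
  next
   case ne: False
   have "A n = \<zero>" unfolding A_def
   proof (rule finsum_zero')
    fix l assume l: "l \<in> K"
    show "\<phi> k l ** h ?i l n = \<zero>"
     using \<phi>_deg[OF k l] h_deg[OF l n, of ?i] ne by (cases "deg k = Suc (deg l)") auto
   qed
   moreover have "B n = \<zero>" unfolding B_def
   proof (rule finsum_zero')
    fix l assume l: "l \<in> K"
    show "h ?i k l ** \<phi> l n = \<zero>"
     using h_deg[OF k l, of ?i] \<phi>_deg[OF l n] ne by (cases "deg l = Suc (deg k)") auto
   qed
   ultimately show ?thesis using vc by simp
  qed
  ultimately show ?thesis using finsum_zero'[of K] by simp
 qed
 also have "?c ** (x ?i ** v S k) = mult_on x S ** v S k"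
 proof (cases "S = {}")
  case True thus ?thesis using vc by (simp add: idx_def x_d mult_on_def)
 next
  case False
  hence "?i \<in> S" using Min_in[OF sub_finite[OF S]] by (simp add: idx_def)
  thus ?thesis using mult_on_remove[OF sub_finite[OF S], of ?i x] vc by (simp add: m_ac)
 qed
 finally show ?thesis .
qed

text \<open>Put \<open>v = Dk y w\<close>, which vanishes on sets of fewer than \<open>r\<close>
  elements. At \<open>card S = r\<close> the Koszul parts of \<open>sh v\<close> and of
  \<open>v\<close> vanish; so \<open>Dk y v = \<zero>\<close> gives \<open>par v = \<zero>\<close>,
  and \<open>contraction\<close> says that the differential of \<open>sh v\<close> is
  \<open>mult_on x S ** v\<close>, which is what has to be subtracted.\<close>

lemma push_step:
 assumes y: "!!i. y i \<in> carrier R" and w: "!!S k. w S k \<in> carrier R" "homog d w"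
  and van: "!!S k. S \<subseteq> {..<d} ==> card S < r ==> k \<in> K ==> Dk y w S k = \<zero>"
  and S: "S \<subseteq> {..<d}" "card S < Suc r" and k: "k \<in> K"
 shows "Dk (\<lambda>i. y i ** x i) (push y w) S k = \<zero>"
proof -
 define v where "v = Dk y w"
 let ?y = "\<lambda>i. y i ** x i" let ?w = "\<lambda>S k. mult_on x S ** w S k"
 have yc: "?y i \<in> carrier R" for i using y by simp
 have vc: "v S k \<in> carrier R" for S k unfolding v_def using y w by simp
 have wc: "?w S k \<in> carrier R" for S k using w(1) by simp
 have Sf: "finite S" by (rule sub_finite[OF S(1)])
 have v0: "v (S - {i}) l = \<zero>" if "i \<in> S" "l \<in> K" for i l
  unfolding v_def using that S card_Diff1_less[OF Sf that(1)] by (intro van) auto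
 have m1: "\<ominus> \<one> \<in> carrier R" by simp
 have "push y w = (\<lambda>S k. ?w S k \<oplus> (\<ominus> \<one>) ** sh v S k)"
  using vc unfolding v_def by (intro ext) (simp add: push_def minus_eq l_minus)
 hence "Dk ?y (push y w) S k = Dk ?y ?w S k \<oplus> (\<ominus> \<one>) ** Dk ?y (sh v) S k"
  using Dk_lin[of ?y ?w "sh v" "\<ominus> \<one>" S k] yc wc vc m1 Sf by simp
 also have "Dk ?y ?w S k = mult_on x S ** v S k"
  unfolding v_def by (rule Dk_mult_on) (use y w(1) Sf in auto)
 finally have "Dk ?y (push y w) S k = mult_on x S ** v S k \<oplus> (\<ominus> \<one>) ** Dk ?y (sh v) S k" .
 moreover have "Dk ?y (sh v) S k = mult_on x S ** v S k"
 proof -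
  have "sh v (S - {i}) k = \<zero>" if "i \<in> S" for i
   unfolding sh_def using mv_zero[of "v (S - {i})"] v0[OF that] by simp
  hence 1: "dlt ?y (sh v) S k = \<zero>" by (intro dlt_zero) (use yc in auto)
  have "par v S l = \<zero>" if l: "l \<in> K" for l
  proof -
   have "dlt y v S l = \<zero>" by (rule dlt_zero) (use v0 l y in auto)
   moreover have "Dk y v S l = \<zero>" unfolding v_def by (rule Dk_Dk) (use y w Sf l in auto)
   ultimately show ?thesis using vc by (simp add: Dk_def)
  qed
  hence 2: "sh (par v) S k = \<zero>" unfolding sh_def using mv_zero[of "par v S"] by simp
  have "homog (Suc d) v" unfolding v_def by (rule homog_Dk) (use y w in auto)
  hence "par (sh v) S k = mult_on x S ** v S k"
   using contraction[of v S k] vc S(1) k 2 by simp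
  thus ?thesis using 1 vc by (simp add: Dk_def)
 qed
 ultimately show ?thesis using vc by (simp add: l_minus r_neg)
qed

text \<open>\<open>pushn n w\<close> lives at level \<open>Suc n\<close>, starting from level 1:
  each push raises the exponent of the parameters by one.\<close>

fun pushn :: "nat => (nat set => 'k => 'a) => nat set => 'k => 'a" where
 "pushn 0 w = w"
| "pushn (Suc n) w = push (\<lambda>i. x i [^] Suc n) (pushn n w)"

lemma pushn_in_carrier [simp]: "(!!S k. w S k \<in> carrier R) ==> pushn n w S k \<in> carrier R"
proof (induction n arbitrary: S k)
 case (Suc n)
 show ?case unfolding pushn.simps by (rule push_in_carrier) (use Suc in auto)
qed simp

text \<open>Each push gains one cardinality. Those of subsets of \<open>{..<d}\<close> run from 0 to
  \<open>d\<close>, so \<open>d + 1\<close> pushes suffice and lead to level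
  \<open>d + 2\<close>.\<close>

lemma pushn_cocycle:
 assumes w: "!!S k. w S k \<in> carrier R" "homog d w" and S: "S \<subseteq> {..<d}" and k: "k \<in> K"
 shows "Dk (\<lambda>i. x i [^] (d + 2)) (pushn (Suc d) w) S k = \<zero>"
proof -
 have "homog d (pushn n w) \<and> (\<forall>S k. S \<subseteq> {..<d} --> card S < n --> k \<in> K --> Dk (\<lambda>i. x i [^] Suc n) (pushn n w) S k = \<zero>)" for n
 proof (induction n)
  case 0 thus ?case using w by simp
 next
  case (Suc n)
  let ?y = "\<lambda>i. x i [^] Suc n"
  have y: "?y i \<in> carrier R" for i by simp
  have "homog d (push ?y (pushn n w))" using Suc w by (intro homog_push) auto
  moreover have "Dk (\<lambda>i. ?y i ** x i) (push ?y (pushn n w)) S k = \<zero>"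
   if "S \<subseteq> {..<d}" "card S < Suc n" "k \<in> K" for S k
   by (rule push_step[where r=n]) (use Suc w(1) that in auto)
  ultimately show ?case by simp
 qed
 from this[of "Suc d"] show ?thesis using S k card_mono[of "{..<d}" S] by auto
qed

text \<open>For a cocycle the correction term of \<open>push\<close> is zero, and only the
  transition map remains.\<close>

lemma pushn_of_cocycle:
 assumes w: "!!S k. w S k \<in> carrier R" and cocycle: "!!S k. S \<subseteq> {..<d} ==> k \<in> K ==> Dk x w S k = \<zero>"
  and S: "S \<subseteq> {..<d}" and k: "k \<in> K"
 shows "pushn n w S k = mult_on x S [^] n ** w S k"
proof -
 have "(\<forall>S k. S \<subseteq> {..<d} --> k \<in> K --> pushn n w S k = mult_on x S [^] n ** w S k \<and>
   Dk (\<lambda>i. x i [^] Suc n) (pushn n w) S k = \<zero>)"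
 proof (induction n)
  case 0
  thus ?case using w cocycle by simp
 next
  case (Suc n)
  let ?y = "\<lambda>i. x i [^] Suc n"
  have y: "?y i \<in> carrier R" for i by simp
  have pc: "pushn n w S k \<in> carrier R" for S k using w by simp
  have p: "pushn (Suc n) w S k = mult_on x S ** pushn n w S k" if "S \<subseteq> {..<d}" for S k
  proof -
   have "sh (Dk ?y (pushn n w)) S k = \<zero>"
    unfolding sh_def using mv_zero[of "Dk ?y (pushn n w) S"] Suc that by simp
   thus ?thesis using pc by (simp add: push_def minus_eq)
  qed
  have c: "mult_on x S ** pushn n w S k \<in> carrier R" for S k using pc by simp
  have "Dk (\<lambda>i. x i [^] Suc (Suc n)) (pushn (Suc n) w) S k = \<zero>" if Sk: "S \<subseteq> {..<d}" "k \<in> K" for S k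
  proof -
   have "Dk (\<lambda>i. ?y i ** x i) (pushn (Suc n) w) S k = Dk (\<lambda>i. ?y i ** x i) (\<lambda>S k. mult_on x S ** pushn n w S k) S k"
    by (rule Dk_cong) (use p c Sk in auto)
   also have "\<dots> = mult_on x S ** Dk ?y (pushn n w) S k" by (rule Dk_mult_on) (use pc sub_finite[OF Sk(1)] in auto)
   also have "\<dots> = \<zero>" using Suc Sk by simp
   finally show ?thesis by simp
  qed
  moreover have "pushn (Suc n) w S k = mult_on x S [^] Suc n ** w S k" if Sk: "S \<subseteq> {..<d}" "k \<in> K" for S k
   unfolding p[OF Sk(1)] using Suc Sk w by (simp add: m_ac)
  ultimately show ?case by blast
 qed
 thus ?thesis using S k by blast
qed

section \<open>Linearity of the pushes\<close>

lemma sh_lin: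
 assumes "!!S k. w S k \<in> carrier R" "!!S k. v S k \<in> carrier R" "r \<in> carrier R"
 shows "sh (\<lambda>S k. w S k \<oplus> r ** v S k) S k = sh w S k \<oplus> r ** sh v S k"
proof -
 have "mv K (h (idx S)) (\<lambda>k. w S k \<oplus> r ** v S k) k = mv K (h (idx S)) (w S) k \<oplus> r ** mv K (h (idx S)) (v S) k"
  using assms by (simp add: mv_add[OF fin] mv_smult[OF fin])
 thus ?thesis unfolding sh_def using assms by (simp add: r_distr m_lcomm[of r])
qed

lemma sh_cong: "(!!k. k \<in> K ==> w S k = w' S k) ==> (!!S k. w' S k \<in> carrier R) ==> sh w S k = sh w' S k"
 unfolding sh_def using mv_cong[of K "w S" "w' S" "h (idx S)" k] by simp

lemma push_lin:
 assumes y: "!!i. y i \<in> carrier R" and w: "!!S k. w S k \<in> carrier R" "!!S k. v S k \<in> carrier R" and r: "r \<in> carrier R" and S: "finite S"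
 shows "push y (\<lambda>S k. w S k \<oplus> r ** v S k) S k = push y w S k \<oplus> r ** push y v S k"
proof -
 have D: "Dk y w S k \<in> carrier R" "Dk y v S k \<in> carrier R" for S k using y w by simp_all
 have "sh (Dk y (\<lambda>S k. w S k \<oplus> r ** v S k)) S k = sh (\<lambda>S k. Dk y w S k \<oplus> r ** Dk y v S k) S k"
  by (rule sh_cong) (use Dk_lin[of y w v r S] y w r S D in auto)
 also have "\<dots> = sh (Dk y w) S k \<oplus> r ** sh (Dk y v) S k" by (rule sh_lin) (use D r in auto)
 finally show ?thesis
  unfolding push_def using w r D
  by (simp add: minus_eq r_distr minus_add r_minus m_lcomm[of r] a_ac)
qed

lemma push_cong:
 assumes "!!T l. finite T ==> w T l = w' T l" "!!S k. w' S k \<in> carrier R" "!!i. y i \<in> carrier R" "finite S"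
 shows "push y w S k = push y w' S k"
proof -
 have "Dk y w S l = Dk y w' S l" if "l \<in> K" for l
  by (rule Dk_cong) (use assms that finite_subset in blast)+
 hence "sh (Dk y w) S k = sh (Dk y w') S k" by (rule sh_cong) (use assms in simp_all)
 thus ?thesis using assms by (simp add: push_def)
qed

lemma pushn_lin:
 assumes w: "!!S k. w S k \<in> carrier R" "!!S k. v S k \<in> carrier R" and r: "r \<in> carrier R" and S: "finite S"
 shows "pushn n (\<lambda>S k. w S k \<oplus> r ** v S k) S k = pushn n w S k \<oplus> r ** pushn n v S k"
 using S
proof (induction n arbitrary: S k)
 case (Suc n)
 let ?y = "\<lambda>i. x i [^] Suc n"
 have pc: "pushn n w S k \<in> carrier R" "pushn n v S k \<in> carrier R" for S k using w by simp_all
 have c: "pushn n w S k \<oplus> r ** pushn n v S k \<in> carrier R" for S k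
  using pc(1) pc(2) r by simp
 have y: "?y i \<in> carrier R" for i by simp
 have "pushn (Suc n) (\<lambda>S k. w S k \<oplus> r ** v S k) S k = push ?y (\<lambda>S k. pushn n w S k \<oplus> r ** pushn n v S k) S k"
  unfolding pushn.simps by (rule push_cong) (use Suc.IH Suc.prems c y in auto)
 also have "\<dots> = pushn (Suc n) w S k \<oplus> r ** pushn (Suc n) v S k"
  unfolding pushn.simps by (rule push_lin) (use y pc r Suc.prems in auto)
 finally show ?case .
qed simp

lemma pushn_finsum:
 assumes A: "finite A" and w: "!!c S k. w c S k \<in> carrier R" and a: "!!c. a c \<in> carrier R" and S: "finite S"
 shows "pushn n (\<lambda>S k. \<Oplus>c\<in>A. a c ** w c S k) S k = (\<Oplus>c\<in>A. a c ** pushn n (w c) S k)"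
 using A
proof (induction A rule: finite_induct)
 case empty
 have "pushn n (\<lambda>S k. \<zero>) S k = pushn n (\<lambda>S k. \<zero>) S k \<oplus> \<ominus> \<one> ** pushn n (\<lambda>S k. \<zero>) S k"
  using pushn_lin[of "\<lambda>S k. \<zero>" "\<lambda>S k. \<zero>" "\<ominus> \<one>" S n k] S by simp
 hence "pushn n (\<lambda>S k. \<zero>) S k = \<zero>" by (simp add: l_minus r_neg)
 thus ?case by simp
next
 case (insert c A)
 have c: "(\<Oplus>c\<in>A. a c ** w c S k) \<in> carrier R" for S k
  using w a by (auto intro!: finsum_closed)
 have "(\<lambda>S k. \<Oplus>c\<in>insert c A. a c ** w c S k) = (\<lambda>S k. (\<Oplus>c\<in>A. a c ** w c S k) \<oplus> a c ** w c S k)"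
 proof (intro ext)
  fix S k
  have "(\<Oplus>c\<in>A. a c ** w c S k) \<in> carrier R" using w a by (auto intro!: finsum_closed)
  thus "(\<Oplus>c\<in>insert c A. a c ** w c S k) = (\<Oplus>c\<in>A. a c ** w c S k) \<oplus> a c ** w c S k"
   using insert w a by (simp add: a_comm)
 qed
 hence "pushn n (\<lambda>S k. \<Oplus>c\<in>insert c A. a c ** w c S k) S k
   = pushn n (\<lambda>S k. \<Oplus>c\<in>A. a c ** w c S k) S k \<oplus> a c ** pushn n (w c) S k"
  using pushn_lin[of "\<lambda>S k. \<Oplus>c\<in>A. a c ** w c S k" "w c" "a c" S n k] c w a S by simp
 also have "\<dots> = (\<Oplus>c\<in>insert c A. a c ** pushn n (w c) S k)"
 proof -
  have pc: "pushn n (w b) S k \<in> carrier R" for b using w by simp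
  have "(\<Oplus>c\<in>A. a c ** pushn n (w c) S k) \<in> carrier R" using pc a by (auto intro!: finsum_closed)
  thus ?thesis using insert pc a by (simp add: a_comm)
 qed
 finally show ?case .
qed

end

section \<open>Compatibility with Frobenius\<close>

lemma (in char_p_ring) frobenius_finsum:
 assumes "finite A" "!!i. i \<in> A ==> f i \<in> carrier R"
 shows "(\<Oplus>i\<in>A. f i) [^] (p ^ e) = (\<Oplus>i\<in>A. f i [^] (p ^ e))"
 using assms
proof (induction A rule: finite_induct)
 case (insert a A)
 hence "f \<in> A \<rightarrow> carrier R" "f a \<in> carrier R" "(\<lambda>i. f i [^] (p ^ e)) \<in> A \<rightarrow> carrier R" by auto
 thus ?case using insert by (simp add: frobenius_add)
qed (simp add: frobenius_zero)

lemma (in char_p_ring) frobenius_sg: "sg n [^] (p ^ e) = sg n"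
proof -
 have "(\<ominus> \<one>) [^] (p ^ e) = \<ominus> \<one>"
  using frobenius_minus[of \<zero> \<one> e] frobenius_zero by (simp add: minus_eq)
 hence "((\<ominus> \<one>) [^] (p ^ e)) [^] n = (\<ominus> \<one>) [^] n" by simp
 thus ?thesis unfolding sg_def by (simp add: nat_pow_pow mult.commute)
qed

lemma (in cring) mult_on_pow:
 assumes "finite S" "!!i. \<mu> i \<in> carrier R" shows "mult_on \<mu> S [^] (n::nat) = mult_on (\<lambda>i. \<mu> i [^] n) S"
 using assms(1)
proof (induction S rule: finite_induct)
 case (insert a S)
 have m: "mult_on \<nu> (insert a S) = \<nu> a ** mult_on \<nu> S" if "!!i. \<nu> i \<in> carrier R" for \<nu>
  unfolding mult_on_def by (rule finprod_insert) (use insert(1,2) that in auto)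
 show ?case using insert(3) assms(2) m[of \<mu>] m[of "\<lambda>i. \<mu> i [^] n"] by (simp add: nat_pow_distrib)
qed (simp add: mult_on_def)

locale frobenius_koszul = koszul R d K deg \<phi> h x + char_p_ring R p
 for R :: "('a, 'm) ring_scheme" (structure) and d :: nat and K :: "'k set" and deg :: "'k => nat"
  and \<phi> :: "'k => 'k => 'a" and h :: "nat => 'k => 'k => 'a" and x :: "nat => 'a" and p :: nat +
 fixes k0 :: 'k
 assumes k0: "k0 \<in> K" "deg k0 = 0" and k0_unique: "k \<in> K ==> deg k = 0 ==> k = k0"
begin

text \<open>Frobenius is a ring homomorphism, so the equations for \<open>\<phi>\<close> and
  \<open>h\<close> persist when all entries, and with them the parameters, are raised to the
  \<open>q\<close>-th power.\<close>

lemma frobenius_twist: "koszul R d K deg (\<lambda>k l. \<phi> k l [^] (p ^ e)) (\<lambda>i k l. h i k l [^] (p ^ e)) (\<lambda>i. x i [^] (p ^ e))"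
proof
 let ?q = "p ^ e"
 have s: "(\<Oplus>l\<in>K. a l ** b l) [^] ?q = (\<Oplus>l\<in>K. a l [^] ?q ** b l [^] ?q)"
  if ab: "!!l. a l \<in> carrier R" "!!l. b l \<in> carrier R" for a b
  using frobenius_finsum[OF fin, of "\<lambda>l. a l ** b l" e] ab by (simp add: nat_pow_distrib)
 show "(\<Oplus>l\<in>K. \<phi> k l [^] ?q ** \<phi> l n [^] ?q) = \<zero>" if kn: "k \<in> K" "n \<in> K" for k n
  using s[of "\<phi> k" "\<lambda>l. \<phi> l n"] \<phi>\<phi>[OF kn] frobenius_zero by simp
 show "(\<Oplus>l\<in>K. \<phi> k l [^] ?q ** h i l n [^] ?q) \<oplus> (\<Oplus>l\<in>K. h i k l [^] ?q ** \<phi> l n [^] ?q)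
   = (if k = n then x i [^] ?q else \<zero>)"
  if A: "i \<le> d" "k \<in> K" "n \<in> K" "i < deg k" "deg k \<le> Suc d" for i k n
 proof -
  have c: "(\<Oplus>l\<in>K. \<phi> k l ** h i l n) \<in> carrier R" "(\<Oplus>l\<in>K. h i k l ** \<phi> l n) \<in> carrier R"
   by (auto intro!: finsum_closed)
  have "((\<Oplus>l\<in>K. \<phi> k l ** h i l n) \<oplus> (\<Oplus>l\<in>K. h i k l ** \<phi> l n)) [^] ?q = (if k = n then x i [^] ?q else \<zero>)"
   unfolding homotopy[OF A] using frobenius_zero by simp
  thus ?thesis
   unfolding frobenius_add[OF c] using s[of "\<phi> k" "\<lambda>l. h i l n"] s[of "h i k" "\<lambda>l. \<phi> l n"] by simp
 qed
qed (use fin x_d frobenius_zero \<phi>_deg h_deg in auto)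

text \<open>\<open>push\<close> is made of ring operations on the cochain and on the entries of
  \<open>\<phi>\<close>, \<open>h\<close> and \<open>x\<close>, all of which are twisted together;
  the signs are fixed by Frobenius.\<close>

lemma pushn_frobenius:
 assumes w: "!!S k. w S k \<in> carrier R" and S: "finite S"
 shows "koszul.pushn R d K (\<lambda>k l. \<phi> k l [^] (p ^ e)) (\<lambda>i k l. h i k l [^] (p ^ e)) (\<lambda>i. x i [^] (p ^ e)) n
   (\<lambda>S k. w S k [^] (p ^ e)) S k = pushn n w S k [^] (p ^ e)"
proof -
 let ?q = "p ^ e"
 interpret Q: koszul R d K deg "\<lambda>k l. \<phi> k l [^] ?q" "\<lambda>i k l. h i k l [^] ?q" "\<lambda>i. x i [^] ?q"
  by (rule frobenius_twist)
 have mvq: "mv K A v k [^] ?q = mv K (\<lambda>k l. A k l [^] ?q) (\<lambda>l. v l [^] ?q) k"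
  if "!!k l. A k l \<in> carrier R" "!!l. v l \<in> carrier R" for A v k
  unfolding mv_def using that by (simp add: frobenius_finsum[OF fin] nat_pow_distrib)
 have Dkq: "Dk y v S k [^] ?q = Q.Dk (\<lambda>i. y i [^] ?q) (\<lambda>S k. v S k [^] ?q) S k"
  if "!!i. y i \<in> carrier R" "!!S k. v S k \<in> carrier R" "finite S" for y v S k
 proof -
  have "dlt y v S k [^] ?q = dlt (\<lambda>i. y i [^] ?q) (\<lambda>S k. v S k [^] ?q) S k"
   unfolding dlt_def using that by (simp add: frobenius_finsum nat_pow_distrib frobenius_sg)
  moreover have "par v S k [^] ?q = Q.par (\<lambda>S k. v S k [^] ?q) S k"
   unfolding par_def Q.par_def using that by (simp add: nat_pow_distrib frobenius_sg mvq)
  ultimately show ?thesis unfolding Dk_def Q.Dk_def using that by (simp add: frobenius_add)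
 qed
 have pushq: "push y v S k [^] ?q = Q.push (\<lambda>i. y i [^] ?q) (\<lambda>S k. v S k [^] ?q) S k"
  if y: "!!i. y i \<in> carrier R" and v: "!!S k. v S k \<in> carrier R" and S: "finite S" for y v S k
 proof -
  have D: "Dk y v S l \<in> carrier R" for S l using y v by simp
  have "sh (Dk y v) S k [^] ?q = Q.sh (\<lambda>S k. Dk y v S k [^] ?q) S k"
   unfolding sh_def Q.sh_def using D S by (simp add: nat_pow_distrib frobenius_sg mvq mult_on_pow)
  also have "\<dots> = Q.sh (Q.Dk (\<lambda>i. y i [^] ?q) (\<lambda>S k. v S k [^] ?q)) S k"
   by (rule Q.sh_cong) (use Dkq[OF y v S] y v in auto)
  finally show ?thesis
   unfolding push_def Q.push_def using v y S D by (simp add: frobenius_minus nat_pow_distrib mult_on_pow)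
 qed
 show ?thesis
  using S
 proof (induction n arbitrary: S k)
  case (Suc n)
  let ?y = "\<lambda>i. x i [^] Suc n"
  have pc: "pushn n w S k \<in> carrier R" for S k using w by simp
  have "pushn (Suc n) w S k [^] ?q = Q.push (\<lambda>i. ?y i [^] ?q) (\<lambda>S k. pushn n w S k [^] ?q) S k"
   unfolding pushn.simps by (rule pushq) (use pc Suc.prems in auto)
  also have "\<dots> = Q.push (\<lambda>i. ?y i [^] ?q) (Q.pushn n (\<lambda>S k. w S k [^] ?q)) S k"
   by (rule Q.push_cong) (use Suc w in auto)
  also have "(\<lambda>i. ?y i [^] ?q) = (\<lambda>i. (x i [^] ?q) [^] Suc n)"
   by (simp only: nat_pow_pow[OF x_closed] mult.commute)
  finally show ?case by simp
 qed simp
qed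

definition unit_cochain :: "nat set \<times> 'k => nat set => 'k => 'a" where
 "unit_cochain c S k = (if (S, k) = c then \<one> else \<zero>)"

definition top_basis :: "(nat set \<times> 'k) set" where
 "top_basis = {(S, k). S \<subseteq> {..<d} \<and> k \<in> K \<and> card S + deg k = d}"

text \<open>The coefficient, at the full index set and in coefficient degree 0, of the cocycle
  pushed from the basis cochain \<open>c\<close>. The elements of the hull killed by
  \<open>I\<close> will be \<open>\<rho> c\<close> times \<open>\<eta> (d + 2)\<close>.\<close>

definition \<rho> :: "nat set \<times> 'k => 'a" where
 "\<rho> c = pushn (Suc d) (unit_cochain c) {..<d} k0"

lemma finite_top_basis: "finite top_basis"
 by (rule finite_subset[of _ "Pow {..<d} \<times> K"]) (auto simp: top_basis_def fin)

lemma unit_cochain_closed [simp]: "unit_cochain c S k \<in> carrier R"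
 by (simp add: unit_cochain_def)

lemma \<rho>_closed [simp]: "\<rho> c \<in> carrier R"
 by (simp add: \<rho>_def del: pushn.simps)

text \<open>Evaluate the cocycle condition at the full set and at \<open>k\<close>: the Koszul part
  is a combination of the \<open>x i ^ (d + 2)\<close>, and the other part is
  \<open>\<phi> k k0 ** \<rho> c\<close> up to sign, \<open>k0\<close> being the only basis element
  of degree 0.\<close>

lemma \<rho>_annihilated:
 assumes c: "c \<in> top_basis" and k: "k \<in> K" "deg k = 1"
 shows "\<phi> k k0 ** \<rho> c \<in> Idl ((\<lambda>i. x i [^] (d + 2)) ` {..<d})"
proof -
 define v where "v = pushn (Suc d) (unit_cochain c)"
 let ?S = "{..<d}" and ?y = "\<lambda>i. x i [^] (d + 2)"
 let ?J = "Idl (?y ` ?S)"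
 have v: "v S k \<in> carrier R" for S k unfolding v_def by (rule pushn_in_carrier) simp
 have J: "ideal ?J R" by (rule genideal_ideal) auto
 have "?y ` ?S \<subseteq> ?J" by (rule genideal_self) auto
 hence yJ: "?y i \<in> ?J" if "i < d" for i using that by blast
 have "homog d (unit_cochain c)" using c by (auto simp: homog_def unit_cochain_def top_basis_def)
 hence "Dk ?y v ?S k = \<zero>" unfolding v_def by (intro pushn_cocycle) (use k in auto)
 hence "dlt ?y v ?S k \<oplus> par v ?S k = \<zero>" by (simp add: Dk_def)
 moreover have "par v ?S k = sg d ** (\<phi> k k0 ** \<rho> c)"
 proof -
  have "mv K \<phi> (v ?S) k = (\<Oplus>l\<in>K. if k0 = l then \<phi> k l ** v ?S l else \<zero>)"
   unfolding mv_def
  proof (rule finsum_cong')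
   fix l assume l: "l \<in> K"
   show "\<phi> k l ** v ?S l = (if k0 = l then \<phi> k l ** v ?S l else \<zero>)"
   proof (cases "k0 = l")
    case False
    hence "\<phi> k l = \<zero>" using \<phi>_deg[OF k(1) l] k0_unique[OF l] k(2) by auto
    thus ?thesis using False v by simp
   qed simp
  qed (use v in auto)
  also have "\<dots> = \<phi> k k0 ** \<rho> c" unfolding \<rho>_def v_def[symmetric] by (rule finsum_singleton[OF k0(1) fin]) (use v in auto)
  finally show ?thesis by (simp add: par_def)
 qed
 moreover have dJ: "dlt ?y v ?S k \<in> ?J"
 proof -
  have "sg (pos i ?S) ** (?y i ** v (?S - {i}) k) \<in> ?J" if "i \<in> ?S" for i
   using idealD(5)[OF J idealD(6)[OF J yJ[of i] v] sg_closed] that by auto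
  thus ?thesis unfolding dlt_def by (rule finsum_in_ideal[OF J])
 qed
 ultimately have "dlt ?y v ?S k \<oplus> sg d ** (\<phi> k k0 ** \<rho> c) = \<zero>" by simp
 hence "sg d ** (\<phi> k k0 ** \<rho> c) = \<ominus> dlt ?y v ?S k"
  using minus_equality[of "sg d ** (\<phi> k k0 ** \<rho> c)" "dlt ?y v ?S k"] idealD(2)[OF J dJ] by (simp add: a_comm)
 hence "sg d ** (\<phi> k k0 ** \<rho> c) \<in> ?J" using idealD(7)[OF J dJ] by simp
 hence "sg d ** (sg d ** (\<phi> k k0 ** \<rho> c)) \<in> ?J" by (rule idealD(5)[OF J _ sg_closed])
 thus ?thesis by (simp add: sg_sg_cancel)
qed

text \<open>The twisted push of \<open>w\<close> is computed twice at the top: on a cocycle it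
  multiplies by a power of the product of the parameters, while by linearity and
  \<open>pushn_frobenius\<close> it is a combination of \<open>q\<close>-th powers of the
  \<open>\<rho> c\<close>.\<close>

lemma top_component:
 assumes w: "!!S k. w S k \<in> carrier R" "!!S k. (S, k) \<notin> top_basis ==> w S k = \<zero>"
  and cocycle: "!!S k. S \<subseteq> {..<d} ==> k \<in> K ==>
   dlt (\<lambda>i. x i [^] (p ^ e)) w S k \<oplus> sg (card S) ** mv K (\<lambda>k l. \<phi> k l [^] (p ^ e)) (w S) k = \<zero>"
 shows "mult_on x {..<d} [^] (p ^ e * Suc d) ** w {..<d} k0 = (\<Oplus>c\<in>top_basis. w (fst c) (snd c) ** \<rho> c [^] (p ^ e))"
proof -
 let ?q = "p ^ e"
 interpret Q: koszul R d K deg "\<lambda>k l. \<phi> k l [^] ?q" "\<lambda>i k l. h i k l [^] ?q" "\<lambda>i. x i [^] ?q"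
  by (rule frobenius_twist)
 let ?e = "\<lambda>c S k. unit_cochain c S k [^] ?q"
 \<comment> \<open>Basis cochains have entries 0 and 1, so they are Frobenius twists of
   themselves.\<close>
 have e: "?e c = unit_cochain c" for c by (intro ext) (simp add: unit_cochain_def frobenius_zero)
 have w_sum: "w = (\<lambda>S k. \<Oplus>c\<in>top_basis. w (fst c) (snd c) ** unit_cochain c S k)"
 proof (intro ext)
  fix S k
  show "w S k = (\<Oplus>c\<in>top_basis. w (fst c) (snd c) ** unit_cochain c S k)"
  proof (cases "(S, k) \<in> top_basis")
   case True
   have "(\<Oplus>c\<in>top_basis. w (fst c) (snd c) ** unit_cochain c S k)
     = (\<Oplus>c\<in>top_basis. if (S, k) = c then w (fst c) (snd c) else \<zero>)"
    by (rule finsum_cong') (use w in \<open>auto simp: unit_cochain_def\<close>)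
   also have "\<dots> = w S k"
    using finsum_singleton[OF True finite_top_basis, of "\<lambda>c. w (fst c) (snd c)"] w(1) by simp
   finally show ?thesis by simp
  next
   case False
   hence "(\<Oplus>c\<in>top_basis. w (fst c) (snd c) ** unit_cochain c S k) = \<zero>"
    by (intro finsum_zero') (use w(1) in \<open>auto simp: unit_cochain_def\<close>)
   thus ?thesis using w(2)[OF False] by simp
  qed
 qed
 have "Q.pushn (Suc d) w {..<d} k0 = mult_on (\<lambda>i. x i [^] ?q) {..<d} [^] Suc d ** w {..<d} k0"
  by (rule Q.pushn_of_cocycle) (use w(1) cocycle k0 in \<open>auto simp: Q.Dk_def Q.par_def\<close>)
 also have "mult_on (\<lambda>i. x i [^] ?q) {..<d} [^] Suc d = mult_on x {..<d} [^] (?q * Suc d)"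
  by (simp only: mult_on_pow[symmetric, OF finite_lessThan x_closed] nat_pow_pow[OF mult_on_closed[OF x_closed]])
 finally have 1: "Q.pushn (Suc d) w {..<d} k0 = mult_on x {..<d} [^] (?q * Suc d) ** w {..<d} k0" .
 have "Q.pushn (Suc d) w {..<d} k0 = (\<Oplus>c\<in>top_basis. w (fst c) (snd c) ** Q.pushn (Suc d) (unit_cochain c) {..<d} k0)"
  by (subst w_sum, rule Q.pushn_finsum) (use finite_top_basis w(1) in auto)
 also have "\<dots> = (\<Oplus>c\<in>top_basis. w (fst c) (snd c) ** \<rho> c [^] ?q)"
 proof (rule finsum_cong')
  fix c
  have "Q.pushn (Suc d) (?e c) {..<d} k0 = \<rho> c [^] ?q"
   unfolding \<rho>_def by (rule pushn_frobenius) auto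
  thus "w (fst c) (snd c) ** Q.pushn (Suc d) (unit_cochain c) {..<d} k0 = w (fst c) (snd c) ** \<rho> c [^] ?q"
   unfolding e by simp
 qed (use w(1) in auto)
 finally show ?thesis using 1 by simp
qed

end

section \<open>Cocycles from deep matrices\<close>

context noetherian_local
begin

text \<open>By \<open>dlt_contraction\<close> the \<open>y i\<close> multiply cocycles into
  coboundaries. Artin--Rees then gives a submodule of cochains that meets the cocycles in
  coboundaries only and absorbs powers of the \<open>y i\<close>; it contains all sufficiently deep
  cochains.\<close>

lemma deep_koszul_cocycles_bound:
 fixes y :: "nat => 'a"
 assumes y: "!!i. y i \<in> carrier R" and N: "mpow N \<subseteq> Idl (y ` {..<d})"
 shows "\<exists>M. \<forall>z. (\<forall>S. z S \<in> mpow M) \<and> (\<forall>S\<subseteq>{..<d}. dlt y (\<lambda>S (k::unit). z S) S () = \<zero>) -->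
   (\<exists>b. (\<forall>S. b S \<in> carrier R) \<and> (\<forall>S\<subseteq>{..<d}. dlt y (\<lambda>S (k::unit). b S) S () = z S))"
proof -
 let ?A = "Pow {..<d}" and ?V = "vector_module R (Pow {..<d})"
 let ?d = "\<lambda>z S. dlt y (\<lambda>S (k::unit). z S) S ()"
 interpret V: module R ?V by (rule vector_module)
 define Dz where "Dz z S = (if S \<in> ?A then ?d z S else \<zero>)" for z S
 define Zc where "Zc = {z \<in> carrier ?V. Dz z = 0[?V]}"
 define Bc where "Bc = Dz ` carrier ?V"
 have fS: "finite S" if "S \<in> ?A" for S using that finite_subset by auto
 have dc: "?d f S \<in> carrier R" if "f \<in> vectors R ?A" for f S by (rule dlt_closed) (use y vectorsD(1)[OF that] in auto)
 have "Dz \<in> module_hom R ?V ?V"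
 proof (rule module_homI; unfold vector_module_simps)
  show "Dz f \<in> vectors R ?A" if "f \<in> vectors R ?A" for f using dc[OF that] unfolding vectors_def Dz_def by auto
  show "Dz (\<lambda>S. f S \<oplus> g S) = (\<lambda>S. Dz f S \<oplus> Dz g S)" if "f \<in> vectors R ?A" "g \<in> vectors R ?A" for f g
   using dlt_add[of y "\<lambda>S (k::unit). f S" "\<lambda>S k. g S"] y vectorsD(1)[OF that(1)] vectorsD(1)[OF that(2)] fS
   by (intro ext) (simp add: Dz_def)
  show "Dz (\<lambda>S. r ** f S) = (\<lambda>S. r ** Dz f S)" if "r \<in> carrier R" "f \<in> vectors R ?A" for r f
   using dlt_smult[of y "\<lambda>S (k::unit). f S" r] y vectorsD(1)[OF that(2)] that(1) fS
   by (intro ext) (simp add: Dz_def)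
 qed
 note hom = this
 have Zs: "submodule Zc R ?V" unfolding Zc_def by (rule module_hom_kernel[OF vector_module vector_module hom])
 have Bs: "submodule Bc R ?V" unfolding Bc_def
  by (rule module_hom_image[OF vector_module vector_module hom V.submodule_intro])
   (auto simp: vectors_def)
 have Z: "z \<in> Zc \<longleftrightarrow> z \<in> vectors R ?A \<and> (\<forall>S\<in>?A. ?d z S = \<zero>)" for z
  by (auto simp: Zc_def Dz_def fun_eq_iff)
 have BZ: "Bc \<subseteq> Zc"
 proof
  fix z assume "z \<in> Bc"
  then obtain b where b: "z = Dz b" "b \<in> vectors R ?A" unfolding Bc_def by auto
  have zV: "z \<in> vectors R ?A" using module_homD(1)[OF hom] b by simp
  have "?d z S = \<zero>" if S: "S \<in> ?A" for S
  proof -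
   have "?d z S = dlt y (dlt y (\<lambda>S (k::unit). b S)) S ()"
    unfolding dlt_def[of y _ S "()"] b(1)
    by (rule finsum_cong') (use y S dc[OF b(2)] in \<open>auto simp: subset_iff Dz_def\<close>)
   also have "\<dots> = \<zero>" by (rule dlt_dlt) (use y vectorsD(1)[OF b(2)] fS[OF S] in auto)
   finally show ?thesis .
  qed
  thus "z \<in> Zc" using zV by (simp add: Z)
 qed
 have Yc: "y ` {..<d} \<subseteq> carrier R" using y by auto
 \<comment> \<open>The contraction is cut off outside the subsets of \<open>{..<d}\<close>, which
   does not affect its coboundary at these subsets.\<close>
 have YZ: "v *[?V] z \<in> Bc" if vz: "v \<in> y ` {..<d}" "z \<in> Zc" for v z
 proof -
  obtain i where i: "i < d" "v = y i" using vz(1) by blast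
  have zV: "z \<in> vectors R ?A" using vz(2) Z by blast
  let ?b = "\<lambda>S. if i \<in> S \<or> S \<notin> ?A then \<zero> else sg (pos i (insert i S)) ** z (insert i S)"
  have b: "?b \<in> vectors R ?A" using vectorsD(1)[OF zV] by (auto simp: vectors_def)
  have "?d ?b S = y i ** z S" if S: "S \<in> ?A" for S
  proof -
   have "?d ?b S = ?d (\<lambda>S. if i \<in> S then \<zero> else sg (pos i (insert i S)) ** z (insert i S)) S"
    unfolding dlt_def by (rule finsum_cong') (use S y vectorsD(1)[OF zV] in auto)
   also have "\<dots> = y i ** z S"
   proof (rule dlt_contraction)
    have "insert i S \<in> ?A" using S i by auto
    thus "dlt y (\<lambda>S k. z S) (insert i S) () = \<zero>" using vz(2) Z by blast
   qed (use y vectorsD(1)[OF zV] fS[OF S] in auto)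
   finally show ?thesis .
  qed
  hence "Dz ?b = v *[?V] z" using i(2) vectorsD(2)[OF zV] y by (intro ext) (simp add: Dz_def)
  thus ?thesis unfolding Bc_def using b by (intro image_eqI[of _ _ ?b]) auto
 qed
 obtain K where K: "submodule K R ?V" "K \<inter> Zc \<subseteq> Bc"
  "!!v. v \<in> y ` {..<d} ==> \<exists>N::nat. \<forall>f\<in>carrier ?V. (v [^] N) *[?V] f \<in> K"
  using artin_rees[OF noetherian_vector_module Bs Zs BZ Yc YZ] by auto
 note KD = V.submoduleD[OF K(1)]
 \<comment> \<open>Multipliers of the whole module into \<open>K\<close>: an ideal containing powers
   of the \<open>y i\<close>, hence a power of \<open>m\<close>.\<close>
 define L where "L = {r \<in> carrier R. \<forall>f\<in>carrier ?V. r *[?V] f \<in> K}"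
 have L: "ideal L R"
 proof (rule ideal_intro)
  show "\<zero> \<in> L" using KD(3) V.smult_l_null unfolding L_def by (simp del: vector_module_simps)
  show "a \<oplus> b \<in> L" if "a \<in> L" "b \<in> L" for a b
   using that KD(4) V.smult_l_distr unfolding L_def by (simp del: vector_module_simps)
  show "r ** a \<in> L" if "a \<in> L" "r \<in> carrier R" for a r
   using that KD(5) V.smult_assoc1 unfolding L_def by (simp del: vector_module_simps)
 qed (auto simp: L_def)
 have "\<exists>M. mpow M \<subseteq> L"
 proof (rule parameter_powers_below[OF L y N])
  show "\<exists>n::nat. y i [^] n \<in> L" if i: "i < d" for i
   using K(3)[of "y i"] i y unfolding L_def by (auto simp del: vector_module_simps)
 qed
 then obtain M where M: "mpow M \<subseteq> L" by blast
 show ?thesis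
 proof (intro exI[of _ M] allI impI, elim conjE)
  fix z assume zM: "\<forall>S. z S \<in> mpow M" and dz: "\<forall>S\<subseteq>{..<d}. ?d z S = \<zero>"
  have zc: "z S \<in> carrier R" for S using zM idealD(2)[OF ideal_power_ideal[OF ideal_m]] by blast
  \<comment> \<open>A vector with entries in \<open>mpow M\<close> is a combination of unit vectors
    with coefficients in \<open>L\<close>.\<close>
  have "(\<lambda>S. if S \<in> F then z S else \<zero>) \<in> K" if "F \<subseteq> ?A" for F
   using finite_subset[OF that finite_Pow_iff[THEN iffD2, OF finite_lessThan]] that
  proof (induction F rule: finite_induct)
   case empty thus ?case using KD(3) by simp
  next
   case (insert T F)
   let ?u = "\<lambda>S. if S = T then \<one> else \<zero>"
   have "?u \<in> carrier ?V" using insert by (auto simp: vectors_def)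
   hence "z T *[?V] ?u \<in> K" using zM M unfolding L_def by blast
   hence "z T *[?V] ?u +[?V] (\<lambda>S. if S \<in> F then z S else \<zero>) \<in> K" using KD(4) insert by blast
   moreover have "z T *[?V] ?u +[?V] (\<lambda>S. if S \<in> F then z S else \<zero>) = (\<lambda>S. if S \<in> insert T F then z S else \<zero>)"
    using insert zc by auto
   ultimately show ?case by simp
  qed
  hence zK: "(\<lambda>S. if S \<in> ?A then z S else \<zero>) \<in> K" by blast
  have "?d (\<lambda>S. if S \<in> ?A then z S else \<zero>) S = ?d z S" if "S \<in> ?A" for S
   unfolding dlt_def by (rule finsum_cong') (use that y zc in auto)
  hence "(\<lambda>S. if S \<in> ?A then z S else \<zero>) \<in> Zc" using dz zc by (auto simp: Z vectors_def)
  hence "(\<lambda>S. if S \<in> ?A then z S else \<zero>) \<in> Bc" using zK K(2) by blast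
  then obtain b where b: "b \<in> vectors R ?A" "(\<lambda>S. if S \<in> ?A then z S else \<zero>) = Dz b" unfolding Bc_def by auto
  have "?d b S = z S" if "S \<subseteq> {..<d}" for S using fun_cong[OF b(2), of S] that by (simp add: Dz_def)
  thus "\<exists>b. (\<forall>S. b S \<in> carrier R) \<and> (\<forall>S\<subseteq>{..<d}. ?d b S = z S)"
   using vectorsD(1)[OF b(1)] by (intro exI[of _ b]) simp
 qed
qed

end

context noetherian_local
begin

text \<open>\<open>M\<close> is fixed before \<open>\<psi>\<close>, because the Frobenius power that
  produces \<open>\<psi>\<close> is chosen according to \<open>M\<close>. The cochain starts with
  \<open>\<one>\<close> at the full set and is extended by coefficient degree: the error in the next
  degree is a Koszul cocycle with entries in \<open>mpow M\<close>, hence a coboundary.\<close>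

lemma deep_cocycle:
 fixes y :: "nat => 'a" and K :: "'k set" and deg :: "'k => nat"
 assumes y: "!!i. y i \<in> carrier R" and N: "mpow N \<subseteq> Idl (y ` {..<d})"
  and k0: "k0 \<in> K" "deg k0 = 0" "!!k. k \<in> K ==> deg k = 0 ==> k = k0"
 shows "\<exists>M. \<forall>\<psi>. free_complex R K deg \<psi> \<and> (\<forall>k l. \<psi> k l \<in> mpow M) -->
  (\<exists>w. (\<forall>S k. w S k \<in> carrier R) \<and> (\<forall>S k. \<not> (S \<subseteq> {..<d} \<and> k \<in> K \<and> card S + deg k = d) --> w S k = \<zero>) \<and>
   w {..<d} k0 = \<one> \<and>
   (\<forall>S k. S \<subseteq> {..<d} --> k \<in> K --> dlt y w S k \<oplus> sg (card S) ** mv K \<psi> (w S) k = \<zero>))"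
proof -
 obtain M where M: "!!z. (!!S. z S \<in> mpow M) ==> (!!S. S \<subseteq> {..<d} ==> dlt y (\<lambda>S (k::unit). z S) S () = \<zero>) ==>
   \<exists>b. (\<forall>S. b S \<in> carrier R) \<and> (\<forall>S\<subseteq>{..<d}. dlt y (\<lambda>S (k::unit). b S) S () = z S)"
  using deep_koszul_cocycles_bound[OF y N] by blast
 note MD = idealD[OF ideal_power_ideal[OF ideal_m, of M]]
 show ?thesis
 proof (intro exI[of _ M] allI impI, elim conjE)
  fix \<psi> assume "free_complex R K deg \<psi>" and \<psi>M: "\<forall>k l. \<psi> k l \<in> mpow M"
  then interpret F: free_complex R d K deg \<psi> by simp
  define P where "P j w \<longleftrightarrow> (\<forall>S k. w S k \<in> carrier R) \<and>
   (\<forall>S k. \<not> (S \<subseteq> {..<d} \<and> k \<in> K \<and> card S + deg k = d \<and> deg k \<le> j) --> w S k = \<zero>) \<and>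
   w {..<d} k0 = \<one> \<and> (\<forall>S k. S \<subseteq> {..<d} --> k \<in> K --> deg k \<le> j --> F.Dk y w S k = \<zero>)" for j w
  have "\<exists>w. P j w" for j
  proof (induction j)
   case 0
   let ?w = "\<lambda>S k. if S = {..<d} \<and> k = k0 then \<one> else \<zero>"
   have "F.Dk y ?w S k = \<zero>" if S: "S \<subseteq> {..<d}" and k: "k \<in> K" "deg k \<le> 0" for S k
   proof -
    have "dlt y ?w S k = \<zero>" by (rule F.dlt_zero) (use S y in auto)
    moreover have "mv K \<psi> (?w S) k = \<zero>"
     unfolding mv_def by (rule finsum_zero') (use F.\<phi>_deg[OF k(1)] k(2) in auto)
    ultimately show ?thesis by (simp add: F.Dk_def F.par_def)
   qed
   moreover have "?w S k \<in> carrier R" for S k by simp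
   moreover have "?w S k = \<zero>" if n: "\<not> (S \<subseteq> {..<d} \<and> k \<in> K \<and> card S + deg k = d \<and> deg k \<le> 0)" for S k
   proof -
    have "\<not> (S = {..<d} \<and> k = k0)" using n k0(1,2) by (elim contrapos_nn) simp
    thus ?thesis by (rule if_not_P)
   qed
   ultimately have "P 0 ?w" unfolding P_def by simp
   thus ?case by (rule exI[of _ ?w])
  next
   case (Suc j)
   then obtain w where w: "!!S k. w S k \<in> carrier R"
    "!!S k. \<not> (S \<subseteq> {..<d} \<and> k \<in> K \<and> card S + deg k = d \<and> deg k \<le> j) ==> w S k = \<zero>"
    "w {..<d} k0 = \<one>" "!!S k. S \<subseteq> {..<d} ==> k \<in> K ==> deg k \<le> j ==> F.Dk y w S k = \<zero>"
    unfolding P_def by blast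
   have hw: "F.homog d w" unfolding F.homog_def using w(2) by blast
   have Dc: "F.Dk y w S k \<in> carrier R" for S k using y w(1) by simp
   have Dpar: "F.Dk y w S k = F.par w S k" if k: "deg k = Suc j" for S k
   proof -
    have "dlt y w S k = \<zero>" by (rule F.dlt_zero) (use k w(2) y in auto)
    thus ?thesis using w(1) by (simp add: F.Dk_def)
   qed
   have "\<exists>b. (\<forall>S. b S \<in> carrier R) \<and> (\<forall>S\<subseteq>{..<d}. dlt y (\<lambda>S (k::unit). b S) S () = F.Dk y w S k)"
    if k: "k \<in> K" "deg k = Suc j" for k
   proof (rule M)
    fix S
    have "mv K \<psi> (w S) k \<in> mpow M" unfolding mv_def
     by (rule finsum_in_ideal[OF ideal_power_ideal[OF ideal_m]]) (use MD(6) \<psi>M w(1) in blast)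
    thus "F.Dk y w S k \<in> mpow M" unfolding Dpar[OF k(2)] F.par_def by (rule MD(5)) simp
   next
    fix S assume S: "S \<subseteq> {..<d}"
    have "F.Dk y (F.Dk y w) S k = \<zero>" by (rule F.Dk_Dk) (use y w(1) F.sub_finite[OF S] k in auto)
    moreover have "mv K \<psi> (F.Dk y w S) k = \<zero>"
     unfolding mv_def
    proof (rule finsum_zero')
     fix l assume l: "l \<in> K"
     show "\<psi> k l ** F.Dk y w S l = \<zero>"
      using F.\<phi>_deg[OF k(1) l] w(4)[OF S l] k(2) Dc by (cases "deg l = j") auto
    qed
    moreover have "dlt y (F.Dk y w) S k \<in> carrier R" by (rule dlt_closed) (use y Dc in auto)
    ultimately have "dlt y (F.Dk y w) S k = \<zero>" by (simp add: F.Dk_def[of y "F.Dk y w"] F.par_def)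
    thus "dlt y (\<lambda>S (u::unit). F.Dk y w S k) S () = \<zero>" by (simp add: dlt_def)
   qed
   then obtain b where b: "!!k S. k \<in> K ==> deg k = Suc j ==> b k S \<in> carrier R"
    "!!k S. k \<in> K ==> deg k = Suc j ==> S \<subseteq> {..<d} ==> dlt y (\<lambda>S (u::unit). b k S) S () = F.Dk y w S k"
    by metis
   \<comment> \<open>The negative of the primitive \<open>b\<close> cancels the error; the condition
     on \<open>card S + deg k\<close> keeps the cochain in total degree \<open>d\<close>.\<close>
   define w' where "w' S k = (if deg k \<le> j then w S k else
     if k \<in> K \<and> deg k = Suc j \<and> S \<subseteq> {..<d} \<and> card S + deg k = d then \<ominus> b k S else \<zero>)" for S k
   have w'c: "w' S k \<in> carrier R" for S k unfolding w'_def using w(1) b(1) by simp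
   have mv': "mv K \<psi> (w' S) k = mv K \<psi> (w S) k" if k: "k \<in> K" "deg k \<le> Suc j" for S k
    unfolding mv_def
   proof (rule finsum_cong')
    fix l assume l: "l \<in> K"
    show "\<psi> k l ** w' S l = \<psi> k l ** w S l"
    proof (cases "deg l \<le> j")
     case True thus ?thesis by (simp add: w'_def)
    next
     case False
     hence "\<psi> k l = \<zero>" using F.\<phi>_deg[OF k(1) l] k(2) by auto
     thus ?thesis using w'c w(1) by simp
    qed
   qed (use w(1) in auto)
   have "F.Dk y w' S k = \<zero>" if S: "S \<subseteq> {..<d}" and k: "k \<in> K" "deg k \<le> Suc j" for S k
   proof (cases "deg k \<le> j")
    case True
    have "dlt y w' S k = dlt y w S k" unfolding dlt_def using True by (simp add: w'_def)
    hence "F.Dk y w' S k = F.Dk y w S k" using mv'[OF k] by (simp add: F.Dk_def F.par_def)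
    thus ?thesis using w(4)[OF S k(1) True] by simp
   next
    case False
    hence kj: "deg k = Suc j" using k(2) by simp
    have "dlt y w' S k = \<ominus> F.Dk y w S k"
    proof (cases "card S + deg k = Suc d")
     case True
     have "dlt y w' S k = dlt y (\<lambda>S (u::unit). \<ominus> b k S) S ()"
      unfolding dlt_def
     proof (rule finsum_cong')
      fix i assume i: "i \<in> S"
      have "card S = Suc (card (S - {i}))" using i F.sub_finite[OF S] by (metis card_Suc_Diff1)
      moreover have "S - {i} \<subseteq> {..<d}" using S by blast
      ultimately have "w' (S - {i}) k = \<ominus> b k (S - {i})" unfolding w'_def using True kj k(1) by simp
      thus "sg (pos i S) ** (y i ** w' (S - {i}) k) = sg (pos i S) ** (y i ** \<ominus> b k (S - {i}))" by simp
     qed (use b(1)[OF k(1) kj] y in auto)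
     also have "\<dots> = \<ominus> dlt y (\<lambda>S (u::unit). b k S) S ()"
      by (rule dlt_uminus) (use b(1)[OF k(1) kj] y F.sub_finite[OF S] in auto)
     finally show ?thesis using b(2)[OF k(1) kj S] by simp
    next
     case False
     have "F.homog (Suc d) (F.Dk y w)" by (rule F.homog_Dk) (use y w(1) hw in auto)
     hence "F.Dk y w S k = \<zero>" using False S k(1) unfolding F.homog_def by blast
     moreover have "dlt y w' S k = \<zero>"
     proof (rule F.dlt_zero)
      fix i assume i: "i \<in> S"
      have "card S = Suc (card (S - {i}))" using i F.sub_finite[OF S] by (metis card_Suc_Diff1)
      thus "w' (S - {i}) k = \<zero>" unfolding w'_def using False kj by simp
     qed (use y in auto)
     ultimately show ?thesis by simp
    qed
    thus ?thesis
     using mv'[OF k] Dpar[OF kj, of S] w(1) by (simp add: F.Dk_def[of y w'] F.par_def l_neg)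
   qed
   moreover have "w' S k = \<zero>" if "\<not> (S \<subseteq> {..<d} \<and> k \<in> K \<and> card S + deg k = d \<and> deg k \<le> Suc j)" for S k
   proof (cases "deg k \<le> j")
    case True
    have "w S k = \<zero>" by (rule w(2)) (use that True in auto)
    thus ?thesis using True by (simp add: w'_def)
   next
    case False
    have "\<not> (k \<in> K \<and> deg k = Suc j \<and> S \<subseteq> {..<d} \<and> card S + deg k = d)" using that by (elim contrapos_nn) simp
    thus ?thesis unfolding w'_def if_not_P[OF False] by (rule if_not_P)
   qed
   moreover have "w' {..<d} k0 = \<one>" using w(3) k0(2) by (simp add: w'_def)
   ultimately have "P (Suc j) w'" unfolding P_def using w'c by simp
   thus ?case by (rule exI[of _ w'])
  qed
  then obtain w where w: "P (Max (deg ` K)) w" by blast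
  have mx: "deg k \<le> Max (deg ` K)" if "k \<in> K" for k using F.fin that by simp
  have "F.Dk y w S k = \<zero>" if "S \<subseteq> {..<d}" "k \<in> K" for S k using w mx[OF that(2)] that unfolding P_def by blast
  hence "\<forall>S k. S \<subseteq> {..<d} --> k \<in> K --> dlt y w S k \<oplus> sg (card S) ** mv K \<psi> (w S) k = \<zero>"
   unfolding F.Dk_def F.par_def by blast
  thus "\<exists>w. (\<forall>S k. w S k \<in> carrier R) \<and> (\<forall>S k. \<not> (S \<subseteq> {..<d} \<and> k \<in> K \<and> card S + deg k = d) --> w S k = \<zero>) \<and>
   w {..<d} k0 = \<one> \<and>
   (\<forall>S k. S \<subseteq> {..<d} --> k \<in> K --> dlt y w S k \<oplus> sg (card S) ** mv K \<psi> (w S) k = \<zero>)"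
   using w unfolding P_def by (intro exI[of _ w] conjI) blast+
 qed
qed

lemma pow_in_power_of_m:
 assumes "a \<in> m" "M \<le> q" shows "a [^] (q::nat) \<in> mpow M"
 using pow_in_ideal_power[OF ideal_m assms(1), of q] ideal_power_mono[OF ideal_m assms(2)] by blast

end

section \<open>Ideals with a resolution that splits in high codimension\<close>

context frobenius_hull
begin

text \<open>If \<open>c F\<^sup>e(0 :\<^sub>E I) = 0\<close> for all \<open>e\<close>, then \<open>c = 0\<close>: every \<open>\<eta> n\<close> is a combination of
 elements \<open>F\<^sup>e \<zeta>\<close> with \<open>I \<zeta> = 0\<close>, for \<open>e\<close> large.\<close>

lemma split_resolution_faithful:
 fixes K :: "'k set" and deg :: "'k => nat" and \<phi> :: "'k => 'k => 'a"
 assumes kos: "koszul R d K deg \<phi> h (\<lambda>i. if i < d then x i else \<one>)"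
  and k0: "k0 \<in> K" "deg k0 = 0" "!!k. k \<in> K ==> deg k = 0 ==> k = k0"
  and \<phi>m: "!!k l. \<phi> k l \<in> m"
  and I: "I \<subseteq> Idl ((\<lambda>k. \<phi> k k0) ` {k \<in> K. deg k = 1})"
  and N: "mpow N \<subseteq> Idl (x ` {..<d})"
  and c: "c \<in> carrier R" "!!e \<zeta>. \<zeta> \<in> carrier E ==> (!!i. i \<in> I ==> i *\<^sub>E \<zeta> = 0\<^sub>E) ==> c *\<^sub>E Fr e \<zeta> = 0\<^sub>E"
 shows "c = \<zero>"
proof (rule faithful[OF c(1)])
 fix n :: nat
 define x1 where "x1 = (\<lambda>i. if i < d then x i else \<one>)"
 interpret K: koszul R d K deg \<phi> h x1 unfolding x1_def by (rule kos)
 interpret K: frobenius_koszul R d K deg \<phi> h x1 p k0 by unfold_locales (fact k0)+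
 have x1c: "x1 i \<in> carrier R" for i using K.x_closed .
 have x1i: "(\<lambda>i. x1 i [^] (t::nat)) ` {..<d} = (\<lambda>i. x i [^] t) ` {..<d}" for t
  by (intro image_cong refl) (simp add: x1_def)
 have x1x: "mult_on x1 {..<d} = \<xi>"
  unfolding \<xi> mult_on_def by (rule finprod_cong') (use x_closed in \<open>auto simp: x1_def\<close>)
 \<comment> \<open>The cocycle is first built at level \<open>n\<close>, in order that its top
   component at level \<open>q\<close> be \<open>\<xi>^(q - n)\<close> and thus reach
   \<open>\<eta> n\<close>.\<close>
 define y where "y i = x1 i [^] n" for i
 have yc: "y i \<in> carrier R" for i using x1c by (simp add: y_def)
 have "\<exists>M. mpow M \<subseteq> Idl (y ` {..<d})"
 proof (rule parameter_powers_below[OF genideal_ideal x_closed N])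
  show "y ` {..<d} \<subseteq> carrier R" using yc by auto
  thus "\<exists>t::nat. x l [^] t \<in> Idl (y ` {..<d})" if "l < d" for l
   using genideal_self[of "y ` {..<d}"] that by (intro exI[of _ n]) (auto simp: y_def x1_def)
 qed
 then obtain N' where N': "mpow N' \<subseteq> Idl (y ` {..<d})" by blast
 let ?W = "\<lambda>\<psi>. \<exists>w. (\<forall>S k. w S k \<in> carrier R) \<and> (\<forall>S k. \<not> (S \<subseteq> {..<d} \<and> k \<in> K \<and> card S + deg k = d) --> w S k = \<zero>) \<and>
   w {..<d} k0 = \<one> \<and>
   (\<forall>S k. S \<subseteq> {..<d} --> k \<in> K --> dlt y w S k \<oplus> sg (card S) ** mv K \<psi> (w S) k = \<zero>)"
 have "\<exists>M. \<forall>\<psi>. free_complex R K deg \<psi> \<and> (\<forall>k l. \<psi> k l \<in> mpow M) --> ?W \<psi>"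
  by (rule deep_cocycle[where y=y and K=K and deg=deg, OF yc N' k0])
 then obtain M where M: "\<forall>\<psi>. free_complex R K deg \<psi> \<and> (\<forall>k l. \<psi> k l \<in> mpow M) --> ?W \<psi>" ..
 \<comment> \<open>\<open>p^e \<ge> M\<close> moves the twisted matrices into \<open>mpow M\<close>,
   and \<open>p^e \<ge> n\<close> permits the transition from level \<open>n\<close> to level
   \<open>p^e\<close>.\<close>
 define e where "e = max M n"
 let ?q = "p ^ e"
 have "e \<le> ?q" using less_exp[of e] prime_ge_2_nat[OF prime_p] power_mono[of 2 p e] by linarith
 hence q: "M \<le> ?q" "n \<le> ?q" by (auto simp: e_def)
 interpret Q: koszul R d K deg "\<lambda>k l. \<phi> k l [^] ?q" "\<lambda>i k l. h i k l [^] ?q" "\<lambda>i. x1 i [^] ?q"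
  by (rule K.frobenius_twist)
 have fc: "free_complex R K deg (\<lambda>k l. \<phi> k l [^] ?q)" by (rule Q.free_complex_axioms)
 have "?W (\<lambda>k l. \<phi> k l [^] ?q)"
  by (rule M[THEN spec, THEN mp]) (intro conjI allI fc pow_in_power_of_m \<phi>m q(1))
 then obtain w where w: "!!S k. w S k \<in> carrier R"
  "!!S k. \<not> (S \<subseteq> {..<d} \<and> k \<in> K \<and> card S + deg k = d) ==> w S k = \<zero>" "w {..<d} k0 = \<one>"
  "!!S k. S \<subseteq> {..<d} ==> k \<in> K ==> dlt y w S k \<oplus> sg (card S) ** mv K (\<lambda>k l. \<phi> k l [^] ?q) (w S) k = \<zero>" by blast
 \<comment> \<open>The transition factors from \<open>x^n\<close> to \<open>x^q\<close>.\<close>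
 let ?\<mu> = "\<lambda>i. x1 i [^] (?q - n)"
 define w' where "w' S k = mult_on ?\<mu> S ** w S k" for S k
 have w'c: "w' S k \<in> carrier R" for S k unfolding w'_def using w(1) x1c by simp
 have y\<mu>: "(\<lambda>i. y i ** ?\<mu> i) = (\<lambda>i. x1 i [^] ?q)" using q(2) x1c by (simp add: y_def nat_pow_mult)
 have coc: "dlt (\<lambda>i. x1 i [^] ?q) w' S k \<oplus> sg (card S) ** mv K (\<lambda>k l. \<phi> k l [^] ?q) (w' S) k = \<zero>"
  if S: "S \<subseteq> {..<d}" and k: "k \<in> K" for S k
 proof -
  have "Q.Dk (\<lambda>i. y i ** ?\<mu> i) (\<lambda>S k. mult_on ?\<mu> S ** w S k) S k = mult_on ?\<mu> S ** Q.Dk y w S k"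
   by (rule Q.Dk_mult_on) (use yc x1c w(1) Q.sub_finite[OF S] in auto)
  also have "Q.Dk y w S k = \<zero>" using w(4)[OF S k] by (simp add: Q.Dk_def Q.par_def)
  also have "mult_on ?\<mu> S ** \<zero> = \<zero>" using x1c by simp
  finally show ?thesis unfolding y\<mu> w'_def[symmetric] Q.Dk_def Q.par_def .
 qed
 have "mult_on x1 {..<d} [^] (?q * Suc d) ** w' {..<d} k0 = (\<Oplus>c\<in>K.top_basis. w' (fst c) (snd c) ** K.\<rho> c [^] ?q)"
 proof (rule K.top_component[OF w'c _ coc])
  show "w' S k = \<zero>" if "(S, k) \<notin> K.top_basis" for S k
   using that w(2)[of S k] x1c unfolding w'_def K.top_basis_def by simp
 qed
 moreover have "w' {..<d} k0 = \<xi> [^] (?q - n)"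
  unfolding w'_def w(3) using x1c x1x by (simp add: mult_on_pow[symmetric])
 ultimately have top: "\<xi> [^] (?q * Suc d) ** \<xi> [^] (?q - n) = (\<Oplus>c\<in>K.top_basis. w' (fst c) (snd c) ** K.\<rho> c [^] ?q)"
  unfolding x1x by simp
 \<comment> \<open>The level reached by the \<open>e\<close>-th Frobenius action from
   \<open>\<eta> (d + 2)\<close>. The exponents \<open>q * Suc d\<close> from pushing and
   \<open>q - n\<close> from the transition add up to \<open>?t - n\<close>, so \<open>top\<close>
   turns \<open>\<eta> n\<close> into a combination of the \<open>\<rho> b ^ q\<close> applied to
   \<open>\<eta> ?t\<close>.\<close>
 let ?t = "?q * (d + 2)"
 have "?t = n + (?q * Suc d + (?q - n))" using q(2) by (simp add: algebra_simps)
 hence \<eta>n: "\<eta> n = (\<xi> [^] (?q * Suc d) ** \<xi> [^] (?q - n)) *\<^sub>E \<eta> ?t"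
  using \<eta>_shift[of "?q * Suc d + (?q - n)" n] by (simp only: nat_pow_mult[OF \<xi>_closed])
 \<comment> \<open>\<open>\<rho> b ^ q\<close> times \<open>\<eta> ?t\<close> is the Frobenius image
   of \<open>\<rho> b\<close> times \<open>\<eta> (d + 2)\<close>, which \<open>I\<close> kills by
   \<open>\<rho>_annihilated\<close>.\<close>
 have \<rho>0: "c *\<^sub>E ((K.\<rho> b [^] ?q) *\<^sub>E \<eta> ?t) = 0\<^sub>E" if b: "b \<in> K.top_basis" for b
 proof -
  have "c *\<^sub>E Fr e (K.\<rho> b *\<^sub>E \<eta> (d + 2)) = 0\<^sub>E"
  proof (rule c(2))
   show "K.\<rho> b *\<^sub>E \<eta> (d + 2) \<in> carrier E" using \<eta>_closed by simp
   let ?A = "{r \<in> carrier R. r *\<^sub>E (K.\<rho> b *\<^sub>E \<eta> (d + 2)) = 0\<^sub>E}"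
   have "Idl ((\<lambda>k. \<phi> k k0) ` {k \<in> K. deg k = 1}) \<subseteq> ?A"
   proof (rule genideal_minimal)
    show "ideal ?A R" by (rule E.annihilator_ideal) (use \<eta>_closed in simp)
    show "(\<lambda>k. \<phi> k k0) ` {k \<in> K. deg k = 1} \<subseteq> ?A"
    proof
     fix a assume "a \<in> (\<lambda>k. \<phi> k k0) ` {k \<in> K. deg k = 1}"
     then obtain k where k: "k \<in> K" "deg k = 1" "a = \<phi> k k0" by blast
     have "a ** K.\<rho> b \<in> Idl ((\<lambda>i. x i [^] (d + 2)) ` {..<d})"
      using K.\<rho>_annihilated[OF b k(1,2)] unfolding k(3) x1i .
     hence "(a ** K.\<rho> b) *\<^sub>E \<eta> (d + 2) = 0\<^sub>E" by (rule Idl_kills_\<eta>)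
     thus "a \<in> ?A" using k(3) \<eta>_closed by (simp add: E.smult_assoc1)
    qed
   qed
   thus "i *\<^sub>E (K.\<rho> b *\<^sub>E \<eta> (d + 2)) = 0\<^sub>E" if "i \<in> I" for i using I that by blast
  qed
  thus ?thesis using Fr_\<eta>[OF K.\<rho>_closed[of b], of e "d + 2"] by simp
 qed
 let ?A = "{r \<in> carrier R. r *\<^sub>E (c *\<^sub>E \<eta> ?t) = 0\<^sub>E}"
 have "(\<Oplus>b\<in>K.top_basis. w' (fst b) (snd b) ** K.\<rho> b [^] ?q) \<in> ?A"
 proof (rule finsum_in_ideal)
  show A: "ideal ?A R" by (rule E.annihilator_ideal) (use \<eta>_closed c(1) in simp)
  fix b assume "b \<in> K.top_basis"
  hence "K.\<rho> b [^] ?q \<in> ?A"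
   using \<rho>0[of b] E.smult_commute[OF c(1), of "K.\<rho> b [^] ?q" "\<eta> ?t"] \<eta>_closed by simp
  thus "w' (fst b) (snd b) ** K.\<rho> b [^] ?q \<in> ?A" by (rule idealD(5)[OF A _ w'c])
 qed
 thus "c *\<^sub>E \<eta> n = 0\<^sub>E"
  unfolding \<eta>n top using E.smult_commute[OF c(1), of _ "\<eta> ?t"] \<eta>_closed by simp
qed

end

section \<open>Matrices and free resolutions\<close>

context cring
begin

text \<open>Matrices are functions on all pairs of indices that vanish outside the rectangle, so
  that equality of matrices is equality of functions.\<close>

definition mats :: "nat => nat => (nat => nat => 'a) set" where
 "mats r c = {A. (\<forall>k l. A k l \<in> carrier R) \<and> (\<forall>k l. \<not> (k < r \<and> l < c) --> A k l = \<zero>)}"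

definition mmul :: "nat => (nat => nat => 'a) => (nat => nat => 'a) => nat => nat => 'a" where
 "mmul n A B = (\<lambda>k l. \<Oplus>i\<in>{..<n}. A k i ** B i l)"

definition madd :: "(nat => nat => 'a) => (nat => nat => 'a) => nat => nat => 'a" where
 "madd A B = (\<lambda>k l. A k l \<oplus> B k l)"

definition msub :: "(nat => nat => 'a) => (nat => nat => 'a) => nat => nat => 'a" where
 "msub A B = (\<lambda>k l. A k l \<ominus> B k l)"

definition msm :: "'a => (nat => nat => 'a) => nat => nat => 'a" where
 "msm u A = (\<lambda>k l. u ** A k l)"

definition mzero :: "nat => nat => 'a" where "mzero = (\<lambda>k l. \<zero>)"

definition mone :: "nat => nat => nat => 'a" where "mone n = (\<lambda>k l. if k = l \<and> k < n then \<one> else \<zero>)"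

lemma matsD: "A \<in> mats r c ==> A k l \<in> carrier R" "A \<in> mats r c ==> \<not> k < r ==> A k l = \<zero>"
  "A \<in> mats r c ==> \<not> l < c ==> A k l = \<zero>"
 by (auto simp: mats_def)

lemma matsI: "(!!k l. A k l \<in> carrier R) ==> (!!k l. \<not> (k < r \<and> l < c) ==> A k l = \<zero>) ==> A \<in> mats r c"
 by (auto simp: mats_def)

lemma mmul_mats: assumes "A \<in> mats r n" "B \<in> mats n' c" shows "mmul n A B \<in> mats r c"
proof (rule matsI)
 note A = matsD[OF assms(1)] and B = matsD[OF assms(2)]
 show "mmul n A B k l \<in> carrier R" for k l unfolding mmul_def by (rule finsum_closed) (use A(1) B(1) in auto)
 show "mmul n A B k l = \<zero>" if "\<not> (k < r \<and> l < c)" for k l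
  unfolding mmul_def
 proof (rule finsum_zero')
  fix i
  show "A k i ** B i l = \<zero>" using that A(1)[of k i] A(2)[of k i] B(1)[of i l] B(3)[of l i] by (cases "k < r") auto
 qed
qed

lemma madd_mats: "A \<in> mats r c ==> B \<in> mats r c ==> madd A B \<in> mats r c"
 by (auto simp: mats_def madd_def)

lemma msub_mats: "A \<in> mats r c ==> B \<in> mats r c ==> msub A B \<in> mats r c"
 by (auto simp: mats_def msub_def minus_eq)

lemma msm_mats: "u \<in> carrier R ==> A \<in> mats r c ==> msm u A \<in> mats r c"
 by (auto simp: mats_def msm_def)

lemma mzero_mats: "mzero \<in> mats r c" by (auto simp: mats_def mzero_def)

lemma mone_mats: "mone n \<in> mats n n" by (auto simp: mats_def mone_def)

lemma mmul_assoc: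
 assumes "A \<in> mats r n" "B \<in> mats n' c" "C \<in> mats c' t"
 shows "mmul n A (mmul m B C) = mmul m (mmul n A B) C"
proof (intro ext)
 fix k l
 note A = matsD(1)[OF assms(1)] and B = matsD(1)[OF assms(2)] and C = matsD(1)[OF assms(3)]
 have "mmul n A (mmul m B C) k l = (\<Oplus>i\<in>{..<n}. \<Oplus>j\<in>{..<m}. (A k i ** B i j) ** C j l)"
  unfolding mmul_def
  by (rule finsum_cong') (use A B C in \<open>auto simp: finsum_rdistr m_assoc Pi_def intro!: finsum_closed\<close>)
 also have "\<dots> = (\<Oplus>j\<in>{..<m}. \<Oplus>i\<in>{..<n}. (A k i ** B i j) ** C j l)"
  by (rule finsum_swap) (use A B C in auto)
 also have "\<dots> = mmul m (mmul n A B) C k l"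
  unfolding mmul_def
  by (rule finsum_cong') (use A B C in \<open>auto simp: finsum_ldistr Pi_def intro!: finsum_closed\<close>)
 finally show "mmul n A (mmul m B C) k l = mmul m (mmul n A B) C k l" .
qed

lemma mmul_add_l:
 assumes "A \<in> mats r n" "A' \<in> mats r n" "B \<in> mats n' c"
 shows "mmul n (madd A A') B = madd (mmul n A B) (mmul n A' B)"
 using matsD(1)[OF assms(1)] matsD(1)[OF assms(2)] matsD(1)[OF assms(3)]
 by (intro ext) (simp add: mmul_def madd_def l_distr finsum_addf)

lemma mmul_sm_l:
 assumes "u \<in> carrier R" "A \<in> mats r n" "B \<in> mats n' c"
 shows "mmul n (msm u A) B = msm u (mmul n A B)"
 using assms(1) matsD(1)[OF assms(2)] matsD(1)[OF assms(3)]
 by (intro ext) (simp add: mmul_def msm_def m_assoc finsum_rdistr Pi_def)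

lemma mmul_sm_r:
 assumes "u \<in> carrier R" "A \<in> mats r n" "B \<in> mats n' c"
 shows "mmul n A (msm u B) = msm u (mmul n A B)"
 using assms(1) matsD(1)[OF assms(2)] matsD(1)[OF assms(3)]
 by (intro ext) (simp add: mmul_def msm_def m_lcomm finsum_rdistr Pi_def)

lemma msub_eq: "A \<in> mats r c ==> B \<in> mats r c ==> msub A B = madd A (msm (\<ominus> \<one>) B)"
 using matsD(1)[of A] matsD(1)[of B] by (intro ext) (simp add: msub_def madd_def msm_def minus_eq l_minus)

lemma mmul_add_r:
 assumes "A \<in> mats r n" "B \<in> mats n' c" "B' \<in> mats n' c"
 shows "mmul n A (madd B B') = madd (mmul n A B) (mmul n A B')"
 using matsD(1)[OF assms(1)] matsD(1)[OF assms(2)] matsD(1)[OF assms(3)]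
 by (intro ext) (simp add: mmul_def madd_def r_distr finsum_addf)

lemma mmul_sub_l:
 assumes "A \<in> mats r n" "A' \<in> mats r n" "B \<in> mats n' c"
 shows "mmul n (msub A A') B = msub (mmul n A B) (mmul n A' B)"
proof -
 have m: "\<ominus> \<one> \<in> carrier R" by simp
 show ?thesis
  unfolding msub_eq[OF assms(1,2)] msub_eq[OF mmul_mats[OF assms(1,3)] mmul_mats[OF assms(2,3)]]
  using mmul_add_l[OF assms(1) msm_mats[OF m assms(2)] assms(3)] mmul_sm_l[OF m assms(2,3)] by simp
qed

lemma mmul_sub_r:
 assumes "A \<in> mats r n" "B \<in> mats n' c" "B' \<in> mats n' c"
 shows "mmul n A (msub B B') = msub (mmul n A B) (mmul n A B')"
proof -
 have m: "\<ominus> \<one> \<in> carrier R" by simp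
 show ?thesis
  unfolding msub_eq[OF assms(2,3)] msub_eq[OF mmul_mats[OF assms(1,2)] mmul_mats[OF assms(1,3)]]
  using mmul_add_r[OF assms(1,2) msm_mats[OF m assms(3)]] mmul_sm_r[OF m assms(1,3)] by simp
qed

lemma mmul_zero_l: "B \<in> mats n' c ==> mmul n mzero B = mzero"
 using matsD(1)[of B] by (intro ext) (simp add: mmul_def mzero_def)

lemma mmul_zero_r: "A \<in> mats r n ==> mmul n' A mzero = mzero"
 using matsD(1)[of A] by (intro ext) (simp add: mmul_def mzero_def)

lemma mmul_one_l: assumes "A \<in> mats n c" shows "mmul n (mone n) A = A"
proof (intro ext)
 fix k l
 note A = matsD[OF assms]
 show "mmul n (mone n) A k l = A k l"
 proof (cases "k < n")
  case True
  have "(\<Oplus>i\<in>{..<n}. mone n k i ** A i l) = (\<Oplus>i\<in>{..<n}. if k = i then A i l else \<zero>)"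
   by (rule finsum_cong') (use A(1) True in \<open>auto simp: mone_def\<close>)
  also have "\<dots> = A k l" by (rule finsum_singleton) (use True A(1) in auto)
  finally show ?thesis by (simp add: mmul_def)
 next
  case False
  hence "mmul n (mone n) A k l = \<zero>" unfolding mmul_def
   by (intro finsum_zero') (use A(1) in \<open>auto simp: mone_def\<close>)
  thus ?thesis using A(2)[OF False] by simp
 qed
qed

lemma mmul_one_r: assumes "A \<in> mats r n" shows "mmul n A (mone n) = A"
proof (intro ext)
 fix k l
 note A = matsD[OF assms]
 show "mmul n A (mone n) k l = A k l"
 proof (cases "l < n")
  case True
  have "(\<Oplus>i\<in>{..<n}. A k i ** mone n i l) = (\<Oplus>i\<in>{..<n}. if l = i then A k i else \<zero>)"
   by (rule finsum_cong') (use A(1) True in \<open>auto simp: mone_def\<close>)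
  also have "\<dots> = A k l" by (rule finsum_singleton) (use True A(1) in auto)
  finally show ?thesis by (simp add: mmul_def)
 next
  case False
  hence "mmul n A (mone n) k l = \<zero>" unfolding mmul_def
   by (intro finsum_zero') (use A(1) in \<open>auto simp: mone_def\<close>)
  thus ?thesis using A(3)[OF False] by simp
 qed
qed

lemma msm_msm: "u \<in> carrier R ==> v \<in> carrier R ==> A \<in> mats r c ==> msm u (msm v A) = msm (u ** v) A"
 using matsD(1)[of A] by (intro ext) (simp add: msm_def m_assoc)

lemma msm_add: "u \<in> carrier R ==> A \<in> mats r c ==> B \<in> mats r c ==> msm u (madd A B) = madd (msm u A) (msm u B)"
 using matsD(1)[of A] matsD(1)[of B] by (intro ext) (simp add: msm_def madd_def r_distr)

lemma madd_msub: "A \<in> mats r c ==> B \<in> mats r c ==> madd (msub A B) B = A"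
 using matsD(1)[of A] matsD(1)[of B] by (intro ext) (simp add: msub_def madd_def minus_eq a_assoc l_neg)

lemma msub_self: "A \<in> mats r c ==> msub A A = mzero"
 using matsD(1)[of A] by (intro ext) (simp add: msub_def mzero_def minus_eq r_neg)

text \<open>Free complexes that are exact up to multiplication by elements of \<open>U\<close>; row \<open>k\<close> of \<open>A j\<close>
 is the image of the \<open>k\<close>-th basis element of the \<open>(j+1)\<close>-st module.\<close>

definition exact_upto :: "'a set => (nat => nat) => (nat => nat => nat => 'a) => bool" where
 "exact_upto U n A \<longleftrightarrow> (\<forall>j. A j \<in> mats (n (Suc j)) (n j)) \<and>
   (\<forall>j. mmul (n (Suc j)) (A (Suc j)) (A j) = mzero) \<and>
   (\<forall>j r M. M \<in> mats r (n (Suc j)) \<and> mmul (n (Suc j)) M (A j) = mzero -->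
    (\<exists>u\<in>U. \<exists>W\<in>mats r (n (Suc (Suc j))). msm u M = mmul (n (Suc (Suc j))) W (A (Suc j))))"

text \<open>A resolution of \<open>R / I\<close> after inverting \<open>U\<close>: an honest one for
  \<open>U = {\<one>}\<close>, and one of the localisation at a prime when \<open>U\<close> is its
  complement.\<close>

definition resolves_upto :: "'a set => 'a set => (nat => nat) => (nat => nat => nat => 'a) => bool" where
 "resolves_upto U I n A \<longleftrightarrow> exact_upto U n A \<and> n 0 = 1 \<and> (\<forall>k. A 0 k 0 \<in> I) \<and>
   (\<forall>r M. M \<in> mats r 1 \<and> (\<forall>k. M k 0 \<in> I) --> (\<exists>u\<in>U. \<exists>W\<in>mats r (n 1). msm u M = mmul (n 1) W (A 0)))"

lemma exact_uptoD:
 assumes "exact_upto U n A"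
 shows "A j \<in> mats (n (Suc j)) (n j)" "mmul (n (Suc j)) (A (Suc j)) (A j) = mzero"
  "M \<in> mats r (n (Suc j)) ==> mmul (n (Suc j)) M (A j) = mzero ==>
    \<exists>u\<in>U. \<exists>W\<in>mats r (n (Suc (Suc j))). msm u M = mmul (n (Suc (Suc j))) W (A (Suc j))"
 using assms unfolding exact_upto_def by blast+

lemma resolves_uptoD:
 assumes "resolves_upto U I n A"
 shows "exact_upto U n A" "n 0 = 1" "A 0 k 0 \<in> I"
  "M \<in> mats r 1 ==> (!!k. M k 0 \<in> I) ==> \<exists>u\<in>U. \<exists>W\<in>mats r (n 1). msm u M = mmul (n 1) W (A 0)"
 using assms unfolding resolves_upto_def by blast+

lemma resolves_upto_mono: "resolves_upto U I n A ==> U \<subseteq> U' ==> resolves_upto U' I n A"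
 unfolding resolves_upto_def exact_upto_def by blast

definition mult_set :: "'a set => bool" where
 "mult_set U \<longleftrightarrow> U \<subseteq> carrier R \<and> \<one> \<in> U \<and> (\<forall>a\<in>U. \<forall>b\<in>U. a ** b \<in> U)"

text \<open>Each lift costs a factor from \<open>U\<close>, by which the maps built so far are
  multiplied; so only finitely many degrees are treated, and degree 0 becomes multiplication by
  \<open>u\<close>.\<close>

lemma chain_map_exists:
 assumes U: "mult_set U" and I: "ideal I R" and A: "resolves_upto U I n A" and B: "resolves_upto U I n' B"
 shows "\<exists>u\<in>U. \<exists>\<alpha>. (\<forall>j\<le>D. \<alpha> j \<in> mats (n j) (n' j)) \<and> \<alpha> 0 = msm u (mone 1) \<and>
  (\<forall>j<D. mmul (n j) (A j) (\<alpha> j) = mmul (n' (Suc j)) (\<alpha> (Suc j)) (B j))"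
proof (induction D)
 case 0
 have "\<one> \<in> U" "\<one> \<in> carrier R" using U unfolding mult_set_def by auto
 thus ?case using resolves_uptoD(2)[OF A] resolves_uptoD(2)[OF B] msm_mats[OF _ mone_mats, of \<one> 1]
  by (intro bexI[of _ \<one>] exI[of _ "\<lambda>_. msm \<one> (mone 1)"]) auto
next
 case (Suc D)
 then obtain u \<alpha> where \<alpha>: "u \<in> U" "!!j. j \<le> D ==> \<alpha> j \<in> mats (n j) (n' j)" "\<alpha> 0 = msm u (mone 1)"
  "!!j. j < D ==> mmul (n j) (A j) (\<alpha> j) = mmul (n' (Suc j)) (\<alpha> (Suc j)) (B j)" by blast
 note AD = exact_uptoD[OF resolves_uptoD(1)[OF A]] and BD = exact_uptoD[OF resolves_uptoD(1)[OF B]]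
 let ?M = "mmul (n D) (A D) (\<alpha> D)"
 have M: "?M \<in> mats (n (Suc D)) (n' D)" by (rule mmul_mats[OF AD(1) \<alpha>(2)]) simp
 have "\<exists>v\<in>U. \<exists>W\<in>mats (n (Suc D)) (n' (Suc D)). msm v ?M = mmul (n' (Suc D)) W (B D)"
 proof (cases D)
  case 0
  have uc: "u \<in> carrier R" using U \<alpha>(1) unfolding mult_set_def by blast
  have "?M k 0 \<in> I" for k
  proof -
   have a: "A 0 k 0 \<in> I" "A 0 k 0 \<in> carrier R" using resolves_uptoD(3)[OF A] idealD(2)[OF I] by auto
   have "?M k 0 = A 0 k 0 ** u"
    unfolding 0 \<alpha>(3) mmul_def using resolves_uptoD(2)[OF A] a uc by (simp add: msm_def mone_def lessThan_Suc)
   thus ?thesis using idealD(6)[OF I a(1) uc] by simp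
  qed
  thus ?thesis using resolves_uptoD(4)[OF B, of ?M "n (Suc D)"] M resolves_uptoD(2)[OF B] unfolding 0 by simp
 next
  case (Suc D')
  have Dm: "\<alpha> D' \<in> mats (n D') (n' D')" "\<alpha> D \<in> mats (n D) (n' D)" using \<alpha>(2) Suc by auto
  have "mmul (n' D) ?M (B D') = mmul (n D) (A D) (mmul (n' D) (\<alpha> D) (B D'))"
   by (rule mmul_assoc[symmetric, OF AD(1) Dm(2) BD(1)])
  also have "mmul (n' D) (\<alpha> D) (B D') = mmul (n D') (A D') (\<alpha> D')" using \<alpha>(4)[of D'] Suc by simp
  also have "mmul (n D) (A D) (mmul (n D') (A D') (\<alpha> D')) = mmul (n D') (mmul (n D) (A D) (A D')) (\<alpha> D')"
   by (rule mmul_assoc[OF AD(1) AD(1) Dm(1)])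
  also have "mmul (n D) (A D) (A D') = mzero" using AD(2)[of D'] Suc by simp
  also have "mmul (n D') mzero (\<alpha> D') = mzero" by (rule mmul_zero_l[OF Dm(1)])
  finally show ?thesis using BD(3)[of ?M "n (Suc D)" D'] M unfolding Suc by simp
 qed
 then obtain v W where v: "v \<in> U" "W \<in> mats (n (Suc D)) (n' (Suc D))" "msm v ?M = mmul (n' (Suc D)) W (B D)" by blast
 have c: "v \<in> carrier R" "u \<in> carrier R" "v ** u \<in> U" using U v(1) \<alpha>(1) unfolding mult_set_def by auto
 define \<alpha>' where "\<alpha>' j = (if j \<le> D then msm v (\<alpha> j) else W)" for j
 have "\<alpha>' j \<in> mats (n j) (n' j)" if "j \<le> Suc D" for j
  using that v(2) msm_mats[OF c(1) \<alpha>(2)] by (auto simp: \<alpha>'_def le_Suc_eq)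
 moreover have "\<alpha>' 0 = msm (v ** u) (mone 1)" unfolding \<alpha>'_def \<alpha>(3) using msm_msm[OF c(1,2) mone_mats] by simp
 moreover have "mmul (n j) (A j) (\<alpha>' j) = mmul (n' (Suc j)) (\<alpha>' (Suc j)) (B j)" if j: "j < Suc D" for j
 proof (cases "j = D")
  case True
  thus ?thesis using mmul_sm_r[OF c(1) AD(1) \<alpha>(2), of D D] v(3) by (simp add: \<alpha>'_def)
 next
  case False
  hence jD: "j < D" using j by simp
  thus ?thesis
   using mmul_sm_r[OF c(1) AD(1) \<alpha>(2), of j j] mmul_sm_l[OF c(1) \<alpha>(2)[of "Suc j"] BD(1), of j] \<alpha>(4)[OF jD]
   by (simp add: \<alpha>'_def)
 qed
 ultimately show ?case using c(3) by (intro bexI[of _ "v ** u"] exI[of _ \<alpha>']) auto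
qed

text \<open>Only \<open>B\<close> has to be exact: \<open>u f - A h\<close> in the next degree is a
  row-wise cycle of \<open>B\<close> and is lifted at the cost of a further factor, which is then
  applied to the earlier maps.\<close>

lemma null_homotopy_exists:
 assumes U: "mult_set U" and A: "!!j. A j \<in> mats (n (Suc j)) (n j)" "!!j. mmul (n (Suc j)) (A (Suc j)) (A j) = mzero"
  and B: "exact_upto U n' B"
  and f: "!!j. j \<le> D ==> f j \<in> mats (n j) (n' j)"
   "!!j. j < D ==> mmul (n j) (A j) (f j) = mmul (n' (Suc j)) (f (Suc j)) (B j)"
  and f0: "\<exists>u\<in>U. \<exists>W\<in>mats (n 0) (n' 1). msm u (f 0) = mmul (n' 1) W (B 0)"
 shows "\<exists>u\<in>U. \<exists>h. (\<forall>j\<le>D. h j \<in> mats (n j) (n' (Suc j))) \<and> msm u (f 0) = mmul (n' 1) (h 0) (B 0) \<and>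
  (\<forall>j<D. msm u (f (Suc j)) = madd (mmul (n' (Suc (Suc j))) (h (Suc j)) (B (Suc j))) (mmul (n j) (A j) (h j)))"
 using f
proof (induction D)
 case 0
 obtain u W where "u \<in> U" "W \<in> mats (n 0) (n' 1)" "msm u (f 0) = mmul (n' 1) W (B 0)" using f0 by blast
 thus ?case by (intro bexI[of _ u] exI[of _ "\<lambda>_. W"]) auto
next
 case (Suc D)
 note BD = exact_uptoD[OF B]
 obtain u h where h: "u \<in> U" "!!j. j \<le> D ==> h j \<in> mats (n j) (n' (Suc j))" "msm u (f 0) = mmul (n' 1) (h 0) (B 0)"
  "!!j. j < D ==> msm u (f (Suc j)) = madd (mmul (n' (Suc (Suc j))) (h (Suc j)) (B (Suc j))) (mmul (n j) (A j) (h j))"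
  using Suc by auto
 have uc: "u \<in> carrier R" using U h(1) unfolding mult_set_def by blast
 have fm: "f (Suc D) \<in> mats (n (Suc D)) (n' (Suc D))" "f D \<in> mats (n D) (n' D)" using Suc(2) by auto
 have hm: "h D \<in> mats (n D) (n' (Suc D))" using h(2) by simp
 let ?M = "msub (msm u (f (Suc D))) (mmul (n D) (A D) (h D))"
 have ufm: "msm u (f (Suc D)) \<in> mats (n (Suc D)) (n' (Suc D))" by (rule msm_mats[OF uc fm(1)])
 have Ah: "mmul (n D) (A D) (h D) \<in> mats (n (Suc D)) (n' (Suc D))" by (rule mmul_mats[OF A(1) hm])
 have M: "?M \<in> mats (n (Suc D)) (n' (Suc D))" by (rule msub_mats[OF ufm Ah])
 have uf: "mmul (n D) (A D) (msm u (f D)) = mmul (n D) (A D) (mmul (n' (Suc D)) (h D) (B D))"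
 proof (cases D)
  case 0 thus ?thesis using h(3) by simp
 next
  case (Suc D')
  have h': "h D' \<in> mats (n D') (n' D)" using h(2)[of D'] Suc by simp
  have "msm u (f D) = madd (mmul (n' (Suc D)) (h D) (B D)) (mmul (n D') (A D') (h D'))" using h(4)[of D'] Suc by simp
  hence "mmul (n D) (A D) (msm u (f D)) = madd (mmul (n D) (A D) (mmul (n' (Suc D)) (h D) (B D))) (mmul (n D) (A D) (mmul (n D') (A D') (h D')))"
   using mmul_add_r[OF A(1)[of D] mmul_mats[OF hm BD(1)[of D]], of "mmul (n D') (A D') (h D')"]
    mmul_mats[OF A(1)[of D'] h'] Suc by simp
  also have "mmul (n D) (A D) (mmul (n D') (A D') (h D')) = mmul (n D') (mmul (n D) (A D) (A D')) (h D')"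
   by (rule mmul_assoc[OF A(1) A(1) h'])
  also have "mmul (n D) (A D) (A D') = mzero" using A(2)[of D'] Suc by simp
  also have "mmul (n D') mzero (h D') = mzero" by (rule mmul_zero_l[OF h'])
  also have "madd (mmul (n D) (A D) (mmul (n' (Suc D)) (h D) (B D))) mzero = mmul (n D) (A D) (mmul (n' (Suc D)) (h D) (B D))"
   using matsD(1)[OF mmul_mats[OF A(1)[of D] mmul_mats[OF hm BD(1)[of D]]]] by (intro ext) (simp add: madd_def mzero_def)
  finally show ?thesis .
 qed
 have "mmul (n' (Suc D)) ?M (B D) = msub (mmul (n' (Suc D)) (msm u (f (Suc D))) (B D)) (mmul (n' (Suc D)) (mmul (n D) (A D) (h D)) (B D))"
  by (rule mmul_sub_l[OF ufm Ah BD(1)])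
 also have "mmul (n' (Suc D)) (msm u (f (Suc D))) (B D) = msm u (mmul (n' (Suc D)) (f (Suc D)) (B D))"
  by (rule mmul_sm_l[OF uc fm(1) BD(1)])
 also have "mmul (n' (Suc D)) (f (Suc D)) (B D) = mmul (n D) (A D) (f D)" using Suc(3)[of D] by simp
 also have "msm u (mmul (n D) (A D) (f D)) = mmul (n D) (A D) (msm u (f D))" by (rule mmul_sm_r[symmetric, OF uc A(1) fm(2)])
 also have "mmul (n' (Suc D)) (mmul (n D) (A D) (h D)) (B D) = mmul (n D) (A D) (mmul (n' (Suc D)) (h D) (B D))"
  by (rule mmul_assoc[symmetric, OF A(1) hm BD(1)])
 also have "msub (mmul (n D) (A D) (msm u (f D))) (mmul (n D) (A D) (mmul (n' (Suc D)) (h D) (B D))) = mzero"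
  unfolding uf by (rule msub_self[OF mmul_mats[OF A(1) mmul_mats[OF hm BD(1)]]])
 finally obtain v W where v: "v \<in> U" "W \<in> mats (n (Suc D)) (n' (Suc (Suc D)))" "msm v ?M = mmul (n' (Suc (Suc D))) W (B (Suc D))"
  using BD(3)[OF M] by blast
 have vc: "v \<in> carrier R" "v ** u \<in> U" using U v(1) h(1) unfolding mult_set_def by auto
 define h' where "h' j = (if j \<le> D then msm v (h j) else W)" for j
 have "h' j \<in> mats (n j) (n' (Suc j))" if "j \<le> Suc D" for j
  using that v(2) msm_mats[OF vc(1) h(2)] by (auto simp: h'_def le_Suc_eq)
 moreover have "msm (v ** u) (f 0) = mmul (n' 1) (h' 0) (B 0)"
  using msm_msm[OF vc(1) uc Suc(2)[of 0]] h(3) mmul_sm_l[OF vc(1) h(2)[of 0] BD(1)[of 0]] by (simp add: h'_def)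
 moreover have "msm (v ** u) (f (Suc j)) = madd (mmul (n' (Suc (Suc j))) (h' (Suc j)) (B (Suc j))) (mmul (n j) (A j) (h' j))"
  if j: "j < Suc D" for j
 proof (cases "j = D")
  case True
  have "msm (v ** u) (f (Suc D)) = msm v (msm u (f (Suc D)))" by (rule msm_msm[symmetric, OF vc(1) uc fm(1)])
  also have "msm u (f (Suc D)) = madd ?M (mmul (n D) (A D) (h D))" by (rule madd_msub[symmetric, OF ufm Ah])
  also have "msm v \<dots> = madd (msm v ?M) (msm v (mmul (n D) (A D) (h D)))" by (rule msm_add[OF vc(1) M Ah])
  also have "msm v (mmul (n D) (A D) (h D)) = mmul (n D) (A D) (msm v (h D))" by (rule mmul_sm_r[symmetric, OF vc(1) A(1) hm])
  finally show ?thesis using True v(3) by (simp add: h'_def)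
 next
  case False
  hence jD: "j < D" using j by simp
  have hj: "h j \<in> mats (n j) (n' (Suc j))" "h (Suc j) \<in> mats (n (Suc j)) (n' (Suc (Suc j)))" using h(2) jD by auto
  have "msm (v ** u) (f (Suc j)) = msm v (msm u (f (Suc j)))" by (rule msm_msm[symmetric, OF vc(1) uc Suc(2)]) (use jD in simp)
  also have "\<dots> = madd (msm v (mmul (n' (Suc (Suc j))) (h (Suc j)) (B (Suc j)))) (msm v (mmul (n j) (A j) (h j)))"
   unfolding h(4)[OF jD] by (rule msm_add[OF vc(1) mmul_mats[OF hj(2) BD(1)] mmul_mats[OF A(1) hj(1)]])
  finally show ?thesis
   using mmul_sm_l[OF vc(1) hj(2) BD(1)[of "Suc j"]] mmul_sm_r[OF vc(1) A(1) hj(1)] jD by (simp add: h'_def)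
 qed
 ultimately show ?case using vc(2) by (intro bexI[of _ "v ** u"] exI[of _ h']) auto
qed

end

section \<open>Comparison of resolutions and depth\<close>

context cring
begin

lemma mult_set_prime: "primeideal P R ==> mult_set (carrier R - P)"
 unfolding mult_set_def using primeD(2,3)[of P] by auto

lemma mult_set_one: "mult_set {\<one>}" unfolding mult_set_def by auto

lemma mult_setD: "mult_set U ==> u \<in> U ==> u \<in> carrier R" "mult_set U ==> \<one> \<in> U"
  "mult_set U ==> u \<in> U ==> v \<in> U ==> u ** v \<in> U"
 unfolding mult_set_def by auto

lemma mats_zero_cols: "A \<in> mats r 0 ==> A = mzero"
 unfolding mats_def mzero_def by (intro ext) auto

lemma msub_mzero: "A \<in> mats r c ==> msub A mzero = A"
 unfolding mats_def mzero_def msub_def by (intro ext) (auto simp: minus_eq)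

text \<open>Multiplication by \<open>u\<close> on the module of degree \<open>Suc j\<close>, not
  \<open>j\<close>, is the boundary of the homotopy \<open>h\<close>.\<close>

abbreviation contracts :: "(nat => nat) => (nat => nat => nat => 'a) => (nat => nat => nat => 'a) => 'a => nat => bool" where
 "contracts n A h u j \<equiv> msm u (mone (n (Suc j))) =
   madd (mmul (n (Suc (Suc j))) (h (Suc j)) (A (Suc j))) (mmul (n j) (A j) (h j))"

text \<open>The composite of comparison maps from \<open>A\<close> to \<open>B\<close> and back
  lifts multiplication by \<open>u ** v\<close>, so their difference is null homotopic. In degrees
  where \<open>B\<close> is zero the composite vanishes, and multiplication itself is
  contracted.\<close>

lemma comparison_homotopy:
 assumes U: "mult_set U" and I: "ideal I R" and A: "resolves_upto U I n A" and B: "resolves_upto U I n' B"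
 shows "\<exists>u\<in>U. \<exists>h. (\<forall>j\<le>D. h j \<in> mats (n j) (n (Suc j))) \<and>
  (\<forall>j<D. n' (Suc j) = 0 --> contracts n A h u j)"
proof -
 note AD = exact_uptoD[OF resolves_uptoD(1)[OF A]] and BD = exact_uptoD[OF resolves_uptoD(1)[OF B]]
 note An = resolves_uptoD(2)[OF A] and Bn = resolves_uptoD(2)[OF B]
 obtain u \<alpha> where \<alpha>: "u \<in> U" "!!j. j \<le> D ==> \<alpha> j \<in> mats (n j) (n' j)" "\<alpha> 0 = msm u (mone 1)"
  "!!j. j < D ==> mmul (n j) (A j) (\<alpha> j) = mmul (n' (Suc j)) (\<alpha> (Suc j)) (B j)"
  using chain_map_exists[OF U I A B, of D] by blast
 obtain v \<beta> where \<beta>: "v \<in> U" "!!j. j \<le> D ==> \<beta> j \<in> mats (n' j) (n j)" "\<beta> 0 = msm v (mone 1)"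
  "!!j. j < D ==> mmul (n' j) (B j) (\<beta> j) = mmul (n (Suc j)) (\<beta> (Suc j)) (A j)"
  using chain_map_exists[OF U I B A, of D] by blast
 have c: "u \<in> carrier R" "v \<in> carrier R" "u ** v \<in> U" "u ** v \<in> carrier R"
  using mult_setD[OF U] \<alpha>(1) \<beta>(1) by auto
 define f where "f j = msub (msm (u ** v) (mone (n j))) (mmul (n' j) (\<alpha> j) (\<beta> j))" for j
 have sm: "msm (u ** v) (mone (n j)) \<in> mats (n j) (n j)" for j by (rule msm_mats[OF c(4) mone_mats])
 have ab: "mmul (n' j) (\<alpha> j) (\<beta> j) \<in> mats (n j) (n j)" if "j \<le> D" for j
  by (rule mmul_mats[OF \<alpha>(2)[OF that] \<beta>(2)[OF that]])
 have fm: "f j \<in> mats (n j) (n j)" if "j \<le> D" for j unfolding f_def by (rule msub_mats[OF sm ab[OF that]])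
 have f0: "f 0 = mzero"
 proof -
  have "mmul (n' 0) (\<alpha> 0) (\<beta> 0) = msm u (mmul 1 (mone 1) (msm v (mone 1)))"
   unfolding \<alpha>(3) \<beta>(3) Bn by (rule mmul_sm_l[OF c(1) mone_mats msm_mats[OF c(2) mone_mats]])
  also have "mmul 1 (mone 1) (msm v (mone 1)) = msm v (mone 1)" by (rule mmul_one_l[OF msm_mats[OF c(2) mone_mats]])
  also have "msm u (msm v (mone 1)) = msm (u ** v) (mone 1)" by (rule msm_msm[OF c(1,2) mone_mats])
  finally show ?thesis unfolding f_def An by (simp add: msub_self[OF msm_mats[OF c(4) mone_mats]])
 qed
 have comm: "mmul (n j) (A j) (f j) = mmul (n (Suc j)) (f (Suc j)) (A j)" if j: "j < D" for j
 proof -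
  have m: "\<alpha> j \<in> mats (n j) (n' j)" "\<alpha> (Suc j) \<in> mats (n (Suc j)) (n' (Suc j))"
   "\<beta> j \<in> mats (n' j) (n j)" "\<beta> (Suc j) \<in> mats (n' (Suc j)) (n (Suc j))" using \<alpha>(2) \<beta>(2) j by auto
  have "mmul (n j) (A j) (f j) = msub (mmul (n j) (A j) (msm (u ** v) (mone (n j)))) (mmul (n j) (A j) (mmul (n' j) (\<alpha> j) (\<beta> j)))"
   unfolding f_def by (rule mmul_sub_r[OF AD(1) sm ab]) (use j in simp)
  also have "mmul (n j) (A j) (msm (u ** v) (mone (n j))) = msm (u ** v) (A j)"
   using mmul_sm_r[OF c(4) AD(1)[of j] mone_mats] mmul_one_r[OF AD(1)[of j]] by simp
  also have "\<dots> = mmul (n (Suc j)) (msm (u ** v) (mone (n (Suc j)))) (A j)"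
   using mmul_sm_l[OF c(4) mone_mats AD(1)[of j]] mmul_one_l[OF AD(1)[of j]] by simp
  also have "mmul (n j) (A j) (mmul (n' j) (\<alpha> j) (\<beta> j)) = mmul (n' j) (mmul (n j) (A j) (\<alpha> j)) (\<beta> j)"
   by (rule mmul_assoc[OF AD(1) m(1,3)])
  also have "\<dots> = mmul (n' j) (mmul (n' (Suc j)) (\<alpha> (Suc j)) (B j)) (\<beta> j)" using \<alpha>(4)[OF j] by simp
  also have "\<dots> = mmul (n' (Suc j)) (\<alpha> (Suc j)) (mmul (n' j) (B j) (\<beta> j))" by (rule mmul_assoc[symmetric, OF m(2) BD(1) m(3)])
  also have "mmul (n' j) (B j) (\<beta> j) = mmul (n (Suc j)) (\<beta> (Suc j)) (A j)" using \<beta>(4)[OF j] .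
  also have "mmul (n' (Suc j)) (\<alpha> (Suc j)) (mmul (n (Suc j)) (\<beta> (Suc j)) (A j)) =
    mmul (n (Suc j)) (mmul (n' (Suc j)) (\<alpha> (Suc j)) (\<beta> (Suc j))) (A j)" by (rule mmul_assoc[OF m(2,4) AD(1)])
  also have "msub (mmul (n (Suc j)) (msm (u ** v) (mone (n (Suc j)))) (A j))
    (mmul (n (Suc j)) (mmul (n' (Suc j)) (\<alpha> (Suc j)) (\<beta> (Suc j))) (A j)) = mmul (n (Suc j)) (f (Suc j)) (A j)"
   unfolding f_def by (rule mmul_sub_l[symmetric, OF sm ab AD(1)]) (use j in simp)
  finally show ?thesis .
 qed
 have "\<exists>w\<in>U. \<exists>W\<in>mats (n 0) (n 1). msm w (f 0) = mmul (n 1) W (A 0)"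
  using mult_setD(2)[OF U] mmul_zero_l[OF AD(1)[of 0], of "n 1"] mzero_mats[of "n 0" "n 1"]
  by (intro bexI[of _ \<one>] bexI[of _ mzero]) (auto simp: f0 msm_def mzero_def)
 from null_homotopy_exists[where D = D, OF U AD(1,2) resolves_uptoD(1)[OF A] fm comm this]
 obtain w h where h: "w \<in> U" "!!j. j \<le> D ==> h j \<in> mats (n j) (n (Suc j))"
  "!!j. j < D ==> msm w (f (Suc j)) = madd (mmul (n (Suc (Suc j))) (h (Suc j)) (A (Suc j))) (mmul (n j) (A j) (h j))"
  by auto
 have wc: "w \<in> carrier R" "w ** (u ** v) \<in> U" using mult_setD[OF U] h(1) c(3) by auto
 \<comment> \<open>For \<open>n' (Suc j) = 0\<close> the matrix \<open>\<alpha> (Suc j)\<close> has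
   no columns, so \<open>f (Suc j)\<close> is multiplication by \<open>u ** v\<close>.\<close>
 have "contracts n A h (w ** (u ** v)) j"
  if j: "j < D" and z: "n' (Suc j) = 0" for j
 proof -
  have "f (Suc j) = msm (u ** v) (mone (n (Suc j)))"
   using mmul_zero_l[of "\<beta> (Suc j)" "n' (Suc j)" "n (Suc j)" 0] \<alpha>(2)[of "Suc j"] \<beta>(2)[of "Suc j"] j z mats_zero_cols[of "\<alpha> (Suc j)" "n (Suc j)"]
   by (simp add: f_def msub_mzero[OF sm])
  thus ?thesis using h(3)[OF j] msm_msm[OF wc(1) c(4) mone_mats, of "n (Suc j)"] by simp
 qed
 thus ?thesis using wc(2) h(2) by (intro bexI[of _ "w ** (u ** v)"] exI[of _ h]) auto
qed

lemma mmul_in_ideal: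
 assumes P: "ideal P R" and A: "A \<in> mats r n" and B: "B \<in> mats n' c"
  and in_P: "(\<forall>k l. A k l \<in> P) \<or> (\<forall>k l. B k l \<in> P)"
 shows "mmul n A B k l \<in> P"
proof -
 have "A k i ** B i l \<in> P" for i
  using in_P idealD(5)[OF P, of "B i l" "A k i"] idealD(6)[OF P, of "A k i" "B i l"] matsD(1)[OF A] matsD(1)[OF B] by auto
 thus ?thesis unfolding mmul_def by (rule finsum_in_ideal[OF P])
qed

text \<open>A diagonal entry on the left would be \<open>u\<close>, while all entries on the right
  lie in \<open>P\<close>.\<close>

lemma minimal_homotopy_zero:
 assumes P: "ideal P R" and A: "!!j. A j \<in> mats (n (Suc j)) (n j)" "!!j k l. A j k l \<in> P"
  and h: "h j \<in> mats (n j) (n (Suc j))" "h (Suc j) \<in> mats (n (Suc j)) (n (Suc (Suc j)))"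
  and u: "u \<notin> P" "u \<in> carrier R"
  and eq: "contracts n A h u j"
 shows "n (Suc j) = 0"
proof (rule ccontr)
 assume "n (Suc j) ~= 0"
 hence "u = msm u (mone (n (Suc j))) 0 0" using u(2) by (simp add: msm_def mone_def)
 also have "\<dots> \<in> P" unfolding eq madd_def
  using idealD(4)[OF P mmul_in_ideal[OF P h(2) A(1)] mmul_in_ideal[OF P A(1) h(1)]] A(2) by simp
 finally show False using u(1) by simp
qed

end

text \<open>Through associated primes: the maximal ones among the annihilators modulo
  \<open>b\<close> are prime, every zero divisor lies in one of them, and prime avoidance puts
  \<open>P\<close> into a single one.\<close>

lemma (in noetherian_cring) zero_divisor_ideal:
 assumes b: "ideal b R" and P: "ideal P R" and zd: "!!y. y \<in> P ==> \<exists>z\<in>carrier R - b. y ** z \<in> b"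
 shows "\<exists>z\<in>carrier R - b. \<forall>y\<in>P. y ** z \<in> b"
proof -
 define ann where "ann z = {r \<in> carrier R. r ** z \<in> b}" for z
 have ann: "ideal (ann z) R" if "z \<in> carrier R" for z unfolding ann_def by (rule quotient_ideal[OF b that])
 define Z where "Z = {z \<in> carrier R - b. \<forall>w\<in>carrier R - b. ann z \<subseteq> ann w --> ann w = ann z}"
 have above: "\<exists>z'\<in>Z. ann z \<subseteq> ann z'" if z: "z \<in> carrier R - b" for z
 proof -
  obtain M where M: "M \<in> ann ` {w \<in> carrier R - b. ann z \<subseteq> ann w}"
   "!!J. J \<in> ann ` {w \<in> carrier R - b. ann z \<subseteq> ann w} ==> M \<subseteq> J ==> J = M"
   by (rule maximal_ideal_in[of "ann ` {w \<in> carrier R - b. ann z \<subseteq> ann w}"]) (use z ann in auto)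
  then obtain w where w: "w \<in> carrier R - b" "ann z \<subseteq> ann w" "M = ann w" by blast
  have "ann w' = ann w" if "w' \<in> carrier R - b" "ann w \<subseteq> ann w'" for w'
   using M(2)[of "ann w'"] w that by blast
  thus ?thesis using w unfolding Z_def by blast
 qed
 have prime: "primeideal (ann z) R" if z: "z \<in> Z" for z
 proof (rule primeidealI)
  have zc: "z \<in> carrier R" "z \<notin> b" using z unfolding Z_def by auto
  show "ideal (ann z) R" "cring R" using ann zc(1) is_cring by auto
  have "\<one> \<notin> ann z" using zc unfolding ann_def by simp
  thus "carrier R ~= ann z" by blast
  fix r s assume rs: "r \<in> carrier R" "s \<in> carrier R" "r ** s \<in> ann z"
  show "r \<in> ann z \<or> s \<in> ann z"
  proof (rule disjCI)
   assume "s \<notin> ann z"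
   hence sz: "s ** z \<in> carrier R - b" using rs zc unfolding ann_def by auto
   have "ann z \<subseteq> ann (s ** z)"
    using idealD(5)[OF b] rs(2) zc(1) unfolding ann_def by (auto simp: m_lcomm[of _ s z])
   hence "ann (s ** z) = ann z" using z sz unfolding Z_def by blast
   moreover have "r \<in> ann (s ** z)" using rs zc(1) unfolding ann_def by (auto simp: m_assoc)
   ultimately show "r \<in> ann z" by simp
  qed
 qed
 \<comment> \<open>A finite \<open>F\<close> that generates all of \<open>Z\<close> modulo
   \<open>b\<close> stands in for finiteness of the set of maximal annihilators.\<close>
 define S where "S = {Idl (b \<union> F) | F. finite F \<and> F \<subseteq> Z}"
 have bF: "b \<union> F \<subseteq> carrier R" if "F \<subseteq> Z" for F using that idealD(1)[OF b] unfolding Z_def by auto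
 obtain L where L: "L \<in> S" "!!J. J \<in> S ==> L \<subseteq> J ==> J = L"
  by (rule maximal_ideal_in[of S]) (use genideal_ideal bF in \<open>auto simp: S_def\<close>)
 then obtain F where F: "L = Idl (b \<union> F)" "finite F" "F \<subseteq> Z" unfolding S_def by auto
 have ZL: "z \<in> L" if z: "z \<in> Z" for z
 proof -
  have zF: "b \<union> insert z F \<subseteq> carrier R" using bF[of "insert z F"] F(3) z by simp
  have "Idl (b \<union> insert z F) \<in> S" using F z unfolding S_def by blast
  moreover have "L \<subseteq> Idl (b \<union> insert z F)" unfolding F(1)
   by (rule genideal_minimal[OF genideal_ideal[OF zF]]) (use genideal_self[OF zF] in auto)
  ultimately show ?thesis using L(2) genideal_self[OF zF] by blast
 qed
 have "\<exists>Q\<in>ann ` F. P \<subseteq> Q"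
 proof (rule ccontr)
  assume nsub: "\<not> ?thesis"
  obtain x where x: "x \<in> P" "!!Q. Q \<in> ann ` F ==> x \<notin> Q"
   by (rule prime_avoidance[of "ann ` F" P]) (use nsub F prime P in auto)
  obtain z where z: "z \<in> carrier R - b" "x ** z \<in> b" using zd[OF x(1)] by blast
  obtain z' where z': "z' \<in> Z" "ann z \<subseteq> ann z'" using above[OF z(1)] by blast
  have xc: "x \<in> carrier R" using idealD(2)[OF P x(1)] .
  have xz: "x \<in> ann z'" using z'(2) z(2) xc unfolding ann_def by auto
  have zc: "z' \<in> carrier R" "z' \<notin> b" using z'(1) unfolding Z_def by auto
  have nle: "\<not> ann f \<subseteq> ann z'" if f: "f \<in> F" for f
   using x(2)[of "ann f"] xz f F(3) zc unfolding Z_def by blast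
  \<comment> \<open>No \<open>ann f\<close> lies below the prime \<open>ann z'\<close>, so a product
    of elements of the \<open>ann f\<close> stays outside \<open>ann z'\<close>; yet it kills
    \<open>F\<close>, hence \<open>L\<close>, hence \<open>z'\<close> modulo
    \<open>b\<close>.\<close>
  have "\<exists>t\<in>carrier R. t \<notin> ann z' \<and> (\<forall>f\<in>G. t \<in> ann f)" if "finite G" "G \<subseteq> F" for G
   using that
  proof (induction G)
   case empty
   thus ?case using zc by (intro bexI[of _ \<one>]) (auto simp: ann_def)
  next
   case (insert f G)
   then obtain t where t: "t \<in> carrier R" "t \<notin> ann z'" "!!g. g \<in> G ==> t \<in> ann g" by auto
   obtain a where a: "a \<in> ann f" "a \<notin> ann z'" using nle[of f] insert(4) by blast
   have fc: "f \<in> carrier R" "G \<subseteq> carrier R" using insert(4) F(3) unfolding Z_def by auto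
   have ac: "a \<in> carrier R" using a(1) unfolding ann_def by simp
   have "t ** a \<notin> ann z'" using primeD(3)[OF prime[OF z'(1)], of t a] t a ac by blast
   moreover have "t ** a \<in> ann g" if "g \<in> insert f G" for g
   proof (cases "g = f")
    case True thus ?thesis using idealD(5)[OF ann[OF fc(1)] a(1) t(1)] by simp
   next
    case False
    hence "g \<in> G" "g \<in> carrier R" using that fc by auto
    thus ?thesis using idealD(6)[OF ann t(3) ac] by simp
   qed
   ultimately show ?case using t(1) ac by (intro bexI[of _ "t ** a"]) auto
  qed
  from this[OF F(2)] obtain t where t: "t \<in> carrier R" "t \<notin> ann z'" "!!f. f \<in> F ==> t \<in> ann f" by auto
  have "L \<subseteq> ann t" unfolding F(1)
  proof (rule genideal_minimal[OF ann[OF t(1)]])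
   have "f \<in> ann t" if f: "f \<in> F" for f
    using t(3)[OF f] f F(3) t(1) m_comm[of t f] unfolding ann_def Z_def by auto
   moreover have "f \<in> ann t" if "f \<in> b" for f
    using that idealD(6)[OF b that t(1)] idealD(2)[OF b that] unfolding ann_def by simp
   ultimately show "b \<union> F \<subseteq> ann t" by auto
  qed
  hence "z' ** t \<in> b" using ZL[OF z'(1)] unfolding ann_def by auto
  hence "t \<in> ann z'" using t(1) zc m_comm[of t z'] unfolding ann_def by simp
  thus False using t(2) by simp
 qed
 then obtain f where "f \<in> F" "P \<subseteq> ann f" by auto
 thus ?thesis using F(3) unfolding Z_def ann_def by blast
qed


text \<open>Finitely many multipliers are multiplied together; \<open>mult\<close> says that a
  further factor does no harm.\<close>

lemma (in cring) common_multiplier: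
 assumes U: "mult_set U" and Q: "!!l. l < (r::nat) ==> \<exists>u\<in>U. Q u l"
  and mult: "!!u v l. u \<in> U ==> v \<in> U ==> Q u l ==> Q (v ** u) l"
 shows "\<exists>u\<in>U. \<forall>l<r. Q u l"
 using Q
proof (induction r)
 case 0 thus ?case using mult_setD(2)[OF U] by auto
next
 case (Suc r)
 then obtain u v where uv: "u \<in> U" "!!l. l < r ==> Q u l" "v \<in> U" "Q v r" by (meson less_Suc_eq)
 have "Q (v ** u) l" if "l < Suc r" for l
 proof (cases "l = r")
  case True
  have "v ** u = u ** v" using mult_setD(1)[OF U] uv m_comm by blast
  thus ?thesis using mult[OF uv(3,1,4)] True by simp
 next
  case False
  thus ?thesis using mult[OF uv(1,3)] uv(2)[of l] that by simp
 qed
 thus ?case using mult_setD(3)[OF U uv(3,1)] by (intro bexI[of _ "v ** u"]) auto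
qed

text \<open>The products \<open>y^k s\<close> with \<open>s\<close> outside \<open>Q\<close> form a
  multiplicative set, disjoint from \<open>b\<close> because \<open>y\<close> is regular modulo
  \<open>b\<close>; a prime avoiding this set lies below \<open>Q\<close>.\<close>

lemma (in noetherian_cring) prime_below_avoiding:
 assumes b: "ideal b R" and y: "y \<in> carrier R" "!!z. z \<in> carrier R ==> y ** z \<in> b ==> z \<in> b"
  and Q: "primeideal Q R" "b \<subseteq> Q"
 shows "\<exists>Q'. primeideal Q' R \<and> b \<subseteq> Q' \<and> Q' \<subseteq> Q \<and> y \<notin> Q'"
proof -
 define S where "S = {y [^] k ** s | (k::nat) s. s \<in> carrier R - Q}"
 have S: "S \<subseteq> carrier R" "\<one> \<in> S" using y(1) primeD(2)[OF Q(1)] unfolding S_def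
  by (auto intro!: exI[of _ "0::nat"] exI[of _ \<one>])
 have Sm: "a ** a' \<in> S" if aa: "a \<in> S" "a' \<in> S" for a a'
 proof -
  obtain k s k' s' where *: "a = y [^] (k::nat) ** s" "s \<in> carrier R - Q" "a' = y [^] (k'::nat) ** s'" "s' \<in> carrier R - Q"
   using aa unfolding S_def by blast
  have "a ** a' = y [^] (k + k') ** (s ** s')"
   unfolding *(1,3) nat_pow_mult[OF y(1), symmetric] using *(2,4) y(1) by (simp add: m_ac)
  thus ?thesis unfolding S_def using mult_setD(3)[OF mult_set_prime[OF Q(1)] *(2,4)] by blast
 qed
 have yk: "z \<in> b" if "y [^] k ** z \<in> b" "z \<in> carrier R" for k :: nat and z
  using that
 proof (induction k arbitrary: z)
  case (Suc k)
  have "y [^] Suc k ** z = y [^] k ** (y ** z)" using y(1) Suc(3) by (simp add: m_assoc)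
  thus ?case using Suc(1)[of "y ** z"] Suc(2,3) y(1) y(2)[of z] by simp
 qed simp
 have bS: "b \<inter> S = {}" using yk Q(2) unfolding S_def by blast
 obtain Q' where Q': "primeideal Q' R" "b \<subseteq> Q'" "Q' \<inter> S = {}"
  by (rule prime_disjoint[OF b S Sm bS])
 have "y [^] (1::nat) ** \<one> \<in> S" unfolding S_def using primeD(2)[OF Q(1)] by blast
 hence "y \<notin> Q'" using Q'(3) y(1) by auto
 moreover have "s \<in> Q" if s: "s \<in> Q'" for s
 proof (rule ccontr)
  have sc: "s \<in> carrier R" using idealD(2)[OF primeD(1)[OF Q'(1)] s] .
  assume "s \<notin> Q"
  hence "y [^] (0::nat) ** s \<in> S" unfolding S_def using sc by blast
  thus False using Q'(3) s sc by auto
 qed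
 ultimately show ?thesis using Q'(1,2) by blast
qed

text \<open>Going modulo one element at a time that is regular modulo the previous ones: the complex
 stays exact in degrees \<open>> j\<close> modulo \<open>b\<close>, and such an element exists as long as \<open>j < t\<close>,
 since otherwise a multiple of a basis vector of the last nonzero module would be a cycle.\<close>

lemma (in noetherian_cring) minimal_complex_chain:
 assumes P: "primeideal P R" and A: "exact_upto (carrier R - P) n A" "!!j k l. A j k l \<in> P"
  and t: "n t > 0" "n (Suc t) = 0"
 shows "chain_to R t P"
proof -
 let ?U = "carrier R - P"
 note U = mult_set_prime[OF P] and PI = primeD(1)[OF P] and AD = exact_uptoD[OF A(1)]
 note PD = idealD[OF PI]
 \<comment> \<open>The contraction to \<open>R\<close> of the localisation of \<open>b\<close> at
   \<open>P\<close>.\<close>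
 define sat where "sat b = {x \<in> carrier R. \<exists>u\<in>?U. u ** x \<in> b}" for b
 have sat: "ideal (sat b) R" "b \<subseteq> sat b" "!!u x. u \<in> ?U ==> x \<in> carrier R ==> u ** x \<in> sat b ==> x \<in> sat b"
  "!!Q. primeideal Q R ==> b \<subseteq> Q ==> Q \<subseteq> P ==> sat b \<subseteq> Q"
  if b: "ideal b R" for b
 proof -
  note bD = idealD[OF b]
  show "ideal (sat b) R"
  proof (rule ideal_intro)
   show "sat b \<subseteq> carrier R" unfolding sat_def by auto
   show "\<zero> \<in> sat b" unfolding sat_def using bD(3) mult_setD(2)[OF U] by (auto intro!: bexI[of _ \<one>])
  next
   fix x y assume "x \<in> sat b" "y \<in> sat b"
   then obtain u v where uv: "u \<in> ?U" "u ** x \<in> b" "v \<in> ?U" "v ** y \<in> b" and c: "x \<in> carrier R" "y \<in> carrier R"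
    unfolding sat_def by blast
   have uc: "u \<in> carrier R" "v \<in> carrier R" using uv by auto
   have "(u ** v) ** (x \<oplus> y) = v ** (u ** x) \<oplus> u ** (v ** y)" using uc c by algebra
   also have "\<dots> \<in> b" using bD(4)[OF bD(5)[OF uv(2) uc(2)] bD(5)[OF uv(4) uc(1)]] .
   finally show "x \<oplus> y \<in> sat b" unfolding sat_def using mult_setD(3)[OF U uv(1,3)] c by blast
  next
   fix x r assume "x \<in> sat b" and r: "r \<in> carrier R"
   then obtain u where u: "u \<in> ?U" "u ** x \<in> b" "x \<in> carrier R" unfolding sat_def by blast
   have "u ** (r ** x) = r ** (u ** x)" using u r by (simp add: m_lcomm)
   hence "u ** (r ** x) \<in> b" using bD(5)[OF u(2) r] by simp
   thus "r ** x \<in> sat b" unfolding sat_def using u(1) m_closed[OF r u(3)] by blast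
  qed
  show "b \<subseteq> sat b" using bD(2) mult_setD(2)[OF U] unfolding sat_def by (auto intro!: bexI[of _ \<one>])
  show "x \<in> sat b" if that: "u \<in> ?U" "x \<in> carrier R" "u ** x \<in> sat b" for u x
  proof -
   note ux = that
   obtain v where v: "v \<in> ?U" "v ** (u ** x) \<in> b" using ux(3) unfolding sat_def by blast
   have "(v ** u) ** x \<in> b" using v that m_assoc[of v u x] by auto
   thus ?thesis unfolding sat_def using mult_setD(3)[OF U v(1) that(1)] that(2) by blast
  qed
  show "sat b \<subseteq> Q" if Q: "primeideal Q R" "b \<subseteq> Q" "Q \<subseteq> P" for Q
  proof
   fix x assume "x \<in> sat b"
   then obtain u where u: "u \<in> ?U" "u ** x \<in> b" "x \<in> carrier R" unfolding sat_def by blast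
   thus "x \<in> Q" using primeD(3)[OF Q(1), of u x] Q by blast
  qed
 qed
 \<comment> \<open>Exactness modulo \<open>b\<close> in degrees above \<open>j\<close>, up to
   multipliers outside \<open>P\<close>; single rows suffice for the induction.\<close>
 define ex where "ex j b \<longleftrightarrow> (\<forall>i\<ge>j. \<forall>M\<in>mats 1 (n (Suc i)). (\<forall>l. mmul (n (Suc i)) M (A i) 0 l \<in> b) -->
   (\<exists>u\<in>?U. \<exists>W\<in>mats 1 (n (Suc (Suc i))). \<forall>l. u ** M 0 l \<ominus> mmul (n (Suc (Suc i))) W (A (Suc i)) 0 l \<in> b))" for j b
 have "\<exists>b. ideal b R \<and> b \<subseteq> P \<and> (\<forall>u\<in>?U. \<forall>x\<in>carrier R. u ** x \<in> b --> x \<in> b) \<and> ex j b \<and>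
   (\<forall>Q. primeideal Q R \<and> b \<subseteq> Q \<and> Q \<subseteq> P --> chain_to R j Q)" if "j \<le> t" for j
  using that
 proof (induction j)
  case 0
  note s = sat[OF zeroideal]
  have "ex 0 (sat {\<zero>})" unfolding ex_def
  proof (intro allI ballI impI)
   fix i M assume M: "M \<in> mats 1 (n (Suc i))" and z: "\<forall>l. mmul (n (Suc i)) M (A i) 0 l \<in> sat {\<zero>}"
   note MA = mmul_mats[OF M AD(1)[of i]]
   have "\<exists>u\<in>?U. \<forall>l<n i. u ** mmul (n (Suc i)) M (A i) 0 l = \<zero>"
   proof (rule common_multiplier[OF U])
    show "\<exists>u\<in>?U. u ** mmul (n (Suc i)) M (A i) 0 l = \<zero>" for l using z unfolding sat_def by blast
   next
    fix u v l assume "u \<in> ?U" "v \<in> ?U" "u ** mmul (n (Suc i)) M (A i) 0 l = \<zero>"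
    thus "(v ** u) ** mmul (n (Suc i)) M (A i) 0 l = \<zero>" using m_assoc[of v u] matsD(1)[OF MA] by simp
   qed
   then obtain u where u: "u \<in> ?U" "!!l. l < n i ==> u ** mmul (n (Suc i)) M (A i) 0 l = \<zero>" by blast
   have uc: "u \<in> carrier R" using u by simp
   have "msm u (mmul (n (Suc i)) M (A i)) k l = mzero k l" for k l
    using u(2)[of l] matsD(2)[OF MA, of k l] matsD(3)[OF MA, of l k] uc
    by (cases "k = 0"; cases "l < n i") (auto simp: msm_def mzero_def)
   hence "mmul (n (Suc i)) (msm u M) (A i) = mzero"
    unfolding mmul_sm_l[OF uc M AD(1)] by (intro ext)
   from AD(3)[OF msm_mats[OF uc M] this] obtain v W where v: "v \<in> ?U" "W \<in> mats 1 (n (Suc (Suc i)))"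
    "msm v (msm u M) = mmul (n (Suc (Suc i))) W (A (Suc i))" by blast
   have "(v ** u) ** M 0 l \<ominus> mmul (n (Suc (Suc i))) W (A (Suc i)) 0 l = \<zero>" for l
   proof -
    have "mmul (n (Suc (Suc i))) W (A (Suc i)) 0 l = (v ** u) ** M 0 l"
     unfolding v(3)[symmetric] msm_def using v(1) uc matsD(1)[OF M] by (simp add: m_assoc)
    thus ?thesis using v(1) uc matsD(1)[OF M] by (simp add: r_neg minus_eq)
   qed
   thus "\<exists>u\<in>?U. \<exists>W\<in>mats 1 (n (Suc (Suc i))). \<forall>l. u ** M 0 l \<ominus> mmul (n (Suc (Suc i))) W (A (Suc i)) 0 l \<in> sat {\<zero>}"
    using mult_setD(3)[OF U v(1) u(1)] v(2) idealD(3)[OF s(1)]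
    by (intro bexI[of _ "v ** u"] bexI[of _ W]) auto
  qed
  moreover have "chain_to R 0 Q" if "primeideal Q R" for Q using chain_to_0[OF that] .
  moreover have "sat {\<zero>} \<subseteq> P" using s(4)[OF P] PD(3) by simp
  ultimately show ?case using s(1,3) by (intro exI[of _ "sat {\<zero>}"]) simp
 next
  case (Suc j)
  then obtain b where b: "ideal b R" "b \<subseteq> P" "!!u x. u \<in> ?U ==> x \<in> carrier R ==> u ** x \<in> b ==> x \<in> b"
   "ex j b" "!!Q. primeideal Q R ==> b \<subseteq> Q ==> Q \<subseteq> P ==> chain_to R j Q" by auto
  note bD = idealD[OF b(1)]
  have exj: "\<exists>u\<in>?U. \<exists>W\<in>mats 1 (n (Suc (Suc i))). \<forall>l. u ** M 0 l \<ominus> mmul (n (Suc (Suc i))) W (A (Suc i)) 0 l \<in> b"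
   if "j \<le> i" "M \<in> mats 1 (n (Suc i))" "!!l. mmul (n (Suc i)) M (A i) 0 l \<in> b" for i M
   using b(4) that unfolding ex_def by blast
  have "\<exists>y\<in>P. \<forall>z\<in>carrier R. y ** z \<in> b --> z \<in> b"
  proof (rule ccontr)
   assume "\<not> ?thesis"
   hence "\<exists>z\<in>carrier R - b. \<forall>y\<in>P. y ** z \<in> b" by (intro zero_divisor_ideal[OF b(1) PI]) blast
   then obtain z where z: "z \<in> carrier R" "z \<notin> b" "!!y. y \<in> P ==> y ** z \<in> b" by blast
   obtain i where i: "t = Suc i" "j \<le> i" using Suc(2) by (cases t) auto
   \<comment> \<open>\<open>z\<close> times the first basis vector of the last nonzero module. It is
     a cycle modulo \<open>b\<close> because the entries of \<open>A i\<close> lie in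
     \<open>P\<close>, and since \<open>n (Suc t) = 0\<close> it can only be a boundary if a
     multiple of \<open>z\<close> lies in \<open>b\<close>.\<close>
   let ?M = "\<lambda>k l. if k = (0::nat) \<and> l = (0::nat) then z else \<zero>"
   have M: "?M \<in> mats 1 (n (Suc i))" using z(1) t(1) i(1) by (intro matsI) auto
   have "mmul (n (Suc i)) ?M (A i) 0 l = A i 0 l ** z" for l
   proof -
    have "mmul (n (Suc i)) ?M (A i) 0 l = (\<Oplus>k\<in>{..<n (Suc i)}. if 0 = k then z ** A i k l else \<zero>)"
     unfolding mmul_def by (rule finsum_cong') (use z(1) matsD(1)[OF AD(1)] in auto)
    also have "\<dots> = z ** A i 0 l"
     by (rule finsum_singleton) (use z(1) matsD(1)[OF AD(1)] t(1) i(1) in auto)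
    finally show ?thesis using z(1) matsD(1)[OF AD(1)] m_comm by simp
   qed
   then obtain u W where uW: "u \<in> ?U" "W \<in> mats 1 (n (Suc (Suc i)))"
    "!!l. u ** ?M 0 l \<ominus> mmul (n (Suc (Suc i))) W (A (Suc i)) 0 l \<in> b"
    using exj[OF i(2) M] z(3)[OF A(2)] by auto
   have "u ** z \<in> b" using uW(3)[of 0] uW(1) z(1) t(2) i(1) by (simp add: mmul_def minus_eq)
   thus False using b(3)[OF uW(1) z(1)] z(2) by simp
  qed
  then obtain y where y: "y \<in> P" "!!z. z \<in> carrier R ==> y ** z \<in> b ==> z \<in> b" by blast
  have yc: "y \<in> carrier R" using PD(2)[OF y(1)] .
  note ad = adjoin_ideal[OF b(1) yc]
  let ?b = "sat (adjoin b y)"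
  note s = sat[OF ad(1)]
  have le: "b \<subseteq> ?b" "y \<in> ?b" using s(2) ad(2,3) by auto
  have "ex (Suc j) ?b" unfolding ex_def
  proof (intro allI ballI impI)
   fix i M assume ij: "Suc j \<le> i" and M: "M \<in> mats 1 (n (Suc i))" and z: "\<forall>l. mmul (n (Suc i)) M (A i) 0 l \<in> ?b"
   then obtain i0 where i0: "i = Suc i0" "j \<le> i0" by (cases i) auto
   let ?MA = "mmul (n (Suc i)) M (A i)"
   note MA = mmul_mats[OF M AD(1)[of i]]
   have "\<exists>u\<in>?U. \<forall>l<n i. u ** ?MA 0 l \<in> adjoin b y"
   proof (rule common_multiplier[OF U])
    show "\<exists>u\<in>?U. u ** ?MA 0 l \<in> adjoin b y" for l using z unfolding sat_def by blast
   next
    fix u v l assume "u \<in> ?U" "v \<in> ?U" "u ** ?MA 0 l \<in> adjoin b y"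
    thus "(v ** u) ** ?MA 0 l \<in> adjoin b y"
     using m_assoc[of v u "?MA 0 l"] matsD(1)[OF MA] idealD(5)[OF ad(1), of "u ** ?MA 0 l" v] by simp
   qed
   then obtain u where u: "u \<in> ?U" "!!l. l < n i ==> u ** ?MA 0 l \<in> adjoin b y" by blast
   have uc: "u \<in> carrier R" using u by simp
   have "\<exists>v\<in>carrier R. u ** ?MA 0 l \<ominus> y ** v \<in> b" if l: "l < n i" for l
   proof -
    obtain c v where cv: "u ** ?MA 0 l = c \<oplus> v ** y" "c \<in> b" "v \<in> carrier R"
     using u(2)[OF l] unfolding adjoin_def by blast
    have "u ** ?MA 0 l \<ominus> y ** v = c" unfolding cv(1) using bD(2)[OF cv(2)] cv(3) yc by algebra
    thus ?thesis using cv(2,3) by (intro bexI[of _ v]) simp_all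
   qed
   then obtain v where v: "!!l. l < n i ==> v l \<in> carrier R \<and> u ** ?MA 0 l \<ominus> y ** v l \<in> b" by metis
   define V where "V k l = (if k = (0::nat) \<and> l < n i then v l else \<zero>)" for k l
   have V: "V \<in> mats 1 (n i)" using v by (intro matsI) (auto simp: V_def)
   define N where "N = msub (msm u ?MA) (msm y V)"
   have N: "N \<in> mats 1 (n i)" unfolding N_def by (rule msub_mats[OF msm_mats[OF uc MA] msm_mats[OF yc V]])
   have Nb: "N k l \<in> b" for k l
   proof (cases "k = 0 \<and> l < n i")
    case True thus ?thesis using v by (simp add: N_def msub_def msm_def V_def)
   next
    case False
    hence "N k l = \<zero>" using matsD(2,3)[OF N, of k l] matsD(3)[OF N, of l k] by auto
    thus ?thesis using bD(3) by simp
   qed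
   note Ai = AD(1)[of i0, folded i0(1)]
   \<comment> \<open>\<open>A i\<close> followed by \<open>A i0\<close> is zero, so \<open>y\<close>
     times the boundary of \<open>V\<close> lies in \<open>b\<close>; regularity of \<open>y\<close>
     makes \<open>V\<close> a cycle modulo \<open>b\<close>.\<close>
   have VA: "mmul (n i) V (A i0) 0 l \<in> b" for l
   proof -
    note VAm = mmul_mats[OF V Ai]
    have "mmul (n i) N (A i0) = msub (mmul (n i) (msm u ?MA) (A i0)) (mmul (n i) (msm y V) (A i0))"
     unfolding N_def by (rule mmul_sub_l[OF msm_mats[OF uc MA] msm_mats[OF yc V] Ai])
    also have "mmul (n i) (msm u ?MA) (A i0) = msm u (mmul (n i) ?MA (A i0))" by (rule mmul_sm_l[OF uc MA Ai])
    also have "mmul (n i) ?MA (A i0) = mmul (n (Suc i)) M (mmul (n i) (A i) (A i0))"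
     by (rule mmul_assoc[symmetric, OF M AD(1) Ai])
    also have "mmul (n i) (A i) (A i0) = mzero" using AD(2)[of i0] i0(1) by simp
    also have "mmul (n (Suc i)) M mzero = mzero" by (rule mmul_zero_r[OF M])
    also have "mmul (n i) (msm y V) (A i0) = msm y (mmul (n i) V (A i0))" by (rule mmul_sm_l[OF yc V Ai])
    finally have "mmul (n i) N (A i0) 0 l = \<ominus> (y ** mmul (n i) V (A i0) 0 l)"
     using uc yc matsD(1)[OF VAm] by (simp add: msub_def msm_def mzero_def minus_eq)
    moreover have "mmul (n i) N (A i0) 0 l \<in> b" by (rule mmul_in_ideal[OF b(1) N Ai]) (use Nb in auto)
    ultimately have "y ** mmul (n i) V (A i0) 0 l \<in> b"
     using bD(7) yc matsD(1)[OF VAm] by (metis m_closed minus_minus)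
    thus ?thesis using y(2) matsD(1)[OF VAm] by blast
   qed
   obtain u' W where u': "u' \<in> ?U" "W \<in> mats 1 (n (Suc i))"
    "!!l. u' ** V 0 l \<ominus> mmul (n (Suc i)) W (A i) 0 l \<in> b"
    using exj[OF i0(2), of V] V VA unfolding i0(1) by auto
   have u'c: "u' \<in> carrier R" using u' by simp
   \<comment> \<open>Subtracting \<open>y\<close> times the lift \<open>W\<close> of
     \<open>V\<close> turns a cycle modulo \<open>b + R y\<close> into a cycle modulo
     \<open>b\<close>, to which the induction hypothesis applies.\<close>
   define M' where "M' = msub (msm (u' ** u) M) (msm y W)"
   have uu: "u' ** u \<in> carrier R" using uc u'c by simp
   have M': "M' \<in> mats 1 (n (Suc i))" unfolding M'_def by (rule msub_mats[OF msm_mats[OF uu M] msm_mats[OF yc u'(2)]])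
   have "mmul (n (Suc i)) M' (A i) 0 l \<in> b" for l
   proof -
    note WA = matsD(1)[OF mmul_mats[OF u'(2) AD(1)[of i]]]
    have "mmul (n (Suc i)) M' (A i) = msub (mmul (n (Suc i)) (msm (u' ** u) M) (A i)) (mmul (n (Suc i)) (msm y W) (A i))"
     unfolding M'_def by (rule mmul_sub_l[OF msm_mats[OF uu M] msm_mats[OF yc u'(2)] AD(1)])
    also have "\<dots> = msub (msm (u' ** u) ?MA) (msm y (mmul (n (Suc i)) W (A i)))"
     unfolding mmul_sm_l[OF uu M AD(1)] mmul_sm_l[OF yc u'(2) AD(1)] ..
    finally have "mmul (n (Suc i)) M' (A i) 0 l = u' ** (u ** ?MA 0 l \<ominus> y ** V 0 l) \<oplus> y ** (u' ** V 0 l \<ominus> mmul (n (Suc i)) W (A i) 0 l)"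
     unfolding msub_def msm_def using uc u'c yc matsD(1)[OF MA, of 0 l] WA[of 0 l] matsD(1)[OF V, of 0 l] by algebra
    moreover have "u ** ?MA 0 l \<ominus> y ** V 0 l \<in> b" using Nb[of 0 l] unfolding N_def msub_def msm_def .
    ultimately show ?thesis using bD(4)[OF bD(5)[OF _ u'c] bD(5)[OF u'(3) yc]] by simp
   qed
   then obtain u'' W' where u'': "u'' \<in> ?U" "W' \<in> mats 1 (n (Suc (Suc i)))"
    "!!l. u'' ** M' 0 l \<ominus> mmul (n (Suc (Suc i))) W' (A (Suc i)) 0 l \<in> b"
    using exj[of i M'] M' ij by auto
   have u''c: "u'' \<in> carrier R" using u'' by simp
   have "(u'' ** (u' ** u)) ** M 0 l \<ominus> mmul (n (Suc (Suc i))) W' (A (Suc i)) 0 l \<in> ?b" for l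
   proof -
    have "(u'' ** (u' ** u)) ** M 0 l \<ominus> mmul (n (Suc (Suc i))) W' (A (Suc i)) 0 l =
     (u'' ** M' 0 l \<ominus> mmul (n (Suc (Suc i))) W' (A (Suc i)) 0 l) \<oplus> (u'' ** W 0 l) ** y"
     unfolding M'_def msub_def msm_def
     using uc u'c u''c yc matsD(1)[OF M, of 0 l] matsD(1)[OF u'(2), of 0 l] matsD(1)[OF mmul_mats[OF u''(2) AD(1)[of "Suc i"]], of 0 l]
     by algebra
    moreover have "u'' ** W 0 l \<in> carrier R" using u''c matsD(1)[OF u'(2)] by simp
    ultimately show ?thesis
     using idealD(4)[OF s(1) subsetD[OF le(1) u''(3)] idealD(5)[OF s(1) le(2)]] by simp
   qed
   thus "\<exists>u\<in>?U. \<exists>W\<in>mats 1 (n (Suc (Suc i))). \<forall>l. u ** M 0 l \<ominus> mmul (n (Suc (Suc i))) W (A (Suc i)) 0 l \<in> ?b"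
    using mult_setD(3)[OF U u''(1) mult_setD(3)[OF U u'(1) u(1)]] u''(2) by blast
  qed
  moreover have "chain_to R (Suc j) Q" if Q: "primeideal Q R" "?b \<subseteq> Q" "Q \<subseteq> P" for Q
  proof -
   \<comment> \<open>\<open>Q\<close> contains \<open>y\<close>, while some prime between
     \<open>b\<close> and \<open>Q\<close> does not; so the chain below \<open>Q\<close> grows by
     one.\<close>
   obtain Q' where Q': "primeideal Q' R" "b \<subseteq> Q'" "Q' \<subseteq> Q" "y \<notin> Q'"
    using prime_below_avoiding[OF b(1) yc y(2) Q(1)] Q(2) le(1) by blast
   hence "Q' \<subset> Q" using le(2) Q(2) by blast
   thus ?thesis using chain_to_Suc[OF b(5)[OF Q'(1,2)] _ Q(1)] Q(3) by blast
  qed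
  moreover have "?b \<subseteq> P" using s(4)[OF P] ad(4)[OF PI b(2) y(1)] by blast
  ultimately show ?case using s(1,3) by (intro exI[of _ ?b]) simp
 qed
 from this[OF le_refl] obtain b where "b \<subseteq> P"
  "\<forall>Q. primeideal Q R \<and> b \<subseteq> Q \<and> Q \<subseteq> P --> chain_to R t Q" by (elim exE conjE)
 thus ?thesis using P by simp
qed

section \<open>Minimal resolutions\<close>

context cring
begin

definition mvec :: "nat => (nat => 'a) => (nat => nat => 'a) => nat => 'a" where
 "mvec r v A = (\<lambda>l. \<Oplus>i\<in>{..<r}. v i ** A i l)"

lemma mmul_row: "mmul n A B k = mvec n (A k) B"
 by (simp add: mmul_def mvec_def)

lemma mats_row: "A \<in> mats r c ==> A k \<in> vectors R {..<c}"
 by (auto simp: mats_def vectors_def)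

lemma mvec_closed:
 assumes "v \<in> vectors R B" "A \<in> mats r' c" shows "mvec r v A \<in> vectors R {..<c}"
 using vectorsD[OF assms(1)] matsD[OF assms(2)] unfolding vectors_def mvec_def
 by (auto intro!: finsum_closed finsum_zero')

lemma mvec_add:
 assumes "v \<in> vectors R B" "w \<in> vectors R B" "A \<in> mats r' c"
 shows "mvec r (\<lambda>i. v i \<oplus> w i) A = (\<lambda>l. mvec r v A l \<oplus> mvec r w A l)"
 using vectorsD(1)[OF assms(1)] vectorsD(1)[OF assms(2)] matsD(1)[OF assms(3)]
 by (simp add: mvec_def l_distr finsum_addf)

lemma mvec_sm:
 assumes "s \<in> carrier R" "v \<in> vectors R B" "A \<in> mats r' c"
 shows "mvec r (\<lambda>i. s ** v i) A = (\<lambda>l. s ** mvec r v A l)"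
 using assms(1) vectorsD(1)[OF assms(2)] matsD(1)[OF assms(3)]
 by (simp add: mvec_def m_assoc finsum_rdistr Pi_def)

lemma mvec_zero: "A \<in> mats r' c ==> mvec r (\<lambda>_. \<zero>) A = (\<lambda>_. \<zero>)"
 using matsD(1)[of A] by (simp add: mvec_def)

lemma mvec_hom:
 assumes A: "A \<in> mats r' c"
 shows "(\<lambda>v. mvec r v A) \<in> module_hom R (vector_module R {..<r}) (vector_module R {..<c})"
 by (rule module_homI) (use mvec_closed[OF _ A] mvec_add[OF _ _ A] mvec_sm[OF _ _ A] in auto)

lemma row_kernel_submodule:
 assumes "A \<in> mats r c"
 shows "submodule {v \<in> vectors R {..<r}. mvec r v A = (\<lambda>_. \<zero>)} R (vector_module R {..<r})"
 using module_hom_kernel[OF vector_module vector_module mvec_hom[OF assms]] by simp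

lemma row_space_submodule:
 assumes A: "A \<in> mats r c"
 shows "submodule ((\<lambda>w. mvec r w A) ` vectors R {..<r}) R (vector_module R {..<c})"
 by (rule module_hom_image[OF vector_module vector_module mvec_hom[OF A] module.submodule_intro[OF vector_module]])
  (auto simp: vectors_def)

definition generates_upto :: "'a set => (nat => 'a) set => nat => nat => (nat => nat => 'a) => bool" where
 "generates_upto U N r c A \<longleftrightarrow> A \<in> mats r c \<and> (\<forall>k<r. A k \<in> N) \<and>
   (\<forall>v\<in>N. \<exists>u\<in>U. \<exists>w\<in>vectors R {..<r}. (\<lambda>l. u ** v l) = mvec r w A)"

lemma rows_upto:
 assumes U: "mult_set U" and A: "A \<in> mats n c" and M: "M \<in> mats r c"
  and ex: "!!k. k < r ==> \<exists>u\<in>U. \<exists>w\<in>vectors R {..<n}. (\<lambda>l. u ** M k l) = mvec n w A"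
 shows "\<exists>u\<in>U. \<exists>W\<in>mats r n. msm u M = mmul n W A"
proof -
 have "\<exists>u\<in>U. \<forall>k<r. \<exists>w\<in>vectors R {..<n}. (\<lambda>l. u ** M k l) = mvec n w A"
 proof (rule common_multiplier[OF U ex])
  fix u v k assume uv: "u \<in> U" "v \<in> U" "\<exists>w\<in>vectors R {..<n}. (\<lambda>l. u ** M k l) = mvec n w A"
  then obtain w where w: "w \<in> vectors R {..<n}" "(\<lambda>l. u ** M k l) = mvec n w A" by blast
  have c: "u \<in> carrier R" "v \<in> carrier R" using mult_setD(1)[OF U] uv by auto
  have "(\<lambda>l. (v ** u) ** M k l) = (\<lambda>l. v ** (u ** M k l))"
   using c matsD(1)[OF M] by (simp add: m_assoc)
  also have "\<dots> = (\<lambda>l. v ** mvec n w A l)" using fun_cong[OF w(2)] by simp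
  also have "\<dots> = mvec n (\<lambda>i. v ** w i) A" by (rule mvec_sm[symmetric, OF c(2) w(1) A])
  finally show "\<exists>w\<in>vectors R {..<n}. (\<lambda>l. (v ** u) ** M k l) = mvec n w A"
   using w(1) c by (intro bexI[of _ "\<lambda>i. v ** w i"]) (auto simp: vectors_def)
 qed
 then obtain u where u: "u \<in> U" "!!k. k < r ==> \<exists>w\<in>vectors R {..<n}. (\<lambda>l. u ** M k l) = mvec n w A" by blast
 then obtain w where w: "!!k. k < r ==> w k \<in> vectors R {..<n} \<and> (\<lambda>l. u ** M k l) = mvec n (w k) A" by metis
 define W where "W k = (if k < r then w k else (\<lambda>_. \<zero>))" for k
 have "W \<in> mats r n" using w by (intro matsI) (auto simp: W_def vectors_def)
 moreover have "msm u M k = mmul n W A k" for k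
  using w[of k] mvec_zero[OF A, of n] matsD(2)[OF M, of k] mult_setD(1)[OF U u(1)]
  by (cases "k < r") (auto simp: mmul_row W_def msm_def)
 ultimately show ?thesis using u(1) by (intro bexI[of _ u] bexI[of _ W]) auto
qed

end

context noetherian_cring
begin

text \<open>Any \<open>v\<close> in \<open>N\<close> may be appended as a further row; a row space
  that is maximal among those inside \<open>N\<close> therefore contains it already.\<close>

lemma finitely_generated_rows:
 assumes N: "submodule N R (vector_module R {..<c})"
 shows "\<exists>r A. generates_upto {\<one>} N r c A"
proof -
 define S where "S r A = (\<lambda>w. mvec r w A) ` vectors R {..<r}" for r A
 define spaces where "spaces = {S r A | r A. A \<in> mats r c \<and> (\<forall>k<r. A k \<in> N)}"
 have NV: "N \<subseteq> vectors R {..<c}" using module.submoduleD(1)[OF vector_module N] by simp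
 have "S 0 mzero \<in> spaces" unfolding spaces_def using mzero_mats by blast
 moreover have "submodule L R (vector_module R {..<c})" if "L \<in> spaces" for L
  using that row_space_submodule unfolding spaces_def S_def by auto
 ultimately obtain L where L: "L \<in> spaces" "!!L'. L' \<in> spaces ==> L \<subseteq> L' ==> L' = L"
  using noetherian_vector_module[of "{..<c}"] unfolding noetherian_module_def by (metis empty_iff finite_lessThan)
 then obtain r A where A: "L = S r A" "A \<in> mats r c" "!!k. k < r ==> A k \<in> N" unfolding spaces_def by blast
 have "v \<in> L" if v: "v \<in> N" for v
 proof -
  define A' where "A' = A(r := v)"
  have vV: "v \<in> vectors R {..<c}" using NV v by blast
  have A': "A' \<in> mats (Suc r) c" unfolding A'_def
   using matsD[OF A(2)] vectorsD[OF vV] by (intro matsI) auto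
  have row: "mvec (Suc r) w A' = (\<lambda>l. w r ** v l \<oplus> mvec r w A l)" if "w \<in> vectors R {..<Suc r}" for w
  proof
   fix l
   have "(\<Oplus>i\<in>{..<r}. w i ** A' i l) = (\<Oplus>i\<in>{..<r}. w i ** A i l)"
    by (rule finsum_cong') (use vectorsD(1)[OF that] matsD(1)[OF A(2)] in \<open>auto simp: A'_def\<close>)
   thus "mvec (Suc r) w A' l = w r ** v l \<oplus> mvec r w A l"
    using vectorsD(1)[OF that] matsD(1)[OF A'] by (simp add: mvec_def lessThan_Suc Pi_def) (simp add: A'_def)
  qed
  have wS: "w \<in> vectors R {..<Suc r}" if "w \<in> vectors R {..<r}" for w using that by (auto simp: vectors_def)
  have "S (Suc r) A' \<in> spaces" unfolding spaces_def
   using A' A(3) v by (intro CollectI exI[of _ "Suc r"] exI[of _ A']) (auto simp: A'_def less_Suc_eq)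
  moreover have "L \<subseteq> S (Suc r) A'"
  proof
   fix z assume "z \<in> L"
   then obtain w where w: "w \<in> vectors R {..<r}" "z = mvec r w A" unfolding A(1) S_def by blast
   have "mvec (Suc r) w A' = z" unfolding row[OF wS[OF w(1)]] w(2)
    using vectorsD(2)[OF w(1), of r] vectorsD(1)[OF vV] vectorsD(1)[OF mvec_closed[OF w(1) A(2)]] by simp
   thus "z \<in> S (Suc r) A'" unfolding S_def using wS[OF w(1)] by blast
  qed
  ultimately have "S (Suc r) A' = L" by (rule L(2))
  moreover have "v \<in> S (Suc r) A'"
  proof -
   let ?w = "\<lambda>i. if i = r then \<one> else \<zero>"
   have w: "?w \<in> vectors R {..<Suc r}" by (auto simp: vectors_def)
   have "mvec r ?w A l = \<zero>" for l unfolding mvec_def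
    by (rule finsum_zero') (use matsD(1)[OF A(2)] in auto)
   hence "mvec (Suc r) ?w A' = v" unfolding row[OF w] using vectorsD(1)[OF vV] by simp
   thus ?thesis unfolding S_def using w by blast
  qed
  ultimately show ?thesis by simp
 qed
 hence "\<exists>w\<in>vectors R {..<r}. (\<lambda>l. \<one> ** v l) = mvec r w A" if "v \<in> N" for v
  using that vectorsD(1)[OF subsetD[OF NV that]] unfolding A(1) S_def by auto
 thus ?thesis unfolding generates_upto_def using A by blast
qed

text \<open>With the least number of rows, a relation having a coefficient \<open>w i\<close>
  outside \<open>P\<close> would allow the \<open>i\<close>-th row to be eliminated, up to the
  multiplier \<open>w i\<close>.\<close>

lemma minimal_generators:
 assumes P: "primeideal P R" and N: "submodule N R (vector_module R {..<c})"
 shows "\<exists>r A. generates_upto (carrier R - P) N r c A \<and>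
  (\<forall>w\<in>vectors R {..<r}. mvec r w A = (\<lambda>_. \<zero>) --> (\<forall>i. w i \<in> P))"
proof -
 let ?U = "carrier R - P"
 note U = mult_set_prime[OF P]
 have NV: "N \<subseteq> vectors R {..<c}" using module.submoduleD(1)[OF vector_module N] by simp
 define r where "r = (LEAST r. \<exists>A. generates_upto ?U N r c A)"
 have "\<exists>r A. generates_upto ?U N r c A"
  using finitely_generated_rows[OF N] mult_setD(2)[OF U] unfolding generates_upto_def by blast
 hence "\<exists>A. generates_upto ?U N r c A" unfolding r_def by (rule LeastI_ex)
 then obtain A where gen: "generates_upto ?U N r c A" by blast
 hence A: "A \<in> mats r c" "!!k. k < r ==> A k \<in> N"
  "!!v. v \<in> N ==> \<exists>u\<in>?U. \<exists>w\<in>vectors R {..<r}. (\<lambda>l. u ** v l) = mvec r w A"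
  unfolding generates_upto_def by auto
 have "w i \<in> P" if w: "w \<in> vectors R {..<r}" "mvec r w A = (\<lambda>_. \<zero>)" for w i
 proof (rule ccontr)
  assume wi: "w i \<notin> P"
  note wc = vectorsD(1)[OF w(1)]
  have ir: "i < r" using vectorsD(2)[OF w(1), of i] wi idealD(3)[OF primeD(1)[OF P]] by (cases "i < r") auto
  then obtain r' where r': "r = Suc r'" by (cases r) auto
  define skip where "skip j = (if j < i then j else Suc j)" for j
  have skip: "inj_on skip {..<r'}" "skip ` {..<r'} = {..<r} - {i}"
  proof -
   show "inj_on skip {..<r'}" by (auto simp: inj_on_def skip_def split: if_splits)
   have "k \<in> skip ` {..<r'}" if "k < r" "k ~= i" for k
    using that ir r' by (intro image_eqI[of _ _ "if k < i then k else k - 1"]) (auto simp: skip_def)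
   moreover have "skip k < r \<and> skip k ~= i" if "k < r'" for k using that r' by (simp add: skip_def)
   ultimately show "skip ` {..<r'} = {..<r} - {i}" by (intro subset_antisym subsetI) (blast, simp)
  qed
  define A' where "A' j = (if j < r' then A (skip j) else (\<lambda>_. \<zero>))" for j
  have A': "A' \<in> mats r' c" using matsD[OF A(1)] by (intro matsI) (auto simp: A'_def)
  have "generates_upto ?U N r' c A'" unfolding generates_upto_def
  proof (intro conjI allI ballI impI)
   show "A' \<in> mats r' c" by fact
   show "A' k \<in> N" if "k < r'" for k using that skip(2) A(2)[of "skip k"] by (auto simp: A'_def)
  next
   fix v assume v: "v \<in> N"
   then obtain u w' where uw: "u \<in> ?U" "w' \<in> vectors R {..<r}" "(\<lambda>l. u ** v l) = mvec r w' A" using A(3) by blast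
   note w'c = vectorsD(1)[OF uw(2)] and vc = vectorsD(1)[OF subsetD[OF NV v]]
   have uc: "u \<in> carrier R" using uw(1) by simp
   \<comment> \<open>A combination of the coordinates \<open>w'\<close> with the relation
     \<open>w\<close>, chosen so that the \<open>i\<close>-th coordinate vanishes.\<close>
   define q where "q j = w i ** w' j \<ominus> w' i ** w j" for j
   have q: "q \<in> vectors R {..<r}" using wc w'c vectorsD(2)[OF w(1)] vectorsD(2)[OF uw(2)]
    unfolding q_def vectors_def by (auto simp: minus_eq)
   note qc = vectorsD(1)[OF q]
   have qi: "q i = \<zero>" using wc w'c by (simp add: q_def m_comm[of "w i"] r_neg minus_eq)
   have q': "(\<lambda>j. if j < r' then q (skip j) else \<zero>) \<in> vectors R {..<r'}" using qc by (auto simp: vectors_def)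
   have "(w i ** u) ** v l = mvec r' (\<lambda>j. if j < r' then q (skip j) else \<zero>) A' l" for l
   proof -
    have term_c: "q j ** A j l \<in> carrier R" for j using qc matsD(1)[OF A(1)] by simp
    have "(w i ** u) ** v l = w i ** mvec r w' A l \<oplus> \<ominus> (w' i ** mvec r w A l)"
     using fun_cong[OF uw(3), of l] w(2) wc uc vc w'c vectorsD(1)[OF mvec_closed[OF uw(2) A(1)]] by (simp add: m_assoc)
    also have "\<dots> = w i ** mvec r w' A l \<oplus> (\<ominus> w' i) ** mvec r w A l"
     using w'c vectorsD(1)[OF mvec_closed[OF w(1) A(1)]] by (simp add: l_minus)
    also have "\<dots> = mvec r (\<lambda>j. w i ** w' j \<oplus> (\<ominus> w' i) ** w j) A l"
    proof -
     have m: "(\<lambda>j. w i ** w' j) \<in> vectors R {..<r}" "(\<lambda>j. (\<ominus> w' i) ** w j) \<in> vectors R {..<r}"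
      using wc w'c vectorsD(2)[OF w(1)] vectorsD(2)[OF uw(2)] by (auto simp: vectors_def)
     show ?thesis unfolding mvec_add[OF m A(1)]
      using mvec_sm[OF wc[of i] uw(2) A(1), of r] mvec_sm[OF _ w(1) A(1), of "\<ominus> w' i" r] w'c by simp
    qed
    also have "(\<lambda>j. w i ** w' j \<oplus> (\<ominus> w' i) ** w j) = q"
     using wc w'c by (intro ext) (simp add: q_def minus_eq l_minus)
    also have "mvec r q A l = (\<Oplus>j\<in>insert i ({..<r} - {i}). q j ** A j l)"
     unfolding mvec_def using ir by (simp add: insert_absorb)
    also have "\<dots> = (\<Oplus>j\<in>{..<r} - {i}. q j ** A j l)"
     using finsum_insert[of "{..<r} - {i}" i "\<lambda>j. q j ** A j l"] term_c qi matsD(1)[OF A(1)] by simp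
    also have "\<dots> = (\<Oplus>j\<in>{..<r'}. q (skip j) ** A (skip j) l)"
     unfolding skip(2)[symmetric] by (rule finsum_reindex[OF _ skip(1)]) (use term_c in auto)
    also have "\<dots> = mvec r' (\<lambda>j. if j < r' then q (skip j) else \<zero>) A' l"
     unfolding mvec_def by (rule finsum_cong') (use term_c in \<open>auto simp: A'_def\<close>)
    finally show ?thesis .
   qed
   thus "\<exists>u\<in>?U. \<exists>w\<in>vectors R {..<r'}. (\<lambda>l. u ** v l) = mvec r' w A'"
    using mult_setD(3)[OF U _ uw(1), of "w i"] wc wi q'
    by (intro bexI[of _ "w i ** u"] bexI[of _ "\<lambda>j. if j < r' then q (skip j) else \<zero>"]) auto
  qed
  hence "r \<le> r'" unfolding r_def by (intro Least_le) blast
  thus False using r' by simp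
 qed
 thus ?thesis using gen by blast
qed

text \<open>Minimal generators are chosen for each kernel in turn. That relations among the rows of
  one matrix have entries in \<open>P\<close> is what puts the rows of the next one into
  \<open>P\<close>; for the first matrix this is \<open>I \<subseteq> P\<close>.\<close>

lemma minimal_resolution:
 assumes P: "primeideal P R" and I: "ideal I R" "I \<subseteq> P"
 shows "\<exists>n A. resolves_upto (carrier R - P) I n A \<and> (\<forall>j k l. A j k l \<in> P)"
proof -
 let ?U = "carrier R - P"
 note U = mult_set_prime[OF P]
 define rel where "rel r A \<longleftrightarrow> (\<forall>w\<in>vectors R {..<r}. mvec r w A = (\<lambda>_. \<zero>) --> (\<forall>i. w i \<in> P))" for r A
 define Ker where "Ker r A = {v \<in> vectors R {..<r}. mvec r v A = (\<lambda>_. \<zero>)}" for r A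
 define N0 where "N0 = {v \<in> vectors R {..<1::nat}. v 0 \<in> I}"
 have N0: "submodule N0 R (vector_module R {..<1})"
  by (rule module.submodule_intro[OF vector_module]) (use idealD[OF I(1)] in \<open>auto simp: N0_def vectors_def\<close>)
 define good where "good j s \<longleftrightarrow> (case s of (c, r, A) => A \<in> mats r c \<and> rel r A \<and>
  (j = 0 --> c = 1 \<and> generates_upto ?U N0 r 1 A))" for j :: nat and s
 have "\<exists>s. \<forall>j. good j (s j) \<and> (case s j of (c, r, A) => case s (Suc j) of (c', r', A') =>
   c' = r \<and> generates_upto ?U (Ker r A) r' r A')"
 proof (rule dependent_nat_choice)
  obtain r A where "generates_upto ?U N0 r 1 A" "rel r A"
   using minimal_generators[OF P N0] unfolding rel_def by blast
  thus "\<exists>s. good 0 s" unfolding good_def by (intro exI[of _ "(1, r, A)"]) (auto simp: generates_upto_def)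
 next
  fix s j assume "good j s"
  obtain c r A where s: "s = (c, r, A)" by (metis prod_cases3)
  hence A: "A \<in> mats r c" using \<open>good j s\<close> by (simp add: good_def)
  obtain r' A' where "generates_upto ?U (Ker r A) r' r A'" "rel r' A'"
   using minimal_generators[OF P row_kernel_submodule[OF A]] unfolding rel_def Ker_def by blast
  thus "\<exists>t. good (Suc j) t \<and> (case s of (c, r, A) => case t of (c', r', A') =>
   c' = r \<and> generates_upto ?U (Ker r A) r' r A')"
   unfolding s good_def by (intro exI[of _ "(r, r', A')"]) (auto simp: generates_upto_def)
 qed
 then obtain s where s': "\<forall>j. good j (s j) \<and> (case s j of (c, r, A) => case s (Suc j) of (c', r', A') =>
   c' = r \<and> generates_upto ?U (Ker r A) r' r A')" by (elim exE)
 note s = s'[rule_format, THEN conjunct1] s'[rule_format, THEN conjunct2]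
 define n where "n j = fst (s j)" for j
 define A where "A j = snd (snd (s j))" for j
 have nS: "n (Suc j) = fst (snd (s j))" for j
  using s(2)[of j] unfolding n_def by (cases "s j"; cases "s (Suc j)") auto
 have sj: "s j = (n j, n (Suc j), A j)" for j
  by (rule prod_eqI) (auto simp: n_def nS[unfolded n_def] A_def intro: prod_eqI)
 have A: "A j \<in> mats (n (Suc j)) (n j)" "rel (n (Suc j)) (A j)" for j
  using s(1)[of j] unfolding sj good_def by auto
 have n0: "n 0 = 1" and g0: "generates_upto ?U N0 (n 1) 1 (A 0)" using s(1)[of 0] unfolding sj good_def by auto
 have g: "generates_upto ?U (Ker (n (Suc j)) (A j)) (n (Suc (Suc j))) (n (Suc j)) (A (Suc j))" for j
  using s(2)[of j] unfolding sj by auto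
 have gK: "A (Suc j) k \<in> Ker (n (Suc j)) (A j)" if "k < n (Suc (Suc j))" for j k
  using g[of j] that unfolding generates_upto_def by blast
 have g0K: "A 0 k \<in> N0" if "k < n 1" for k using g0 that unfolding generates_upto_def by blast
 have AP: "A j k l \<in> P" for j k l
 proof (cases "k < n (Suc j)")
  case False thus ?thesis using matsD(2)[OF A(1)] idealD(3)[OF primeD(1)[OF P]] by simp
 next
  case True
  show ?thesis
  proof (cases j)
   case 0
   show ?thesis
   proof (cases "l = 0")
    case True thus ?thesis using g0K[of k] \<open>k < n (Suc j)\<close> I(2) unfolding 0 N0_def by auto
   next
    case False
    hence "A j k l = \<zero>" using matsD(3)[OF A(1), of l j k] n0 0 by simp
    thus ?thesis using idealD(3)[OF primeD(1)[OF P]] by simp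
   qed
  next
   case (Suc j')
   thus ?thesis using gK[of k j'] A(2)[of j'] True unfolding Ker_def rel_def by blast
  qed
 qed
 have "exact_upto ?U n A" unfolding exact_upto_def
 proof (intro conjI allI impI)
  show "A j \<in> mats (n (Suc j)) (n j)" for j by (rule A(1))
  show "mmul (n (Suc j)) (A (Suc j)) (A j) = mzero" for j
  proof
   fix k
   have "A (Suc j) k = (\<lambda>_. \<zero>)" if "\<not> k < n (Suc (Suc j))"
    using matsD(2)[OF A(1)[of "Suc j"] that] by (intro ext)
   thus "mmul (n (Suc j)) (A (Suc j)) (A j) k = mzero k"
    using gK[of k j] mvec_zero[OF A(1)]
    unfolding mmul_row mzero_def Ker_def by (cases "k < n (Suc (Suc j))") auto
  qed
 next
  fix j r M assume M: "M \<in> mats r (n (Suc j)) \<and> mmul (n (Suc j)) M (A j) = mzero"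
  show "\<exists>u\<in>?U. \<exists>W\<in>mats r (n (Suc (Suc j))). msm u M = mmul (n (Suc (Suc j))) W (A (Suc j))"
  proof (rule rows_upto[OF U A(1)])
   show "M \<in> mats r (n (Suc j))" using M by simp
   fix k
   have "M k \<in> Ker (n (Suc j)) (A j)"
    using M mats_row[of M r "n (Suc j)" k] mmul_row[of "n (Suc j)" M "A j" k]
    unfolding Ker_def by (simp add: mzero_def)
   thus "\<exists>u\<in>?U. \<exists>w\<in>vectors R {..<n (Suc (Suc j))}. (\<lambda>l. u ** M k l) = mvec (n (Suc (Suc j))) w (A (Suc j))"
    using g[of j] unfolding generates_upto_def by blast
  qed
 qed
 moreover have "\<exists>u\<in>?U. \<exists>W\<in>mats r (n 1). msm u M = mmul (n 1) W (A 0)"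
  if "M \<in> mats r 1" "\<forall>k. M k 0 \<in> I" for r M
 proof (rule rows_upto[OF U])
  show "A 0 \<in> mats (n 1) 1" "M \<in> mats r 1" using A(1)[of 0] n0 that by auto
  fix k
  have "M k \<in> N0" using that mats_row[of M r 1 k] unfolding N0_def by auto
  thus "\<exists>u\<in>?U. \<exists>w\<in>vectors R {..<n 1}. (\<lambda>l. u ** M k l) = mvec (n 1) w (A 0)"
   using g0 unfolding generates_upto_def by blast
 qed
 moreover have "A 0 k 0 \<in> I" for k
  using g0K[of k] matsD(2)[OF A(1)[of 0], of k 0] idealD(3)[OF I(1)] by (cases "k < n 1") (auto simp: N0_def)
 ultimately show ?thesis using n0 AP unfolding resolves_upto_def by (intro exI[of _ n] exI[of _ A]) simp
qed

end

context noetherian_local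
begin

text \<open>Multipliers outside \<open>m\<close> are units and can be divided out.\<close>

lemma resolves_upto_units:
 assumes "resolves_upto (carrier R - m) I n A"
 shows "resolves_upto {\<one>} I n A"
proof -
 note D = resolves_uptoD[OF assms]
 have key: "\<exists>u\<in>{\<one>}. \<exists>W\<in>mats r n'. msm u M = mmul n' W B"
  if M: "M \<in> mats r c" and B: "B \<in> mats n' c" and ex: "\<exists>u\<in>carrier R - m. \<exists>W\<in>mats r n'. msm u M = mmul n' W B" for M r c n' B
 proof -
  obtain u W where u: "u \<in> carrier R - m" "W \<in> mats r n'" "msm u M = mmul n' W B" using ex by blast
  obtain b where b: "b \<in> carrier R" "u ** b = \<one>" using unit_outside_m[of u] u(1) by auto
  have uc: "u \<in> carrier R" using u by simp
  have "msm \<one> M = msm b (msm u M)" using msm_msm[OF b(1) uc M] b uc by (simp add: m_comm)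
  also have "\<dots> = mmul n' (msm b W) B" unfolding u(3) by (rule mmul_sm_l[symmetric, OF b(1) u(2) B])
  finally show ?thesis using msm_mats[OF b(1) u(2)] by blast
 qed
 note E = exact_uptoD[OF D(1)]
 have "\<exists>u\<in>{\<one>}. \<exists>W\<in>mats r (n (Suc (Suc j))). msm u M = mmul (n (Suc (Suc j))) W (A (Suc j))"
  if "M \<in> mats r (n (Suc j))" "mmul (n (Suc j)) M (A j) = mzero" for j r M
  by (rule key[OF that(1) E(1) E(3)[OF that]])
 moreover have "\<exists>u\<in>{\<one>}. \<exists>W\<in>mats r (n 1). msm u M = mmul (n 1) W (A 0)"
  if "M \<in> mats r 1" "\<forall>k. M k 0 \<in> I" for r M
  by (rule key[OF that(1)]) (use E(1)[of 0] D(2) D(4)[OF that(1)] that(2) in auto)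
 ultimately show ?thesis using E(1,2) D(2,3) unfolding resolves_upto_def exact_upto_def by simp
qed

end

section \<open>Projective modules and finite resolutions\<close>

definition free_module :: "('a, 'm) ring_scheme => 'k set => ('a, 'k => 'a) module" where
 "free_module R B = (vector_module R B)\<lparr>carrier := {f \<in> vectors R B. finite {k. f k ~= \<zero>\<^bsub>R\<^esub>}}\<rparr>"

lemma module_hom_finsum:
 assumes "module R M" "module R N" "f \<in> module_hom R M N" "finite S" "!!i. i \<in> S ==> g i \<in> carrier M"
 shows "f (finsum M g S) = finsum N (\<lambda>i. f (g i)) S"
proof -
 interpret M: module R M by fact
 interpret N: module R N by fact
 note f = module_homD[OF assms(3)]
 show ?thesis using assms(4,5)
 proof (induction S)
  case empty thus ?case using module_hom_zero[OF assms(1-3)] by simp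
 next
  case (insert i S)
  hence "g \<in> S \<rightarrow> carrier M" "g i \<in> carrier M" "(\<lambda>i. f (g i)) \<in> S \<rightarrow> carrier N" "f (g i) \<in> carrier N"
   using f(1) by auto
  thus ?case using insert f(2)[of "g i" "finsum M g S"] by simp
 qed
qed

definition combination :: "('a, 'm) ring_scheme => ('a, 'b) module => ('k => 'b) => ('k => 'a) => 'b" where
 "combination R N a f = (\<Oplus>\<^bsub>N\<^esub>k\<in>{k. f k ~= \<zero>\<^bsub>R\<^esub>}. f k *[N] a k)"

context cring
begin

lemma free_module_simps [simp]:
 "carrier (free_module R B) = {f \<in> vectors R B. finite {k. f k ~= \<zero>}}" "0[free_module R B] = (\<lambda>_. \<zero>)"
 "f +[free_module R B] g = (\<lambda>k. f k \<oplus> g k)" "r *[free_module R B] f = (\<lambda>k. r ** f k)"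
 by (simp_all add: free_module_def vector_module_def)

lemma free_module: "module R (free_module R B)"
 unfolding free_module_def
proof (rule submodule.submodule_is_module[OF module.submodule_intro[OF vector_module] vector_module], goal_cases)
 case (3 f g)
 have "{k. f k \<oplus> g k ~= \<zero>} \<subseteq> {k. f k ~= \<zero>} \<union> {k. g k ~= \<zero>}" by auto
 thus ?case using 3 by (auto simp: vectors_def intro: finite_subset)
next
 case (4 r f)
 have "{k. r ** f k ~= \<zero>} \<subseteq> {k. f k ~= \<zero>}" using 4 by auto
 thus ?case using 4 by (auto simp: vectors_def intro: finite_subset)
qed (auto simp: vectors_def)

lemma combination_superset:
 assumes N: "module R N" and a: "!!k. k \<in> B ==> a k \<in> carrier N" and f: "f \<in> vectors R B"
  and S: "finite S" "S \<subseteq> B" "{k. f k ~= \<zero>} \<subseteq> S"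
 shows "combination R N a f = (\<Oplus>\<^bsub>N\<^esub>k\<in>S. f k *[N] a k)"
proof -
 interpret N: module R N by fact
 show ?thesis unfolding combination_def
 proof (rule N.add.finprod_mono_neutral_cong_left[OF S(1,3)])
  show "f i *[N] a i = 0[N]" if "i \<in> S - {k. f k ~= \<zero>}" for i
   using a[of i] S(2) that by auto
  show "(\<lambda>k. f k *[N] a k) \<in> S \<rightarrow> carrier N" using a S(2) vectorsD(1)[OF f] by auto
 qed simp
qed

lemma combination_hom:
 assumes N: "module R N" and a: "!!k. k \<in> B ==> a k \<in> carrier N"
 shows "combination R N a \<in> module_hom R (free_module R B) N"
proof -
 interpret N: module R N by fact
 have sub: "{k. f k ~= \<zero>} \<subseteq> B" if "f \<in> vectors R B" for f using vectorsD(2)[OF that] by blast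
 show ?thesis
 proof (rule module_homI, goal_cases)
  case (1 f)
  hence f: "f \<in> vectors R B" by simp
  show ?case unfolding combination_def
   by (rule N.finsum_closed) (use a vectorsD(1)[OF f] sub[OF f] in auto)
 next
  case (2 f g)
  hence fg: "f \<in> vectors R B" "g \<in> vectors R B" "finite {k. f k ~= \<zero>}" "finite {k. g k ~= \<zero>}" by auto
  let ?S = "{k. f k ~= \<zero>} \<union> {k. g k ~= \<zero>}"
  have S: "finite ?S" "?S \<subseteq> B" using fg sub by auto
  have aS: "a k \<in> carrier N" if "k \<in> ?S" for k using a[of k] S(2) that by auto
  have s: "(\<lambda>k. f k \<oplus> g k) \<in> vectors R B" using fg by (auto simp: vectors_def)
  have "combination R N a (\<lambda>k. f k \<oplus> g k) = (\<Oplus>\<^bsub>N\<^esub>k\<in>?S. (f k \<oplus> g k) *[N] a k)"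
   by (rule combination_superset[OF N a s S]) auto
  also have "\<dots> = (\<Oplus>\<^bsub>N\<^esub>k\<in>?S. f k *[N] a k +[N] g k *[N] a k)"
   by (rule N.finsum_cong') (use aS vectorsD(1)[OF fg(1)] vectorsD(1)[OF fg(2)] in \<open>auto simp: N.smult_l_distr\<close>)
  also have "\<dots> = (\<Oplus>\<^bsub>N\<^esub>k\<in>?S. f k *[N] a k) +[N] (\<Oplus>\<^bsub>N\<^esub>k\<in>?S. g k *[N] a k)"
   by (rule N.finsum_addf) (use aS vectorsD(1)[OF fg(1)] vectorsD(1)[OF fg(2)] in auto)
  also have "\<dots> = combination R N a f +[N] combination R N a g"
   using combination_superset[OF N a fg(1) S] combination_superset[OF N a fg(2) S] by simp
  finally show ?case by simp
 next
  case (3 r f)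
  hence f: "r \<in> carrier R" "f \<in> vectors R B" "finite {k. f k ~= \<zero>}" by auto
  have s: "(\<lambda>k. r ** f k) \<in> vectors R B" using f by (auto simp: vectors_def)
  have aS: "a k \<in> carrier N" if "f k ~= \<zero>" for k using a[of k] sub[OF f(2)] that by auto
  have "combination R N a (\<lambda>k. r ** f k) = (\<Oplus>\<^bsub>N\<^esub>k\<in>{k. f k ~= \<zero>}. (r ** f k) *[N] a k)"
   by (rule combination_superset[OF N a s f(3) sub[OF f(2)]]) (use f(1) in auto)
  also have "\<dots> = (\<Oplus>\<^bsub>N\<^esub>k\<in>{k. f k ~= \<zero>}. r *[N] (f k *[N] a k))"
   by (rule N.finsum_cong') (use aS f(1) vectorsD(1)[OF f(2)] in \<open>auto simp: N.smult_assoc1\<close>)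
  also have "\<dots> = r *[N] combination R N a f" unfolding combination_def
   by (rule N.finsum_smult_ldistr[symmetric, OF f(3,1)]) (use aS vectorsD(1)[OF f(2)] in auto)
  finally show ?case by simp
 qed
qed

lemma hom_combination:
 assumes N: "module R N" and N': "module R N'" and g: "g \<in> module_hom R N N'"
  and a: "!!k. k \<in> B ==> a k \<in> carrier N" "!!k. k \<in> B ==> g (a k) = a' k" and f: "f \<in> carrier (free_module R B)"
 shows "g (combination R N a f) = combination R N' a' f"
proof -
 interpret N: module R N by fact
 interpret N': module R N' by fact
 have fv: "f \<in> vectors R B" "finite {k. f k ~= \<zero>}" using f by auto
 note fc = vectorsD(1)[OF fv(1)]
 have B: "k \<in> B" if "f k ~= \<zero>" for k using vectorsD(2)[OF fv(1)] that by blast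
 have "g (combination R N a f) = (\<Oplus>\<^bsub>N'\<^esub>k\<in>{k. f k ~= \<zero>}. g (f k *[N] a k))"
  unfolding combination_def by (rule module_hom_finsum[OF N N' g fv(2)]) (use a B fc in auto)
 also have "\<dots> = combination R N' a' f" unfolding combination_def
  by (rule N'.finsum_cong') (use a(2)[OF B] module_homD(1)[OF g a(1)[OF B]] module_homD(3)[OF g fc a(1)[OF B]] fc in auto)
 finally show ?thesis .
qed

definition basis_vector :: "'k => 'k => 'a" where "basis_vector k = (\<lambda>l. if l = k then \<one> else \<zero>)"

lemma basis_vector_closed: "k \<in> B ==> basis_vector k \<in> carrier (free_module R B)"
proof -
 assume "k \<in> B"
 moreover have "{l. basis_vector k l ~= \<zero>} \<subseteq> {k}" by (auto simp: basis_vector_def)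
 ultimately show ?thesis by (auto simp: basis_vector_def vectors_def intro: finite_subset)
qed

lemma combination_basis_vector:
 assumes N: "module R N" and a: "a k \<in> carrier N" shows "combination R N a (basis_vector k) = a k"
proof -
 interpret N: module R N by fact
 have "combination R N a (basis_vector k) = (\<Oplus>\<^bsub>N\<^esub>l\<in>{k}. basis_vector k l *[N] a l)"
  by (rule combination_superset[OF N, of "{k}"]) (use a in \<open>auto simp: basis_vector_def vectors_def\<close>)
 thus ?thesis using a by (simp add: basis_vector_def)
qed

lemma free_expansion:
 assumes f: "f \<in> carrier (free_module R B)"
 shows "combination R (free_module R B) basis_vector f = f"
proof
 fix l
 interpret S: module R "self_module R" by (rule self_module)
 have fv: "f \<in> vectors R B" "finite {k. f k ~= \<zero>}" using f by auto
 have B: "k \<in> B" if "f k ~= \<zero>" for k using vectorsD(2)[OF fv(1)] that by blast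
 have ev: "(\<lambda>v. v l) \<in> module_hom R (free_module R B) (self_module R)"
  by (rule module_homI) (auto simp: vectors_def)
 have "combination R (free_module R B) basis_vector f l = combination R (self_module R) (\<lambda>k. basis_vector k l) f"
  by (rule hom_combination[OF free_module self_module ev basis_vector_closed _ f]) auto
 also have "\<dots> = (\<Oplus>\<^bsub>self_module R\<^esub>k\<in>{l}. f k ** basis_vector k l)" if "f l ~= \<zero>"
 proof -
  have "combination R (self_module R) (\<lambda>k. basis_vector k l) f = (\<Oplus>\<^bsub>self_module R\<^esub>k\<in>{k. f k ~= \<zero>}. f k ** basis_vector k l)"
   by (simp add: combination_def)
  also have "\<dots> = (\<Oplus>\<^bsub>self_module R\<^esub>k\<in>{l}. f k ** basis_vector k l)"
   by (rule S.add.finprod_mono_neutral_cong_right)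
    (use fv that vectorsD(1)[OF fv(1)] in \<open>auto simp: basis_vector_def\<close>)
  finally show ?thesis .
 qed
 moreover have "combination R (self_module R) (\<lambda>k. basis_vector k l) f = \<zero>" if "f l = \<zero>"
 proof -
  have "combination R (self_module R) (\<lambda>k. basis_vector k l) f = (\<Oplus>\<^bsub>self_module R\<^esub>k\<in>{k. f k ~= \<zero>}. 0[self_module R])"
   unfolding combination_def
   by (rule S.finsum_cong') (use that vectorsD(1)[OF fv(1)] in \<open>auto simp: basis_vector_def\<close>)
  thus ?thesis using S.finsum_zero by simp
 qed
 ultimately show "combination R (free_module R B) basis_vector f l = f l"
  using vectorsD(1)[OF fv(1), of l] by (cases "f l = \<zero>") (auto simp: basis_vector_def)
qed

lemma free_lift:
 assumes N: "module R N" and N': "module R N'" and g: "g \<in> module_hom R N N'"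
  and \<gamma>: "\<gamma> \<in> module_hom R (free_module R B) N'" "\<gamma> ` carrier (free_module R B) \<subseteq> g ` carrier N"
 shows "\<exists>\<alpha>\<in>module_hom R (free_module R B) N. \<forall>v\<in>carrier (free_module R B). g (\<alpha> v) = \<gamma> v"
proof -
 have "\<forall>k\<in>B. \<exists>a\<in>carrier N. g a = \<gamma> (basis_vector k)"
 proof
  fix k assume k: "k \<in> B"
  have "\<gamma> (basis_vector k) \<in> g ` carrier N" by (rule subsetD[OF \<gamma>(2) imageI[OF basis_vector_closed[OF k]]])
  thus "\<exists>a\<in>carrier N. g a = \<gamma> (basis_vector k)" by (elim imageE) (rule bexI, rule sym)
 qed
 then obtain a where a: "!!k. k \<in> B ==> a k \<in> carrier N" "!!k. k \<in> B ==> g (a k) = \<gamma> (basis_vector k)" by metis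
 have "g (combination R N a v) = \<gamma> v" if v: "v \<in> carrier (free_module R B)" for v
 proof -
  have "g (combination R N a v) = combination R N' (\<lambda>k. \<gamma> (basis_vector k)) v"
   by (rule hom_combination[OF N N' g a v])
  also have "\<dots> = \<gamma> (combination R (free_module R B) basis_vector v)"
   by (rule hom_combination[symmetric, OF free_module N' \<gamma>(1) basis_vector_closed _ v]) auto
  finally show ?thesis using free_expansion[OF v] by simp
 qed
 thus ?thesis using combination_hom[OF N a(1)] by (intro bexI[of _ "combination R N a"]) auto
qed

text \<open>The test modules in \<open>projective_module\<close> live on fixed types. The free
  module on \<open>carrier Q\<close> has the right type, so \<open>Q\<close> splits off from it, and
  lifting from the free module works over every type.\<close>

lemma projective_lift:
 assumes Q: "projective_module R Q" and N: "module R N" and N': "module R N'" and g: "g \<in> module_hom R N N'"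
  and \<gamma>: "\<gamma> \<in> module_hom R Q N'" "\<gamma> ` carrier Q \<subseteq> g ` carrier N"
 shows "\<exists>\<beta>\<in>module_hom R Q N. \<forall>x\<in>carrier Q. g (\<beta> x) = \<gamma> x"
proof -
 have Qm: "module R Q" using Q unfolding projective_module_def by simp
 let ?F = "free_module R (carrier Q)" and ?\<pi> = "combination R Q (\<lambda>q. q)"
 have \<pi>: "?\<pi> \<in> module_hom R ?F Q" by (rule combination_hom[OF Qm])
 have surj: "?\<pi> ` carrier ?F = carrier Q"
 proof (intro subset_antisym subsetI)
  fix x assume "x \<in> ?\<pi> ` carrier ?F" thus "x \<in> carrier Q" using module_homD(1)[OF \<pi>] by blast
 next
  fix x assume x: "x \<in> carrier Q"
  have "x = ?\<pi> (basis_vector x)" using combination_basis_vector[OF Qm, of "\<lambda>q. q" x] x by simp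
  thus "x \<in> ?\<pi> ` carrier ?F" using basis_vector_closed[OF x] by (rule image_eqI)
 qed
 have "(\<lambda>x. x) \<in> module_hom R Q Q" by (rule module_homI) auto
 hence "\<exists>h\<in>module_hom R Q ?F. \<forall>x\<in>carrier Q. ?\<pi> (h x) = (\<lambda>x. x) x"
  using Q free_module \<pi> surj Qm unfolding projective_module_def by blast
 then obtain h where h: "h \<in> module_hom R Q ?F" "!!x. x \<in> carrier Q ==> ?\<pi> (h x) = x" by blast
 have \<gamma>\<pi>: "(\<lambda>v. \<gamma> (?\<pi> v)) ` carrier ?F \<subseteq> g ` carrier N" using \<gamma>(2) surj by blast
 obtain \<alpha> where \<alpha>: "\<alpha> \<in> module_hom R ?F N" "\<forall>v\<in>carrier ?F. g (\<alpha> v) = \<gamma> (?\<pi> v)"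
  using free_lift[OF N N' g module_hom_comp[OF \<pi> \<gamma>(1)] \<gamma>\<pi>] by (elim bexE)
 show ?thesis
  using module_hom_comp[OF h(1) \<alpha>(1)] \<alpha>(2)[rule_format, OF module_homD(1)[OF h(1)]] h(2)
  by (intro bexI[of _ "\<lambda>x. \<alpha> (h x)"]) auto
qed

text \<open>The lifting properties are hypotheses since the two directions obtain them differently,
  by \<open>free_lift\<close> and by \<open>projective_lift\<close>. No multipliers occur here, so
  all degrees are constructed at once.\<close>

lemma resolution_comparison:
 fixes S :: "nat => ('a, 's) module" and T :: "nat => ('a, 't) module"
 assumes S: "!!j. module R (S j)" "!!j. ds j \<in> module_hom R (S (Suc j)) (S j)" "es \<in> module_hom R (S 0) M"
   "!!x. x \<in> carrier (S 1) ==> es (ds 0 x) = 0[M]"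
   "!!j x. x \<in> carrier (S (Suc (Suc j))) ==> ds j (ds (Suc j) x) = 0[S j]"
  and T: "!!j. module R (T j)" "!!j. dt j \<in> module_hom R (T (Suc j)) (T j)"
   "module_ker (T 0) M et \<subseteq> dt 0 ` carrier (T 1)"
   "!!j. module_ker (T (Suc j)) (T j) (dt j) \<subseteq> dt (Suc j) ` carrier (T (Suc (Suc j)))"
  and lift0: "\<exists>f\<in>module_hom R (S 0) (T 0). \<forall>x\<in>carrier (S 0). et (f x) = es x"
  and lift: "!!j \<gamma>. \<gamma> \<in> module_hom R (S (Suc j)) (T j) ==> \<gamma> ` carrier (S (Suc j)) \<subseteq> dt j ` carrier (T (Suc j)) ==>
   \<exists>f\<in>module_hom R (S (Suc j)) (T (Suc j)). \<forall>x\<in>carrier (S (Suc j)). dt j (f x) = \<gamma> x"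
 shows "\<exists>f. (\<forall>j. f j \<in> module_hom R (S j) (T j)) \<and> (\<forall>x\<in>carrier (S 0). et (f 0 x) = es x) \<and>
  (\<forall>j. \<forall>x\<in>carrier (S (Suc j)). dt j (f (Suc j) x) = f j (ds j x))"
proof -
 define good where "good j f \<longleftrightarrow> f \<in> module_hom R (S j) (T j) \<and>
  (case j of 0 => \<forall>x\<in>carrier (S 0). et (f x) = es x
   | Suc i => \<forall>x\<in>carrier (S (Suc i)). ds i x = 0[S i] --> dt i (f x) = 0[T i])" for j f
 have step: "\<exists>f'. good (Suc j) f' \<and> (\<forall>x\<in>carrier (S (Suc j)). dt j (f' x) = f (ds j x))" if good: "good j f" for j f
 proof -
  have f: "f \<in> module_hom R (S j) (T j)" using good unfolding good_def by simp
  have "(\<lambda>x. f (ds j x)) ` carrier (S (Suc j)) \<subseteq> dt j ` carrier (T (Suc j))"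
  proof (rule image_subsetI)
   fix x assume x: "x \<in> carrier (S (Suc j))"
   have fx: "f (ds j x) \<in> carrier (T j)" using module_homD(1)[OF f module_homD(1)[OF S(2) x]] .
   show "f (ds j x) \<in> dt j ` carrier (T (Suc j))"
   proof (cases j)
    case 0
    have "et (f (ds 0 x)) = 0[M]"
     using good S(4)[of x] module_homD(1)[OF S(2), of x 0] x unfolding good_def 0 by simp
    thus ?thesis using T(3) fx unfolding 0 module_ker_def by auto
   next
    case (Suc i)
    have "dt i (f (ds j x)) = 0[T i]"
     using good S(5)[of x i] module_homD(1)[OF S(2), of x j] x unfolding good_def Suc by simp
    thus ?thesis using T(4)[of i] fx unfolding Suc module_ker_def by auto
   qed
  qed
  from lift[OF module_hom_comp[OF S(2) f] this]
  obtain f' where f': "f' \<in> module_hom R (S (Suc j)) (T (Suc j))" "\<forall>x\<in>carrier (S (Suc j)). dt j (f' x) = f (ds j x)"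
   by (elim bexE)
  thus ?thesis using module_hom_zero[OF S(1) T(1) f] unfolding good_def by (intro exI[of _ f']) simp
 qed
 obtain f0 where f0: "good 0 f0" using lift0 unfolding good_def by auto
 have "\<exists>f. \<forall>j. good j (f j) \<and> (\<forall>x\<in>carrier (S (Suc j)). dt j (f (Suc j) x) = f j (ds j x))"
  by (rule dependent_nat_choice) (use f0 step in blast)+
 then obtain f where f: "\<forall>j. good j (f j) \<and> (\<forall>x\<in>carrier (S (Suc j)). dt j (f (Suc j) x) = f j (ds j x))" by (elim exE)
 hence "good 0 (f 0)" by blast
 thus ?thesis using f unfolding good_def by (intro exI[of _ f]) simp
qed

end


section \<open>Homomorphisms of free modules of finite rank as matrices\<close>

context cring
begin

lemma free_module_finite: "free_module R {..<r::nat} = vector_module R {..<r}"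
proof -
 have "finite {k. f k ~= \<zero>}" if "f \<in> vectors R {..<r}" for f
  by (rule finite_subset[of _ "{..<r}"]) (use vectorsD(2)[OF that] in auto)
 hence "{f \<in> vectors R {..<r}. finite {k. f k ~= \<zero>}} = vectors R {..<r}" by blast
 thus ?thesis by (simp add: free_module_def vector_module_def)
qed

lemma mvec_comp:
 assumes v: "v \<in> vectors R {..<r}" and A: "A \<in> mats r n" and B: "B \<in> mats n c"
 shows "mvec n (mvec r v A) B = mvec r v (mmul n A B)"
proof -
 let ?M = "\<lambda>k l. if k = (0::nat) then v l else \<zero>"
 have "?M \<in> mats 1 r" using vectorsD[OF v] by (intro matsI) auto
 from mmul_assoc[OF this A B, of n] have "mmul r ?M (mmul n A B) 0 = mmul n (mmul r ?M A) B 0" by simp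
 thus ?thesis by (simp add: mmul_row)
qed

lemma mvec_basis_vector:
 assumes A: "A \<in> mats r' c" and k: "k < r" shows "mvec r (basis_vector k) A = A k"
proof
 fix l
 have "mvec r (basis_vector k) A l = (\<Oplus>i\<in>{..<r}. if k = i then A i l else \<zero>)"
  unfolding mvec_def by (rule finsum_cong') (use matsD(1)[OF A] in \<open>auto simp: basis_vector_def\<close>)
 also have "\<dots> = A k l" by (rule finsum_singleton) (use k matsD(1)[OF A] in auto)
 finally show "mvec r (basis_vector k) A l = A k l" .
qed

lemma hom_eq_on_basis:
 assumes N: "module R N" and f: "f \<in> module_hom R (free_module R B) N" and g: "g \<in> module_hom R (free_module R B) N"
  and eq: "!!k. k \<in> B ==> f (basis_vector k) = g (basis_vector k)" and v: "v \<in> carrier (free_module R B)"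
 shows "f v = g v"
proof -
 have "f (combination R (free_module R B) basis_vector v) = combination R N (\<lambda>k. g (basis_vector k)) v"
  by (rule hom_combination[OF free_module N f basis_vector_closed _ v]) (simp_all add: eq)
 also have "\<dots> = g (combination R (free_module R B) basis_vector v)"
  by (rule hom_combination[symmetric, OF free_module N g basis_vector_closed _ v]) simp_all
 finally show ?thesis unfolding free_expansion[OF v] .
qed

lemma exact_row:
 assumes G: "exact_upto {\<one>} n A" and v: "v \<in> vectors R {..<n (Suc j)}" "mvec (n (Suc j)) v (A j) = (\<lambda>_. \<zero>)"
 shows "\<exists>w\<in>vectors R {..<n (Suc (Suc j))}. mvec (n (Suc (Suc j))) w (A (Suc j)) = v"
proof -
 note E = exact_uptoD[OF G]
 let ?M = "\<lambda>k l. if k = (0::nat) then v l else \<zero>"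
 have M: "?M \<in> mats 1 (n (Suc j))" using vectorsD[OF v(1)] by (intro matsI) auto
 have "mmul (n (Suc j)) ?M (A j) k = mzero k" for k
  using v(2) mvec_zero[OF E(1)] unfolding mmul_row mzero_def by (cases "k = 0") simp_all
 hence "mmul (n (Suc j)) ?M (A j) = mzero" by (intro ext) simp
 from E(3)[OF M this] obtain W where W: "W \<in> mats 1 (n (Suc (Suc j)))"
  "msm \<one> ?M = mmul (n (Suc (Suc j))) W (A (Suc j))" by blast
 have "mvec (n (Suc (Suc j))) (W 0) (A (Suc j)) = v"
  using fun_cong[OF W(2), of 0] vectorsD(1)[OF v(1)] by (simp add: mmul_row msm_def)
 thus ?thesis using mats_row[OF W(1)] by blast
qed

end

text \<open>A minimal resolution is a summand, up to homotopy, of every projective resolution: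
 composing comparison maps in both directions gives an endomorphism homotopic to the identity,
 which vanishes where the projective resolution does.\<close>

lemma (in noetherian_local) finite_minimal_resolution:
 fixes Q :: "nat => ('a, 'q) module"
 assumes I: "ideal I R" and G: "resolves_upto {\<one>} I n A" and Am: "!!j k l. A j k l \<in> m"
  and Q: "projective_resolution R (ideal_module R I) Q dq e" "!!i. L < i ==> carrier (Q i) = {0[Q i]}"
  and iL: "L \<le> i"
 shows "n (Suc (Suc i)) = 0"
proof -
 note E = exact_uptoD[OF resolves_uptoD(1)[OF G]] and G0 = resolves_uptoD(2-4)[OF G]
 define M where "M = ideal_module R I"
 have M: "module R M" unfolding M_def ideal_module_def
  using submodule.submodule_is_module[of I R "self_module R"] submodule_self I self_module by blast
 have Ms: "carrier M = I" "0[M] = \<zero>" "!!x y. x +[M] y = x \<oplus> y" "!!r x. r *[M] x = r ** x"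
  unfolding M_def ideal_module_def by (simp_all add: self_module_def)
 have Qp: "projective_module R (Q j)" "module R (Q j)" for j
  using Q(1) unfolding projective_resolution_def projective_module_def by auto
 have Qd: "!!j. dq j \<in> module_hom R (Q (Suc j)) (Q j)" "e \<in> module_hom R (Q 0) M" "e ` carrier (Q 0) = I"
  "dq 0 ` carrier (Q 1) = module_ker (Q 0) M e"
  "!!j. dq (Suc j) ` carrier (Q (Suc (Suc j))) = module_ker (Q (Suc j)) (Q j) (dq j)"
  using Q(1) Ms(1) unfolding projective_resolution_def M_def[symmetric] by auto
 \<comment> \<open>\<open>Q\<close> resolves \<open>I\<close>, so the minimal resolution of
   \<open>R / I\<close> is shifted: degree \<open>j\<close> has rank \<open>n (Suc j)\<close>, and
   \<open>A 0\<close> becomes the augmentation onto \<open>I\<close>.\<close>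
 define V where "V j = free_module R {..<n (Suc j)}" for j
 define dv where "dv j v = mvec (n (Suc (Suc j))) v (A (Suc j))" for j v
 define ev where "ev v = mvec (n 1) v (A 0) 0" for v
 have V: "module R (V j)" "carrier (V j) = vectors R {..<n (Suc j)}" "0[V j] = (\<lambda>_. \<zero>)" for j
  unfolding V_def free_module_finite by (simp_all add: vector_module)
 have dv: "dv j \<in> module_hom R (V (Suc j)) (V j)" for j
  unfolding V_def dv_def free_module_finite by (rule mvec_hom[OF E(1)])
 have ev: "ev \<in> module_hom R (V 0) M"
 proof (rule module_homI, unfold Ms V(2))
  fix v assume v: "v \<in> vectors R {..<n (Suc 0)}"
  have "(\<lambda>k l. if k = (0::nat) then v l else \<zero>) \<in> mats 1 (n 1)" using vectorsD[OF v] by (intro matsI) auto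
  moreover have "A 0 k l \<in> I" for k l
   using G0(2)[of k] matsD(3)[OF E(1)[of 0], of l k] G0(1) idealD(3)[OF I] by (cases "l = 0") auto
  ultimately have "mmul (n 1) (\<lambda>k l. if k = (0::nat) then v l else \<zero>) (A 0) 0 0 \<in> I"
   using E(1)[of 0] by (intro mmul_in_ideal[OF I]) auto
  thus "ev v \<in> I" by (simp add: ev_def mmul_row)
 qed (use mvec_add[OF _ _ E(1)[of 0]] mvec_sm[OF _ _ E(1)[of 0]] in \<open>auto simp: ev_def V_def free_module_finite\<close>)
 have dd: "mvec (n (Suc j)) (dv j v) (A j) = (\<lambda>_. \<zero>)" if "v \<in> carrier (V (Suc j))" for j v
 proof -
  have "mvec (n (Suc j)) (dv j v) (A j) = mvec (n (Suc (Suc j))) v mzero"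
   unfolding dv_def E(2)[of j, symmetric] using that by (intro mvec_comp[OF _ E(1) E(1)]) (simp add: V(2))
  moreover have "v k \<in> carrier R" for k using that vectorsD(1)[of v] by (simp add: V(2))
  ultimately show ?thesis by (simp add: mvec_def mzero_def)
 qed
 have ex: "v \<in> dv j ` carrier (V (Suc j))" if "v \<in> carrier (V j)" "mvec (n (Suc j)) v (A j) = (\<lambda>_. \<zero>)" for j v
  using exact_row[OF resolves_uptoD(1)[OF G], of v j] that unfolding V(2) dv_def by blast
 have ev0: "mvec (n 1) v (A 0) = (\<lambda>_. \<zero>)" if "v \<in> carrier (V 0)" "ev v = \<zero>" for v
 proof
  fix l
  have c: "mvec (n 1) v (A 0) \<in> vectors R {..<n 0}" using that(1) mvec_closed[OF _ E(1)] by (simp add: V(2))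
  show "mvec (n 1) v (A 0) l = \<zero>" using that(2) G0(1) vectorsD(2)[OF c, of l] by (cases "l = 0") (auto simp: ev_def)
 qed
 have "\<exists>f. (\<forall>j. f j \<in> module_hom R (V j) (Q j)) \<and> (\<forall>x\<in>carrier (V 0). e (f 0 x) = ev x) \<and>
  (\<forall>j. \<forall>x\<in>carrier (V (Suc j)). dq j (f (Suc j) x) = f j (dv j x))"
 proof (rule resolution_comparison[where M = M])
  show "ev (dv 0 x) = 0[M]" if "x \<in> carrier (V 1)" for x using dd[of x 0] that by (simp add: ev_def Ms)
  show "dv j (dv (Suc j) x) = 0[V j]" if "x \<in> carrier (V (Suc (Suc j)))" for j x
   using dd[OF that] unfolding dv_def[of j] V(3) .
  show "\<exists>f\<in>module_hom R (V 0) (Q 0). \<forall>x\<in>carrier (V 0). e (f x) = ev x"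
   unfolding V_def by (rule free_lift[OF Qp(2) M Qd(2)]) (use ev module_homD(1)[OF ev] Qd(3) Ms in \<open>auto simp: V_def\<close>)
  show "\<exists>f\<in>module_hom R (V (Suc j)) (Q (Suc j)). \<forall>x\<in>carrier (V (Suc j)). dq j (f x) = \<gamma> x"
   if "\<gamma> \<in> module_hom R (V (Suc j)) (Q j)" "\<gamma> ` carrier (V (Suc j)) \<subseteq> dq j ` carrier (Q (Suc j))" for j \<gamma>
   using that unfolding V_def by (rule free_lift[OF Qp(2) Qp(2) Qd(1)])
 qed (use V Qp(2) dv ev Qd in auto)
 then obtain \<alpha> where \<alpha>: "\<forall>j. \<alpha> j \<in> module_hom R (V j) (Q j)" "\<forall>x\<in>carrier (V 0). e (\<alpha> 0 x) = ev x"
  "\<forall>j. \<forall>x\<in>carrier (V (Suc j)). dq j (\<alpha> (Suc j) x) = \<alpha> j (dv j x)" by (elim exE conjE)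
 have "\<exists>f. (\<forall>j. f j \<in> module_hom R (Q j) (V j)) \<and> (\<forall>x\<in>carrier (Q 0). ev (f 0 x) = e x) \<and>
  (\<forall>j. \<forall>x\<in>carrier (Q (Suc j)). dv j (f (Suc j) x) = f j (dq j x))"
 proof (rule resolution_comparison[where M = M])
  show "e (dq 0 x) = 0[M]" if "x \<in> carrier (Q 1)" for x using Qd(4) that unfolding module_ker_def by blast
  show "dq j (dq (Suc j) x) = 0[Q j]" if "x \<in> carrier (Q (Suc (Suc j)))" for j x
   using Qd(5)[of j] that unfolding module_ker_def by blast
  show "module_ker (V 0) M ev \<subseteq> dv 0 ` carrier (V 1)"
   using ex[of _ 0] ev0 unfolding module_ker_def Ms by auto
  show "module_ker (V (Suc j)) (V j) (dv j) \<subseteq> dv (Suc j) ` carrier (V (Suc (Suc j)))" for j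
   using ex[of _ "Suc j"] unfolding module_ker_def V(3) dv_def[of j] by auto
  have "x \<in> ev ` carrier (V 0)" if x: "x \<in> I" for x
  proof -
   let ?M = "\<lambda>k l. if k = (0::nat) \<and> l = (0::nat) then x else \<zero>"
   have "?M \<in> mats 1 1" "\<forall>k. ?M k 0 \<in> I" using x idealD(2,3)[OF I] by (auto simp: mats_def)
   then obtain W where W: "W \<in> mats 1 (n 1)" "msm \<one> ?M = mmul (n 1) W (A 0)" using G0(3)[of ?M 1] by blast
   have "ev (W 0) = x" using fun_cong[OF fun_cong[OF W(2), of 0], of 0] idealD(2)[OF I x] by (simp add: ev_def mmul_row msm_def)
   thus ?thesis using mats_row[OF W(1), of 0] by (auto simp: V(2))
  qed
  thus "\<exists>f\<in>module_hom R (Q 0) (V 0). \<forall>x\<in>carrier (Q 0). ev (f x) = e x"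
   by (intro projective_lift[OF Qp(1) V(1) M ev Qd(2)]) (use Qd(3) in auto)
  show "\<exists>f\<in>module_hom R (Q (Suc j)) (V (Suc j)). \<forall>x\<in>carrier (Q (Suc j)). dv j (f x) = \<gamma> x"
   if "\<gamma> \<in> module_hom R (Q (Suc j)) (V j)" "\<gamma> ` carrier (Q (Suc j)) \<subseteq> dv j ` carrier (V (Suc j))" for j \<gamma>
   by (rule projective_lift[OF Qp(1) V(1) V(1) dv that])
 qed (use V Qp(2) dv ev Qd in auto)
 then obtain \<beta> where \<beta>: "\<forall>j. \<beta> j \<in> module_hom R (Q j) (V j)" "\<forall>x\<in>carrier (Q 0). ev (\<beta> 0 x) = e x"
  "\<forall>j. \<forall>x\<in>carrier (Q (Suc j)). dv j (\<beta> (Suc j) x) = \<beta> j (dq j x)" by (elim exE conjE)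
 define F where "F j v = \<beta> j (\<alpha> j v)" for j v
 have \<alpha>c: "\<alpha> j v \<in> carrier (Q j)" if "v \<in> carrier (V j)" for j v using module_homD(1)[OF \<alpha>(1)[rule_format] that] .
 have F: "F j \<in> module_hom R (V j) (V j)" for j
  unfolding F_def by (rule module_hom_comp[OF \<alpha>(1)[rule_format] \<beta>(1)[rule_format]])
 have Fd: "dv j (F (Suc j) v) = F j (dv j v)" if "v \<in> carrier (V (Suc j))" for j v
  using \<alpha>(3) \<beta>(3) \<alpha>c[OF that] that unfolding F_def by simp
 have Fe: "ev (F 0 v) = ev v" if "v \<in> carrier (V 0)" for v
  using \<alpha>(2) \<beta>(2) \<alpha>c[OF that] that unfolding F_def by simp
 have bv: "basis_vector k \<in> carrier (V j)" if "k < n (Suc j)" for j k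
  using basis_vector_closed[of k "{..<n (Suc j)}"] that unfolding V_def by blast
 \<comment> \<open>The matrix of \<open>F j\<close>, whose rows are the images of the basis vectors,
   leads back to the calculus of \<open>null_homotopy_exists\<close>.\<close>
 define Fm where "Fm j k = (if k < n (Suc j) then F j (basis_vector k) else (\<lambda>_. \<zero>))" for j k
 have Fm: "Fm j \<in> mats (n (Suc j)) (n (Suc j))" for j
  using module_homD(1)[OF F bv] by (intro matsI) (auto simp: Fm_def V(2) vectors_def)
 have mF: "mvec (n (Suc j)) v (Fm j) = F j v" if "v \<in> carrier (V j)" for j v
 proof (rule hom_eq_on_basis[where f = "\<lambda>v. mvec (n (Suc j)) v (Fm j)", OF V(1)[of j]])
  show "(\<lambda>v. mvec (n (Suc j)) v (Fm j)) \<in> module_hom R (free_module R {..<n (Suc j)}) (V j)"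
   unfolding V_def free_module_finite by (rule mvec_hom[OF Fm])
  show "F j \<in> module_hom R (free_module R {..<n (Suc j)}) (V j)" using F[of j] unfolding V_def .
  show "v \<in> carrier (free_module R {..<n (Suc j)})" using that unfolding V_def .
  fix k assume "k \<in> {..<n (Suc j)}"
  thus "mvec (n (Suc j)) (basis_vector k) (Fm j) = F j (basis_vector k)"
   using mvec_basis_vector[OF Fm] by (simp add: Fm_def)
 qed
 have zero_row: "A j k = (\<lambda>_. \<zero>)" if "\<not> k < n (Suc j)" for j k using matsD(2)[OF E(1) that] by (intro ext)
 define f where "f j = msub (mone (n (Suc j))) (Fm j)" for j
 have f: "f j \<in> mats (n (Suc j)) (n (Suc j))" for j unfolding f_def by (rule msub_mats[OF mone_mats Fm])
 have Fcomm: "mmul (n (Suc j)) (A (Suc j)) (Fm j) = mmul (n (Suc (Suc j))) (Fm (Suc j)) (A (Suc j))" for j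
 proof
  fix k
  show "mmul (n (Suc j)) (A (Suc j)) (Fm j) k = mmul (n (Suc (Suc j))) (Fm (Suc j)) (A (Suc j)) k"
  proof (cases "k < n (Suc (Suc j))")
   case True
   have r: "A (Suc j) k = dv j (basis_vector k)" unfolding dv_def using mvec_basis_vector[OF E(1) True] by simp
   have "mmul (n (Suc j)) (A (Suc j)) (Fm j) k = F j (dv j (basis_vector k))"
    unfolding mmul_row r by (rule mF[OF module_homD(1)[OF dv bv[OF True]]])
   also have "\<dots> = dv j (F (Suc j) (basis_vector k))" by (rule Fd[symmetric, OF bv[OF True]])
   finally show ?thesis using True unfolding mmul_row by (simp add: Fm_def dv_def)
  next
   case False
   thus ?thesis unfolding mmul_row zero_row[OF False]
    using mvec_zero[OF Fm, of "n (Suc j)" j] mvec_zero[OF E(1), of "n (Suc (Suc j))" "Suc j"] by (simp add: Fm_def)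
  qed
 qed
 have comm: "mmul (n (Suc j)) (A (Suc j)) (f j) = mmul (n (Suc (Suc j))) (f (Suc j)) (A (Suc j))" for j
  unfolding f_def mmul_sub_r[OF E(1) mone_mats Fm] mmul_sub_l[OF mone_mats Fm E(1)]
   mmul_one_r[OF E(1)] mmul_one_l[OF E(1)] Fcomm ..
 have F0: "mmul (n 1) (Fm 0) (A 0) = A 0"
 proof
  fix k
  show "mmul (n 1) (Fm 0) (A 0) k = A 0 k"
  proof (cases "k < n 1")
   case True
   hence k: "basis_vector k \<in> carrier (V 0)" using bv[of k 0] by simp
   have r: "mvec (n 1) (basis_vector k) (A 0) = A 0 k" using mvec_basis_vector[OF E(1) True, of 0] by simp
   show ?thesis
   proof
    fix l
    show "mmul (n 1) (Fm 0) (A 0) k l = A 0 k l"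
    proof (cases "l = 0")
     case l: True
     have "ev (F 0 (basis_vector k)) = A 0 k 0" using Fe[OF k] r by (simp add: ev_def)
     thus ?thesis using True l by (simp add: mmul_row Fm_def ev_def)
    next
     case False
     hence "\<not> l < n 0" using G0(1) by simp
     thus ?thesis
      using matsD(3)[OF E(1)[of 0]] matsD(3)[OF mmul_mats[OF Fm[of 0] E(1)[of 0]], of l k] by simp
    qed
   qed
  next
   case False
   hence "Fm 0 k = (\<lambda>_. \<zero>)" "A 0 k = (\<lambda>_. \<zero>)" using zero_row[of k 0] by (auto simp: Fm_def)
   thus ?thesis unfolding mmul_row using mvec_zero[OF E(1)] by simp
  qed
 qed
 \<comment> \<open>\<open>F\<close> lifts the identity of \<open>I\<close>, so \<open>f 0\<close>
   has its rows in the kernel of the augmentation; exactness gives the first homotopy.\<close>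
 have "mmul (n (Suc 0)) (f 0) (A 0) = mzero"
  using mmul_sub_l[OF mone_mats Fm[of 0] E(1)[of 0]] mmul_one_l[OF E(1)[of 0]] F0 msub_self[OF E(1)[of 0]]
  by (simp add: f_def)
 from E(3)[OF f this] have start: "\<exists>u\<in>{\<one>}. \<exists>W\<in>mats (n (Suc 0)) (n (Suc 1)). msm u (f 0) = mmul (n (Suc 1)) W (A (Suc 0))"
  by simp
 have exs: "exact_upto {\<one>} (\<lambda>j. n (Suc j)) (\<lambda>j. A (Suc j))"
  using resolves_uptoD(1)[OF G] unfolding exact_upto_def by blast
 have "\<exists>u\<in>{\<one>}. \<exists>h. (\<forall>j\<le>Suc i. h j \<in> mats (n (Suc j)) (n (Suc (Suc j)))) \<and> msm u (f 0) = mmul (n (Suc 1)) (h 0) (A (Suc 0)) \<and>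
  (\<forall>j<Suc i. msm u (f (Suc j)) = madd (mmul (n (Suc (Suc (Suc j)))) (h (Suc j)) (A (Suc (Suc j)))) (mmul (n (Suc j)) (A (Suc j)) (h j)))"
  by (rule null_homotopy_exists[OF mult_set_one _ _ exs]) (use E f comm start in auto)
 then obtain h where h: "!!j. j \<le> Suc i ==> h j \<in> mats (n (Suc j)) (n (Suc (Suc j)))"
  "msm \<one> (f (Suc i)) = madd (mmul (n (Suc (Suc (Suc i)))) (h (Suc i)) (A (Suc (Suc i)))) (mmul (n (Suc i)) (A (Suc i)) (h i))"
  by auto
 \<comment> \<open>\<open>F (Suc i)\<close> factors through \<open>Q (Suc i)\<close>, which is zero.
   Hence the identity is null homotopic in that degree, and minimality leaves rank 0.\<close>
 have "F (Suc i) v = (\<lambda>_. \<zero>)" if v: "v \<in> carrier (V (Suc i))" for v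
 proof -
  have "\<alpha> (Suc i) v = 0[Q (Suc i)]" using \<alpha>c[OF v] Q(2)[of "Suc i"] iL by simp
  thus ?thesis unfolding F_def using module_hom_zero[OF Qp(2) V(1) \<beta>(1)[rule_format]] V(3) by simp
 qed
 hence "Fm (Suc i) = mzero" unfolding Fm_def mzero_def using bv by (intro ext) auto
 hence "f (Suc i) = mone (n (Suc (Suc i)))" using msub_mzero[OF mone_mats] by (simp add: f_def)
 thus ?thesis
  using minimal_homotopy_zero[OF ideal_m, of "\<lambda>j. A (Suc j)" "\<lambda>j. n (Suc j)" h i \<one>] E(1) Am h
   primeD(2)[OF prime_m] by simp
qed

section \<open>Null-homotopic parameters\<close>

context noetherian_local
begin

text \<open>As in the inequality of Auslander and Buchsbaum: comparison with the finite resolution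
  \<open>B\<close> makes the minimal one finite, and its last nonzero module, in degree
  \<open>t\<close>, forces a chain of length \<open>t\<close> below \<open>P\<close>.\<close>

lemma minimal_resolution_length:
 assumes P: "primeideal P R" and I: "ideal I R"
  and A: "resolves_upto (carrier R - P) I n A" "!!j k l. A j k l \<in> P"
  and B: "resolves_upto {\<one>} I n' B" "!!j. L \<le> j ==> n' (Suc j) = 0"
  and b: "\<not> chain_to R b P"
 shows "n b = 0"
proof (rule ccontr)
 assume nb: "n b ~= 0"
 note U = mult_set_prime[OF P] and PI = primeD(1)[OF P]
 have B': "resolves_upto (carrier R - P) I n' B" by (rule resolves_upto_mono[OF B(1)]) (use mult_setD(2)[OF U] in simp)
 have zero: "n (Suc j) = 0" if Lj: "L \<le> j" for j
 proof -
  obtain u h where h: "u \<in> carrier R - P" "!!i. i \<le> Suc j ==> h i \<in> mats (n i) (n (Suc i))"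
   "contracts n A h u j"
   using comparison_homotopy[OF U I A(1) B', of "Suc j"] B(2)[OF Lj] by blast
  show ?thesis
   by (rule minimal_homotopy_zero[OF PI exact_uptoD(1)[OF resolves_uptoD(1)[OF A(1)]] A(2) h(2) h(2) _ _ h(3)]) (use h(1) in auto)
 qed
 define T where "T = {t. n t ~= 0}"
 have "t \<le> L" if "n t ~= 0" for t
 proof (cases t)
  case (Suc k)
  hence "\<not> L \<le> k" using zero[of k] that by auto
  thus ?thesis using Suc by simp
 qed simp
 hence T: "finite T" "b \<in> T" unfolding T_def using nb by (auto intro: finite_subset[of _ "{..L}"])
 moreover have "T ~= {}" using T(2) by blast
 ultimately have "Max T \<in> T" "b \<le> Max T" using Max_in[OF T(1)] Max_ge[OF T] by auto
 moreover have "Suc (Max T) \<notin> T" using Max_ge[OF T(1), of "Suc (Max T)"] Suc_n_not_le_n by blast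
 ultimately show False
  using minimal_complex_chain[OF P resolves_uptoD(1)[OF A(1)] A(2), of "Max T"] chain_to_mono[of R "Max T" P b] b
  unfolding T_def by auto
qed

text \<open>Multiplication by these elements is null homotopic in degrees above \<open>i\<close>,
  since \<open>contracts\<close> at \<open>j\<close> concerns degree \<open>Suc j\<close>. The range
  stops at \<open>d\<close>, beyond which nothing is asked.\<close>

definition null_multipliers :: "nat => (nat => nat) => (nat => nat => nat => 'a) => 'a set" where
 "null_multipliers i n A = {a \<in> carrier R. \<exists>h. (\<forall>j\<le>Suc d. h j \<in> mats (n j) (n (Suc j))) \<and>
   (\<forall>j. i \<le> j \<and> j \<le> d --> contracts n A h a j)}"

lemma null_multipliers_ideal:
 assumes A: "!!j. A j \<in> mats (n (Suc j)) (n j)"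
 shows "ideal (null_multipliers i n A) R"
proof (rule ideal_intro)
 show "null_multipliers i n A \<subseteq> carrier R" unfolding null_multipliers_def by auto
 have "madd (mmul (n (Suc (Suc j))) mzero (A (Suc j))) (mmul (n j) (A j) mzero) = msm \<zero> (mone (n (Suc j)))" for j
  unfolding mmul_zero_l[OF A] mmul_zero_r[OF A] by (intro ext) (simp add: madd_def mzero_def msm_def mone_def)
 thus "\<zero> \<in> null_multipliers i n A"
  unfolding null_multipliers_def using mzero_mats by (auto intro!: exI[of _ "\<lambda>_. mzero"])
next
 fix a b assume "a \<in> null_multipliers i n A" "b \<in> null_multipliers i n A"
 then obtain h h' where h: "a \<in> carrier R" "!!j. j \<le> Suc d ==> h j \<in> mats (n j) (n (Suc j))"
  "!!j. i \<le> j ==> j \<le> d ==> contracts n A h a j"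
  and h': "b \<in> carrier R" "!!j. j \<le> Suc d ==> h' j \<in> mats (n j) (n (Suc j))"
  "!!j. i \<le> j ==> j \<le> d ==> contracts n A h' b j"
  unfolding null_multipliers_def by blast
 have "msm (a \<oplus> b) (mone (n (Suc j))) = madd (mmul (n (Suc (Suc j))) (madd (h (Suc j)) (h' (Suc j))) (A (Suc j))) (mmul (n j) (A j) (madd (h j) (h' j)))"
  if "i \<le> j" "j \<le> d" for j
 proof -
  note m = h(2)[of j] h(2)[of "Suc j"] h'(2)[of j] h'(2)[of "Suc j"]
  note c = matsD(1)[OF mmul_mats[OF m(2) A[of "Suc j"]]] matsD(1)[OF mmul_mats[OF m(4) A[of "Suc j"]]]
   matsD(1)[OF mmul_mats[OF A[of j] m(1)]] matsD(1)[OF mmul_mats[OF A[of j] m(3)]]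
  have e: "msm (a \<oplus> b) (mone (n (Suc j))) = madd (msm a (mone (n (Suc j)))) (msm b (mone (n (Suc j))))"
   using h(1) h'(1) by (intro ext) (simp add: msm_def madd_def mone_def)
  show ?thesis
   unfolding e h(3)[OF that] h'(3)[OF that] using that m c
   by (subst mmul_add_l[of _ "n (Suc j)" "n (Suc (Suc j))" _ _ "n (Suc (Suc j))" "n (Suc j)"] mmul_add_r[of _ "n (Suc j)" "n j" _ "n j" "n (Suc j)"]; (simp add: A)?)+
    (intro ext, simp add: madd_def a_ac)
 qed
 thus "a \<oplus> b \<in> null_multipliers i n A"
  unfolding null_multipliers_def using h(1,2) h'(1,2)
  by (intro CollectI conjI exI[of _ "\<lambda>j. madd (h j) (h' j)"]) (auto intro: madd_mats)
next
 fix a r assume "a \<in> null_multipliers i n A" and r: "r \<in> carrier R"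
 then obtain h where h: "a \<in> carrier R" "!!j. j \<le> Suc d ==> h j \<in> mats (n j) (n (Suc j))"
  "!!j. i \<le> j ==> j \<le> d ==> contracts n A h a j"
  unfolding null_multipliers_def by blast
 have "msm (r ** a) (mone (n (Suc j))) = madd (mmul (n (Suc (Suc j))) (msm r (h (Suc j))) (A (Suc j))) (mmul (n j) (A j) (msm r (h j)))"
  if "i \<le> j" "j \<le> d" for j
 proof -
  have m: "h j \<in> mats (n j) (n (Suc j))" "h (Suc j) \<in> mats (n (Suc j)) (n (Suc (Suc j)))" using h(2) that by auto
  show ?thesis
   unfolding msm_msm[OF r h(1) mone_mats, symmetric] h(3)[OF that] mmul_sm_l[OF r m(2) A] mmul_sm_r[OF r A m(1)]
   by (rule msm_add[OF r mmul_mats[OF m(2) A] mmul_mats[OF A m(1)]])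
 qed
 thus "r ** a \<in> null_multipliers i n A"
  unfolding null_multipliers_def using h(1,2) r
  by (intro CollectI conjI exI[of _ "\<lambda>j. msm r (h j)"]) (auto intro: msm_mats)
qed

text \<open>Outside \<open>I\<close> the complex is contractible; at a prime containing \<open>I\<close> it is homotopic, up to
 elements outside the prime, to the minimal resolution there, which is short.\<close>

lemma null_multipliers_not_below:
 assumes I: "ideal I R" and A: "resolves_upto {\<one>} I n A" "!!j. L \<le> j ==> n (Suc j) = 0"
  and Q: "primeideal Q R" "\<not> chain_to R (Suc i) Q"
 shows "\<not> null_multipliers i n A \<subseteq> Q"
proof (cases "I \<subseteq> Q")
 case True
 note U = mult_set_prime[OF Q(1)]
 obtain n' B where B: "resolves_upto (carrier R - Q) I n' B" "!!j k l. B j k l \<in> Q"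
  using minimal_resolution[OF Q(1) I True] by auto
 \<comment> \<open>The height of \<open>Q\<close> is at most \<open>i\<close>, and it bounds the
   length of the minimal resolution at \<open>Q\<close>.\<close>
 have n': "n' (Suc j) = 0" if "i \<le> j" for j
  by (rule minimal_resolution_length[OF Q(1) I B A]) (use chain_to_mono[of R "Suc j" Q "Suc i"] that Q(2) in auto)
 have A': "resolves_upto (carrier R - Q) I n A" by (rule resolves_upto_mono[OF A(1)]) (use mult_setD(2)[OF U] in simp)
 obtain u h where u: "u \<in> carrier R - Q" "\<forall>j\<le>Suc d. h j \<in> mats (n j) (n (Suc j))"
  "\<forall>j<Suc d. n' (Suc j) = 0 --> contracts n A h u j"
  using comparison_homotopy[OF U I A' B(1), of "Suc d"] by blast
 have "u \<in> null_multipliers i n A"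
  unfolding null_multipliers_def using u n' by (intro CollectI conjI exI[of _ h]) auto
 thus ?thesis using u(1) by blast
next
 case False
 then obtain a where a: "a \<in> I" "a \<notin> Q" by blast
 have ac: "a \<in> carrier R" using idealD(2)[OF I a(1)] .
 note E = exact_uptoD[OF resolves_uptoD(1)[OF A(1)]] and D = resolves_uptoD(2-4)[OF A(1)]
 have f: "msm a (mone (n j)) \<in> mats (n j) (n j)" for j by (rule msm_mats[OF ac mone_mats])
 \<comment> \<open>Multiplication by an element of \<open>I\<close> is zero on \<open>R / I\<close>,
   hence null homotopic on the whole resolution.\<close>
 have "msm a (mone 1) k 0 \<in> I" for k
  using a(1) ac idealD(3)[OF I] by (simp add: msm_def mone_def)
 hence start: "\<exists>u\<in>{\<one>}. \<exists>W\<in>mats (n 0) (n 1). msm u (msm a (mone (n 0))) = mmul (n 1) W (A 0)"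
  using D(3)[of "msm a (mone 1)" 1] f[of 0] D(1) by simp
 have comm: "mmul (n j) (A j) (msm a (mone (n j))) = mmul (n (Suc j)) (msm a (mone (n (Suc j)))) (A j)" for j
  unfolding mmul_sm_r[OF ac E(1) mone_mats] mmul_sm_l[OF ac mone_mats E(1)] mmul_one_r[OF E(1)] mmul_one_l[OF E(1)] ..
 have "\<exists>u\<in>{\<one>}. \<exists>h. (\<forall>j\<le>Suc d. h j \<in> mats (n j) (n (Suc j))) \<and> msm u (msm a (mone (n 0))) = mmul (n 1) (h 0) (A 0) \<and>
  (\<forall>j<Suc d. msm u (msm a (mone (n (Suc j)))) = madd (mmul (n (Suc (Suc j))) (h (Suc j)) (A (Suc j))) (mmul (n j) (A j) (h j)))"
  by (rule null_homotopy_exists[where f = "\<lambda>j. msm a (mone (n j))", OF mult_set_one E(1,2) resolves_uptoD(1)[OF A(1)] f comm start])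
 then obtain h where h: "\<forall>j\<le>Suc d. h j \<in> mats (n j) (n (Suc j))"
  "\<forall>j<Suc d. msm \<one> (msm a (mone (n (Suc j)))) = madd (mmul (n (Suc (Suc j))) (h (Suc j)) (A (Suc j))) (mmul (n j) (A j) (h j))"
  by auto
 have "a \<in> null_multipliers i n A"
  unfolding null_multipliers_def using h ac msm_msm[OF one_closed ac mone_mats] by (intro CollectI conjI exI[of _ h]) auto
 thus ?thesis using a(2) by blast
qed

text \<open>The \<open>i\<close>-th parameter is drawn from the ideal
  \<open>null_multipliers i\<close>, which lies in no prime of height at most \<open>i\<close>; this
  is the condition under which \<open>parameters_extend\<close> succeeds.\<close>

lemma null_homotopic_parameters:
 assumes I: "ideal I R" "I \<subseteq> m" and A: "resolves_upto {\<one>} I n A" "!!j k l. A j k l \<in> m" "!!j. L \<le> j ==> n (Suc j) = 0"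
 shows "\<exists>x N H. (\<forall>i<d. x i \<in> m) \<and> mpow N \<subseteq> Idl (x ` {..<d}) \<and> n (Suc d) = 0 \<and>
  (\<forall>i<d. \<forall>j\<le>Suc d. H i j \<in> mats (n j) (n (Suc j))) \<and>
  (\<forall>i<d. \<forall>j. i \<le> j \<and> j \<le> d --> contracts n A (H i) (x i) j)"
proof -
 note E = exact_uptoD[OF resolves_uptoD(1)[OF A(1)]]
 have ni: "ideal (null_multipliers i n A) R" for i by (rule null_multipliers_ideal) (rule E(1))
 obtain x N where x: "!!i. i < d ==> x i \<in> m" "!!i. 0 \<le> i ==> i < d ==> x i \<in> null_multipliers i n A"
  "mpow N \<subseteq> Idl (x ` {..<d})"
  by (rule parameters_extend[where n = 0 and ?x0.0 = "\<lambda>_. \<zero>" and c = "\<lambda>i. null_multipliers i n A"])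
   (use ni null_multipliers_not_below[OF I(1) A(1,3)] chain_to_0 in auto)
 have "\<forall>i. \<exists>h. i < d --> (\<forall>j\<le>Suc d. h j \<in> mats (n j) (n (Suc j))) \<and>
   (\<forall>j. i \<le> j \<and> j \<le> d --> contracts n A h (x i) j)"
 proof
  fix i
  show "\<exists>h. i < d --> (\<forall>j\<le>Suc d. h j \<in> mats (n j) (n (Suc j))) \<and>
   (\<forall>j. i \<le> j \<and> j \<le> d --> contracts n A h (x i) j)"
   using x(2)[of i] unfolding null_multipliers_def by blast
 qed
 from choice[OF this] obtain H where H: "\<forall>i. i < d --> (\<forall>j\<le>Suc d. H i j \<in> mats (n j) (n (Suc j))) \<and>
   (\<forall>j. i \<le> j \<and> j \<le> d --> contracts n A (H i) (x i) j)" by (elim exE)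
 have "\<one> \<in> carrier R - m" using primeD(2)[OF prime_m] by simp
 hence "resolves_upto (carrier R - m) I n A" by (intro resolves_upto_mono[OF A(1)]) simp
 from minimal_resolution_length[OF prime_m I(1) this A(2) A(1,3)] have "n (Suc d) = 0"
  using chain_to_bound[of "Suc d" m] by fastforce
 thus ?thesis using x(1,3) H by (intro exI[of _ x] exI[of _ N] exI[of _ H]) simp
qed

end

section \<open>From matrices to the Koszul setting\<close>

context cring
begin

lemma sum_over_degree:
 fixes n :: "nat => nat"
 assumes g: "!!l. l \<in> Sigma {..d} (\<lambda>j. {..<n j}) ==> g l \<in> carrier R"
   "!!l. l \<in> Sigma {..d} (\<lambda>j. {..<n j}) ==> fst l ~= j ==> g l = \<zero>"
  and j: "j \<le> d \<or> n j = 0"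
 shows "(\<Oplus>l\<in>Sigma {..d} (\<lambda>j. {..<n j}). g l) = (\<Oplus>b\<in>{..<n j}. g (j, b))"
proof -
 let ?K = "Sigma {..d} (\<lambda>j. {..<n j})"
 have sub: "Pair j ` {..<n j} \<subseteq> ?K" using j by auto
 have "(\<Oplus>b\<in>{..<n j}. g (j, b)) = (\<Oplus>l\<in>Pair j ` {..<n j}. g l)"
  by (rule finsum_reindex[symmetric]) (use g(1) sub in \<open>auto simp: inj_on_def\<close>)
 also have "\<dots> = (\<Oplus>l\<in>?K. g l)"
 proof (rule add.finprod_mono_neutral_cong_left)
  show "g l = \<zero>" if "l \<in> ?K - Pair j ` {..<n j}" for l
   using g(2)[of l] that by (cases "fst l = j") (auto simp: image_iff)
 qed (use g(1) sub in auto)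
 finally show ?thesis by simp
qed

text \<open>Basis elements are pairs of degree and position. Truncation at degree \<open>d\<close>
  is harmless because \<open>n (Suc d) = 0\<close>, and for \<open>i = d\<close> the homotopy
  condition is empty, no degree being larger than \<open>d\<close>.\<close>

lemma koszul_of_homotopies:
 assumes A: "!!j. A j \<in> mats (n (Suc j)) (n j)" "!!j. mmul (n (Suc j)) (A (Suc j)) (A j) = mzero"
  and x: "!!i. i < d ==> x i \<in> carrier R" and nd: "n (Suc d) = 0"
  and H: "!!i j. i < d ==> j \<le> Suc d ==> H i j \<in> mats (n j) (n (Suc j))"
   "!!i j. i < d ==> i \<le> j ==> j \<le> d ==> contracts n A (H i) (x i) j"
 shows "koszul R d (Sigma {..d} (\<lambda>j. {..<n j})) fst
  (\<lambda>k l. if fst k = Suc (fst l) then A (fst l) (snd k) (snd l) else \<zero>)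
  (\<lambda>i k l. if i < d \<and> fst k \<le> d \<and> fst l = Suc (fst k) then H i (fst k) (snd k) (snd l) else \<zero>)
  (\<lambda>i. if i < d then x i else \<one>)"
proof
 let ?K = "Sigma {..d} (\<lambda>j. {..<n j})"
 let ?\<phi> = "\<lambda>k l. if fst k = Suc (fst l) then A (fst l) (snd k) (snd l) else \<zero>"
 let ?h = "\<lambda>i k l. if i < d \<and> fst k \<le> d \<and> fst l = Suc (fst k) then H i (fst k) (snd k) (snd l) else \<zero>"
 note Ac = matsD(1)[OF A(1)]
 have Hc: "H i j a b \<in> carrier R" if "i < d" "j \<le> d" for i j a b using matsD(1)[OF H(1)] that by simp
 show fin: "finite ?K" by simp
 show \<phi>c: "?\<phi> k l \<in> carrier R" for k l using Ac by simp
 show hc: "?h i k l \<in> carrier R" for i k l using Hc by simp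
 show "(if i < d then x i else \<one>) \<in> carrier R" for i using x by simp
 show "(\<Oplus>l\<in>?K. ?\<phi> k l ** ?\<phi> l n') = \<zero>" if K: "k \<in> ?K" "n' \<in> ?K" for k n'
 proof (cases "fst k = Suc (Suc (fst n'))")
  case True
  have "(\<Oplus>l\<in>?K. ?\<phi> k l ** ?\<phi> l n') = (\<Oplus>b\<in>{..<n (Suc (fst n'))}. ?\<phi> k (Suc (fst n'), b) ** ?\<phi> (Suc (fst n'), b) n')"
   by (rule sum_over_degree) (use Ac True K in auto)
  also have "\<dots> = mmul (n (Suc (fst n'))) (A (Suc (fst n'))) (A (fst n')) (snd k) (snd n')"
   using True by (simp add: mmul_def)
  finally show ?thesis unfolding A(2) by (simp add: mzero_def)
 next
  case False
  show ?thesis by (rule finsum_zero') (use False Ac in auto)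
 qed
 show "(\<Oplus>l\<in>?K. ?\<phi> k l ** ?h i l n') \<oplus> (\<Oplus>l\<in>?K. ?h i k l ** ?\<phi> l n') = (if k = n' then (if i < d then x i else \<one>) else \<zero>)"
  if i: "i \<le> d" and K: "k \<in> ?K" "n' \<in> ?K" and ik: "i < fst k" "fst k \<le> Suc d" for i k n'
 proof (cases "fst n' = fst k")
  case True
  have id: "i < d" using K(1) ik(1) by auto
  obtain j where j: "fst k = Suc j" "i \<le> j" "j < d" using K(1) ik(1) by (cases "fst k") auto
  have j': "fst n' = Suc j" using True j(1) by simp
  have "(\<Oplus>l\<in>?K. ?\<phi> k l ** ?h i l n') = (\<Oplus>b\<in>{..<n j}. ?\<phi> k (j, b) ** ?h i (j, b) n')"
   by (rule sum_over_degree) (use Ac Hc id j j' in auto)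
  also have "\<dots> = mmul (n j) (A j) (H i j) (snd k) (snd n')"
   using id j j' by (simp add: mmul_def)
  finally have 1: "(\<Oplus>l\<in>?K. ?\<phi> k l ** ?h i l n') = mmul (n j) (A j) (H i j) (snd k) (snd n')" .
  have "Suc (Suc j) \<le> d \<or> n (Suc (Suc j)) = 0" using j(3) nd by (cases "Suc j = d") auto
  hence "(\<Oplus>l\<in>?K. ?h i k l ** ?\<phi> l n') = (\<Oplus>b\<in>{..<n (Suc (Suc j))}. ?h i k (Suc (Suc j), b) ** ?\<phi> (Suc (Suc j), b) n')"
   by (intro sum_over_degree) (use Ac Hc id j j' in auto)
  also have "\<dots> = mmul (n (Suc (Suc j))) (H i (Suc j)) (A (Suc j)) (snd k) (snd n')"
   using id j j' by (simp add: mmul_def)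
  finally have 2: "(\<Oplus>l\<in>?K. ?h i k l ** ?\<phi> l n') = mmul (n (Suc (Suc j))) (H i (Suc j)) (A (Suc j)) (snd k) (snd n')" .
  have m: "H i j \<in> mats (n j) (n (Suc j))" "H i (Suc j) \<in> mats (n (Suc j)) (n (Suc (Suc j)))" using H(1) id j(3) by auto
  have "(\<Oplus>l\<in>?K. ?\<phi> k l ** ?h i l n') \<oplus> (\<Oplus>l\<in>?K. ?h i k l ** ?\<phi> l n') = msm (x i) (mone (n (Suc j))) (snd k) (snd n')"
   unfolding 1 2 H(2)[OF id j(2) less_imp_le[OF j(3)]] madd_def
   by (rule a_comm[OF matsD(1)[OF mmul_mats[OF A(1) m(1)]] matsD(1)[OF mmul_mats[OF m(2) A(1)]]])
  also have "\<dots> = (if k = n' then x i else \<zero>)"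
   using K(1) j(1) True x[OF id] by (auto simp: msm_def mone_def prod_eq_iff)
  finally show ?thesis using id by simp
 next
  case False
  have "(\<Oplus>l\<in>?K. ?\<phi> k l ** ?h i l n') = \<zero>" by (rule finsum_zero') (use False Ac Hc in auto)
  moreover have "(\<Oplus>l\<in>?K. ?h i k l ** ?\<phi> l n') = \<zero>" by (rule finsum_zero') (use False Ac Hc in auto)
  ultimately show ?thesis using False by auto
 qed
qed auto

end

text \<open>Were \<open>\<tau>\<close> contained in \<open>I\<close>, a nonzero element of
  \<open>\<tau>\<close> would kill all Frobenius images of elements annihilated by \<open>I\<close>,
  against \<open>split_resolution_faithful\<close>.\<close>

lemma (in frobenius_hull) tau_not_in_finite_resolution:
 assumes I: "ideal I R" and A: "resolves_upto {\<one>} I n A" "!!j k l. A j k l \<in> m" and nd: "n (Suc d) = 0"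
  and N: "mpow N \<subseteq> Idl (x ` {..<d})"
  and H: "!!i j. i < d ==> j \<le> Suc d ==> H i j \<in> mats (n j) (n (Suc j))"
   "!!i j. i < d ==> i \<le> j ==> j \<le> d ==> contracts n A (H i) (x i) j"
 shows "\<not> \<tau> \<subseteq> I"
proof
 assume \<tau>I: "\<tau> \<subseteq> I"
 obtain c where c: "c \<in> \<tau>" "c ~= \<zero>" using \<tau>_nonzero by blast
 have cc: "c \<in> carrier R" using idealD(2)[OF I subsetD[OF \<tau>I c(1)]] .
 note E = exact_uptoD[OF resolves_uptoD(1)[OF A(1)]] and D = resolves_uptoD(2-4)[OF A(1)]
 let ?K = "Sigma {..d} (\<lambda>j. {..<n j})"
 let ?\<phi> = "\<lambda>k l. if fst k = Suc (fst l) then A (fst l) (snd k) (snd l) else \<zero>"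
 have "c = \<zero>"
 proof (rule split_resolution_faithful[where K = ?K and ?k0.0 = "(0, 0)"])
  show "koszul R d ?K fst ?\<phi>
   (\<lambda>i k l. if i < d \<and> fst k \<le> d \<and> fst l = Suc (fst k) then H i (fst k) (snd k) (snd l) else \<zero>)
   (\<lambda>i. if i < d then x i else \<one>)"
   by (rule koszul_of_homotopies[OF E(1,2) x_closed nd H])
  show "(0, 0) \<in> ?K" "fst (0::nat, 0::nat) = 0" using D(1) by auto
  show "k = (0, 0)" if "k \<in> ?K" "fst k = 0" for k using that D(1) by auto
  show "?\<phi> k l \<in> m" for k l using A(2) idealD(3)[OF ideal_m] by simp
  show "mpow N \<subseteq> Idl (x ` {..<d})" by (rule N)
  show "c \<in> carrier R" by (rule cc)
  show "c *\<^sub>E Fr e \<zeta> = 0\<^sub>E" if "\<zeta> \<in> carrier E" "!!i. i \<in> I ==> i *\<^sub>E \<zeta> = 0\<^sub>E" for e \<zeta>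
   using \<tau>_kills_Fr[OF \<tau>I c(1)] that by blast
  let ?S = "(\<lambda>k. ?\<phi> k (0, 0)) ` {k \<in> ?K. fst k = 1}"
  have S: "?S \<subseteq> carrier R" using matsD(1)[OF E(1)] by auto
  note SI = genideal_ideal[OF S]
  show "I \<subseteq> Idl ?S"
  proof
   fix a assume a: "a \<in> I"
   let ?M = "\<lambda>k l. if k = (0::nat) \<and> l = (0::nat) then a else \<zero>"
   have M: "?M \<in> mats 1 1" "!!k. ?M k 0 \<in> I" using a idealD(2,3)[OF I] by (auto simp: mats_def)
   obtain W where W: "W \<in> mats 1 (n 1)" "msm \<one> ?M = mmul (n 1) W (A 0)" using D(3)[OF M] by blast
   have "a = msm \<one> ?M 0 0" using idealD(2)[OF I a] by (simp add: msm_def)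
   also have "\<dots> = mmul (n 1) W (A 0) 0 0" unfolding W(2) ..
   also have "\<dots> \<in> Idl ?S"
   proof (rule mmul_in_ideal[OF SI W(1) E(1)[of 0]])
    have "A 0 k l \<in> Idl ?S" for k l
    proof (cases "k < n 1 \<and> l = 0")
     case True
     \<comment> \<open>For \<open>d = 0\<close> the assumption \<open>nd\<close> would say
       \<open>n 1 = 0\<close>, and there would be no row \<open>k\<close>.\<close>
     hence "1 \<le> d" using nd by (cases d) auto
     hence "(1, k) \<in> {k \<in> ?K. fst k = 1}" using True by simp
     from imageI[OF this, of "\<lambda>k. ?\<phi> k (0, 0)"] have "A 0 k l \<in> ?S" using True by simp
     thus ?thesis using genideal_self[OF S] by blast
    next
     case False
     hence "A 0 k l = \<zero>" using matsD(2,3)[OF E(1)[of 0]] D(1) by auto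
     thus ?thesis using idealD(3)[OF SI] by simp
    qed
    thus "(\<forall>k l. W k l \<in> Idl ?S) \<or> (\<forall>k l. A 0 k l \<in> Idl ?S)" by blast
   qed
   finally show "a \<in> Idl ?S" .
  qed
 qed
 thus False using c(2) by simp
qed

section \<open>The conductor\<close>

context cring
begin

abbreviation "nzd \<equiv> non_zero_divisors R"
abbreviation mulK (infixl \<open>*\<^sub>K\<close> 70) where "x *\<^sub>K y \<equiv> x \<otimes>\<^bsub>total_frac R\<^esub> y"
abbreviation addK (infixl \<open>+\<^sub>K\<close> 65) where "x +\<^sub>K y \<equiv> x \<oplus>\<^bsub>total_frac R\<^esub> y"

definition frac :: "'a => 'a => ('a \<times> 'a) set" where
 "frac a s = frac_rel R `` {(a, s)}"

lemma nzdD: "s \<in> nzd ==> s \<in> carrier R"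
  "s \<in> nzd ==> x \<in> carrier R ==> s ** x = \<zero> ==> x = \<zero>"
 unfolding non_zero_divisors_def by auto

lemma nzd_cancel:
 assumes "s \<in> nzd" "x \<in> carrier R" "y \<in> carrier R" "s ** x = s ** y" shows "x = y"
proof -
 have "s ** (x \<ominus> y) = s ** x \<ominus> s ** y" using nzdD(1)[OF assms(1)] assms(2,3) by algebra
 also have "\<dots> = \<zero>" using assms nzdD(1)[OF assms(1)] by (simp add: minus_eq r_neg)
 finally show ?thesis using nzdD(2)[OF assms(1), of "x \<ominus> y"] assms(2,3) by simp
qed

lemma nzd_one: "\<one> \<in> nzd" unfolding non_zero_divisors_def by simp

lemma nzd_mult:
 assumes "s \<in> nzd" "t \<in> nzd" shows "s ** t \<in> nzd"
proof -
 note D = nzdD[OF assms(1)] nzdD[OF assms(2)]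
 have "x = \<zero>" if x: "x \<in> carrier R" "s ** t ** x = \<zero>" for x
 proof -
  have "s ** (t ** x) = \<zero>" using x D(1,3) by (simp add: m_assoc)
  thus ?thesis using D(4)[OF x(1)] D(2)[of "t ** x"] D(3) x(1) by simp
 qed
 thus ?thesis unfolding non_zero_divisors_def using D(1,3) by simp
qed

lemma nzd_pow: "s \<in> nzd ==> s [^] (n::nat) \<in> nzd"
 by (induction n) (auto simp: nzd_one nzd_mult)

lemma frac_eq:
 assumes "a \<in> carrier R" "b \<in> carrier R" "s \<in> nzd" "t \<in> nzd"
 shows "frac a s = frac b t \<longleftrightarrow> a ** t = b ** s"
proof
 assume "frac a s = frac b t"
 moreover have "(b, t) \<in> frac b t" using assms unfolding frac_def frac_rel_def by auto
 ultimately show "a ** t = b ** s" unfolding frac_def frac_rel_def by auto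
next
 assume eq: "a ** t = b ** s"
 have c: "s \<in> carrier R" "t \<in> carrier R" using nzdD assms by auto
 have "a ** u = e ** s \<longleftrightarrow> b ** u = e ** t" if "e \<in> carrier R" "u \<in> nzd" for e u
 proof -
  have u: "u \<in> carrier R" using nzdD that by auto
  have "a ** u = e ** s \<longleftrightarrow> t ** (a ** u) = t ** (e ** s)"
   using nzd_cancel[OF assms(4), of "a ** u" "e ** s"] assms c u that by auto
  also have "t ** (a ** u) = (a ** t) ** u" using assms c u by algebra
  also have "\<dots> = s ** (b ** u)" unfolding eq using assms c u by algebra
  also have "t ** (e ** s) = s ** (e ** t)" using c that by algebra
  also have "s ** (b ** u) = s ** (e ** t) \<longleftrightarrow> b ** u = e ** t"
   using nzd_cancel[OF assms(3), of "b ** u" "e ** t"] assms c u that by auto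
  finally show ?thesis .
 qed
 thus "frac a s = frac b t" unfolding frac_def frac_rel_def using assms by blast
qed

lemma frac_mem:
 "(a', s') \<in> frac a s ==> a' \<in> carrier R \<and> s' \<in> nzd \<and> a' ** s = a ** s'"
 unfolding frac_def frac_rel_def by auto

lemma frac_self: "a \<in> carrier R ==> s \<in> nzd ==> (a, s) \<in> frac a s"
 unfolding frac_def frac_rel_def by auto

lemma frac_cases:
 assumes "x \<in> carrier (total_frac R)"
 obtains a s where "x = frac a s" "a \<in> carrier R" "s \<in> nzd"
 using assms unfolding total_frac_def frac_def by (auto elim!: quotientE)

lemma frac_closed: "a \<in> carrier R ==> s \<in> nzd ==> frac a s \<in> carrier (total_frac R)"
 unfolding total_frac_def frac_def by (auto intro!: quotientI)

text \<open>The operations of \<open>total_frac\<close> are unions over all representatives;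
  independence of the choice makes the union collapse to one member.\<close>

lemma frac_binary:
 assumes ab: "a \<in> carrier R" "b \<in> carrier R" "s \<in> nzd" "t \<in> nzd"
  and c: "!!a' b' s' t'. (a', s') \<in> frac a s ==> (b', t') \<in> frac b t ==> g a' s' b' t' = g a s b t"
 shows "(\<Union>(a', s')\<in>frac a s. \<Union>(b', t')\<in>frac b t. g a' s' b' t') = g a s b t"
proof (rule SUP_eq_const)
 show "frac a s ~= {}" using frac_self[OF ab(1,3)] by blast
 fix p assume p: "p \<in> frac a s"
 have "(\<Union>(b', t')\<in>frac b t. g (fst p) (snd p) b' t') = g a s b t"
 proof (rule SUP_eq_const)
  show "frac b t ~= {}" using frac_self[OF ab(2,4)] by blast
  show "(case q of (b', t') => g (fst p) (snd p) b' t') = g a s b t" if "q \<in> frac b t" for q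
   using c[of "fst p" "snd p" "fst q" "snd q"] p that by (simp add: case_prod_beta)
 qed
 thus "(case p of (a', s') => \<Union>(b', t')\<in>frac b t. g a' s' b' t') = g a s b t"
  by (simp add: case_prod_beta)
qed

lemma frac_mult:
 assumes ab: "a \<in> carrier R" "b \<in> carrier R" "s \<in> nzd" "t \<in> nzd"
 shows "frac a s *\<^sub>K frac b t = frac (a ** b) (s ** t)"
proof -
 have "(\<Union>(a', s')\<in>frac a s. \<Union>(b', t')\<in>frac b t. frac (a' ** b') (s' ** t')) = frac (a ** b) (s ** t)"
 proof (rule frac_binary[OF ab])
  fix a' b' s' t' assume el: "(a', s') \<in> frac a s" "(b', t') \<in> frac b t"
  have m: "a' \<in> carrier R" "s' \<in> nzd" "b' \<in> carrier R" "t' \<in> nzd"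
   "a' ** s = a ** s'" "b' ** t = b ** t'" using frac_mem[OF el(1)] frac_mem[OF el(2)] by simp_all
  note n = m(1,3) nzdD(1)[OF m(2)] nzdD(1)[OF m(4)] ab(1,2) nzdD(1)[OF ab(3)] nzdD(1)[OF ab(4)]
  have "(a' ** b') ** (s ** t) = (a' ** s) ** (b' ** t)" using n by algebra
  also have "\<dots> = (a ** b) ** (s' ** t')" unfolding m(5,6) using n by algebra
  finally show "frac (a' ** b') (s' ** t') = frac (a ** b) (s ** t)"
   using frac_eq m ab nzd_mult by simp
 qed
 thus ?thesis by (simp add: total_frac_def frac_def)
qed

lemma frac_add:
 assumes ab: "a \<in> carrier R" "b \<in> carrier R" "s \<in> nzd" "t \<in> nzd"
 shows "frac a s +\<^sub>K frac b t = frac (a ** t \<oplus> b ** s) (s ** t)"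
proof -
 have "(\<Union>(a', s')\<in>frac a s. \<Union>(b', t')\<in>frac b t. frac (a' ** t' \<oplus> b' ** s') (s' ** t')) = frac (a ** t \<oplus> b ** s) (s ** t)"
 proof (rule frac_binary[OF ab])
  fix a' b' s' t' assume el: "(a', s') \<in> frac a s" "(b', t') \<in> frac b t"
  have m: "a' \<in> carrier R" "s' \<in> nzd" "b' \<in> carrier R" "t' \<in> nzd"
   "a' ** s = a ** s'" "b' ** t = b ** t'" using frac_mem[OF el(1)] frac_mem[OF el(2)] by simp_all
  note n = m(1,3) nzdD(1)[OF m(2)] nzdD(1)[OF m(4)] ab(1,2) nzdD(1)[OF ab(3)] nzdD(1)[OF ab(4)]
  have "(a' ** t' \<oplus> b' ** s') ** (s ** t) = (a' ** s) ** (t' ** t) \<oplus> (b' ** t) ** (s' ** s)" using n by algebra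
  also have "\<dots> = (a ** t \<oplus> b ** s) ** (s' ** t')" unfolding m(5,6) using n by algebra
  finally show "frac (a' ** t' \<oplus> b' ** s') (s' ** t') = frac (a ** t \<oplus> b ** s) (s ** t)"
   using frac_eq m ab nzd_mult nzdD(1) by simp
 qed
 thus ?thesis by (simp add: total_frac_def frac_def)
qed

lemma total_frac_simps: "\<one>\<^bsub>total_frac R\<^esub> = frac \<one> \<one>" "0[total_frac R] = frac \<zero> \<one>" "frac_embed R a = frac a \<one>"
 by (simp_all add: total_frac_def frac_def frac_embed_def)

lemma total_frac_cring: "cring (total_frac R)"
proof (rule cringI)
 note nc = nzdD(1)
 show "abelian_group (total_frac R)"
 proof (rule abelian_groupI; (elim frac_cases)?; (unfold total_frac_simps)?)
  fix x a s assume x: "x = frac a s" "a \<in> carrier R" "s \<in> nzd"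
  note sc = nc[OF x(3)]
  show "frac \<zero> \<one> +\<^sub>K x = x" using x sc by (simp add: frac_add nzd_one)
  have "frac (\<ominus> a) s +\<^sub>K x = frac \<zero> \<one>"
   using x sc by (simp add: frac_add frac_eq nzd_one nzd_mult l_minus l_neg)
  thus "\<exists>y\<in>carrier (total_frac R). y +\<^sub>K x = frac \<zero> \<one>"
   using frac_closed[of "\<ominus> a" s] x by auto
 next
  show "frac \<zero> \<one> \<in> carrier (total_frac R)" by (rule frac_closed) (auto simp: nzd_one)
 next
  fix x y a s b t assume *: "x = frac a s" "a \<in> carrier R" "s \<in> nzd"
   "y = frac b t" "b \<in> carrier R" "t \<in> nzd"
  note n = *(2,5) nc[OF *(3)] nc[OF *(6)]
  show "x +\<^sub>K y \<in> carrier (total_frac R)"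
   unfolding *(1,4) using * n by (simp add: frac_add frac_closed nzd_mult)
  show "x +\<^sub>K y = y +\<^sub>K x"
   unfolding *(1,4) using * n by (simp add: frac_add a_comm[of "a ** t"] m_comm[of s])
 next
  fix x y z a s b t c u assume *: "x = frac a s" "a \<in> carrier R" "s \<in> nzd"
   "y = frac b t" "b \<in> carrier R" "t \<in> nzd" "z = frac c u" "c \<in> carrier R" "u \<in> nzd"
  note n = *(2,5,8) nc[OF *(3)] nc[OF *(6)] nc[OF *(9)]
  have "(a ** t \<oplus> b ** s) ** u \<oplus> c ** (s ** t) = a ** (t ** u) \<oplus> (b ** u \<oplus> c ** t) ** s" using n by algebra
  thus "x +\<^sub>K y +\<^sub>K z = x +\<^sub>K (y +\<^sub>K z)"
   unfolding *(1,4,7) using * n by (simp add: frac_add nzd_mult m_assoc)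
 qed
 show "comm_monoid (total_frac R)"
 proof (rule comm_monoidI; (elim frac_cases)?; (unfold total_frac_simps)?)
  show "frac \<one> \<one> \<in> carrier (total_frac R)" by (rule frac_closed) (auto simp: nzd_one)
 qed (auto simp: frac_mult nzd_mult nzd_one frac_closed m_ac nc)
 fix x y z assume "x \<in> carrier (total_frac R)" "y \<in> carrier (total_frac R)" "z \<in> carrier (total_frac R)"
 then obtain a s b t c u where *: "x = frac a s" "a \<in> carrier R" "s \<in> nzd"
   "y = frac b t" "b \<in> carrier R" "t \<in> nzd" "z = frac c u" "c \<in> carrier R" "u \<in> nzd"
  by (elim frac_cases)
 note n = *(2,5,8) nc[OF *(3)] nc[OF *(6)] nc[OF *(9)]
 have "((a ** t \<oplus> b ** s) ** c) ** ((s ** u) ** (t ** u)) = ((a ** c) ** (t ** u) \<oplus> (b ** c) ** (s ** u)) ** ((s ** t) ** u)"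
  using n by algebra
 thus "(x +\<^sub>K y) *\<^sub>K z = x *\<^sub>K z +\<^sub>K y *\<^sub>K z"
  unfolding *(1,4,7) using * n by (simp add: frac_add frac_mult nzd_mult frac_eq)
qed

lemma frac_pow:
 assumes "a \<in> carrier R" "s \<in> nzd"
 shows "frac a s [^]\<^bsub>total_frac R\<^esub> (n::nat) = frac (a [^] n) (s [^] n)"
proof -
 interpret K: cring "total_frac R" by (rule total_frac_cring)
 show ?thesis
  by (induction n) (use assms in \<open>simp_all add: total_frac_simps frac_mult nzd_pow\<close>)
qed

text \<open>Evaluating a polynomial at \<open>a/s\<close> over the common denominator \<open>s\<^sup>l\<close>, where \<open>l\<close> is the
 number of coefficients.\<close>

fun numerator :: "'a => 'a => 'a list => 'a" where
 "numerator a s [] = \<zero>"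
| "numerator a s (r # rs) = (r ** a [^] length rs \<oplus> numerator a s rs) ** s"

lemma numerator_closed:
 "a \<in> carrier R ==> s \<in> carrier R ==> set rs \<subseteq> carrier R ==> numerator a s rs \<in> carrier R"
 by (induction rs) auto

lemma eval_frac:
 assumes as: "a \<in> carrier R" "s \<in> nzd" and "set rs \<subseteq> carrier R"
 shows "ring.eval (total_frac R) (map (frac_embed R) rs) (frac a s) = frac (numerator a s rs) (s [^] length rs)"
 using assms(3)
proof (induction rs)
 case Nil
 interpret K: cring "total_frac R" by (rule total_frac_cring)
 show ?case by (simp add: total_frac_simps)
next
 case (Cons r rs)
 interpret K: cring "total_frac R" by (rule total_frac_cring)
 let ?l = "length rs"
 have sc: "s \<in> carrier R" "s [^] ?l \<in> nzd" "s [^] ?l \<in> carrier R" using nzdD(1)[OF as(2)] nzd_pow[OF as(2)] by auto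
 have n: "numerator a s rs \<in> carrier R" "r \<in> carrier R" "a [^] ?l \<in> carrier R" using Cons(2) as(1) sc numerator_closed by auto
 have "ring.eval (total_frac R) (map (frac_embed R) (r # rs)) (frac a s) =
   frac (r ** a [^] ?l) (s [^] ?l) +\<^sub>K frac (numerator a s rs) (s [^] ?l)"
  using Cons as n sc by (simp add: total_frac_simps(3)[of r] frac_pow frac_mult nzd_one)
 also have "\<dots> = frac (r ** a [^] ?l ** s [^] ?l \<oplus> numerator a s rs ** s [^] ?l) (s [^] ?l ** s [^] ?l)"
  using n sc by (simp add: frac_add)
 also have "\<dots> = frac (numerator a s (r # rs)) (s [^] length (r # rs))"
 proof -
  have "(r ** a [^] ?l ** s [^] ?l \<oplus> numerator a s rs ** s [^] ?l) ** (s [^] ?l ** s)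
   = (r ** a [^] ?l \<oplus> numerator a s rs) ** s ** (s [^] ?l ** s [^] ?l)"
   using n sc by algebra
  thus ?thesis using n sc as(2) nzd_mult by (simp add: frac_eq)
 qed
 finally show ?case .
qed

text \<open>Stated for an arbitrary factor \<open>t\<close>, because the recursion passes one more
  factor \<open>s\<close> on to the remaining coefficients.\<close>

lemma numerator_in_ideal:
 assumes b: "ideal b R" and as: "a \<in> carrier R" "s \<in> carrier R"
 shows "set rs \<subseteq> carrier R ==> t \<in> carrier R ==> (!!i. i < length rs ==> t ** (a [^] i ** s [^] (length rs - i)) \<in> b) ==>
  t ** numerator a s rs \<in> b"
proof (induction rs arbitrary: t)
 case Nil
 thus ?case using idealD(3)[OF b] by simp
next
 case (Cons r rs)
 let ?l = "length rs"
 have n: "numerator a s rs \<in> carrier R" "r \<in> carrier R" "a [^] ?l \<in> carrier R" "t \<in> carrier R" "t ** s \<in> carrier R"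
  using Cons(2,3) as numerator_closed by auto
 have "t ** (a [^] ?l ** s) \<in> b" using Cons(4)[of ?l] as by simp
 hence "r ** (t ** (a [^] ?l ** s)) \<in> b" using idealD(5)[OF b] n by blast
 moreover have "(t ** s) ** numerator a s rs \<in> b"
 proof (rule Cons(1))
  fix i assume i: "i < ?l"
  have "(t ** s) ** (a [^] i ** s [^] (?l - i)) = t ** (a [^] i ** s [^] (length (r # rs) - i))"
   using as n i by (simp add: Suc_diff_le m_ac)
  thus "(t ** s) ** (a [^] i ** s [^] (?l - i)) \<in> b" using Cons(4)[of i] i by simp
 qed (use Cons(2) n in auto)
 moreover have "t ** numerator a s (r # rs) = r ** (t ** (a [^] ?l ** s)) \<oplus> (t ** s) ** numerator a s rs"
  unfolding numerator.simps using n as by algebra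
 ultimately show ?case using idealD(4)[OF b] by simp
qed

text \<open>Induction on \<open>N\<close>. Below the degree \<open>l\<close> of the equation the
  factor \<open>s^l\<close> suffices; from \<open>l\<close> on, the monic equation replaces
  \<open>a^l\<close> by terms with lower powers of \<open>a\<close> and complementary powers of
  \<open>s\<close>, each of which raises \<open>B\<close> by the right amount.\<close>

lemma integral_powers:
 assumes as: "a \<in> carrier R" "s \<in> nzd" and x: "frac a s \<in> integral_closure R"
 shows "\<exists>l::nat. \<forall>N::nat. \<exists>q\<in>carrier R. s [^] l ** a [^] N = s [^] N ** q"
proof -
 interpret K: cring "total_frac R" by (rule total_frac_cring)
 have sc: "s \<in> carrier R" using nzdD(1)[OF as(2)] .
 obtain f where f: "set f \<subseteq> frac_embed R ` carrier R" "f ~= []" "hd f = \<one>\<^bsub>total_frac R\<^esub>"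
  "ring.eval (total_frac R) f (frac a s) = 0[total_frac R]"
  using x unfolding integral_closure_def polynomial_def by blast
 have "f \<in> map (frac_embed R) ` lists (carrier R)" using f(1) unfolding lists_image[symmetric] by (simp add: lists_eq_set)
 then obtain rs' where rs': "set rs' \<subseteq> carrier R" "f = map (frac_embed R) rs'" by (auto simp: lists_eq_set)
 then obtain r rs where rs: "rs' = r # rs" using f(2) by (cases rs') auto
 have c: "r \<in> carrier R" "set rs \<subseteq> carrier R" using rs rs' by auto
 have "frac r \<one> = frac \<one> \<one>" using f(3) rs rs' by (simp add: total_frac_simps)
 hence r: "r = \<one>" using frac_eq[of r \<one> \<one> \<one>] c nzd_one by simp
 let ?l = "length rs"
 have nc: "numerator a s rs \<in> carrier R" using numerator_closed as sc c by auto
 have "frac (numerator a s rs') (s [^] length rs') = frac \<zero> \<one>"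
  using f(4) eval_frac[OF as rs'(1)] rs'(2) by (simp add: total_frac_simps)
 hence "numerator a s rs' = \<zero>"
  using frac_eq[of "numerator a s rs'" \<zero> "s [^] length rs'" \<one>] numerator_closed[OF as(1) sc rs'(1)] nzd_pow[OF as(2), of "length rs'"] nzd_one nzdD(1)[OF nzd_pow[OF as(2)]]
  by simp
 \<comment> \<open>The numerator of a nonempty list carries a final factor \<open>s\<close>, which
   is cancelled next.\<close>
 hence "s ** (a [^] ?l \<oplus> numerator a s rs) = \<zero>"
  using rs r as sc nc by (simp add: m_comm[of s])
 hence "a [^] ?l \<oplus> numerator a s rs = \<zero>" using nzdD(2)[OF as(2), of "a [^] ?l \<oplus> numerator a s rs"] as(1) nc by simp
 hence al: "a [^] ?l = \<ominus> numerator a s rs" using as(1) nc by (simp add: minus_equality)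
 define B where "B N = {z \<in> carrier R. \<exists>q\<in>carrier R. s [^] ?l ** z = s [^] N ** q}" for N :: nat
 have B: "ideal (B N) R" for N
 proof (rule ideal_intro)
  show "B N \<subseteq> carrier R" unfolding B_def by auto
  show "\<zero> \<in> B N" unfolding B_def using sc by (auto intro!: bexI[of _ \<zero>])
 next
  fix z w assume "z \<in> B N" "w \<in> B N"
  then obtain q q' where q: "z \<in> carrier R" "q \<in> carrier R" "s [^] ?l ** z = s [^] N ** q"
   "w \<in> carrier R" "q' \<in> carrier R" "s [^] ?l ** w = s [^] N ** q'" unfolding B_def by blast
  hence "s [^] ?l ** (z \<oplus> w) = s [^] N ** (q \<oplus> q')" using sc by (simp add: r_distr)
  thus "z \<oplus> w \<in> B N" unfolding B_def using q by blast
 next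
  fix z r assume "z \<in> B N" "r \<in> carrier R"
  then obtain q where q: "z \<in> carrier R" "q \<in> carrier R" "s [^] ?l ** z = s [^] N ** q" "r \<in> carrier R" unfolding B_def by blast
  hence "s [^] ?l ** (r ** z) = s [^] N ** (r ** q)" using sc by (simp add: m_lcomm[of _ r])
  thus "r ** z \<in> B N" unfolding B_def using q by blast
 qed
 have shift: "z ** s [^] k \<in> B (N + k)" if "z \<in> B N" for z k N
 proof -
  obtain q where q: "z \<in> carrier R" "q \<in> carrier R" "s [^] ?l ** z = s [^] N ** q"
   using \<open>z \<in> B N\<close> unfolding B_def by blast
  have "s [^] ?l ** (z ** s [^] k) = s [^] (N + k) ** q"
   using q sc by (simp add: m_assoc[symmetric] nat_pow_mult[symmetric]) (simp add: m_ac)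
  thus ?thesis unfolding B_def using q sc by blast
 qed
 have "a [^] N \<in> B N" for N
 proof (induction N rule: less_induct)
  case (less N)
  show ?case
  proof (cases "N < ?l")
   case True
   have "s [^] ?l ** a [^] N = s [^] N ** (s [^] (?l - N) ** a [^] N)"
    using True sc as(1) by (simp add: m_assoc[symmetric] nat_pow_mult)
   thus ?thesis unfolding B_def using sc as(1) by blast
  next
   case False
   have "a [^] (N - ?l) ** numerator a s rs \<in> B N"
   proof (rule numerator_in_ideal[OF B as(1) sc c(2)])
    fix i assume i: "i < ?l"
    have "a [^] (N - ?l + i) ** s [^] (?l - i) \<in> B (N - ?l + i + (?l - i))"
     by (rule shift[OF less]) (use i False in simp)
    moreover have "a [^] (N - ?l) ** (a [^] i ** s [^] (?l - i)) = a [^] (N - ?l + i) ** s [^] (?l - i)"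
     using as(1) sc by (simp add: nat_pow_mult[symmetric] m_assoc)
    ultimately show "a [^] (N - ?l) ** (a [^] i ** s [^] (?l - i)) \<in> B N" using i False by simp
   qed (use as in simp)
   hence "\<ominus> (a [^] (N - ?l) ** numerator a s rs) \<in> B N" by (rule idealD(7)[OF B])
   moreover have "a [^] N = a [^] (N - ?l) ** a [^] ?l" using False as(1) by (simp add: nat_pow_mult)
   ultimately show ?thesis unfolding al using as(1) nc by (simp add: r_minus)
  qed
 qed
 thus ?thesis unfolding B_def by blast
qed

end

section \<open>The test ideal inside the conductor\<close>

context noetherian_cring
begin

text \<open>An element regular modulo zero is avoided by some prime below \<open>P\<close>, which by
  minimality is \<open>P\<close> itself.\<close>

lemma nzd_not_in_minimal_prime:
 assumes s: "s \<in> nzd" and P: "minimal_prime R P" shows "s \<notin> P"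
proof -
 have P': "primeideal P R" using P unfolding minimal_prime_def by simp
 have "{\<zero>} \<subseteq> P" using idealD(3)[OF primeD(1)[OF P']] by simp
 then obtain Q where "primeideal Q R" "Q \<subseteq> P" "s \<notin> Q"
  using prime_below_avoiding[OF zeroideal nzdD(1)[OF s] _ P'] nzdD(2)[OF s] by auto
 thus ?thesis using P unfolding minimal_prime_def by blast
qed

lemma test_ideal_multiplies_integral:
 assumes as: "a \<in> carrier R" "s \<in> nzd" "frac a s \<in> integral_closure R"
  and c: "c \<in> test_ideal R p"
 shows "\<exists>r\<in>carrier R. c ** a = r ** s"
proof -
 have sc: "s \<in> carrier R" using nzdD(1)[OF as(2)] .
 define J where "J = PIdl s"
 have J: "ideal J R" "s \<in> J" unfolding J_def using cgenideal_ideal[OF sc] cgenideal_self[OF sc] by auto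
 obtain l :: nat where l: "!!N::nat. \<exists>q\<in>carrier R. s [^] l ** a [^] N = s [^] N ** q"
  using integral_powers[OF as] by blast
 have F: "ideal (frobenius_power R J q) R" "s [^] q \<in> frobenius_power R J q" for q
 proof -
  have sub: "{x [^] q |x. x \<in> J} \<subseteq> carrier R" using idealD(2)[OF J(1)] by auto
  show "ideal (frobenius_power R J q) R" unfolding frobenius_power_def by (rule genideal_ideal[OF sub])
  show "s [^] q \<in> frobenius_power R J q" unfolding frobenius_power_def using genideal_self[OF sub] J(2) by blast
 qed
 have "s [^] l ** a [^] (p ^ e) \<in> frobenius_power R J (p ^ e)" for e
  using l[of "p ^ e"] idealD(6)[OF F] by auto
 \<comment> \<open>The multiplier \<open>s^l\<close> does not depend on \<open>e\<close>; being a
   nonzerodivisor, it avoids all minimal primes.\<close>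
 hence "a \<in> tight_closure R p J"
  unfolding tight_closure_def using as(1) sc nzd_not_in_minimal_prime[OF nzd_pow[OF as(2), of l]]
  by (intro CollectI conjI bexI[of _ "s [^] l"]) auto
 hence "c ** a \<in> J" using c J(1) unfolding test_ideal_def by blast
 thus ?thesis unfolding J_def cgenideal_def by blast
qed

lemma conductor_contains_test_ideal:
 assumes c: "c \<in> test_ideal R p"
 shows "frac_embed R c \<in> conductor R"
proof -
 have cc: "c \<in> carrier R" using c unfolding test_ideal_def by simp
 have "frac c \<one> *\<^sub>K x \<in> frac_embed R ` carrier R" if x: "x \<in> integral_closure R" for x
 proof -
  have "x \<in> carrier (total_frac R)" using x unfolding integral_closure_def by simp
  then obtain a s where as: "x = frac a s" "a \<in> carrier R" "s \<in> nzd" by (rule frac_cases)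
  obtain r where r: "r \<in> carrier R" "c ** a = r ** s"
   using test_ideal_multiplies_integral[OF as(2,3) _ c] x unfolding as(1) by blast
  have "frac c \<one> *\<^sub>K x = frac r \<one>"
   unfolding as(1) using frac_mult[OF cc as(2) nzd_one as(3)] frac_eq[of "c ** a" r s \<one>] cc as r nzd_one nzdD(1)[OF as(3)] by simp
  thus ?thesis using r(1) by (simp add: total_frac_simps)
 qed
 thus ?thesis unfolding conductor_def using frac_closed[OF cc nzd_one] by (simp add: total_frac_simps)
qed

lemma conductor_not_in:
 assumes "\<not> test_ideal R p \<subseteq> I" "I \<subseteq> carrier R"
 shows "\<not> conductor R \<subseteq> frac_embed R ` I"
proof
 assume sub: "conductor R \<subseteq> frac_embed R ` I"
 obtain c where c: "c \<in> test_ideal R p" "c \<notin> I" using assms(1) by blast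
 obtain i where i: "i \<in> I" "frac_embed R c = frac_embed R i"
  using sub conductor_contains_test_ideal[OF c(1)] by blast
 hence "c = i" using frac_eq[of c i \<one> \<one>] nzd_one c(1) assms(2) unfolding test_ideal_def total_frac_simps by auto
 thus False using i(1) c(2) by simp
qed

end

section \<open>Quasi-Gorenstein rings\<close>

context noetherian_local
begin

text \<open>\<open>\<sigma>\<close> is the image of \<open>\<one>\<close> under the embedding of the
  residue field. The socle is controlled by essentiality of that embedding, and torsion is read off
  from the generators \<open>\<eta> t\<close>.\<close>

lemma frobenius_hull_exists:
 fixes E :: "('a, 'c set) module"
 assumes hull: "injective_hull R (quot_module (self_module R) m) E"
  and lc: "is_local_cohomology TYPE('c) R m (self_module R) d E"
  and complete: "adically_complete R m" and p: "Factorial_Ring.prime p" "has_char R p"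
  and x: "!!l. x l \<in> carrier R" "!!l. l < d ==> x l \<in> m" "mpow N \<subseteq> Idl (x ` {..<d})"
 shows "\<exists>\<sigma> \<eta>. frobenius_hull R m d E \<sigma> p x \<eta> (\<Otimes>l\<in>{..<d}. x l)"
proof -
 obtain \<eta> where \<eta>: "\<forall>t. \<eta> t \<in> carrier E" "\<forall>e\<in>carrier E. \<exists>r\<in>carrier R. \<exists>t. e = r *[E] \<eta> t"
  "\<forall>t. (\<Otimes>l\<in>{..<d}. x l) *[E] \<eta> (Suc t) = \<eta> t" "\<forall>t. \<forall>l<d. (x l [^] t) *[E] \<eta> t = 0[E]"
  "\<forall>t. \<forall>r\<in>carrier R. r *[E] \<eta> t = 0[E] -->
    (\<exists>s. r ** (\<Otimes>l\<in>{..<d}. x l) [^] (s::nat) \<in> Idl ((\<lambda>l. x l [^] (t + s)) ` {..<d}))"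
  by (rule top_local_cohomology[OF lc x(1) _ x(3), THEN exE]) (rule x(2), assumption, elim conjE, rule that, assumption+)
 have inj: "injective_module R E" using hull unfolding injective_hull_def by blast
 hence Em: "module R E" unfolding injective_module_def by blast
 interpret E: module R E by (rule Em)
 obtain i where i: "i \<in> module_hom R (quot_module (self_module R) m) E" "inj_on i (carrier (quot_module (self_module R) m))"
  "!!N. submodule N R E ==> N ~= {0[E]} ==> N \<inter> i ` carrier (quot_module (self_module R) m) ~= {0[E]}"
  using hull unfolding injective_hull_def by blast
 have sub: "submodule m R (self_module R)" unfolding submodule_self by (rule ideal_m)
 obtain \<pi> where \<pi>: "!!z. z \<in> carrier (self_module R) ==> \<pi> z \<in> carrier E"
  "i ` carrier (quot_module (self_module R) m) = \<pi> ` carrier (self_module R)"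
  "!!z w. z \<in> carrier (self_module R) ==> w \<in> carrier (self_module R) ==> \<pi> (z +[self_module R] w) = \<pi> z +[E] \<pi> w"
  "!!r z. r \<in> carrier R ==> z \<in> carrier (self_module R) ==> \<pi> (r *[self_module R] z) = r *[E] \<pi> z"
  "!!z. z \<in> carrier (self_module R) ==> \<pi> z = 0[E] \<longleftrightarrow> z \<in> m"
  by (rule quot_module_map[OF self_module sub Em i(1,2)]) (rule that)
 define \<sigma> where "\<sigma> = \<pi> \<one>"
 have \<sigma>: "\<sigma> \<in> carrier E" "\<sigma> ~= 0[E]" using \<pi>(1,5)[of \<one>] primeD(2)[OF prime_m] by (auto simp: \<sigma>_def)
 have \<pi>r: "\<pi> r = r *[E] \<sigma>" if "r \<in> carrier R" for r using \<pi>(4)[of r \<one>] that by (simp add: \<sigma>_def)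
 have m\<sigma>: "r *[E] \<sigma> = 0[E]" if "r \<in> m" for r
  using \<pi>(5)[of r] \<pi>r[of r] that idealD(2)[OF ideal_m that] by simp
 \<comment> \<open>A nonzero \<open>R e\<close> meets the residue field in some nonzero
   \<open>r e = s \<sigma>\<close>; as \<open>m\<close> kills \<open>e\<close>, the factor
   \<open>r\<close> is a unit.\<close>
 have socle: "\<exists>r\<in>carrier R. e = r *[E] \<sigma>" if e: "e \<in> carrier E" "!!r. r \<in> m ==> r *[E] e = 0[E]" for e
 proof (cases "e = 0[E]")
  case True
  thus ?thesis using \<sigma>(1) by (intro bexI[of _ \<zero>]) auto
 next
  case False
  let ?N = "{r *[E] e | r. r \<in> carrier R}"
  have N: "submodule ?N R E" "e \<in> ?N" by (rule E.cyclic_submodule[OF e(1)])+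
  have "?N ~= {0[E]}" using False N(2) by blast
  from i(3)[OF N(1) this] have "?N \<inter> \<pi> ` carrier R ~= {0[E]}" unfolding \<pi>(2) by simp
  moreover have "0[E] \<in> ?N \<inter> \<pi> ` carrier R"
  proof
   show "0[E] \<in> ?N" by (rule E.submoduleD(3)[OF N(1)])
   have "\<pi> \<zero> = 0[E]" using \<pi>r[of \<zero>] \<sigma>(1) by simp
   thus "0[E] \<in> \<pi> ` carrier R" by (metis imageI zero_closed)
  qed
  ultimately obtain y where y: "y \<in> ?N" "y \<in> \<pi> ` carrier R" "y ~= 0[E]" by blast
  obtain r where r: "y = r *[E] e" "r \<in> carrier R" using y(1) by blast
  obtain s where s: "y = s *[E] \<sigma>" "s \<in> carrier R" using y(2) \<pi>r by auto
  have "r \<notin> m" using y(3) e(2) r(1) by auto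
  then obtain b where b: "b \<in> carrier R" "r ** b = \<one>" using unit_outside_m[of r] r(2) by blast
  have "e = (b ** r) *[E] e" using b r(2) e(1) m_comm[of b r] by simp
  also have "\<dots> = b *[E] (s *[E] \<sigma>)" using b(1) r e(1) s(1) by (simp add: E.smult_assoc1)
  also have "\<dots> = (b ** s) *[E] \<sigma>" using b(1) s(2) \<sigma>(1) by (simp add: E.smult_assoc1)
  finally show ?thesis using b(1) s(2) by blast
 qed
 have torsion: "\<exists>n. \<forall>a\<in>mpow n. a *[E] e = 0[E]" if e: "e \<in> carrier E" for e
 proof -
  obtain r t where r: "r \<in> carrier R" "e = r *[E] \<eta> t" using \<eta>(2) e by blast
  let ?J = "{a \<in> carrier R. a *[E] \<eta> t = 0[E]}"
  have "\<exists>K. mpow K \<subseteq> ?J"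
  proof (rule parameter_powers_below[OF E.annihilator_ideal x(1,3)])
   show "\<eta> t \<in> carrier E" using \<eta>(1) by simp
   show "\<exists>n::nat. x l [^] n \<in> ?J" if "l < d" for l
    using \<eta>(4) x(1) that by (intro exI[of _ t]) simp
  qed
  then obtain K where K: "mpow K \<subseteq> ?J" by blast
  have "a *[E] e = 0[E]" if "a \<in> mpow K" for a
   using subsetD[OF K that] r \<eta>(1) E.smult_commute[of a r "\<eta> t"] by simp
  thus ?thesis by blast
 qed
 have "frobenius_hull R m d E \<sigma> p x \<eta> (\<Otimes>l\<in>{..<d}. x l)"
 proof
  show "!!e. e \<in> carrier E ==> \<exists>r\<in>carrier R. \<exists>t. e = r *[E] \<eta> t" using \<eta>(2) by simp
 qed (use inj \<sigma> m\<sigma> socle torsion complete p x(1) \<eta> in auto)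
 thus ?thesis by blast
qed

text \<open>The height of a parameter ideal equals the number of its generators, which is just what
  allows them to be completed to a system of parameters; the hull is then described with that
  system.\<close>

lemma test_ideal_not_in_parameter_ideal:
 fixes E :: "('a, 'c set) module"
 assumes E: "injective_hull R (quot_module (self_module R) m) E" "is_local_cohomology TYPE('c) R m (self_module R) d E"
   "adically_complete R m" "Factorial_Ring.prime p" "has_char R p"
  and I: "parameter_ideal R I"
 shows "\<not> test_ideal R p \<subseteq> I"
proof -
 obtain xs where xs: "set xs \<subseteq> carrier R" "I = Idl (set xs)" "ideal_height R I = enat (length xs)"
  using I unfolding parameter_ideal_def by blast
 let ?n = "length xs" and ?x0 = "\<lambda>i. xs ! i"
 have x0: "?x0 ` {..<?n} = set xs" by (auto simp: set_conv_nth)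
 have ht: "chain_to R ?n Q" if Q: "primeideal Q R" "set xs \<subseteq> Q" for Q
 proof (rule prime_height_ge_chain[OF Q(1)])
  have "I \<subseteq> Q" unfolding xs(2) by (rule genideal_minimal[OF primeD(1)[OF Q(1)] Q(2)])
  thus "enat ?n \<le> prime_height R Q" unfolding xs(3)[symmetric] ideal_height_def
   using Q(1) by (intro INF_lower) simp
 qed
 \<comment> \<open>Without a prime over \<open>I\<close> the infimum is empty and the height
   infinite, contrary to the finite number of generators.\<close>
 have "{Q. primeideal Q R \<and> I \<subseteq> Q} ~= {}"
 proof
  assume "{Q. primeideal Q R \<and> I \<subseteq> Q} = {}"
  hence "ideal_height R I = \<infinity>" unfolding ideal_height_def by (simp only: image_empty Inf_empty top_enat_def)
  thus False using xs(3) by simp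
 qed
 then obtain Q where Q: "primeideal Q R" "I \<subseteq> Q" by blast
 have xsQ: "set xs \<subseteq> Q" using Q(2) genideal_self[OF xs(1)] unfolding xs(2) by blast
 have nd: "?n \<le> d" using chain_to_bound[OF ht[OF Q(1) xsQ]] .
 have "set xs \<subseteq> m" using xsQ prime_le_m[OF Q(1)] by blast
 obtain x N where x: "!!i. i < ?n ==> x i = ?x0 i" "!!i. i < d ==> x i \<in> m"
  "!!i. ?n \<le> i ==> i < d ==> x i \<in> carrier R" "mpow N \<subseteq> Idl (x ` {..<d})"
 proof (rule parameters_extend[where ?x0.0 = ?x0 and n = ?n and c = "\<lambda>_. carrier R"])
  show "?x0 ` {..<?n} \<subseteq> m" using \<open>set xs \<subseteq> m\<close> unfolding x0 .
  show "chain_to R ?n Q" if "primeideal Q R" "?x0 ` {..<?n} \<subseteq> Q" for Q using ht that unfolding x0 .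
  show "\<not> carrier R \<subseteq> Q" if "primeideal Q R" for Q using primeD(2)[OF that] by blast
 qed (use nd oneideal in auto)
 \<comment> \<open>Padded by zero, since the locale asks for an element of \<open>R\<close> at every
   index.\<close>
 define y where "y l = (if l < d then x l else \<zero>)" for l
 have y: "y l \<in> carrier R" "l < d ==> y l \<in> m" "y ` {..<d} = x ` {..<d}" for l
  using x(2) idealD(2)[OF ideal_m] by (auto simp: y_def image_def)
 have "mpow N \<subseteq> Idl (y ` {..<d})" using x(4) unfolding y(3) .
 hence "\<exists>\<sigma> \<eta>. frobenius_hull R m d E \<sigma> p y \<eta> (\<Otimes>l\<in>{..<d}. y l)"
  by (intro frobenius_hull_exists[OF E y(1)]) (rule y(2))
 then obtain \<sigma> \<eta> where hull: "frobenius_hull R m d E \<sigma> p y \<eta> (\<Otimes>l\<in>{..<d}. y l)" by blast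
 interpret frobenius_hull R m d E \<sigma> p y \<eta> "\<Otimes>l\<in>{..<d}. y l" by (rule hull)
 have sub: "y ` {..<d} \<subseteq> carrier R" using y(1) by auto
 have "?x0 i \<in> x ` {..<d}" if "i < ?n" for i using x(1)[OF that] that nd by (intro image_eqI[of _ _ i]) auto
 hence "set xs \<subseteq> y ` {..<d}" unfolding x0[symmetric] y(3) by blast
 hence "I \<subseteq> Idl (y ` {..<d})" unfolding xs(2)
  using genideal_self[OF sub] by (intro genideal_minimal[OF genideal_ideal[OF sub]]) blast
 thus ?thesis by (rule \<tau>_not_in_parameters)
qed

lemma test_ideal_not_in_finite_dimensional_ideal:
 fixes E :: "('a, 'c set) module"
 assumes E: "injective_hull R (quot_module (self_module R) m) E" "is_local_cohomology TYPE('c) R m (self_module R) d E"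
   "adically_complete R m" "Factorial_Ring.prime p" "has_char R p"
  and I: "ideal I R" "I ~= carrier R" "proj_dim TYPE('q) R (ideal_module R I) < \<infinity>"
 shows "\<not> test_ideal R p \<subseteq> I"
proof -
 have "{n. \<exists>(P :: nat => ('a, 'q) module) dq e. projective_resolution R (ideal_module R I) P dq e \<and>
   (\<forall>i>n. carrier (P i) = {0[P i]})} ~= {}" (is "?S ~= {}")
 proof
  assume "?S = {}"
  hence "proj_dim TYPE('q) R (ideal_module R I) = \<infinity>" unfolding proj_dim_def by (simp only: image_empty Inf_empty top_enat_def)
  thus False using I(3) by simp
 qed
 then obtain L and Q :: "nat => ('a, 'q) module" and dq e where Q: "projective_resolution R (ideal_module R I) Q dq e"
  "!!i. L < i ==> carrier (Q i) = {0[Q i]}" by blast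
 have Im: "I \<subseteq> m" using proper_le_m[OF I(1)] ideal_one_carrier[OF I(1)] I(2) by blast
 obtain n A where A: "resolves_upto (carrier R - m) I n A" "!!j k l. A j k l \<in> m"
  using minimal_resolution[OF prime_m I(1) Im] by auto
 note A1 = resolves_upto_units[OF A(1)]
 \<comment> \<open>\<open>Q\<close> resolves \<open>I\<close> and not \<open>R / I\<close>, which
   shifts the bound on the length by one.\<close>
 have fin: "n (Suc j) = 0" if "Suc L \<le> j" for j
  using finite_minimal_resolution[OF I(1) A1 A(2) Q, of "j - 1"] that by (cases j) auto
 obtain x N H where x: "\<forall>i<d. x i \<in> m" "mpow N \<subseteq> Idl (x ` {..<d})" "n (Suc d) = 0"
  "\<forall>i<d. \<forall>j\<le>Suc d. H i j \<in> mats (n j) (n (Suc j))"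
  "\<forall>i<d. \<forall>j. i \<le> j \<and> j \<le> d --> contracts n A (H i) (x i) j"
  by (rule null_homotopic_parameters[where L = "Suc L", OF I(1) Im A1 A(2), THEN exE])
   (rule fin, assumption, elim exE conjE, rule that, assumption+)
 define y where "y l = (if l < d then x l else \<zero>)" for l
 have y: "y l \<in> carrier R" "l < d ==> y l \<in> m" "y ` {..<d} = x ` {..<d}" for l
  using x(1) idealD(2)[OF ideal_m] by (auto simp: y_def image_def)
 have N: "mpow N \<subseteq> Idl (y ` {..<d})" using x(2) unfolding y(3) .
 have "\<exists>\<sigma> \<eta>. frobenius_hull R m d E \<sigma> p y \<eta> (\<Otimes>l\<in>{..<d}. y l)"
  by (rule frobenius_hull_exists[OF E y(1) _ N]) (rule y(2))
 then obtain \<sigma> \<eta> where hull: "frobenius_hull R m d E \<sigma> p y \<eta> (\<Otimes>l\<in>{..<d}. y l)" by blast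
 interpret frobenius_hull R m d E \<sigma> p y \<eta> "\<Otimes>l\<in>{..<d}. y l" by (rule hull)
 show ?thesis
  by (rule tau_not_in_finite_resolution[OF I(1) A1 A(2) x(3) N]) (use x(4,5) in \<open>auto simp: y_def\<close>)
qed

end

text \<open>A finite supremum is attained: if all chains were shorter than \<open>d\<close>, the
  dimension would be at most \<open>d - 1\<close>, where \<open>d > 0\<close> because the maximal
  ideal alone is a chain of length 0.\<close>

lemma noetherian_local_of_krull_dim:
 assumes "noetherian_ring R" "local_ring R" "krull_dim R = enat d"
 shows "noetherian_local R (max_ideal R) d"
proof -
 have R: "noetherian_cring R" using assms(1,2) unfolding local_ring_def noetherian_cring_def by blast
 have ex: "\<exists>!M. maximalideal M R" using assms(2) unfolding local_ring_def by blast
 hence m: "maximalideal (max_ideal R) R" unfolding max_ideal_def by (rule theI')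
 have bound: "n \<le> d" if "prime_chain R n P" for n P
 proof -
  have "enat n \<le> krull_dim R" unfolding krull_dim_def by (rule SUP_upper) (use that in blast)
  thus ?thesis unfolding assms(3) by simp
 qed
 have "\<exists>P. prime_chain R d P"
 proof (rule ccontr)
  assume neg: "\<not> ?thesis"
  have lt: "n < d" if "prime_chain R n P" for n P using bound[OF that] neg that by (cases "n = d") auto
  have "primeideal (max_ideal R) R" using m cring.maximalideal_prime assms(2) unfolding local_ring_def by blast
  hence "prime_chain R 0 (\<lambda>_. max_ideal R)" unfolding prime_chain_def by simp
  hence d: "0 < d" by (rule lt)
  have "krull_dim R \<le> enat (d - 1)" unfolding krull_dim_def
   by (rule SUP_least) (use lt in fastforce)
  thus False using d unfolding assms(3) by simp
 qed
 thus ?thesis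
  using R m ex bound unfolding noetherian_local_def noetherian_local_axioms_def by blast
qed

theorem corollary2p6:
  fixes R :: "('a, 'm) ring_scheme" and p :: nat and I :: "'a set"
  assumes "noetherian_ring R" and "local_ring R"
    and "adically_complete R (max_ideal R)"
    and "reduced_ring R" and "equidimensional R"
    and "Factorial_Ring.prime p" and "has_char R p"
    and "quasi_gorenstein TYPE('c) R"
    and "(ideal I R \<and> I \<noteq> carrier R \<and> proj_dim TYPE('d) R (ideal_module R I) < \<infinity>)
         \<or> parameter_ideal R I"
  shows "\<not> parameter_test_ideal R p \<subseteq> I \<and> \<not> conductor R \<subseteq> frac_embed R ` I"
proof -
 obtain d and E :: "('a, 'c set) module" where d: "krull_dim R = enat d"
  and E: "injective_hull R (quot_module (self_module R) (max_ideal R)) E"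
   "is_local_cohomology TYPE('c) R (max_ideal R) (self_module R) d E"
  using assms(8) unfolding quasi_gorenstein_def by blast
 interpret noetherian_local R "max_ideal R" d
  by (rule noetherian_local_of_krull_dim[OF assms(1,2) d])
 have par: "ideal J R" if "parameter_ideal R J" for J
  using that genideal_ideal unfolding parameter_ideal_def by blast
 have "\<not> test_ideal R p \<subseteq> I"
  using assms(9) test_ideal_not_in_parameter_ideal[OF E assms(3,6,7)]
   test_ideal_not_in_finite_dimensional_ideal[OF E assms(3,6,7)] by blast
 moreover have "test_ideal R p \<subseteq> parameter_test_ideal R p"
  using par unfolding test_ideal_def parameter_test_ideal_def by blast
 moreover have "I \<subseteq> carrier R" using assms(9) par idealD(1) by blast
 ultimately show ?thesis using conductor_not_in[of p I] by blast
qed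

end
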